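(* Assume $0<\gamma<\frac{2}{3}$. Then there exist positive constants $\tilde c_0$ and $\tilde\delta_0$ such that for every $0<\delta\le\tilde\delta_0$ one has $$\limsup_{\varepsilon\downarrow0}\ \varepsilon\log\mu^\varepsilon\bigl\{u:\ \mathrm{dist}_{L^\infty}(u,M)\ge\delta\bigr\}\le -\tilde c_0\delta^2 .$$
   Context: $F:\mathbb R\to\mathbb R$ is a (at least $C^3$) function satisfying: (a) $F(u)\ge 0$ for all $u$, and $F(u)=0$ iff $u=\pm1$; (b) $F'$ has exactly the three zeros $-1,0,1$, and $F''(0)<0$, $F''(\pm1)>0$; (c) $F(u)=F(-u)$ for all $u$. For $\varepsilon>0$, $\tilde\nu^\varepsilon$ is the law on $L^2[-1,1]$ of the (continuous) Gaussian process with mean $\mathbb E[\tilde u(s)]=s$ and covariance $\mathrm{Cov}(\tilde u(s),\tilde u(s'))=\varepsilon^{1-\gamma}\bigl(s\wedge s'+1-\frac{(s+1)(s'+1)}{2}\bigr)$, $s,s'\in[-1,1]$, and $\tilde\mu^\varepsilon$ is the probability measure with density proportional to $\exp\bigl(-\varepsilon^{-1-\gamma}\int_{-1}^1F(\tilde u(s))\,ds\bigr)$ with respect to $\tilde\nu^\varepsilon$. Let $T^\varepsilon:L^2[-1,1]\to L^2[-\varepsilon^{-\gamma},\varepsilon^{-\gamma}]$, $T^\varepsilon\tilde u(s)=\tilde u(\varepsilon^\gamma s)$, and let $\mu^\varepsilon=T^\varepsilon_\#\tilde\mu^\varepsilon$ be the pushforward measure. Let $m:\mathbb R\to\mathbb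 R$ be the unique solution of $m'(s)=\sqrt{2F(m(s))}$, $m(0)=0$, $m(\pm\infty)=\pm1$; write $m_\xi(s)=m(s-\xi)$ and $M=\{m_\xi:\xi\in\mathbb R\}$. Functions on $[-\varepsilon^{-\gamma},\varepsilon^{-\gamma}]$ are extended to $\mathbb R$ by $-1$ to the left and $+1$ to the right of this interval, so that $\mu^\varepsilon$ is regarded as a measure on $m+L^2(\mathbb R)=\{u:\mathbb R\to\mathbb R:\ u-m\in L^2(\mathbb R)\}$. Finally $\mathrm{dist}_{L^\infty}(u,M)=\inf_{\xi\in\mathbb R}\|u-m_\xi\|_{L^\infty(\mathbb R)}$. *)

theory Defs
  imports "HOL-Probability.Probability"
begin

definition C_k :: "nat \<Rightarrow> (real \<Rightarrow> real) \<Rightarrow> bool" where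
  "C_k k f \<longleftrightarrow>
     (\<forall>j<k. \<forall>x. (deriv ^^ j) f differentiable (at x)) \<and> continuous_on UNIV ((deriv ^^ k) f)"

definition double_well :: "(real \<Rightarrow> real) \<Rightarrow> bool" where
  "double_well F \<longleftrightarrow>
     C_k 3 F \<and>
     (\<forall>u. F u \<ge> 0) \<and> (\<forall>u. F u = 0 \<longleftrightarrow> u = 1 \<or> u = -1) \<and>
     {u. deriv F u = 0} = {-1, 0, 1} \<and>
     deriv (deriv F) 0 < 0 \<and> deriv (deriv F) 1 > 0 \<and> deriv (deriv F) (-1) > 0 \<and>
     (\<forall>u. F u = F (- u))"

definition instanton :: "(real \<Rightarrow> real) \<Rightarrow> (real \<Rightarrow> real) \<Rightarrow> bool" where
  "instanton F m \<longleftrightarrow>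
     (\<forall>s. (m has_real_derivative sqrt (2 * F (m s))) (at s)) \<and> m 0 = 0 \<and>
     (m \<longlongrightarrow> 1) at_top \<and> (m \<longlongrightarrow> -1) at_bot"

text \<open>
  Elements of \<open>L\<^sup>2(S)\<close> are represented by functions on the line; only their values on \<open>S\<close>
  matter, and functions that agree almost everywhere on \<open>S\<close> are not identified.  The sets
  that are open for the \<open>L\<^sup>2\<close> pseudometric are invariant under this identification, and so
  is the sigma-algebra they generate, which therefore corresponds to the Borel sets of the
  quotient.
\<close>

definition L2 :: "real set \<Rightarrow> (real \<Rightarrow> real) set" where
  "L2 S = {f. set_borel_measurable lborel S f \<and> set_integrable lborel S (\<lambda>s. (f s)\<^sup>2)}"

definition L2_dist :: "real set \<Rightarrow> (real \<Rightarrow> real) \<Rightarrow> (real \<Rightarrow> real) \<Rightarrow> real" where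
  "L2_dist S u v = sqrt (LINT s:S|lborel. (u s - v s)\<^sup>2)"

definition affine_L2 :: "(real \<Rightarrow> real) \<Rightarrow> real set \<Rightarrow> (real \<Rightarrow> real) set" where
  "affine_L2 a S = {u. (\<lambda>s. u s - a s) \<in> L2 S}"

definition L2_open :: "(real \<Rightarrow> real) \<Rightarrow> real set \<Rightarrow> (real \<Rightarrow> real) set \<Rightarrow> bool" where
  "L2_open a S U \<longleftrightarrow>
     U \<subseteq> affine_L2 a S \<and> (\<forall>u\<in>U. \<exists>r>0. \<forall>v\<in>affine_L2 a S. L2_dist S u v < r \<longrightarrow> v \<in> U)"

definition affine_L2_borel :: "(real \<Rightarrow> real) \<Rightarrow> real set \<Rightarrow> (real \<Rightarrow> real) measure" where
  "affine_L2_borel a S = sigma (affine_L2 a S) {U. L2_open a S U}"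

abbreviation L2_borel :: "real set \<Rightarrow> (real \<Rightarrow> real) measure" where
  "L2_borel \<equiv> affine_L2_borel (\<lambda>_. 0)"

text \<open>Degenerate normal laws are admitted: the bridge below is deterministic at \<open>\<plusminus>1\<close>.\<close>

definition gaussian_rv :: "'w measure \<Rightarrow> ('w \<Rightarrow> real) \<Rightarrow> bool" where
  "gaussian_rv P Y \<longleftrightarrow>
     Y \<in> borel_measurable P \<and>
     ((\<exists>c. AE w in P. Y w = c) \<or>
      (\<exists>\<mu> \<sigma>. \<sigma> > 0 \<and> distributed P lborel Y (normal_density \<mu> \<sigma>)))"

definition gaussian_process ::
    "'w measure \<Rightarrow> 't set \<Rightarrow> ('w \<Rightarrow> 't \<Rightarrow> real) \<Rightarrow> ('t \<Rightarrow> real) \<Rightarrow> ('t \<Rightarrow> 't \<Rightarrow> real) \<Rightarrow> bool" where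
  "gaussian_process P I X mean cov \<longleftrightarrow>
     prob_space P \<and>
     (\<forall>J a. finite J \<and> J \<subseteq> I \<longrightarrow> gaussian_rv P (\<lambda>w. \<Sum>s\<in>J. a s * X w s)) \<and>
     (\<forall>s\<in>I. (\<integral>w. X w s \<partial>P) = mean s) \<and>
     (\<forall>s\<in>I. \<forall>s'\<in>I. (\<integral>w. (X w s - mean s) * (X w s' - mean s') \<partial>P) = cov s s')"

definition bridge_cov :: "real \<Rightarrow> real \<Rightarrow> real \<Rightarrow> real \<Rightarrow> real" where
  "bridge_cov \<gamma> \<epsilon> s s' =
     \<epsilon> powr (1 - \<gamma>) * (min s s' + 1 - (s + 1) * (s' + 1) / 2)"

definition bridge_process :: "real \<Rightarrow> real \<Rightarrow> 'w measure \<Rightarrow> ('w \<Rightarrow> real \<Rightarrow> real) \<Rightarrow> bool" where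
  "bridge_process \<gamma> \<epsilon> P X \<longleftrightarrow>
     gaussian_process P {-1..1} X (\<lambda>s. s) (bridge_cov \<gamma> \<epsilon>) \<and>
     (\<forall>w\<in>space P. continuous_on {-1..1} (X w))"

definition process_law :: "'w measure \<Rightarrow> ('w \<Rightarrow> real \<Rightarrow> real) \<Rightarrow> (real \<Rightarrow> real) measure" where
  "process_law P X = distr P (L2_borel {-1..1}) X"

text \<open>
  The potential energy of an arbitrary element of \<open>L\<^sup>2[-1,1]\<close> may be infinite, in which case
  the weight is \<open>exp (-\<infinity>) = 0\<close>.
\<close>

definition gibbs_weight :: "real \<Rightarrow> (real \<Rightarrow> real) \<Rightarrow> (real \<Rightarrow> real) \<Rightarrow> ennreal" where
  "gibbs_weight b F u =
     (let E = (\<integral>\<^sup>+s\<in>{-1..1}. ennreal (F (u s)) \<partial>lborel)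
      in if E = \<infinity> then 0 else ennreal (exp (- b * enn2real E)))"

definition mu_tilde ::
    "(real \<Rightarrow> real) \<Rightarrow> real \<Rightarrow> real \<Rightarrow> (real \<Rightarrow> real) measure \<Rightarrow> (real \<Rightarrow> real) measure" where
  "mu_tilde F \<gamma> \<epsilon> \<nu> =
     (let g = gibbs_weight (\<epsilon> powr (- 1 - \<gamma>)) F
      in density \<nu> (\<lambda>u. g u / (\<integral>\<^sup>+v. g v \<partial>\<nu>)))"

definition T_map :: "real \<Rightarrow> real \<Rightarrow> (real \<Rightarrow> real) \<Rightarrow> real \<Rightarrow> real" where
  "T_map \<gamma> \<epsilon> u = (\<lambda>s. u (\<epsilon> powr \<gamma> * s))"

definition extend :: "real \<Rightarrow> (real \<Rightarrow> real) \<Rightarrow> real \<Rightarrow> real" where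
  "extend l u = (\<lambda>s. if s < - l then -1 else if s > l then 1 else u s)"

definition mu ::
    "(real \<Rightarrow> real) \<Rightarrow> (real \<Rightarrow> real) \<Rightarrow> real \<Rightarrow> real \<Rightarrow> (real \<Rightarrow> real) measure \<Rightarrow> (real \<Rightarrow> real) measure"
  where
  "mu F m \<gamma> \<epsilon> \<nu> =
     (let l = \<epsilon> powr (- \<gamma>)
      in distr (distr (mu_tilde F \<gamma> \<epsilon> \<nu>) (L2_borel {- l..l}) (T_map \<gamma> \<epsilon>))
           (affine_L2_borel m UNIV) (extend l))"

definition instantons :: "(real \<Rightarrow> real) \<Rightarrow> (real \<Rightarrow> real) set" where
  "instantons m = range (\<lambda>\<xi> s. m (s - \<xi>))"

definition Linf_norm :: "(real \<Rightarrow> real) \<Rightarrow> ereal" where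
  "Linf_norm f = esssup lborel (\<lambda>s. ereal \<bar>f s\<bar>)"

definition dist_Linf :: "(real \<Rightarrow> real) \<Rightarrow> (real \<Rightarrow> real) set \<Rightarrow> ereal" where
  "dist_Linf u M = (INF v\<in>M. Linf_norm (\<lambda>s. u s - v s))"

text \<open>The convention \<open>log 0 = -\<infinity>\<close> differs from the library's real logarithm.\<close>

definition eln :: "real \<Rightarrow> ereal" where
  "eln p = (if p = 0 then -\<infinity> else ereal (ln p))"

end

theory Submission
  imports Defs "HOL-Real_Asymp.Real_Asymp"
begin

text \<open>
  After rescaling space by \<open>L = \<epsilon>\<^sup>-\<^sup>\<gamma>\<close>, the path is a Brownian bridge of variance \<open>\<epsilon>\<close> from \<open>-1\<close> to
  \<open>1\<close> on \<open>[-L,L]\<close> with weight \<open>exp (-(1/\<epsilon>) \<integral> F)\<close>. Let \<open>w\<close> be the integral of \<open>\<surd>(2F)\<close> over \<open>[-1,1]\<close>,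
  which is the action of the instanton. It suffices that the weight of the paths far from every
  instanton is at most \<open>exp (-(w + c \<delta>\<^sup>2 - \<kappa>)/\<epsilon>)\<close> and that the total weight is at least
  \<open>exp (-(w + \<kappa>)/\<epsilon>)\<close>, for every \<open>\<kappa> > 0\<close> and small \<open>\<epsilon>\<close>.

  Upper bound: completing the square in the discrete action (kinetic energy plus Riemann sum of \<open>F\<close>)
  leaves \<open>w\<close> plus the squared defects from the flow \<open>m' = \<surd>(2F(m))\<close>. The flow contracts towards the
  wells, so a path of action below \<open>w + c \<delta>\<^sup>2\<close> is shadowed by an instanton. By Jensen's inequality
  the energy integral can be replaced by its Riemann sum on a shifted grid, averaged over the shift.
  The grid values of the bridge are expressed through independent standard normals, whose squares
  sum to the kinetic energy, and a chaining bound excludes oscillations between grid points.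

  Lower bound: force these normals to within \<open>1/n\<close> of the values which an instanton would give, and
  apply Jensen's inequality on this event. The remainder of the bridge after piecewise linear
  interpolation is independent of the event and has variance of order \<open>\<epsilon>\<close>, so its contribution to the energy is \<open>O(\<epsilon> L)\<close>.
\<close>

text \<open>The interval has length \<open>2 L\<close>, which diverges as \<open>\<epsilon>\<close>
  tends to 0. Any pointwise error of the energy density is multiplied by \<open>L\<close>, and a
  typical fluctuation of size \<open>sqrt \<epsilon>\<close> could contribute
  \<open>L * sqrt \<epsilon>\<close>, which need not vanish. Hence the energy is never compared with
  a Riemann sum on one fixed grid: the average over shifts is exact, and in the lower bound
  \<open>F\<close> is used as half the square of a Lipschitz function, so that fluctuations enter
  only through variances and cost \<open>\<epsilon> * L\<close>.

  The mesh stays between two positive bounds independent of \<open>\<epsilon>\<close>, so a grid has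
  of order \<open>L\<close> points. A constant factor per point costs \<open>\<epsilon> * L\<close>
  in the exponent, a factor \<open>1 / (2 N)\<close> per point costs
  \<open>\<epsilon> * L * ln L\<close>. One such factor is forced: \<open>exp (Y^2 / 2)\<close> is
  not integrable for a standard normal \<open>Y\<close>, so the upper bound gives away a fraction
  \<open>\<theta>\<close> of the action. The stability constants, by contrast, must not depend on
  the number of points; nondegeneracy of the wells provides this.\<close>

section \<open>The drift of the instanton equation\<close>

text \<open>The root of \<open>2 * F\<close> has a corner at 1; the change of sign there makes 1 an
  attracting zero from both sides. Freezing \<open>F\<close> outside \<open>[-3,3]\<close> makes the
  field globally Lipschitz without any growth condition on \<open>F\<close>.\<close>

definition drift :: "(real \<Rightarrow> real) \<Rightarrow> real \<Rightarrow> real" where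
  "drift F x = (if x \<le> 1 then 1 else -1) * sqrt (2 * F (max (-3) (min 3 x)))"

lemma double_well_derivs:
  assumes "double_well F"
  shows "\<And>x. (F has_real_derivative deriv F x) (at x)"
    and "\<And>x. (deriv F has_real_derivative deriv (deriv F) x) (at x)"
    and "continuous_on UNIV (deriv (deriv F))"
proof -
  have C: "\<forall>j<3. \<forall>x. (deriv ^^ j) F differentiable (at x)"
    using assms by (auto simp: double_well_def C_k_def)
  show "(F has_real_derivative deriv F x) (at x)" for x
    using C[rule_format, of 0 x] by (simp add: DERIV_deriv_iff_real_differentiable)
  show "(deriv F has_real_derivative deriv (deriv F) x) (at x)" for x
    using C[rule_format, of 1 x] by (simp add: DERIV_deriv_iff_real_differentiable)
  have "deriv (deriv F) differentiable (at x)" for x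
    using C[rule_format, of 2 x] by (simp add: numeral_2_eq_2)
  then show "continuous_on UNIV (deriv (deriv F))"
    by (simp add: continuous_at_imp_continuous_on differentiable_imp_continuous_within)
qed

lemma double_well_even: "double_well F \<Longrightarrow> F (- u) = F u"
  by (auto simp: double_well_def)

lemma double_well_nonneg: "double_well F \<Longrightarrow> F u \<ge> 0"
  by (auto simp: double_well_def)

lemma double_well_zero: "double_well F \<Longrightarrow> F u = 0 \<longleftrightarrow> u = 1 \<or> u = -1"
  by (auto simp: double_well_def)

lemma double_well_pos: "double_well F \<Longrightarrow> u \<noteq> 1 \<Longrightarrow> u \<noteq> -1 \<Longrightarrow> F u > 0"
  using double_well_nonneg[of F u] double_well_zero[of F u] by linarith

lemma double_well_continuous: "double_well F \<Longrightarrow> continuous_on S F"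
  using double_well_derivs(1)[of F]
  by (meson DERIV_isCont continuous_at_imp_continuous_on)

lemma double_well_deriv_continuous: "double_well F \<Longrightarrow> continuous_on S (deriv F)"
  using double_well_derivs(2)[of F]
  by (meson DERIV_isCont continuous_at_imp_continuous_on)

text \<open>\<open>F\<close> rises from 0 at 1 to a positive value at 2, so its derivative is
  positive somewhere; having no zero beyond 1, it keeps this sign.\<close>

lemma double_well_deriv_pos:
  assumes F: "double_well F" and "x > 1"
  shows "deriv F x > 0"
proof -
  have nz: "deriv F y \<noteq> 0" if "y > 1" for y
  proof -
    have "{u. deriv F u = 0} = {-1, 0, 1}" using F by (simp add: double_well_def)
    then have "deriv F y = 0 \<longleftrightarrow> y \<in> {-1, 0, 1}" by blast
    then show ?thesis using that by auto
  qed
  obtain z where z: "1 < z" "z < 2" "F 2 - F 1 = (2 - 1) * deriv F z"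
    using MVT2[of 1 2 F "deriv F"] double_well_derivs(1)[OF F] by auto
  have "F 2 > 0" "F 1 = 0" using double_well_pos[OF F, of 2] double_well_zero[OF F] by auto
  then have pz: "deriv F z > 0" using z by auto
  show ?thesis
  proof (rule ccontr)
    assume "\<not> deriv F x > 0"
    then have neg: "deriv F x < 0" using nz[of x] assms(2) by linarith
    have cont: "continuous_on S (deriv F)" for S by (rule double_well_deriv_continuous[OF F])
    have "\<exists>y. min x z \<le> y \<and> y \<le> max x z \<and> deriv F y = 0"
    proof (cases "x \<le> z")
      case True
      then show ?thesis using IVT'[of "deriv F" x 0 z, OF _ _ _ cont] neg pz by auto
    next
      case False
      then show ?thesis using IVT2'[of "deriv F" x 0 z, OF _ _ _ cont] neg pz by auto
    qed
    then show False using nz assms(2) z(1) by force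
  qed
qed

lemma double_well_mono:
  assumes F: "double_well F" and "1 \<le> x" "x \<le> y"
  shows "F x \<le> F y"
proof (rule DERIV_nonneg_imp_increasing_open[OF assms(3)])
  fix t assume "x < t" "t < y"
  then show "\<exists>D. (F has_real_derivative D) (at t) \<and> 0 \<le> D"
    using double_well_derivs(1)[OF F, of t] double_well_deriv_pos[OF F, of t] assms by force
qed (rule double_well_continuous[OF F])

text \<open>\<open>F\<close> is even and increasing beyond 1, so freezing it outside
  \<open>[-3,3]\<close> can only lower it. This keeps the square of the drift below
  \<open>2 * F\<close> on the whole line.\<close>

lemma double_well_clamp_le:
  assumes F: "double_well F"
  shows "F (max (-3) (min 3 x)) \<le> F x"
proof -
  consider "x < -3" | "-3 \<le> x" "x \<le> 3" | "x > 3" by linarith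
  then show ?thesis
  proof cases
    case 1
    then show ?thesis using double_well_mono[OF F, of 3 "-x"] double_well_even[OF F, of 3]
      double_well_even[OF F, of x] by (auto simp: max_def min_def)
  next
    case 3
    then show ?thesis using double_well_mono[OF F, of 3 x] by auto
  qed (auto)
qed

lemma drift_square_le: "double_well F \<Longrightarrow> (drift F x)\<^sup>2 / 2 \<le> F x"
  using double_well_clamp_le[of F x] double_well_nonneg[of F "max (-3) (min 3 x)"]
  unfolding drift_def by (cases "x \<le> 1") (simp_all only: power_mult_distrib if_True if_False
      real_sqrt_pow2_iff zero_le_mult_iff, auto)

lemma drift_square_eq: "double_well F \<Longrightarrow> \<bar>x\<bar> \<le> 3 \<Longrightarrow> (drift F x)\<^sup>2 / 2 = F x"
  using double_well_nonneg[of F x]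
  by (auto simp: drift_def power_mult_distrib abs_le_iff max_def min_def)

lemma drift_eq_sqrt: "-3 \<le> x \<Longrightarrow> x \<le> 1 \<Longrightarrow> drift F x = sqrt (2 * F x)"
  by (simp add: drift_def max_def min_def)

lemma drift_well: "double_well F \<Longrightarrow> drift F 1 = 0" "double_well F \<Longrightarrow> drift F (-1) = 0"
  using double_well_zero[of F 1] double_well_zero[of F "-1"] by (auto simp: drift_def)

lemma continuous_on_compact_bounded_real:
  fixes f :: "real \<Rightarrow> real"
  assumes "continuous_on {a..b} f"
  obtains C where "C > 0" "\<And>x. x \<in> {a..b} \<Longrightarrow> \<bar>f x\<bar> \<le> C"
proof -
  have "bounded (f ` {a..b})"
    using assms by (intro compact_imp_bounded compact_continuous_image) auto
  then obtain C where "C > 0" "\<forall>y\<in>f ` {a..b}. norm y \<le> C" by (auto simp: bounded_pos)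
  then show thesis using that[of C] by auto
qed

text \<open>A nonnegative function with second derivative at most \<open>C\<close> satisfies \<open>F'\<^sup>2 \<le> 2 C F\<close>,
  since otherwise its quadratic upper bound would become negative.\<close>

lemma double_well_deriv_square_le:
  assumes F: "double_well F"
  obtains C where "C > 0" "\<And>x. \<bar>x\<bar> \<le> 3 \<Longrightarrow> (deriv F x)\<^sup>2 \<le> 2 * C * F x"
proof -
  obtain C1 where C1: "C1 > 0" "\<And>x. x \<in> {-3..3} \<Longrightarrow> \<bar>deriv F x\<bar> \<le> C1"
    using continuous_on_compact_bounded_real[OF double_well_deriv_continuous[OF F]] by blast
  obtain C2 where C2: "C2 > 0" "\<And>x. x \<in> {-4..4} \<Longrightarrow> \<bar>deriv (deriv F) x\<bar> \<le> C2"
    using continuous_on_compact_bounded_real[OF continuous_on_subset[OF double_well_derivs(3)[OF F]]]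
    by blast
  \<comment> \<open>The step \<open>d\<close> below minimises the quadratic upper bound. Including
    \<open>C1\<close> in \<open>C\<close> forces \<open>\<bar>d\<bar> \<le> 1\<close>, so the Taylor
    point stays in \<open>[-4,4]\<close>, where \<open>C2\<close> bounds the second
    derivative.\<close>
  define C where "C = C1 + C2"
  have C: "C > 0" using C1 C2 by (simp add: C_def)
  have "(deriv F x)\<^sup>2 \<le> 2 * C * F x" if x: "\<bar>x\<bar> \<le> 3" for x
  proof (cases "deriv F x = 0")
    case True
    then show ?thesis using C double_well_nonneg[OF F, of x] by simp
  next
    case False
    define d where "d = - deriv F x / C"
    have d0: "d \<noteq> 0" using False C by (simp add: d_def)
    have d1: "\<bar>d\<bar> \<le> 1"
      using C1(2)[of x] x C1(1) C2(1) by (simp add: d_def C_def abs_le_iff)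
    have "\<exists>t. (if x + d < x then x + d < t \<and> t < x else x < t \<and> t < x + d) \<and>
       F (x + d) = (\<Sum>m<2. ((\<lambda>n. (deriv ^^ n) F) m x / fact m) * (x + d - x)^m) +
          (\<lambda>n. (deriv ^^ n) F) 2 t / fact 2 * (x + d - x)^2"
    proof (rule Taylor[where a="-4" and b=4])
      show "\<forall>m t. m < 2 \<and> -4 \<le> t \<and> t \<le> 4 \<longrightarrow>
         ((deriv ^^ m) F has_real_derivative (deriv ^^ Suc m) F t) (at t)"
      proof (intro allI impI)
        fix m :: nat and t :: real assume a: "m < 2 \<and> -4 \<le> t \<and> t \<le> 4"
        then have "m = 0 \<or> m = 1" by auto
        then show "((deriv ^^ m) F has_real_derivative (deriv ^^ Suc m) F t) (at t)"
          using double_well_derivs[OF F] by auto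
      qed
    qed (use d0 d1 x in auto)
    then obtain t where t: "(if x + d < x then x + d < t \<and> t < x else x < t \<and> t < x + d)"
      and eq: "F (x + d) = F x + deriv F x * d + deriv (deriv F) t / 2 * d\<^sup>2"
      by (auto simp: numeral_2_eq_2)
    have "\<bar>t\<bar> \<le> 4" using t x d1 by (auto split: if_splits)
    then have "deriv (deriv F) t \<le> C" using C2(2)[of t] C1(1) unfolding C_def atLeastAtMost_iff by linarith
    then have "deriv (deriv F) t / 2 * d\<^sup>2 \<le> C / 2 * d\<^sup>2" by (intro mult_right_mono) auto
    then have "0 \<le> F x + deriv F x * d + C / 2 * d\<^sup>2"
      using double_well_nonneg[OF F, of "x + d"] eq by linarith
    also have "\<dots> = F x - (deriv F x)\<^sup>2 / (2 * C)"
      using C by (simp add: d_def field_simps power2_eq_square)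
    finally show ?thesis using C by (simp add: field_simps)
  qed
  with C that show thesis by blast
qed

lemma DERIV_bounded_lipschitz:
  fixes f :: "real \<Rightarrow> real"
  assumes "a \<le> b" "continuous_on {a..b} f"
    and "\<And>x. a < x \<Longrightarrow> x < b \<Longrightarrow> \<exists>D. (f has_real_derivative D) (at x) \<and> \<bar>D\<bar> \<le> C"
  shows "\<bar>f b - f a\<bar> \<le> C * (b - a)"
proof -
  have 1: "f b - C * b \<le> f a - C * a"
  proof (rule DERIV_nonpos_imp_decreasing_open[OF assms(1), where f = "\<lambda>x. f x - C * x"])
    fix x assume "a < x" "x < b"
    then obtain D where "(f has_real_derivative D) (at x)" "\<bar>D\<bar> \<le> C" using assms(3) by blast
    then show "\<exists>y. ((\<lambda>x. f x - C * x) has_real_derivative y) (at x) \<and> y \<le> 0"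
      by (intro exI[of _ "D - C"]) (auto intro!: derivative_eq_intros)
  qed (intro continuous_intros assms)
  have 2: "f a + C * a \<le> f b + C * b"
  proof (rule DERIV_nonneg_imp_increasing_open[OF assms(1), where f = "\<lambda>x. f x + C * x"])
    fix x assume "a < x" "x < b"
    then obtain D where "(f has_real_derivative D) (at x)" "\<bar>D\<bar> \<le> C" using assms(3) by blast
    then show "\<exists>y. ((\<lambda>x. f x + C * x) has_real_derivative y) (at x) \<and> y \<ge> 0"
      by (intro exI[of _ "D + C"]) (auto intro!: derivative_eq_intros)
  qed (intro continuous_intros assms)
  show ?thesis using 1 2 by (simp add: algebra_simps abs_le_iff)
qed

lemma sqrt_double_well_deriv:
  assumes F: "double_well F" and "x \<noteq> 1" "x \<noteq> -1"
  shows "((\<lambda>x. sqrt (2 * F x)) has_real_derivative deriv F x / sqrt (2 * F x)) (at x)"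
  using double_well_pos[OF F assms(2,3)] double_well_derivs(1)[OF F, of x]
  by (auto intro!: derivative_eq_intros simp: field_simps)

lemma continuous_drift:
  assumes F: "double_well F" shows "continuous_on S (drift F)"
proof -
  have "continuous_on ({..1} \<union> {1..}) (\<lambda>x. if x \<le> 1 then sqrt (2 * F (max (-3) (min 3 x)))
          else - sqrt (2 * F (max (-3) (min 3 x))))"
    using double_well_zero[OF F]
    by (intro continuous_on_If continuous_intros continuous_on_compose2[OF double_well_continuous[OF F, of UNIV]]) auto
  moreover have "({..1} \<union> {1..}) = (UNIV :: real set)" by auto
  moreover have "drift F = (\<lambda>x. if x \<le> 1 then sqrt (2 * F (max (-3) (min 3 x)))
          else - sqrt (2 * F (max (-3) (min 3 x))))" by (auto simp: drift_def fun_eq_iff)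
  ultimately show ?thesis using continuous_on_subset by fastforce
qed

lemma drift_deriv:
  assumes F: "double_well F" and x: "x \<notin> {-1, 1}" "-3 < x" "x < 3"
  shows "(drift F has_real_derivative (if x < 1 then 1 else -1) * (deriv F x / sqrt (2 * F x))) (at x)"
proof -
  have "((\<lambda>y. (if x < 1 then 1 else -1) * sqrt (2 * F y)) has_real_derivative
      (if x < 1 then 1 else -1) * (deriv F x / sqrt (2 * F x))) (at x)"
    using DERIV_cmult[OF sqrt_double_well_deriv[OF F, of x], of "if x < 1 then 1 else -1"] x by auto
  then show ?thesis
  proof (rule has_field_derivative_transform_within_open[where S = "if x < 1 then {-3<..<1} else {1<..<3}"])
    show "\<And>y. y \<in> (if x < 1 then {-3<..<1} else {1<..<3}) \<Longrightarrow>
       (if x < 1 then 1 else - 1) * sqrt (2 * F y) = drift F y"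
      by (auto simp: drift_def max_def min_def split: if_splits)
  qed (use x in \<open>auto split: if_splits\<close>)
qed

text \<open>Up to sign the derivative of the drift is \<open>deriv F x / sqrt (2 * F x)\<close>, and
  \<open>double_well_deriv_square_le\<close> bounds this quotient even close to the wells, where
  both parts vanish. The bounds are then glued across the wells and the freezing points.\<close>

lemma drift_lipschitz:
  assumes F: "double_well F"
  obtains \<Lambda> where "\<Lambda> > 0" "\<And>x y. \<bar>drift F x - drift F y\<bar> \<le> \<Lambda> * \<bar>x - y\<bar>"
proof -
  obtain C where C: "C > 0" "\<And>x. \<bar>x\<bar> \<le> 3 \<Longrightarrow> (deriv F x)\<^sup>2 \<le> 2 * C * F x"
    using double_well_deriv_square_le[OF F] by blast
  have D: "\<exists>D. (drift F has_real_derivative D) (at x) \<and> \<bar>D\<bar> \<le> sqrt C"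
    if "x \<notin> {-1,1}" "-3 < x" "x < 3" for x
  proof -
    have p: "F x > 0" using double_well_pos[OF F, of x] that by auto
    have "\<bar>deriv F x\<bar> \<le> sqrt (2 * C * F x)"
      using C(2)[of x] that by (intro real_le_rsqrt) (auto)
    then have "\<bar>deriv F x / sqrt (2 * F x)\<bar> \<le> sqrt C"
      using p C(1) by (simp add: abs_divide divide_le_eq real_sqrt_mult mult_ac)
    then show ?thesis using drift_deriv[OF F that] by (intro exI[of _ "(if x < 1 then 1 else -1) * (deriv F x / sqrt (2 * F x))"]) auto
  qed
  have piece: "\<bar>drift F y - drift F x\<bar> \<le> sqrt C * (y - x)"
    if "x \<le> y" "{x<..<y} \<subseteq> {-3<..<3} - {-1,1}" for x y
  proof (rule DERIV_bounded_lipschitz[OF that(1) continuous_drift[OF F]])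
    fix t assume "x < t" "t < y"
    then have "t \<in> {-3<..<3} - {-1,1}" using that(2) by auto
    then show "\<exists>D. (drift F has_real_derivative D) (at t) \<and> \<bar>D\<bar> \<le> sqrt C" using D[of t] by auto
  qed
  have outer: "drift F y = drift F (max (-3) (min 3 y))" for y
    by (auto simp: drift_def max_def min_def)
  have mid: "\<bar>drift F y - drift F x\<bar> \<le> sqrt C * (y - x)" if xy: "-3 \<le> x" "x \<le> y" "y \<le> 3" for x y
  proof -
    define p where "p t = max x (min y t)" for t
    have s1: "\<bar>drift F (p (-1)) - drift F x\<bar> \<le> sqrt C * (p (-1) - x)"
      by (rule piece) (use xy in \<open>auto simp: p_def\<close>)
    have s2: "\<bar>drift F (p 1) - drift F (p (-1))\<bar> \<le> sqrt C * (p 1 - p (-1))"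
      by (rule piece) (use xy in \<open>auto simp: p_def max_def min_def split: if_splits\<close>)
    have s3: "\<bar>drift F y - drift F (p 1)\<bar> \<le> sqrt C * (y - p 1)"
      by (rule piece) (use xy in \<open>auto simp: p_def\<close>)
    show ?thesis using s1 s2 s3 by (simp add: algebra_simps)
  qed
  have main: "\<bar>drift F x - drift F y\<bar> \<le> sqrt C * \<bar>x - y\<bar>" if "x \<le> y" for x y
  proof -
    have "\<bar>drift F y - drift F x\<bar> \<le> sqrt C * (max (-3) (min 3 y) - max (-3) (min 3 x))"
      using mid[of "max (-3) (min 3 x)" "max (-3) (min 3 y)"] that outer[of x] outer[of y] by auto
    also have "\<dots> \<le> sqrt C * (y - x)"
      using that C(1) by (intro mult_left_mono) auto
    finally show ?thesis using that by (simp add: abs_minus_commute)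
  qed
  show thesis
  proof (rule that)
    show "sqrt C > 0" using C by simp
    show "\<bar>drift F x - drift F y\<bar> \<le> sqrt C * \<bar>x - y\<bar>" for x y
      using main[of x y] main[of y x] by (cases "x \<le> y") (auto simp: abs_minus_commute)
  qed
qed

text \<open>Near 1 the function \<open>F\<close> is comparable to \<open>(x - 1)^2\<close> because
  its second derivative is positive there, so the drift behaves like a negative multiple of
  \<open>x - 1\<close>.\<close>

lemma drift_contracting:
  assumes F: "double_well F"
  obtains a \<mu> where "a > 0" "a \<le> 1" "\<mu> > 0"
    "\<And>x y. \<bar>x - 1\<bar> \<le> a \<Longrightarrow> \<bar>y - 1\<bar> \<le> a \<Longrightarrow> (drift F x - drift F y) * (x - y) \<le> - \<mu> * (x - y)\<^sup>2"
proof -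
  \<comment> \<open>With \<open>k\<close> half of the second derivative at 1, continuity confines
    the second derivative to \<open>[k, 3 k]\<close> near 1.\<close>
  define k where "k = deriv (deriv F) 1 / 2"
  have k: "k > 0" using F by (simp add: double_well_def k_def)
  have "isCont (deriv (deriv F)) 1"
    using double_well_derivs(3)[OF F] by (simp add: continuous_on_eq_continuous_at)
  then obtain r where r: "r > 0" "\<And>x. \<bar>x - 1\<bar> < r \<Longrightarrow> \<bar>deriv (deriv F) x - deriv (deriv F) 1\<bar> < k"
    unfolding continuous_at_eps_delta dist_real_def using k by blast
  define a where "a = min (1/2) (r / 2)"
  have a: "a > 0" "a < r" "a \<le> 1/2" using r(1) by (auto simp: a_def)
  have dd: "k \<le> deriv (deriv F) x" "deriv (deriv F) x \<le> 3 * k" if "\<bar>x - 1\<bar> \<le> a" for x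
  proof -
    have "\<bar>deriv (deriv F) x - deriv (deriv F) 1\<bar> < k" using r(2)[of x] that a by linarith
    moreover have "deriv (deriv F) 1 = 2 * k" by (simp add: k_def)
    ultimately show "k \<le> deriv (deriv F) x" "deriv (deriv F) x \<le> 3 * k" by linarith+
  qed
  have F'1: "deriv F 1 = 0" using F unfolding double_well_def by auto
  have F1: "F 1 = 0" using double_well_zero[OF F] by auto
  have D: "deriv F x * (x - 1) \<ge> k * (x - 1)\<^sup>2 \<and> F x \<le> 3 * k * (x - 1)\<^sup>2"
    if x: "\<bar>x - 1\<bar> \<le> a" for x
  proof -
    have mv1: "\<exists>c. \<bar>c - 1\<bar> \<le> a \<and> deriv F y = deriv (deriv F) c * (y - 1)" if "\<bar>y - 1\<bar> \<le> a" for y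
    proof (cases y "1::real" rule: linorder_cases)
      case less
      then obtain c where "y < c" "c < 1" "deriv F 1 - deriv F y = (1 - y) * deriv (deriv F) c"
        using MVT2[of y 1 "deriv F" "deriv (deriv F)"] double_well_derivs(2)[OF F] by blast
      then show ?thesis using F'1 that by (intro exI[of _ c]) (auto simp: algebra_simps)
    next
      case equal
      then show ?thesis using F'1 a by (intro exI[of _ 1]) auto
    next
      case greater
      then obtain c where "1 < c" "c < y" "deriv F y - deriv F 1 = (y - 1) * deriv (deriv F) c"
        using MVT2[of 1 y "deriv F" "deriv (deriv F)"] double_well_derivs(2)[OF F] by blast
      then show ?thesis using F'1 that by (intro exI[of _ c]) (auto simp: algebra_simps)
    qed
    have mv0: "\<exists>c. \<bar>c - 1\<bar> \<le> \<bar>x - 1\<bar> \<and> (c - 1) * (x - 1) \<ge> 0 \<and> F x = deriv F c * (x - 1)"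
    proof (cases x "1::real" rule: linorder_cases)
      case less
      then obtain c where "x < c" "c < 1" "F 1 - F x = (1 - x) * deriv F c"
        using MVT2[of x 1 F "deriv F"] double_well_derivs(1)[OF F] by blast
      moreover from this have "(c - 1) * (x - 1) \<ge> 0" by (intro mult_nonpos_nonpos) auto
      ultimately show ?thesis using F1 by (intro exI[of _ c]) (auto simp: algebra_simps)
    next
      case equal
      then show ?thesis using F1 by auto
    next
      case greater
      then obtain c where c: "1 < c" "c < x" "F x - F 1 = (x - 1) * deriv F c"
        using MVT2[of 1 x F "deriv F"] double_well_derivs(1)[OF F] by blast
      then have "(c - 1) * (x - 1) \<ge> 0" by (intro mult_nonneg_nonneg) auto
      then show ?thesis using F1 c by (intro exI[of _ c]) (auto simp: algebra_simps)
    qed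
    obtain c where c: "\<bar>c - 1\<bar> \<le> a" "deriv F x = deriv (deriv F) c * (x - 1)" using mv1[OF x] by blast
    have "deriv F x * (x - 1) = deriv (deriv F) c * (x - 1)\<^sup>2" by (simp add: c power2_eq_square)
    moreover have "\<dots> \<ge> k * (x - 1)\<^sup>2" using dd[OF c(1)] by (intro mult_right_mono) auto
    moreover obtain c' where c': "\<bar>c' - 1\<bar> \<le> \<bar>x - 1\<bar>" "(c' - 1) * (x - 1) \<ge> 0" "F x = deriv F c' * (x - 1)"
      using mv0 by blast
    obtain c'' where c'': "\<bar>c'' - 1\<bar> \<le> a" "deriv F c' = deriv (deriv F) c'' * (c' - 1)"
      using mv1[of c'] c'(1) x by force
    have "F x = deriv (deriv F) c'' * ((c' - 1) * (x - 1))" using c'(3) c''(2) by simp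
    moreover have "\<dots> \<le> 3 * k * ((c' - 1) * (x - 1))"
      using dd[OF c''(1)] c'(2) by (intro mult_right_mono) auto
    moreover have "(c' - 1) * (x - 1) \<le> (x - 1)\<^sup>2"
    proof -
      have "(c' - 1) * (x - 1) \<le> \<bar>c' - 1\<bar> * \<bar>x - 1\<bar>" by (metis abs_ge_self abs_mult)
      also have "\<dots> \<le> \<bar>x - 1\<bar> * \<bar>x - 1\<bar>" by (intro mult_right_mono c') auto
      finally show ?thesis by (simp add: power2_eq_square)
    qed
    then have "3 * k * ((c' - 1) * (x - 1)) \<le> 3 * k * (x - 1)\<^sup>2" using k by (intro mult_left_mono) auto
    ultimately show ?thesis by linarith
  qed
  \<comment> \<open>The quotient of the lower bound \<open>k * \<bar>x - 1\<bar>\<close> for the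
    derivative of \<open>F\<close> and the upper bound
    \<open>sqrt (6 * k) * \<bar>x - 1\<bar>\<close> for \<open>sqrt (2 * F x)\<close>.\<close>
  define \<mu> where "\<mu> = k / sqrt (6 * k)"
  have \<mu>: "\<mu> > 0" using k by (simp add: \<mu>_def)
  have bd: "\<exists>D. (drift F has_real_derivative D) (at x) \<and> D \<le> - \<mu>" if "\<bar>x - 1\<bar> \<le> a" "x \<noteq> 1" for x
  proof -
    have x': "x \<notin> {-1, 1}" "-3 < x" "x < 3" using that a by (auto simp: abs_le_iff)
    have p: "F x > 0" using double_well_pos[OF F, of x] x' by auto
    have x1: "\<bar>x - 1\<bar> > 0" using that by auto
    have s: "sqrt (2 * F x) \<le> sqrt (6 * k) * \<bar>x - 1\<bar>"
    proof -
      have "sqrt (2 * F x) \<le> sqrt (6 * k * (x - 1)\<^sup>2)" using D[OF that(1)] by simp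
      then show ?thesis by (simp add: real_sqrt_mult)
    qed
    have q: "deriv F x * sgn (x - 1) \<ge> k * \<bar>x - 1\<bar>"
    proof -
      have "deriv F x * (x - 1) = (deriv F x * sgn (x - 1)) * \<bar>x - 1\<bar>"
        by (simp add: mult.assoc sgn_mult_abs)
      moreover have "k * (x - 1)\<^sup>2 = (k * \<bar>x - 1\<bar>) * \<bar>x - 1\<bar>" by (simp add: power2_eq_square mult.assoc)
      ultimately show ?thesis using D[OF that(1)] x1 by (metis mult_le_cancel_right_pos)
    qed
    have "\<mu> \<le> deriv F x * sgn (x - 1) / sqrt (2 * F x)"
    proof -
      have "\<mu> * sqrt (2 * F x) \<le> \<mu> * (sqrt (6 * k) * \<bar>x - 1\<bar>)" using s \<mu> by (intro mult_left_mono) auto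
      also have "\<dots> = k * \<bar>x - 1\<bar>" using k by (simp add: \<mu>_def)
      finally show ?thesis using q p by (simp add: le_divide_eq)
    qed
    then show ?thesis using drift_deriv[OF F x'] x1
      by (intro exI[of _ "(if x < 1 then 1 else -1) * (deriv F x / sqrt (2 * F x))"]) (auto simp: sgn_if split: if_splits)
  qed
  have mono: "drift F y + \<mu> * y \<le> drift F x + \<mu> * x"
    if "x \<le> y" "\<bar>x - 1\<bar> \<le> a" "\<bar>y - 1\<bar> \<le> a" "1 \<notin> {x<..<y}" for x y
  proof (rule DERIV_nonpos_imp_decreasing_open[OF that(1), where f = "\<lambda>x. drift F x + \<mu> * x"])
    fix t assume "x < t" "t < y"
    then have "\<bar>t - 1\<bar> \<le> a" "t \<noteq> 1" using that by (auto simp: abs_le_iff)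
    then obtain D where "(drift F has_real_derivative D) (at t)" "D \<le> - \<mu>" using bd by blast
    then show "\<exists>y. ((\<lambda>x. drift F x + \<mu> * x) has_real_derivative y) (at t) \<and> y \<le> 0"
      by (intro exI[of _ "D + \<mu>"]) (auto intro!: derivative_eq_intros)
  qed (intro continuous_intros continuous_drift F)
  have mono': "drift F y + \<mu> * y \<le> drift F x + \<mu> * x"
    if "x \<le> y" "\<bar>x - 1\<bar> \<le> a" "\<bar>y - 1\<bar> \<le> a" for x y
    using mono[of x y] mono[of x 1] mono[of 1 y] that a by (cases "1 \<in> {x<..<y}") auto
  have main: "(drift F x - drift F y) * (x - y) \<le> - \<mu> * (x - y)\<^sup>2"
    if xy: "\<bar>x - 1\<bar> \<le> a" "\<bar>y - 1\<bar> \<le> a" "x \<le> y" for x y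
  proof -
    have "(drift F x + \<mu> * x - (drift F y + \<mu> * y)) * (x - y) \<le> 0"
      using mono'[of x y] xy by (intro mult_nonneg_nonpos) auto
    then show ?thesis by (simp add: algebra_simps power2_eq_square)
  qed
  show thesis
  proof (rule that[of a \<mu>])
    fix x y assume xy: "\<bar>x - 1\<bar> \<le> a" "\<bar>y - 1\<bar> \<le> a"
    show "(drift F x - drift F y) * (x - y) \<le> - \<mu> * (x - y)\<^sup>2"
      using main[of x y] main[of y x] xy by (cases "x \<le> y") (auto simp: algebra_simps power2_eq_square)
  qed (use a \<mu> in auto)
qed

section \<open>Shadowing of discrete paths of low action\<close>

definition wall_cost :: "(real \<Rightarrow> real) \<Rightarrow> real" where
  "wall_cost F = integral {-1..1} (\<lambda>x. sqrt (2 * F x))"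

text \<open>Completing the square in the action produces increments of this potential. They
  telescope along a path, and between the two wells they add up to the wall cost.\<close>

lemma drift_potential:
  assumes F: "double_well F"
  obtains \<Phi> where "\<And>x. (\<Phi> has_real_derivative drift F x) (at x)" "\<Phi> 1 - \<Phi> (-1) = wall_cost F"
proof -
  have "\<exists>\<Phi>. \<forall>x :: real. (-\<infinity>::ereal) < x \<longrightarrow> x < (\<infinity>::ereal) \<longrightarrow> (\<Phi> has_vector_derivative drift F x) (at x)"
    using continuous_drift[OF F, of UNIV]
    by (intro einterval_antiderivative) (auto simp: continuous_on_eq_continuous_at)
  then have "\<exists>\<Phi>. \<forall>x. (\<Phi> has_vector_derivative drift F x) (at x)" by simp
  then obtain \<Phi> where \<Phi>: "\<And>x. (\<Phi> has_vector_derivative drift F x) (at x)" by blast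
  have "(drift F has_integral (\<Phi> 1 - \<Phi> (-1))) {-1..1}"
    by (rule fundamental_theorem_of_calculus) (auto intro: has_vector_derivative_at_within[OF \<Phi>])
  then have "integral {-1..1} (drift F) = \<Phi> 1 - \<Phi> (-1)" by (rule integral_unique)
  moreover have "integral {-1..1} (drift F) = wall_cost F"
    unfolding wall_cost_def by (rule integral_cong) (simp add: drift_eq_sqrt)
  ultimately show thesis
    using that[of \<Phi>] \<Phi> by (simp add: has_real_derivative_iff_has_vector_derivative)
qed

lemma wall_cost_nonneg: "double_well F \<Longrightarrow> wall_cost F \<ge> 0"
  unfolding wall_cost_def by (intro integral_nonneg integrable_continuous_real continuous_intros
      double_well_continuous) (auto intro: double_well_nonneg)

lemma instanton_mono: "double_well F \<Longrightarrow> instanton F m \<Longrightarrow> mono m"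
  unfolding instanton_def
  by (intro monoI DERIV_nonneg_imp_nondecreasing[of _ _ m]) (auto simp: double_well_nonneg)

lemma instanton_bounds:
  assumes "double_well F" "instanton F m"
  shows "- 1 \<le> m s" "m s \<le> 1"
proof -
  have mono: "mono m" by (rule instanton_mono[OF assms])
  have lim: "(m \<longlongrightarrow> 1) at_top" "(m \<longlongrightarrow> -1) at_bot" using assms(2) by (auto simp: instanton_def)
  show "m s \<le> 1"
    using lim(1) by (rule tendsto_lowerbound)
      (auto intro!: eventually_mono[OF eventually_ge_at_top[of s]] monoD[OF mono])
  show "- 1 \<le> m s"
    using lim(2) by (rule tendsto_upperbound)
      (auto intro!: eventually_mono[OF eventually_le_at_bot[of s]] monoD[OF mono])
qed

lemma instanton_ode:
  assumes "double_well F" "instanton F m"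
  shows "(m has_real_derivative drift F (m s)) (at s)"
  using instanton_bounds[OF assms, of s] assms(2) by (simp add: instanton_def drift_eq_sqrt)

text \<open>Since \<open>F\<close> is even, what is proved towards the right well transfers to the
  left one. This serves the backward half of the shadowing and the left tail of the
  instanton.\<close>

lemma instanton_reflect:
  assumes F: "double_well F" and m: "instanton F m"
  shows "instanton F (\<lambda>s. - m (- s))"
  unfolding instanton_def
proof (intro conjI allI)
  have lim: "(m \<longlongrightarrow> 1) at_top" "(m \<longlongrightarrow> -1) at_bot" using m by (auto simp: instanton_def)
  show "((\<lambda>s. - m (- s)) has_real_derivative sqrt (2 * F (- m (- s)))) (at s)" for s
  proof -
    have "(m has_real_derivative sqrt (2 * F (m (- s)))) (at (- s))" using m by (auto simp: instanton_def)
    then have "((\<lambda>s. - m (- s)) has_real_derivative - (sqrt (2 * F (m (- s))) * (-1))) (at s)"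
      by (intro DERIV_minus DERIV_chain2[of m _ "\<lambda>s. - s"]) (auto intro!: derivative_eq_intros)
    then show ?thesis using double_well_even[OF F] by simp
  qed
  show "- m (- 0) = 0" using m by (simp add: instanton_def)
  have "((\<lambda>s. - m (- s)) \<longlongrightarrow> - (-1)) at_top"
    by (intro tendsto_minus filterlim_compose[OF lim(2)] filterlim_uminus_at_bot_at_top)
  then show "((\<lambda>s. - m (- s)) \<longlongrightarrow> 1) at_top" by simp
  show "((\<lambda>s. - m (- s)) \<longlongrightarrow> - 1) at_bot"
    by (intro tendsto_minus filterlim_compose[OF lim(1)] filterlim_uminus_at_top_at_bot)
qed

lemma instanton_eventually_near_one:
  assumes "instanton F m" "a > 0"
  obtains T where "T \<ge> 0" "\<And>s. s \<ge> T \<Longrightarrow> m s > 1 - a"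
proof -
  have "(m \<longlongrightarrow> 1) at_top" using assms by (simp add: instanton_def)
  then have "eventually (\<lambda>s. m s > 1 - a) at_top" using assms(2) by (intro order_tendstoD(1)) auto
  then obtain T where "\<And>s. s \<ge> T \<Longrightarrow> m s > 1 - a" by (auto simp: eventually_at_top_linorder)
  then show thesis using that[of "max 0 T"] by simp
qed

section \<open>Stability of the flow under noisy Euler steps\<close>

lemma power2_add_le_weighted:
  fixes x y c :: real
  assumes "c > 0"
  shows "(x + y)\<^sup>2 \<le> (1 + c) * x\<^sup>2 + (1 + 1 / c) * y\<^sup>2"
proof -
  have "0 \<le> (c * x - y)\<^sup>2 / c" using assms by simp
  also have "\<dots> = (1 + c) * x\<^sup>2 + (1 + 1 / c) * y\<^sup>2 - (x + y)\<^sup>2"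
    using assms by (simp add: field_simps power2_eq_square)
  finally show ?thesis by simp
qed

text \<open>For the transient phase, where only the Lipschitz bound is known. The additional 1 in
  the rate pays for the weight \<open>d\<close> in Young's inequality, which turns the noise into
  \<open>e^2 / d\<close>, the form of the defects in the action.\<close>

lemma euler_step_expanding:
  fixes z \<beta> e d \<Lambda> :: real
  assumes "0 < d" "d \<le> 1" "\<Lambda> > 0" "\<bar>\<beta>\<bar> \<le> \<Lambda> * \<bar>z\<bar>"
  shows "(z + d * \<beta> + e)\<^sup>2 \<le> exp ((1 + 2 * \<Lambda>) * d) * z\<^sup>2 + 2 * (e\<^sup>2 / d)"
proof -
  have "\<bar>z + d * \<beta>\<bar> \<le> \<bar>z\<bar> + d * (\<Lambda> * \<bar>z\<bar>)"
    using assms by (intro order.trans[OF abs_triangle_ineq] add_left_mono) (simp add: abs_mult)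
  also have "\<dots> = (1 + \<Lambda> * d) * \<bar>z\<bar>" by (simp add: algebra_simps)
  also have "\<dots> \<le> exp (\<Lambda> * d) * \<bar>z\<bar>" by (intro mult_right_mono exp_ge_add_one_self) auto
  finally have "(z + d * \<beta>)\<^sup>2 \<le> (exp (\<Lambda> * d) * \<bar>z\<bar>)\<^sup>2"
    by (metis abs_ge_zero power2_abs power_mono)
  then have 1: "(z + d * \<beta>)\<^sup>2 \<le> exp (2 * \<Lambda> * d) * z\<^sup>2"
    using exp_double[of "\<Lambda> * d"] by (simp add: power_mult_distrib mult.assoc)
  have "(z + d * \<beta> + e)\<^sup>2 \<le> (1 + d) * (z + d * \<beta>)\<^sup>2 + (1 + 1 / d) * e\<^sup>2"
    by (rule power2_add_le_weighted) fact
  also have "\<dots> \<le> exp d * (exp (2 * \<Lambda> * d) * z\<^sup>2) + 2 * (e\<^sup>2 / d)"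
  proof (intro add_mono)
    show "(1 + d) * (z + d * \<beta>)\<^sup>2 \<le> exp d * (exp (2 * \<Lambda> * d) * z\<^sup>2)"
      using 1 by (intro mult_mono exp_ge_add_one_self) auto
    have "(1 + 1 / d) * e\<^sup>2 = (d + 1) * (e\<^sup>2 / d)" using assms by (simp add: field_simps)
    also have "\<dots> \<le> 2 * (e\<^sup>2 / d)" using assms by (intro mult_right_mono) auto
    finally show "(1 + 1 / d) * e\<^sup>2 \<le> 2 * (e\<^sup>2 / d)" .
  qed
  also have "exp d * (exp (2 * \<Lambda> * d) * z\<^sup>2) = exp ((1 + 2 * \<Lambda>) * d) * z\<^sup>2"
    by (simp add: distrib_right exp_add mult.assoc)
  finally show ?thesis .
qed

text \<open>For the phase near the well. Half of the contraction \<open>2 * \<mu> * d\<close>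
  absorbs the second order term of the Euler step, the other half the factor
  \<open>1 + \<mu> * d\<close> from Young's inequality, as
  \<open>(1 + \<mu> * d) * (1 - \<mu> * d) \<le> 1\<close>. Errors then add up without exponential
  growth.\<close>

lemma euler_step_contracting:
  fixes z \<beta> e d \<Lambda> \<mu> :: real
  assumes "0 < d" "d \<le> 1" "\<mu> > 0" "\<bar>\<beta>\<bar> \<le> \<Lambda> * \<bar>z\<bar>" "\<beta> * z \<le> - \<mu> * z\<^sup>2" "d * \<Lambda>\<^sup>2 \<le> \<mu>"
  shows "(z + d * \<beta> + e)\<^sup>2 \<le> z\<^sup>2 + (1 + 1 / \<mu>) * (e\<^sup>2 / d)"
proof -
  have "\<beta>\<^sup>2 \<le> \<Lambda>\<^sup>2 * z\<^sup>2"
    using power_mono[OF assms(4), of 2] by (simp add: power_mult_distrib)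
  then have "d * (d * \<beta>\<^sup>2) \<le> d * (d * (\<Lambda>\<^sup>2 * z\<^sup>2))" using assms by (intro mult_left_mono) auto
  also have "\<dots> = d * (d * \<Lambda>\<^sup>2) * z\<^sup>2" by simp
  also have "\<dots> \<le> d * \<mu> * z\<^sup>2" using assms by (intro mult_left_mono mult_right_mono) auto
  finally have 1: "d * (d * \<beta>\<^sup>2) \<le> d * \<mu> * z\<^sup>2" .
  have 2: "d * (\<beta> * z) \<le> d * (- \<mu> * z\<^sup>2)" using assms by (intro mult_left_mono) auto
  have "(z + d * \<beta>)\<^sup>2 = z\<^sup>2 + 2 * (d * (\<beta> * z)) + d * (d * \<beta>\<^sup>2)"
    by (simp add: power2_eq_square algebra_simps)
  also have "\<dots> \<le> (1 - \<mu> * d) * z\<^sup>2" using 1 2 by (simp add: algebra_simps)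
  finally have 3: "(z + d * \<beta>)\<^sup>2 \<le> (1 - \<mu> * d) * z\<^sup>2" .
  have "(z + d * \<beta> + e)\<^sup>2 \<le> (1 + \<mu> * d) * (z + d * \<beta>)\<^sup>2 + (1 + 1 / (\<mu> * d)) * e\<^sup>2"
    using assms by (intro power2_add_le_weighted) auto
  also have "\<dots> \<le> (1 + \<mu> * d) * ((1 - \<mu> * d) * z\<^sup>2) + (1 + 1 / \<mu>) * (e\<^sup>2 / d)"
  proof (intro add_mono)
    show "(1 + \<mu> * d) * (z + d * \<beta>)\<^sup>2 \<le> (1 + \<mu> * d) * ((1 - \<mu> * d) * z\<^sup>2)"
      using 3 assms by (intro mult_left_mono) (auto intro: add_nonneg_nonneg)
    have "(1 + 1 / (\<mu> * d)) * e\<^sup>2 = (d + 1 / \<mu>) * (e\<^sup>2 / d)" using assms by (simp add: field_simps)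
    also have "\<dots> \<le> (1 + 1 / \<mu>) * (e\<^sup>2 / d)" using assms by (intro mult_right_mono) auto
    finally show "(1 + 1 / (\<mu> * d)) * e\<^sup>2 \<le> (1 + 1 / \<mu>) * (e\<^sup>2 / d)" .
  qed
  also have "(1 + \<mu> * d) * ((1 - \<mu> * d) * z\<^sup>2) = z\<^sup>2 - (\<mu> * d * z)\<^sup>2"
    by (simp add: algebra_simps power2_eq_square)
  also have "\<dots> \<le> z\<^sup>2" by simp
  finally show ?thesis by simp
qed

text \<open>While the instanton travels from 0 towards the well the error may grow exponentially;
  after time \<open>T\<close> both paths are near 1 and each step only adds its noise. So
  \<open>C\<close> contains the exponential of \<open>T + 1\<close> but neither \<open>N\<close> nor
  the total time. Its noise term collects the defects \<open>\<eta>\<close> of the path and the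
  discretisation defects of the sampled instanton.\<close>

lemma noisy_flow_shadowing:
  fixes b m :: "real \<Rightarrow> real" and u t :: "nat \<Rightarrow> real"
  assumes lip: "\<And>x y. \<bar>b x - b y\<bar> \<le> \<Lambda> * \<bar>x - y\<bar>" and \<Lambda>: "\<Lambda> > 0"
    and contr: "\<And>x y. \<bar>x - 1\<bar> \<le> a \<Longrightarrow> \<bar>y - 1\<bar> \<le> a \<Longrightarrow> (b x - b y) * (x - y) \<le> - \<mu> * (x - y)\<^sup>2"
    and a: "a > 0" and \<mu>: "\<mu> > 0"
    and ode: "\<And>s. (m has_real_derivative b (m s)) (at s)"
    and m: "mono m" "\<And>s. -1 \<le> m s" "\<And>s. m s \<le> 1" "m 0 = 0"
    and T: "T \<ge> 0" "\<And>s. s \<ge> T \<Longrightarrow> m s \<ge> 1 - a / 2"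
    and h: "h \<le> 1" "h * \<Lambda>\<^sup>2 \<le> \<mu>" "h > 0"
    and d: "\<And>i. i < N \<Longrightarrow> 0 < t (Suc i) - t i" "\<And>i. i < N \<Longrightarrow> t (Suc i) - t i \<le> h"
    and k: "k \<le> N" "(u k)\<^sup>2 \<le> \<eta>"
    and err: "(\<Sum>i\<in>{k..<N}. (u (Suc i) - u i - (t (Suc i) - t i) * b (u i))\<^sup>2 / (t (Suc i) - t i)) \<le> \<eta>"
    and C: "C = exp ((1 + 2 * \<Lambda>) * (T + 1)) * (\<eta> + (2 + 1 / \<mu>) * (2 * \<eta> + 8 * h * \<Lambda>\<^sup>2))"
    and small: "C \<le> (a / 2)\<^sup>2"
    and i: "k \<le> i" "i \<le> N"
  shows "(u i - m (t i - t k))\<^sup>2 \<le> C"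
proof -
  define D where "D i = t (Suc i) - t i" for i
  define M where "M i = m (t i - t k)" for i
  define e where "e i = u (Suc i) - u i - D i * b (u i)" for i
  define g where "g i = M (Suc i) - M i - D i * b (M i)" for i
  define S where "S i = (\<Sum>j\<in>{k..<i}. (e j - g j)\<^sup>2 / D j)" for i
  define \<kappa> where "\<kappa> = 1 + 2 * \<Lambda>"
  have \<kappa>: "\<kappa> > 0" using \<Lambda> by (simp add: \<kappa>_def)
  have Dpos: "0 < D i" "D i \<le> h" "D i \<le> 1" if "i < N" for i using d[OF that] h by (auto simp: D_def)
  have \<eta>: "\<eta> \<ge> 0" using k(2) by (meson order_trans zero_le_power2)
  have hpos: "k < N \<Longrightarrow> h > 0" using d[of k] by linarith
  have g_le: "\<bar>g i\<bar> \<le> D i * (\<Lambda> * (M (Suc i) - M i))" and M_le: "0 \<le> M (Suc i) - M i" "M (Suc i) - M i \<le> 2"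
    if i: "i < N" for i
  proof -
    let ?x = "t i - t k" and ?y = "t (Suc i) - t k"
    have xy: "?x < ?y" using Dpos[OF i] by (simp add: D_def)
    obtain s where s: "?x < s" "s < ?y" "m ?y - m ?x = (?y - ?x) * b (m s)"
      using MVT2[OF xy, of m "\<lambda>s. b (m s)"] ode by blast
    have ms: "m ?x \<le> m s" "m s \<le> m ?y" using s monoD[OF m(1)] by auto
    then show "0 \<le> M (Suc i) - M i" by (simp add: M_def)
    show "M (Suc i) - M i \<le> 2" using m(2)[of ?x] m(3)[of ?y] by (simp add: M_def)
    have "g i = D i * (b (m s) - b (m ?x))"
      using s(3) by (simp add: g_def M_def D_def algebra_simps)
    then have "\<bar>g i\<bar> = D i * \<bar>b (m s) - b (m ?x)\<bar>" using Dpos[OF i] by (simp add: abs_mult)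
    also have "\<dots> \<le> D i * (\<Lambda> * \<bar>m s - m ?x\<bar>)" using Dpos[OF i] lip by (intro mult_left_mono) auto
    also have "\<dots> \<le> D i * (\<Lambda> * (M (Suc i) - M i))"
      using Dpos[OF i] \<Lambda> ms by (intro mult_left_mono) (auto simp: M_def)
    finally show "\<bar>g i\<bar> \<le> D i * (\<Lambda> * (M (Suc i) - M i))" .
  qed
  \<comment> \<open>In the square of the defect one increment of the instanton is bounded by 2 and
    the other telescopes, so the sum is of order \<open>h\<close> however long the grid is.\<close>
  have gsum: "(\<Sum>j\<in>{k..<N}. (g j)\<^sup>2 / D j) \<le> 4 * h * \<Lambda>\<^sup>2"
  proof (cases "k < N")
    case True
    have "(\<Sum>j\<in>{k..<N}. (g j)\<^sup>2 / D j) \<le> (\<Sum>j\<in>{k..<N}. 2 * h * \<Lambda>\<^sup>2 * (M (Suc j) - M j))"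
    proof (rule sum_mono)
      fix j assume "j \<in> {k..<N}" then have j: "j < N" by simp
      have "(g j)\<^sup>2 \<le> (D j * (\<Lambda> * (M (Suc j) - M j)))\<^sup>2"
        using power_mono[OF g_le[OF j], of 2] by simp
      then have "(g j)\<^sup>2 / D j \<le> (D j * (\<Lambda> * (M (Suc j) - M j)))\<^sup>2 / D j"
        using Dpos[OF j] by (intro divide_right_mono) auto
      also have "\<dots> = D j * \<Lambda>\<^sup>2 * (M (Suc j) - M j) * (M (Suc j) - M j)"
        using Dpos[OF j] by (simp add: power2_eq_square field_simps)
      also have "\<dots> \<le> h * \<Lambda>\<^sup>2 * (M (Suc j) - M j) * 2"
        using Dpos[OF j] M_le[OF j] hpos[OF True] by (intro mult_mono) auto
      finally show "(g j)\<^sup>2 / D j \<le> 2 * h * \<Lambda>\<^sup>2 * (M (Suc j) - M j)" by simp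
    qed
    also have "\<dots> = 2 * h * \<Lambda>\<^sup>2 * (M N - M k)"
      using k(1) by (simp add: sum_distrib_left[symmetric] sum_Suc_diff')
    also have "\<dots> \<le> 2 * h * \<Lambda>\<^sup>2 * 2"
      using hpos[OF True] m(2)[of "t k - t k"] m(3)[of "t N - t k"] by (intro mult_left_mono) (auto simp: M_def m(4))
    finally show ?thesis by simp
  next
    case False
    then show ?thesis using h(3) by simp
  qed
  have Smono: "S i \<le> S N" if "i \<le> N" for i
    unfolding S_def using that Dpos by (intro sum_mono2) (auto simp: less_imp_le)
  have S0: "S i \<ge> 0" if "i \<le> N" for i
    unfolding S_def using that Dpos by (intro sum_nonneg) (auto simp: less_imp_le)
  have SN: "S N \<le> 2 * \<eta> + 8 * h * \<Lambda>\<^sup>2"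
  proof -
    have "S N \<le> (\<Sum>j\<in>{k..<N}. 2 * ((e j)\<^sup>2 / D j) + 2 * ((g j)\<^sup>2 / D j))"
      unfolding S_def
    proof (rule sum_mono)
      fix j assume "j \<in> {k..<N}" then have j: "j < N" by simp
      have "(e j - g j)\<^sup>2 \<le> 2 * (e j)\<^sup>2 + 2 * (g j)\<^sup>2"
        using power2_add_le_weighted[of 1 "e j" "- g j"] by simp
      then have "(e j - g j)\<^sup>2 / D j \<le> (2 * (e j)\<^sup>2 + 2 * (g j)\<^sup>2) / D j"
        using Dpos[OF j] by (intro divide_right_mono) auto
      then show "(e j - g j)\<^sup>2 / D j \<le> 2 * ((e j)\<^sup>2 / D j) + 2 * ((g j)\<^sup>2 / D j)"
        by (simp add: add_divide_distrib)
    qed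
    also have "\<dots> = 2 * (\<Sum>j\<in>{k..<N}. (e j)\<^sup>2 / D j) + 2 * (\<Sum>j\<in>{k..<N}. (g j)\<^sup>2 / D j)"
      by (simp add: sum.distrib sum_distrib_left)
    also have "\<dots> \<le> 2 * \<eta> + 2 * (4 * h * \<Lambda>\<^sup>2)"
      using err gsum by (intro add_mono mult_left_mono) (auto simp: e_def D_def)
    finally show ?thesis by simp
  qed
  \<comment> \<open>The exponent is capped at \<open>T + 1\<close>, so every bound that occurs in
    the induction stays below \<open>C\<close>.\<close>
  have bound: "exp (\<kappa> * min (t i - t k) (T + 1)) * (\<eta> + (2 + 1 / \<mu>) * S i) \<le> C" if i: "i \<le> N" for i
    unfolding C \<kappa>_def[symmetric]
  proof (intro mult_mono)
    show "exp (\<kappa> * min (t i - t k) (T + 1)) \<le> exp (\<kappa> * (T + 1))" using \<kappa> by auto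
    show "\<eta> + (2 + 1 / \<mu>) * S i \<le> \<eta> + (2 + 1 / \<mu>) * (2 * \<eta> + 8 * h * \<Lambda>\<^sup>2)"
      using Smono[OF i] SN \<mu> by (intro add_left_mono mult_left_mono) (auto intro: add_nonneg_nonneg)
    show "0 \<le> \<eta> + (2 + 1 / \<mu>) * S i" using \<eta> \<mu> S0[OF i] by auto
  qed auto
  have tk: "t k \<le> t i" if "k \<le> i" "i \<le> N" for i
    using that
  proof (induction i rule: dec_induct)
    case (step n)
    then show ?case using Dpos[of n] by (simp add: D_def)
  qed auto
  have "(u i - M i)\<^sup>2 \<le> exp (\<kappa> * min (t i - t k) (T + 1)) * (\<eta> + (2 + 1 / \<mu>) * S i)"
    using i
  proof (induction i rule: dec_induct)
    case base
    then show ?case using k T(1) by (simp add: S_def M_def m(4))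
  next
    case (step n)
    have n: "n < N" using step by simp
    note Dn = Dpos[OF n]
    define z where "z = u n - M n"
    define \<beta> where "\<beta> = b (u n) - b (M n)"
    define w where "w = min (t n - t k) (T + 1)"
    define w' where "w' = min (t (Suc n) - t k) (T + 1)"
    define Q where "Q = \<eta> + (2 + 1 / \<mu>) * S n"
    define E where "E = (e n - g n)\<^sup>2 / D n"
    have E: "E \<ge> 0" using Dn by (simp add: E_def)
    have w: "0 \<le> w" "w \<le> w'" using tk[of n] step n T(1) Dn by (auto simp: w_def w'_def D_def)
    have IH: "z\<^sup>2 \<le> exp (\<kappa> * w) * Q" using step by (simp add: z_def w_def Q_def)
    have Q: "Q \<ge> 0" using \<eta> \<mu> S0[of n] n by (auto simp: Q_def)
    have z': "u (Suc n) - M (Suc n) = z + D n * \<beta> + (e n - g n)"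
      by (simp add: z_def \<beta>_def e_def g_def algebra_simps)
    have \<beta>: "\<bar>\<beta>\<bar> \<le> \<Lambda> * \<bar>z\<bar>" unfolding \<beta>_def z_def by (rule lip)
    have S': "\<eta> + (2 + 1 / \<mu>) * S (Suc n) = Q + (2 + 1 / \<mu>) * E"
      using step by (simp add: S_def Q_def E_def algebra_simps)
    have exp1: "1 \<le> exp (\<kappa> * w')" using \<kappa> w by auto
    have goal: "(2 + 1 / \<mu>) * E \<le> exp (\<kappa> * w') * ((2 + 1 / \<mu>) * E)"
      using mult_right_mono[OF exp1, of "(2 + 1 / \<mu>) * E"] E \<mu> by auto
    have "(u (Suc n) - M (Suc n))\<^sup>2 \<le> exp (\<kappa> * w') * Q + (2 + 1 / \<mu>) * E"
    proof (cases "t n - t k < T")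
      case True
      \<comment> \<open>A step has length at most 1. If it starts before \<open>T\<close> it ends
        before \<open>T + 1\<close>, and the cap in \<open>w'\<close> is not reached; this is why
        the cap is not \<open>T\<close>.\<close>
      have ww: "w = t n - t k" "w' = w + D n"
        using True Dn by (auto simp: w_def w'_def D_def)
      have "(u (Suc n) - M (Suc n))\<^sup>2 \<le> exp (\<kappa> * D n) * z\<^sup>2 + 2 * E"
        unfolding z' E_def \<kappa>_def using Dn \<Lambda> \<beta> by (intro euler_step_expanding) auto
      also have "\<dots> \<le> exp (\<kappa> * D n) * (exp (\<kappa> * w) * Q) + (2 + 1 / \<mu>) * E"
        using IH E \<mu> by (intro add_mono mult_left_mono mult_right_mono) auto
      also have "exp (\<kappa> * D n) * (exp (\<kappa> * w) * Q) = exp (\<kappa> * w') * Q"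
        by (simp add: ww distrib_left exp_add mult_ac)
      finally show ?thesis .
    next
      case False
      \<comment> \<open>Bootstrap: the induction bound is below \<open>(a / 2)^2\<close>, and so
        places \<open>u n\<close> itself in the neighbourhood where the contraction holds.\<close>
      have "z\<^sup>2 \<le> C" using IH bound[of n] n by (simp add: w_def Q_def)
      then have "\<bar>z\<bar> \<le> a / 2"
        using small a power2_le_iff_abs_le[of "a / 2" z] by linarith
      moreover have "\<bar>M n - 1\<bar> \<le> a / 2"
        using T(2)[of "t n - t k"] False m(3)[of "t n - t k"] by (simp add: M_def)
      ultimately have "\<bar>u n - 1\<bar> \<le> a" "\<bar>M n - 1\<bar> \<le> a" using a unfolding z_def by linarith+
      then have c: "\<beta> * z \<le> - \<mu> * z\<^sup>2" unfolding \<beta>_def z_def by (rule contr)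
      have "D n * \<Lambda>\<^sup>2 \<le> h * \<Lambda>\<^sup>2" using Dn by (intro mult_right_mono) auto
      then have "(u (Suc n) - M (Suc n))\<^sup>2 \<le> z\<^sup>2 + (1 + 1 / \<mu>) * E"
        unfolding z' E_def using Dn \<beta> c \<mu> h(2) by (intro euler_step_contracting[where \<Lambda> = \<Lambda>]) auto
      also have "\<dots> \<le> exp (\<kappa> * w') * Q + (2 + 1 / \<mu>) * E"
      proof (intro add_mono mult_right_mono)
        have "exp (\<kappa> * w) * Q \<le> exp (\<kappa> * w') * Q" using w \<kappa> Q by (intro mult_right_mono) auto
        then show "z\<^sup>2 \<le> exp (\<kappa> * w') * Q" using IH by linarith
      qed (use E in auto)
      finally show ?thesis .
    qed
    also have "\<dots> \<le> exp (\<kappa> * w') * (Q + (2 + 1 / \<mu>) * E)"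
      using goal by (simp add: distrib_left)
    finally show ?case unfolding S' w'_def .
  qed
  then show ?thesis using bound[OF i(2)] by (simp add: M_def)
qed

text \<open>Completing the square: kinetic energy plus \<open>d * (b x)^2 / 2\<close> equals the
  squared defect plus \<open>b x * (y - x)\<close>. The mean value theorem replaces the last product
  by an increment of \<open>\<Phi>\<close>, at the price
  \<open>\<Lambda> * (y - x)^2\<close>.\<close>

lemma action_step:
  fixes b \<Phi> :: "real \<Rightarrow> real"
  assumes lip: "\<And>x y. \<bar>b x - b y\<bar> \<le> \<Lambda> * \<bar>x - y\<bar>"
    and \<Phi>: "\<And>x. (\<Phi> has_real_derivative b x) (at x)"
    and F: "(b x)\<^sup>2 / 2 \<le> Fx" and d: "d > 0"
  shows "\<Phi> y - \<Phi> x - \<Lambda> * (y - x)\<^sup>2 + (y - x - d * b x)\<^sup>2 / (2 * d) \<le> (y - x)\<^sup>2 / (2 * d) + d * Fx"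
proof -
  have pot: "\<Phi> y - \<Phi> x - \<Lambda> * (y - x)\<^sup>2 \<le> b x * (y - x)"
  proof -
    have "\<exists>s. \<bar>s - x\<bar> \<le> \<bar>y - x\<bar> \<and> \<Phi> y - \<Phi> x = (y - x) * b s"
    proof (cases x y rule: linorder_cases)
      case less
      then obtain s where "x < s" "s < y" "\<Phi> y - \<Phi> x = (y - x) * b s" using MVT2[OF less \<Phi>] by blast
      then show ?thesis by (intro exI[of _ s]) auto
    next
      case greater
      then obtain s where "y < s" "s < x" "\<Phi> x - \<Phi> y = (x - y) * b s" using MVT2[OF greater \<Phi>] by blast
      then show ?thesis by (intro exI[of _ s]) (auto simp: algebra_simps)
    qed auto
    then obtain s where s: "\<bar>s - x\<bar> \<le> \<bar>y - x\<bar>" "\<Phi> y - \<Phi> x = (y - x) * b s" by blast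
    have "(y - x) * (b s - b x) \<le> \<bar>y - x\<bar> * \<bar>b s - b x\<bar>" by (metis abs_ge_self abs_mult)
    also have "\<dots> \<le> \<bar>y - x\<bar> * (\<Lambda> * \<bar>y - x\<bar>)"
    proof (intro mult_left_mono)
      have "\<Lambda> \<ge> 0" using lip[of 0 1] abs_ge_zero[of "b 0 - b 1"] by simp
      then show "\<bar>b s - b x\<bar> \<le> \<Lambda> * \<bar>y - x\<bar>"
        using lip[of s x] s(1) by (meson mult_left_mono order_trans)
    qed auto
    also have "\<dots> = \<Lambda> * \<bar>y - x\<bar>\<^sup>2" by (simp only: power2_eq_square mult_ac)
    finally show ?thesis unfolding power2_abs using s(2) by (simp add: algebra_simps)
  qed
  have "(y - x - d * b x)\<^sup>2 / (2 * d) + b x * (y - x) = (y - x)\<^sup>2 / (2 * d) + d * ((b x)\<^sup>2 / 2)"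
    using d by (simp add: field_simps power2_eq_square)
  also have "\<dots> \<le> (y - x)\<^sup>2 / (2 * d) + d * Fx" using F d by (intro add_left_mono mult_left_mono) auto
  finally show ?thesis using pot by linarith
qed

section \<open>Action of grid paths and its excess over the wall cost\<close>

definition grid_kinetic :: "nat \<Rightarrow> (nat \<Rightarrow> real) \<Rightarrow> (nat \<Rightarrow> real) \<Rightarrow> real" where
  "grid_kinetic N t u = (\<Sum>i<N. (u (Suc i) - u i)\<^sup>2 / (2 * (t (Suc i) - t i)))"

definition grid_mesh :: "real \<Rightarrow> nat \<Rightarrow> (nat \<Rightarrow> real) \<Rightarrow> bool" where
  "grid_mesh h N t \<longleftrightarrow> (\<forall>i<N. 0 < t (Suc i) - t i \<and> t (Suc i) - t i \<le> h)"

text \<open>A single summand of the kinetic energy controls the jump. Small jumps force the path to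
  be nearly 0 where it changes sign.\<close>

lemma grid_kinetic_jump:
  assumes "grid_mesh h N t" "i < N"
  shows "(u (Suc i) - u i)\<^sup>2 \<le> 2 * h * grid_kinetic N t u"
proof -
  have d: "0 < t (Suc i) - t i" "t (Suc i) - t i \<le> h" using assms by (auto simp: grid_mesh_def)
  have le: "(u (Suc i) - u i)\<^sup>2 / (2 * (t (Suc i) - t i)) \<le> grid_kinetic N t u"
    unfolding grid_kinetic_def
    using assms by (intro member_le_sum[of i "{..<N}" "\<lambda>i. (u (Suc i) - u i)\<^sup>2 / (2 * (t (Suc i) - t i))"])
      (auto simp: grid_mesh_def less_imp_le intro!: divide_nonneg_nonneg)
  have "(u (Suc i) - u i)\<^sup>2 = 2 * (t (Suc i) - t i) * ((u (Suc i) - u i)\<^sup>2 / (2 * (t (Suc i) - t i)))"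
    using d by simp
  also have "\<dots> \<le> 2 * h * grid_kinetic N t u"
    using le d by (intro mult_mono) auto
  finally show ?thesis .
qed

text \<open>The sum of \<open>action_step\<close> over the grid. The price for the mean value
  theorem is \<open>2 * h * \<Lambda>\<close> times the kinetic energy and disappears with the mesh.
  Each cell charges its potential to its left end: the first one to a zero of \<open>F\<close>, the
  others with length at most \<open>h\<close>.\<close>

lemma grid_action_excess:
  assumes lip: "\<And>x y. \<bar>b x - b y\<bar> \<le> \<Lambda> * \<bar>x - y\<bar>" and \<Lambda>: "\<Lambda> > 0"
    and \<Phi>: "\<And>x. (\<Phi> has_real_derivative b x) (at x)"
    and F: "\<And>x. (b x)\<^sup>2 / 2 \<le> F x" and F0: "F (u 0) = 0"
    and mesh: "grid_mesh h N t" and N: "N > 0" and h: "h > 0"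
  shows "\<Phi> (u N) - \<Phi> (u 0) - 2 * h * \<Lambda> * grid_kinetic N t u
      + (\<Sum>i<N. (u (Suc i) - u i - (t (Suc i) - t i) * b (u i))\<^sup>2 / (t (Suc i) - t i)) / 2
    \<le> grid_kinetic N t u + h * (\<Sum>i\<in>{1..<N}. F (u i))"
proof -
  define D where "D i = t (Suc i) - t i" for i
  have D: "0 < D i" "D i \<le> h" if "i < N" for i using mesh that by (auto simp: grid_mesh_def D_def)
  have F_nonneg: "F x \<ge> 0" for x using F[of x] by (meson order_trans zero_le_power2 divide_nonneg_pos zero_less_numeral)
  have pot: "(\<Sum>i<N. D i * F (u i)) \<le> h * (\<Sum>i\<in>{1..<N}. F (u i))"
  proof -
    have "(\<Sum>i<N. D i * F (u i)) = D 0 * F (u 0) + (\<Sum>i\<in>{1..<N}. D i * F (u i))"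
      using N by (simp add: sum.atLeast_Suc_lessThan lessThan_atLeast0)
    also have "\<dots> \<le> (\<Sum>i\<in>{1..<N}. h * F (u i))"
      using F0 D F_nonneg by (auto intro!: sum_mono mult_right_mono)
    finally show ?thesis by (simp add: sum_distrib_left)
  qed
  have jumps: "(\<Sum>i<N. \<Lambda> * (u (Suc i) - u i)\<^sup>2) \<le> 2 * h * \<Lambda> * grid_kinetic N t u"
  proof -
    have "(\<Sum>i<N. \<Lambda> * (u (Suc i) - u i)\<^sup>2) \<le> (\<Sum>i<N. 2 * h * \<Lambda> * ((u (Suc i) - u i)\<^sup>2 / (2 * D i)))"
    proof (rule sum_mono)
      fix i assume "i \<in> {..<N}"
      then have i: "i < N" by simp
      have "\<Lambda> * (u (Suc i) - u i)\<^sup>2 = 2 * D i * \<Lambda> * ((u (Suc i) - u i)\<^sup>2 / (2 * D i))"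
        using D[OF i] by simp
      also have "\<dots> \<le> 2 * h * \<Lambda> * ((u (Suc i) - u i)\<^sup>2 / (2 * D i))"
        using D[OF i] \<Lambda> by (intro mult_right_mono) auto
      finally show "\<Lambda> * (u (Suc i) - u i)\<^sup>2 \<le> 2 * h * \<Lambda> * ((u (Suc i) - u i)\<^sup>2 / (2 * D i))" .
    qed
    then show ?thesis by (simp add: grid_kinetic_def sum_distrib_left D_def)
  qed
  have "(\<Sum>i<N. \<Phi> (u (Suc i)) - \<Phi> (u i) - \<Lambda> * (u (Suc i) - u i)\<^sup>2
      + (u (Suc i) - u i - D i * b (u i))\<^sup>2 / (2 * D i))
      \<le> (\<Sum>i<N. (u (Suc i) - u i)\<^sup>2 / (2 * D i) + D i * F (u i))"
    using D by (intro sum_mono action_step[OF lip \<Phi> F]) auto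
  moreover have "(\<Sum>i<N. \<Phi> (u (Suc i)) - \<Phi> (u i)) = \<Phi> (u N) - \<Phi> (u 0)"
    by (rule sum_lessThan_telescope)
  moreover have "(\<Sum>i<N. (u (Suc i) - u i - D i * b (u i))\<^sup>2 / (2 * D i)) =
      (\<Sum>i<N. (u (Suc i) - u i - D i * b (u i))\<^sup>2 / D i) / 2"
    by (simp add: sum_divide_distrib mult.commute)
  ultimately show ?thesis using pot jumps
    by (simp add: sum.distrib sum_subtractf grid_kinetic_def D_def)
qed

text \<open>The excess of the action over the wall cost bounds the sum of the squared defects, and
  \<open>noisy_flow_shadowing\<close> turns this into closeness to the instanton that vanishes at
  time \<open>t k\<close>. The radius \<open>\<delta> / 4\<close> leaves room for oscillations
  between grid points.\<close>

lemma low_action_forward: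
  assumes F: "double_well F" and m: "instanton F m"
  obtains c \<delta>0 where "c > 0" "\<delta>0 > 0" "\<And>\<delta>. 0 < \<delta> \<Longrightarrow> \<delta> \<le> \<delta>0 \<Longrightarrow> \<exists>h0>0. \<forall>h N t u k.
      0 < h \<and> h \<le> h0 \<and> 0 < N \<and> grid_mesh h N t \<and> u 0 = -1 \<and> u N = 1 \<and>
      grid_kinetic N t u + h * (\<Sum>i\<in>{1..<N}. F (u i)) \<le> wall_cost F + c * \<delta>\<^sup>2 \<and>
      k \<le> N \<and> (u k)\<^sup>2 \<le> 2 * h * (wall_cost F + 1) \<longrightarrow>
      (\<forall>i\<in>{k..N}. \<bar>u i - m (t i - t k)\<bar> \<le> \<delta> / 4)"
proof -
  obtain \<Lambda> where \<Lambda>: "\<Lambda> > 0" "\<And>x y. \<bar>drift F x - drift F y\<bar> \<le> \<Lambda> * \<bar>x - y\<bar>"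
    using drift_lipschitz[OF F] by blast
  obtain a \<mu> where a: "a > 0" "a \<le> 1" "\<mu> > 0"
    "\<And>x y. \<bar>x - 1\<bar> \<le> a \<Longrightarrow> \<bar>y - 1\<bar> \<le> a \<Longrightarrow> (drift F x - drift F y) * (x - y) \<le> - \<mu> * (x - y)\<^sup>2"
    using drift_contracting[OF F] by blast
  obtain \<Phi> where \<Phi>: "\<And>x. (\<Phi> has_real_derivative drift F x) (at x)" "\<Phi> 1 - \<Phi> (-1) = wall_cost F"
    using drift_potential[OF F] by blast
  obtain T where T: "T \<ge> 0" "\<And>s. s \<ge> T \<Longrightarrow> m s > 1 - a / 2"
    using instanton_eventually_near_one[OF m, of "a / 2"] a by auto
  have m0: "m 0 = 0" using m by (simp add: instanton_def)
  define w where "w = wall_cost F + 1"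
  have w: "w > 0" using wall_cost_nonneg[OF F] by (simp add: w_def)
  define D where "D = exp ((1 + 2 * \<Lambda>) * (T + 1))"
  \<comment> \<open>With \<open>q = c * \<delta>^2\<close>, the 4 stands for the defect bound
    \<open>4 * q\<close>, and \<open>9 = 8 + 1\<close> for twice this bound plus the discretisation
    defect of at most \<open>q\<close>. The choice makes the shadowing constant at most
    \<open>(\<delta> / 4)^2\<close>.\<close>
  define c where "c = min 1 (1 / (16 * D * (4 + 9 * (2 + 1 / \<mu>))))"
  \<comment> \<open>\<open>\<delta> \<le> 2 * a\<close> keeps the error below \<open>a / 2\<close>,
    inside the contracting region; \<open>\<delta> \<le> 1\<close> gives
    \<open>q \<le> 1\<close>.\<close>
  define \<delta>0 where "\<delta>0 = min 1 (2 * a)"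
  have D: "D > 0" by (simp add: D_def)
  have K: "4 + 9 * (2 + 1 / \<mu>) > 0" using a by (intro add_pos_pos mult_pos_pos) auto
  have c: "c > 0" "c \<le> 1" "D * c * (4 + 9 * (2 + 1 / \<mu>)) \<le> 1 / 16"
  proof -
    show "c > 0" "c \<le> 1" using D K by (auto simp: c_def)
    have "c * (16 * D * (4 + 9 * (2 + 1 / \<mu>))) \<le> 1 / (16 * D * (4 + 9 * (2 + 1 / \<mu>))) * (16 * D * (4 + 9 * (2 + 1 / \<mu>)))"
      using D K by (intro mult_right_mono) (auto simp: c_def)
    also have "\<dots> = 1" using D K by (metis mult_pos_pos nonzero_eq_divide_eq less_irrefl zero_less_numeral)
    finally show "D * c * (4 + 9 * (2 + 1 / \<mu>)) \<le> 1 / 16" by (simp add: mult_ac)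
  qed
  show thesis
  proof (rule that[OF c(1)])
    show "\<delta>0 > 0" using a by (simp add: \<delta>0_def)
    fix \<delta> :: real assume \<delta>: "0 < \<delta>" "\<delta> \<le> \<delta>0"
    define q where "q = c * \<delta>\<^sup>2"
    have q: "q > 0" using c \<delta> by (simp add: q_def)
    have q1: "q \<le> 1"
    proof -
      have "\<delta>\<^sup>2 \<le> 1" using \<delta> by (simp add: \<delta>0_def abs_square_le_1)
      then show ?thesis using mult_mono[of c 1 "\<delta>\<^sup>2" 1] c by (simp add: q_def)
    qed
    \<comment> \<open>In this order: steps of length at most 1; Euler steps that still contract;
      then bounds by multiples of \<open>q\<close> for the jump correction of the action, the
      squared starting value, and the discretisation defect of the instanton.\<close>
    define h0 where "h0 = Min {1, \<mu> / \<Lambda>\<^sup>2, q / (2 * \<Lambda> * w), q / w, q / (8 * \<Lambda>\<^sup>2)}"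
    have h0: "h0 > 0" "h0 \<le> 1" "h0 \<le> \<mu> / \<Lambda>\<^sup>2" "h0 \<le> q / (2 * \<Lambda> * w)" "h0 \<le> q / w" "h0 \<le> q / (8 * \<Lambda>\<^sup>2)"
      using a \<Lambda> w q by (auto simp: h0_def)
    show "\<exists>h0>0. \<forall>h N t u k.
      0 < h \<and> h \<le> h0 \<and> 0 < N \<and> grid_mesh h N t \<and> u 0 = -1 \<and> u N = 1 \<and>
      grid_kinetic N t u + h * (\<Sum>i\<in>{1..<N}. F (u i)) \<le> wall_cost F + c * \<delta>\<^sup>2 \<and>
      k \<le> N \<and> (u k)\<^sup>2 \<le> 2 * h * (wall_cost F + 1) \<longrightarrow>
      (\<forall>i\<in>{k..N}. \<bar>u i - m (t i - t k)\<bar> \<le> \<delta> / 4)"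
    proof (intro exI[of _ h0] conjI allI impI ballI h0)
      fix h N t u k i
      assume A: "0 < h \<and> h \<le> h0 \<and> 0 < N \<and> grid_mesh h N t \<and> u 0 = -1 \<and> u N = 1 \<and>
        grid_kinetic N t u + h * (\<Sum>i\<in>{1..<N}. F (u i)) \<le> wall_cost F + c * \<delta>\<^sup>2 \<and>
        k \<le> N \<and> (u k)\<^sup>2 \<le> 2 * h * (wall_cost F + 1)"
        and i: "i \<in> {k..N}"
      then have h: "0 < h" "h \<le> h0" and mesh: "grid_mesh h N t" and act:
        "grid_kinetic N t u + h * (\<Sum>i\<in>{1..<N}. F (u i)) \<le> wall_cost F + q" by (auto simp: q_def)
      have mul: "h * x \<le> y" if "h0 \<le> y / x" "x > 0" for x y
        using that h by (simp add: pos_le_divide_eq) (meson mult_right_mono order_trans less_imp_le)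
      have h1: "h \<le> 1" "h * \<Lambda>\<^sup>2 \<le> \<mu>" "h * (2 * \<Lambda> * w) \<le> q" "h * w \<le> q" "h * (8 * \<Lambda>\<^sup>2) \<le> q"
        using h h0 \<Lambda> w by (auto intro!: mul)
      have kin: "grid_kinetic N t u \<le> w"
      proof -
        have "0 \<le> h * (\<Sum>i\<in>{1..<N}. F (u i))"
          using h double_well_nonneg[OF F] by (intro mult_nonneg_nonneg sum_nonneg) auto
        then show ?thesis using act q1 unfolding w_def by linarith
      qed
      let ?err = "\<lambda>i. (u (Suc i) - u i - (t (Suc i) - t i) * drift F (u i))\<^sup>2 / (t (Suc i) - t i)"
      have err: "(\<Sum>i<N. ?err i) / 2 \<le> q + 2 * h * \<Lambda> * grid_kinetic N t u"
        using grid_action_excess[of "drift F" \<Lambda> \<Phi> F u h N t, OF \<Lambda>(2,1) \<Phi>(1) drift_square_le[OF F]]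
          act A double_well_zero[OF F, of "-1"] \<Phi>(2) by auto
      also have "2 * h * \<Lambda> * grid_kinetic N t u \<le> 2 * h * \<Lambda> * w" using kin h \<Lambda> by (intro mult_left_mono) auto
      also have "\<dots> \<le> q" using h1(3) by (simp add: mult_ac)
      finally have err': "(\<Sum>i<N. ?err i) \<le> 4 * q" by simp
      have errk: "(\<Sum>i\<in>{k..<N}. ?err i) \<le> 4 * q"
        using mesh by (intro order.trans[OF _ err'] sum_mono2) (auto simp: grid_mesh_def less_imp_le)
      define C where "C = exp ((1 + 2 * \<Lambda>) * (T + 1)) * (4 * q + (2 + 1 / \<mu>) * (2 * (4 * q) + 8 * h * \<Lambda>\<^sup>2))"
      have C: "C \<le> (\<delta> / 4)\<^sup>2"
      proof -
        have "C \<le> D * (4 * q + (2 + 1 / \<mu>) * (9 * q))"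
          unfolding C_def D_def using h1(5) a by (intro mult_left_mono add_left_mono) (auto simp: mult_ac)
        also have "\<dots> = D * c * (4 + 9 * (2 + 1 / \<mu>)) * \<delta>\<^sup>2" by (simp add: q_def algebra_simps)
        also have "\<dots> \<le> 1 / 16 * \<delta>\<^sup>2" using c(3) by (intro mult_right_mono) auto
        finally show ?thesis by (simp add: power2_eq_square)
      qed
      have Ca: "(\<delta> / 4)\<^sup>2 \<le> (a / 2)\<^sup>2" using \<delta> a by (intro power_mono) (auto simp: \<delta>0_def)
      have "(u i - m (t i - t k))\<^sup>2 \<le> C"
      proof (rule noisy_flow_shadowing[OF \<Lambda>(2,1) a(4,1,3) instanton_ode[OF F m] instanton_mono[OF F m]
              instanton_bounds[OF F m] m0 T(1), where h = h and N = N and \<eta> = "4 * q"])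
        show "(u k)\<^sup>2 \<le> 4 * q" using A h1(4) q unfolding w_def by linarith
        show "C = exp ((1 + 2 * \<Lambda>) * (T + 1)) * (4 * q + (2 + 1 / \<mu>) * (2 * (4 * q) + 8 * h * \<Lambda>\<^sup>2))"
          by (simp add: C_def)
        show "C \<le> (a / 2)\<^sup>2" using C Ca by linarith
      qed (use T A h1 h i mesh errk in \<open>auto simp: grid_mesh_def less_imp_le\<close>)
      with C have "(u i - m (t i - t k))\<^sup>2 \<le> (\<delta> / 4)\<^sup>2" by linarith
      then show "\<bar>u i - m (t i - t k)\<bar> \<le> \<delta> / 4" using \<delta> power2_le_iff_abs_le[of "\<delta>/4"] by simp
    qed
  qed
qed

lemma grid_mesh_reverse: "grid_mesh h N t \<Longrightarrow> grid_mesh h N (\<lambda>i. - t (N - i))"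
  unfolding grid_mesh_def
proof (intro allI impI)
  fix i assume a: "\<forall>i<N. 0 < t (Suc i) - t i \<and> t (Suc i) - t i \<le> h" and i: "i < N"
  have "Suc (N - Suc i) = N - i" using i by simp
  then show "0 < - t (N - Suc i) - - t (N - i) \<and> - t (N - Suc i) - - t (N - i) \<le> h"
    using a[rule_format, of "N - Suc i"] i by simp
qed

lemma grid_kinetic_reverse:
  "grid_kinetic N (\<lambda>i. - t (N - i)) (\<lambda>i. - u (N - i)) = grid_kinetic N t u"
proof -
  have "grid_kinetic N (\<lambda>i. - t (N - i)) (\<lambda>i. - u (N - i)) =
     (\<Sum>i<N. (\<lambda>j. (u (Suc j) - u j)\<^sup>2 / (2 * (t (Suc j) - t j))) (N - Suc i))"
    unfolding grid_kinetic_def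
  proof (rule sum.cong[OF refl])
    fix i assume "i \<in> {..<N}"
    then have "Suc (N - Suc i) = N - i" by auto
    then show "(- u (N - Suc i) - - u (N - i))\<^sup>2 / (2 * (- t (N - Suc i) - - t (N - i))) =
         (u (Suc (N - Suc i)) - u (N - Suc i))\<^sup>2 / (2 * (t (Suc (N - Suc i)) - t (N - Suc i)))"
      by (simp add: power2_commute)
  qed
  then show ?thesis
    unfolding sum.nat_diff_reindex[of "\<lambda>j. (u (Suc j) - u j)\<^sup>2 / (2 * (t (Suc j) - t j))"]
    by (simp only: grid_kinetic_def)
qed

text \<open>Shadowing is run forwards from a zero crossing of the path, where the right well attracts,
  and backwards by reflecting the path in the origin.\<close>

lemma low_action_near_instanton:
  assumes F: "double_well F" and m: "instanton F m"
  obtains c \<delta>0 where "c > 0" "\<delta>0 > 0" "\<And>\<delta>. 0 < \<delta> \<Longrightarrow> \<delta> \<le> \<delta>0 \<Longrightarrow> \<exists>h0>0. \<forall>h N t u.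
      0 < h \<and> h \<le> h0 \<and> 0 < N \<and> grid_mesh h N t \<and> u 0 = -1 \<and> u N = 1 \<and>
      grid_kinetic N t u + h * (\<Sum>i\<in>{1..<N}. F (u i)) \<le> wall_cost F + c * \<delta>\<^sup>2 \<longrightarrow>
      (\<exists>\<xi>. \<forall>i\<le>N. \<bar>u i - m (t i - \<xi>)\<bar> \<le> \<delta> / 4)"
proof -
  let ?m = "\<lambda>s. - m (- s)"
  have m': "instanton F ?m" by (rule instanton_reflect[OF F m])
  let ?P = "\<lambda>c m \<delta> h0 h N t u k. 0 < h \<and> h \<le> h0 \<and> 0 < N \<and> grid_mesh h N t \<and> u 0 = -1 \<and> u N = 1 \<and>
      grid_kinetic N t u + h * (\<Sum>i\<in>{1..<N}. F (u i)) \<le> wall_cost F + c * \<delta>\<^sup>2 \<and>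
      k \<le> N \<and> (u k)\<^sup>2 \<le> 2 * h * (wall_cost F + 1) \<longrightarrow>
      (\<forall>i\<in>{k..N}. \<bar>u i - m (t i - t k)\<bar> \<le> \<delta> / (4::real))"
  obtain c1 \<delta>1 where 1: "c1 > 0" "\<delta>1 > 0" "\<And>\<delta>. 0 < \<delta> \<Longrightarrow> \<delta> \<le> \<delta>1 \<Longrightarrow> \<exists>h0>0. \<forall>h N t u k. ?P c1 m \<delta> h0 h N t u k"
    by (rule low_action_forward[OF F m]) (rule that)
  obtain c2 \<delta>2 where 2: "c2 > 0" "\<delta>2 > 0" "\<And>\<delta>. 0 < \<delta> \<Longrightarrow> \<delta> \<le> \<delta>2 \<Longrightarrow> \<exists>h0>0. \<forall>h N t u k. ?P c2 ?m \<delta> h0 h N t u k"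
    by (rule low_action_forward[OF F m']) (rule that)
  define c where "c = min c1 c2"
  \<comment> \<open>The bound \<open>1 / (1 + c)\<close> yields
    \<open>c * \<delta>^2 \<le> 1\<close>, hence kinetic energy at most
    \<open>wall_cost F + 1\<close>.\<close>
  define \<delta>0 where "\<delta>0 = min (min \<delta>1 \<delta>2) (1 / (1 + c))"
  have c: "c > 0" "c \<le> c1" "c \<le> c2" using 1 2 by (auto simp: c_def)
  show thesis
  proof (rule that[of c \<delta>0])
    show "c > 0" "\<delta>0 > 0" using 1 2 c by (auto simp: \<delta>0_def)
    fix \<delta> :: real assume \<delta>: "0 < \<delta>" "\<delta> \<le> \<delta>0"
    have c\<delta>: "c * \<delta>\<^sup>2 \<le> 1"
    proof -
      have \<delta>': "\<delta> \<le> 1 / (1 + c)" "1 / (1 + c) \<le> 1" using \<delta> c by (auto simp: \<delta>0_def)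
      then have "\<delta> \<le> 1" by linarith
      then have "c * \<delta>\<^sup>2 \<le> (1 + c) * (\<delta> * 1)"
        unfolding power2_eq_square using c \<delta> \<open>\<delta> \<le> 1\<close> by (intro mult_mono) auto
      also have "\<dots> \<le> (1 + c) * (1 / (1 + c) * 1)" using \<delta>' c by (intro mult_left_mono mult_right_mono) auto
      finally show ?thesis using c by simp
    qed
    obtain h1 where h1: "h1 > 0" "\<forall>h N t u k. ?P c1 m \<delta> h1 h N t u k"
      using 1(3)[of \<delta>] \<delta> unfolding \<delta>0_def by fastforce
    obtain h2 where h2: "h2 > 0" "\<forall>h N t u k. ?P c2 ?m \<delta> h2 h N t u k"
      using 2(3)[of \<delta>] \<delta> unfolding \<delta>0_def by fastforce
    show "\<exists>h0>0. \<forall>h N t u.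
      0 < h \<and> h \<le> h0 \<and> 0 < N \<and> grid_mesh h N t \<and> u 0 = -1 \<and> u N = 1 \<and>
      grid_kinetic N t u + h * (\<Sum>i\<in>{1..<N}. F (u i)) \<le> wall_cost F + c * \<delta>\<^sup>2 \<longrightarrow>
      (\<exists>\<xi>. \<forall>i\<le>N. \<bar>u i - m (t i - \<xi>)\<bar> \<le> \<delta> / 4)"
    proof (rule exI[of _ "min h1 h2"], intro conjI allI impI)
      show "min h1 h2 > 0" using h1 h2 by simp
      fix h N t u
      assume A: "0 < h \<and> h \<le> min h1 h2 \<and> 0 < N \<and> grid_mesh h N t \<and> u 0 = -1 \<and> u N = 1 \<and>
        grid_kinetic N t u + h * (\<Sum>i\<in>{1..<N}. F (u i)) \<le> wall_cost F + c * \<delta>\<^sup>2"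
      \<comment> \<open>The last nonpositive value. The next one is positive, so
        \<open>\<bar>u k\<bar>\<close> is at most one jump of the path, which is small with the
        mesh.\<close>
      define k where "k = Max {i. i \<le> N \<and> u i \<le> 0}"
      have fin: "finite {i. i \<le> N \<and> u i \<le> 0}" by simp
      have ne: "{i. i \<le> N \<and> u i \<le> 0} \<noteq> {}" using A by (auto intro!: exI[of _ 0])
      have k: "k \<le> N" "u k \<le> 0" using Max_in[OF fin ne] by (auto simp: k_def)
      have kN: "k < N" using k A by (cases "k = N") auto
      have k': "u (Suc k) > 0"
      proof (rule ccontr)
        assume "\<not> u (Suc k) > 0"
        then have "Suc k \<le> k" unfolding k_def using kN by (intro Max_ge) (auto simp: k_def)
        then show False by simp
      qed
      have V: "0 \<le> h * (\<Sum>i\<in>{1..<N}. F (u i))"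
        using A double_well_nonneg[OF F] by (intro mult_nonneg_nonneg sum_nonneg) auto
      have kin: "grid_kinetic N t u \<le> wall_cost F + 1" using A V c\<delta> by linarith
      have uk: "(u k)\<^sup>2 \<le> 2 * h * (wall_cost F + 1)"
      proof -
        have "\<bar>u k\<bar> \<le> \<bar>u (Suc k) - u k\<bar>" using k k' by linarith
        then have "(u k)\<^sup>2 \<le> (u (Suc k) - u k)\<^sup>2" by (simp add: abs_le_square_iff)
        also have "\<dots> \<le> 2 * h * grid_kinetic N t u" using A kN by (intro grid_kinetic_jump) auto
        also have "\<dots> \<le> 2 * h * (wall_cost F + 1)" using kin A by (intro mult_left_mono) auto
        finally show ?thesis .
      qed
      have mono: "c * \<delta>\<^sup>2 \<le> c1 * \<delta>\<^sup>2" "c * \<delta>\<^sup>2 \<le> c2 * \<delta>\<^sup>2" using c by (auto intro: mult_right_mono)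
      have fwd: "\<bar>u i - m (t i - t k)\<bar> \<le> \<delta> / 4" if "k \<le> i" "i \<le> N" for i
        using h1(2)[rule_format, of h N t u k] A k(1) uk mono(1) that by auto
      have bwd: "\<bar>u i - m (t i - t k)\<bar> \<le> \<delta> / 4" if "i \<le> k" for i
      proof -
        \<comment> \<open>Reversing time and changing the sign keeps both boundary values. The map
          \<open>i \<mapsto> N - i\<close> preserves \<open>{1..<N}\<close>, so with
          \<open>F\<close> even the potential energy is unchanged as well.\<close>
        let ?t = "\<lambda>i. - t (N - i)" and ?u = "\<lambda>i. - u (N - i)"
        have "(\<Sum>i\<in>{1..<N}. F (?u i)) = (\<Sum>i\<in>{1..<N}. F (u i))"
          by (rule sum.reindex_bij_witness[of _ "\<lambda>i. N - i" "\<lambda>i. N - i"])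
            (auto simp: double_well_even[OF F])
        then have "\<forall>i\<in>{N - k..N}. \<bar>?u i - - m (- (?t i - ?t (N - k)))\<bar> \<le> \<delta> / 4"
          using h2(2)[rule_format, of h N ?t ?u "N - k"] A k(1) uk mono(2) grid_mesh_reverse[of h N t]
            grid_kinetic_reverse[of N t u] by auto
        from bspec[OF this, of "N - i"] show ?thesis using k that by (simp add: abs_minus_commute)
      qed
      show "\<exists>\<xi>. \<forall>i\<le>N. \<bar>u i - m (t i - \<xi>)\<bar> \<le> \<delta> / 4"
        using fwd bwd nat_le_linear by blast
    qed
  qed
qed

section \<open>Independence of Gaussian vectors\<close>

text \<open>A change of measure: \<open>(1 + W) / (1 + c)\<close> is a density under which
  \<open>Z\<close> keeps its characteristic function and hence its law; comparing the two
  probabilities of \<open>Z \<in> A\<close> gives the factorisation. Adding 1 makes the density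
  nonnegative. If \<open>c = -1\<close>, then \<open>W\<close> is almost surely -1.\<close>

lemma (in prob_space) char_twist_real:
  fixes Z W :: "'a \<Rightarrow> real" and c :: real
  assumes [measurable]: "Z \<in> borel_measurable M" "W \<in> borel_measurable M"
    and W: "\<And>w. \<bar>W w\<bar> \<le> 1"
    and char: "\<And>s. (\<integral>w. of_real (W w) * iexp (s * Z w) \<partial>M) = of_real c * char (distr M borel Z) s"
    and A: "A \<in> sets borel"
  shows "(\<integral>w. W w * indicator A (Z w) \<partial>M) = c * prob (Z -` A \<inter> space M)"
proof -
  have int_W: "integrable M W" by (rule integrable_const_bound[of _ 1]) (use W in auto)
  interpret dZ: real_distribution "distr M borel Z" by (rule real_distribution_distr) simp
  have c: "expectation W = c"
  proof -
    have "complex_of_real (expectation W) = of_real c" using char[of 0] dZ.char_zero by simp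
    then show ?thesis by (simp only: of_real_eq_iff)
  qed
  have ind: "expectation (\<lambda>w. indicator A (Z w)) = prob (Z -` A \<inter> space M)"
  proof -
    have "expectation (\<lambda>w. indicator A (Z w)) = (\<integral>w. indicat_real (Z -` A \<inter> space M) w \<partial>M)"
      by (intro Bochner_Integration.integral_cong) (auto simp: indicator_def)
    then show ?thesis using A by simp
  qed
  have int_ind: "integrable M (\<lambda>w. indicator A (Z w) :: real)"
    by (rule integrable_const_bound[of _ 1]) (use A in \<open>auto simp: indicator_def\<close>)
  have int_Wind: "integrable M (\<lambda>w. W w * indicator A (Z w))"
    by (rule integrable_const_bound[of _ 1]) (use A W in \<open>auto simp: indicator_def\<close>)
  have pos: "0 \<le> 1 + W w" for w using W[of w] by (simp add: abs_le_iff)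
  have sum: "expectation (\<lambda>w. 1 + W w) = 1 + c" using int_W c by (simp add: prob_space)
  show ?thesis
  proof (cases "1 + c = 0")
    case True
    have "AE w in M. 1 + W w = 0"
      using integral_nonneg_eq_0_iff_AE[of M "\<lambda>w. 1 + W w"] int_W pos sum True by auto
    then have "(\<integral>w. W w * indicator A (Z w) \<partial>M) = (\<integral>w. - indicator A (Z w) \<partial>M)"
      by (intro integral_cong_AE) (use A in \<open>auto simp: add_eq_0_iff\<close>)
    then show ?thesis using ind True by (simp add: add_eq_0_iff)
  next
    case False
    have c1: "1 + c > 0" using False sum Bochner_Integration.integral_nonneg[of M "\<lambda>w. 1 + W w"] pos by fastforce
    define f where "f w = (1 + W w) / (1 + c)" for w
    have f0: "f w \<ge> 0" for w using pos[of w] c1 by (simp add: f_def)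
    have [measurable]: "f \<in> borel_measurable M" unfolding f_def by measurable
    have "expectation f = expectation (\<lambda>w. 1 + W w) / (1 + c)"
      unfolding f_def by (rule integral_divide_zero)
    then have f1: "expectation f = 1" unfolding sum using c1 by simp
    have int_f: "integrable M f" unfolding f_def using int_W by auto
    define N where "N = density M f"
    have "emeasure N (space N) = ennreal (expectation f)"
      using nn_integral_eq_integral[OF int_f] f0 by (simp add: N_def emeasure_density cong: nn_integral_cong)
    then interpret N: prob_space N by (intro prob_spaceI) (simp add: f1)
    have [measurable]: "Z \<in> borel_measurable N" by (simp add: N_def)
    interpret dN: real_distribution "distr N borel Z" by (rule N.real_distribution_distr) simp
    have int_Z: "integrable M (\<lambda>w. iexp (s * Z w))" for s
      by (rule integrable_const_bound[of _ 1]) auto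
    have int_WZ: "integrable M (\<lambda>w. of_real (W w) * iexp (s * Z w))" for s
      by (rule integrable_const_bound[of _ 1]) (use W in \<open>auto simp: norm_mult\<close>)
    have "char (distr N borel Z) s = char (distr M borel Z) s" for s
    proof -
      have "char (distr N borel Z) s = (\<integral>w. iexp (s * Z w) \<partial>N)"
        unfolding char_def by (subst integral_distr) auto
      also have "\<dots> = (\<integral>w. f w *\<^sub>R iexp (s * Z w) \<partial>M)"
        unfolding N_def by (rule integral_density) (use f0 in auto)
      also have "\<dots> = (\<integral>w. (iexp (s * Z w) + of_real (W w) * iexp (s * Z w)) / of_real (1 + c) \<partial>M)"
        by (intro Bochner_Integration.integral_cong) (auto simp: f_def scaleR_conv_of_real field_simps)
      also have "\<dots> = ((\<integral>w. iexp (s * Z w) \<partial>M) + of_real c * char (distr M borel Z) s) / of_real (1 + c)"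
        using int_Z int_WZ char[of s] by simp
      also have "(\<integral>w. iexp (s * Z w) \<partial>M) = char (distr M borel Z) s"
        unfolding char_def by (subst integral_distr) auto
      also have "(char (distr M borel Z) s + of_real c * char (distr M borel Z) s) / of_real (1 + c) = char (distr M borel Z) s"
      proof -
        have "complex_of_real (1 + c) \<noteq> 0" using c1 unfolding of_real_eq_0_iff by simp
        moreover have "char (distr M borel Z) s + of_real c * char (distr M borel Z) s =
            char (distr M borel Z) s * of_real (1 + c)" by (simp add: algebra_simps)
        ultimately show ?thesis by (metis nonzero_mult_div_cancel_right)
      qed
      finally show ?thesis .
    qed
    then have "distr N borel Z = distr M borel Z"
      by (intro Levy_uniqueness dN.real_distribution_axioms dZ.real_distribution_axioms) auto
    then have "measure (distr N borel Z) A = measure (distr M borel Z) A" by simp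
    then have "measure N (Z -` A \<inter> space M) = prob (Z -` A \<inter> space M)"
      using A by (simp add: measure_distr N_def)
    moreover have "measure N (Z -` A \<inter> space M) = (\<integral>w. f w * indicator A (Z w) \<partial>M)"
    proof -
      have [measurable]: "Z -` A \<inter> space M \<in> sets M" using A by measurable
      have "measure N (Z -` A \<inter> space M) = (\<integral>w. indicator (Z -` A \<inter> space M) w \<partial>N)"
        by (simp add: N_def)
      also have "\<dots> = (\<integral>w. f w *\<^sub>R indicator (Z -` A \<inter> space M) w \<partial>M)"
        unfolding N_def by (rule integral_density) (use f0 in auto)
      also have "\<dots> = (\<integral>w. f w * indicator A (Z w) \<partial>M)"
        by (intro Bochner_Integration.integral_cong) (auto simp: indicator_def)
      finally show ?thesis .
    qed
    ultimately have "prob (Z -` A \<inter> space M) = (\<integral>w. (indicator A (Z w) + W w * indicator A (Z w)) / (1 + c) \<partial>M)"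
      by (simp add: f_def field_simps)
    also have "\<dots> = (prob (Z -` A \<inter> space M) + (\<integral>w. W w * indicator A (Z w) \<partial>M)) / (1 + c)"
      using int_ind int_Wind ind by simp
    finally show ?thesis using c1 by (simp add: field_simps)
  qed
qed

text \<open>The hypothesis passes to the conjugate of \<open>W\<close> by conjugating it at
  \<open>- s\<close>, hence to the real and the imaginary part, to which the real version
  applies.\<close>

lemma (in prob_space) char_twist:
  fixes Z :: "'a \<Rightarrow> real" and W :: "'a \<Rightarrow> complex" and c :: complex
  assumes [measurable]: "Z \<in> borel_measurable M" "W \<in> borel_measurable M"
    and W: "\<And>w. norm (W w) \<le> 1"
    and char: "\<And>s. (\<integral>w. W w * iexp (s * Z w) \<partial>M) = c * char (distr M borel Z) s"
    and A: "A \<in> sets borel"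
  shows "(\<integral>w. W w * indicator A (Z w) \<partial>M) = c * prob (Z -` A \<inter> space M)"
proof -
  let ?\<phi> = "char (distr M borel Z)"
  have [measurable]: "(\<lambda>w. cnj (W w)) \<in> borel_measurable M"
    by (rule borel_measurable_continuous_on[OF continuous_on_cnj[OF continuous_on_id]]) simp
  have int: "integrable M (\<lambda>w. W w * iexp (s * Z w))" "integrable M (\<lambda>w. cnj (W w) * iexp (s * Z w))" for s
    by (rule integrable_const_bound[of _ 1], use W in \<open>auto simp: norm_mult\<close>)+
  have \<phi>: "?\<phi> s = (\<integral>w. iexp (s * Z w) \<partial>M)" for s
    unfolding char_def by (subst integral_distr) auto
  have cnj: "(\<integral>w. cnj (W w) * iexp (s * Z w) \<partial>M) = cnj c * ?\<phi> s" for s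
  proof -
    have "(\<integral>w. cnj (W w) * iexp (s * Z w) \<partial>M) = (\<integral>w. cnj (W w * iexp (- s * Z w)) \<partial>M)"
      by (intro Bochner_Integration.integral_cong) (auto simp: exp_cnj)
    also have "\<dots> = cnj (\<integral>w. W w * iexp (- s * Z w) \<partial>M)" by (rule Bochner_Integration.integral_cnj)
    also have "\<dots> = cnj c * cnj (?\<phi> (- s))" unfolding char by simp
    also have "cnj (?\<phi> (- s)) = ?\<phi> s"
      unfolding \<phi> Bochner_Integration.integral_cnj[symmetric]
      by (intro Bochner_Integration.integral_cong) (auto simp: exp_cnj)
    finally show ?thesis .
  qed
  have re: "(\<integral>w. Re (W w) * indicator A (Z w) \<partial>M) = Re c * prob (Z -` A \<inter> space M)"
  proof (rule char_twist_real)
    show "\<bar>Re (W w)\<bar> \<le> 1" for w using W[of w] abs_Re_le_cmod[of "W w"] by linarith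
    fix s
    have "(\<integral>w. of_real (Re (W w)) * iexp (s * Z w) \<partial>M) =
        (\<integral>w. (W w * iexp (s * Z w) + cnj (W w) * iexp (s * Z w)) / 2 \<partial>M)"
      by (intro Bochner_Integration.integral_cong) (auto simp: complex_eq_iff)
    also have "\<dots> = (c * ?\<phi> s + cnj c * ?\<phi> s) / 2" using int char cnj by simp
    also have "\<dots> = of_real (Re c) * ?\<phi> s" by (simp add: complex_eq_iff)
    finally show "(\<integral>w. of_real (Re (W w)) * iexp (s * Z w) \<partial>M) = of_real (Re c) * ?\<phi> s" .
  qed (use A in auto)
  have im: "(\<integral>w. Im (W w) * indicator A (Z w) \<partial>M) = Im c * prob (Z -` A \<inter> space M)"
  proof (rule char_twist_real)
    show "\<bar>Im (W w)\<bar> \<le> 1" for w using W[of w] abs_Im_le_cmod[of "W w"] by linarith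
    fix s
    have "(\<integral>w. of_real (Im (W w)) * iexp (s * Z w) \<partial>M) =
        (\<integral>w. (W w * iexp (s * Z w) - cnj (W w) * iexp (s * Z w)) * (- \<i> / 2) \<partial>M)"
      by (intro Bochner_Integration.integral_cong) (auto simp: complex_eq_iff)
    also have "\<dots> = (c * ?\<phi> s - cnj c * ?\<phi> s) * (- \<i> / 2)" using int char cnj by simp
    also have "\<dots> = of_real (Im c) * ?\<phi> s" by (simp add: complex_eq_iff)
    finally show "(\<integral>w. of_real (Im (W w)) * iexp (s * Z w) \<partial>M) = of_real (Im c) * ?\<phi> s" .
  qed (use A in auto)
  have intA: "integrable M (\<lambda>w. W w * indicator A (Z w))"
    by (rule integrable_const_bound[of _ 1]) (use W A in \<open>auto simp: norm_mult indicator_def\<close>)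
  show ?thesis
  proof (rule complex_eqI)
    have "Re (\<integral>w. W w * indicator A (Z w) \<partial>M) = (\<integral>w. Re (W w * indicator A (Z w)) \<partial>M)"
      using integral_Re[OF intA] by simp
    also have "\<dots> = (\<integral>w. Re (W w) * indicator A (Z w) \<partial>M)"
      by (intro Bochner_Integration.integral_cong) (auto simp: indicator_def)
    finally show "Re (\<integral>w. W w * indicator A (Z w) \<partial>M) = Re (c * prob (Z -` A \<inter> space M))" using re by simp
    have "Im (\<integral>w. W w * indicator A (Z w) \<partial>M) = (\<integral>w. Im (W w * indicator A (Z w)) \<partial>M)"
      using integral_Im[OF intA] by simp
    also have "\<dots> = (\<integral>w. Im (W w) * indicator A (Z w) \<partial>M)"
      by (intro Bochner_Integration.integral_cong) (auto simp: indicator_def)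
    finally show "Im (\<integral>w. W w * indicator A (Z w) \<partial>M) = Im (c * prob (Z -` A \<inter> space M))" using im by simp
  qed
qed

text \<open>The characteristic exponentials are traded for indicators one coordinate at a time.\<close>

lemma (in prob_space) indep_vars_char:
  fixes Z :: "'i \<Rightarrow> 'a \<Rightarrow> real"
  assumes I: "finite I" and Z: "\<And>i. i \<in> I \<Longrightarrow> Z i \<in> borel_measurable M"
    and char: "\<And>t. (\<integral>w. iexp (\<Sum>i\<in>I. t i * Z i w) \<partial>M) = (\<Prod>i\<in>I. char (distr M borel (Z i)) (t i))"
  shows "indep_vars (\<lambda>_. borel) Z I"
proof -
  let ?\<phi> = "\<lambda>i. char (distr M borel (Z i))"
  let ?W = "\<lambda>J A t w. (\<Prod>j\<in>J. indicator (A j) (Z j w) :: complex) * iexp (\<Sum>k\<in>I - J. t k * Z k w)"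
  \<comment> \<open>The case \<open>J = {}\<close> is the hypothesis, \<open>J = I\<close> the
    product rule for probabilities. The frequencies \<open>t\<close> stay general because the
    induction step needs every frequency in the coordinate that is being replaced.\<close>
  have claim: "(\<integral>w. ?W J A t w \<partial>M) =
      of_real (\<Prod>j\<in>J. prob (Z j -` A j \<inter> space M)) * (\<Prod>k\<in>I - J. ?\<phi> k (t k))"
    if "J \<subseteq> I" "\<And>j. j \<in> J \<Longrightarrow> A j \<in> sets borel" for J and A :: "'i \<Rightarrow> real set" and t
  proof -
    have "finite J" using that(1) I by (rule finite_subset)
    then show ?thesis using that
    proof (induction J arbitrary: t rule: finite_induct)
      case empty
      then show ?case using char[of t] by simp
    next
      case (insert x J)
      then have xI: "x \<in> I" and JI: "J \<subseteq> I" and xJ: "x \<notin> J" and A[measurable]: "A x \<in> sets borel"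
        and AJ: "\<And>j. j \<in> J \<Longrightarrow> A j \<in> sets borel" by auto
      note Z[OF xI, measurable]
      have split: "I - J = insert x (I - insert x J)" using xI xJ by auto
      define V where "V w = (\<Prod>j\<in>J. indicator (A j) (Z j w) :: complex) * iexp (\<Sum>k\<in>I - insert x J. t k * Z k w)" for w
      define c where "c = of_real (\<Prod>j\<in>J. prob (Z j -` A j \<inter> space M)) * (\<Prod>k\<in>I - insert x J. ?\<phi> k (t k))"
      have V_meas[measurable]: "V \<in> borel_measurable M"
      proof -
        have "(\<lambda>w. indicator (A j) (Z j w) :: complex) \<in> borel_measurable M" if "j \<in> J" for j
          using Z[of j] AJ[OF that] JI that by (intro borel_measurable_indicator') auto
        then have 1: "(\<lambda>w. \<Prod>j\<in>J. indicator (A j) (Z j w) :: complex) \<in> borel_measurable M"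
          by (intro borel_measurable_prod)
        have 2: "(\<lambda>w. \<Sum>k\<in>I - insert x J. t k * Z k w) \<in> borel_measurable M"
          using Z by (intro borel_measurable_sum borel_measurable_times) auto
        show ?thesis unfolding V_def using 1 2 by measurable
      qed
      have V_le: "norm (V w) \<le> 1" for w
      proof -
        have "norm (\<Prod>j\<in>J. indicator (A j) (Z j w) :: complex) \<le> 1"
          unfolding prod_norm[symmetric] by (intro prod_le_1) (auto simp: indicator_def)
        then show ?thesis by (simp add: V_def norm_mult)
      qed
      have "(\<integral>w. V w * indicator (A x) (Z x w) \<partial>M) = c * prob (Z x -` A x \<inter> space M)"
      proof (rule char_twist)
        fix s
        let ?t = "t(x := s)"
        have "(\<integral>w. V w * iexp (s * Z x w) \<partial>M) = (\<integral>w. ?W J A ?t w \<partial>M)"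
        proof (intro Bochner_Integration.integral_cong refl)
          fix w
          have "(\<Sum>k\<in>I - J. ?t k * Z k w) = s * Z x w + (\<Sum>k\<in>I - insert x J. t k * Z k w)"
            unfolding split using I by (subst sum.insert) (auto intro!: sum.cong)
          then show "V w * iexp (s * Z x w) = ?W J A ?t w"
            by (simp add: V_def exp_add ring_distribs)
        qed
        also have "\<dots> = of_real (\<Prod>j\<in>J. prob (Z j -` A j \<inter> space M)) * (\<Prod>k\<in>I - J. ?\<phi> k (?t k))"
          by (rule insert.IH) (use JI AJ in auto)
        also have "(\<Prod>k\<in>I - J. ?\<phi> k (?t k)) = ?\<phi> x s * (\<Prod>k\<in>I - insert x J. ?\<phi> k (t k))"
          unfolding split using I by (subst prod.insert) (auto intro!: prod.cong)
        finally show "(\<integral>w. V w * iexp (s * Z x w) \<partial>M) = c * ?\<phi> x s" by (simp add: c_def mult_ac)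
      qed (use V_le in auto)
      moreover have "(\<lambda>w. ?W (insert x J) A t w) = (\<lambda>w. V w * indicator (A x) (Z x w))"
        using insert.hyps by (auto simp: V_def mult_ac)
      ultimately show ?case using insert.hyps by (simp add: c_def mult_ac)
    qed
  qed
  have real_claim: "prob (\<Inter>j\<in>K. Z j -` B j \<inter> space M) = (\<Prod>j\<in>K. prob (Z j -` B j \<inter> space M))"
    if K: "K \<subseteq> I" "K \<noteq> {}" and B: "\<And>j. j \<in> K \<Longrightarrow> B j \<in> sets borel" for K and B :: "'i \<Rightarrow> real set"
  proof -
    \<comment> \<open>Coordinates outside \<open>K\<close> receive the certain event, so the
      identity for the full family also covers its subfamilies.\<close>
    define A where "A j = (if j \<in> K then B j else UNIV)" for j
    have A: "A j \<in> sets borel" for j using B by (auto simp: A_def)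
    have finK: "finite K" using K I by (auto intro: finite_subset)
    define E where "E = (\<Inter>j\<in>K. Z j -` B j \<inter> space M)"
    have E: "E \<in> events"
      unfolding E_def using K finK B Z by (intro sets.finite_INT) (auto intro!: measurable_sets)
    have "(\<integral>w. ?W I A (\<lambda>_. 0) w \<partial>M) = (\<integral>w. complex_of_real (indicator E w) \<partial>M)"
    proof (intro Bochner_Integration.integral_cong refl)
      fix w assume w: "w \<in> space M"
      show "?W I A (\<lambda>_. 0) w = complex_of_real (indicator E w)"
      proof (cases "w \<in> E")
        case True
        then have "(\<Prod>j\<in>I. indicator (A j) (Z j w) :: complex) = 1"
          using K(2) by (intro prod.neutral) (auto simp: A_def E_def)
        then show ?thesis using True by simp
      next
        case False
        then obtain j where "j \<in> K" "Z j w \<notin> B j" using K w by (auto simp: E_def)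
        then have "(\<Prod>j\<in>I. indicator (A j) (Z j w) :: complex) = 0"
          using I K by (intro prod_zero) (auto simp: A_def intro!: bexI[of _ j])
        then show ?thesis using False by simp
      qed
    qed
    also have "\<dots> = of_real (prob E)" using E by (simp add: integral_complex_of_real)
    finally have "complex_of_real (prob E) = of_real (\<Prod>j\<in>I. prob (Z j -` A j \<inter> space M))"
      using claim[of I A "\<lambda>_. 0"] A by simp
    then have "prob E = (\<Prod>j\<in>I. prob (Z j -` A j \<inter> space M))" by (simp only: of_real_eq_iff)
    also have "\<dots> = (\<Prod>j\<in>K. prob (Z j -` B j \<inter> space M))"
      using K I by (intro prod.mono_neutral_cong_right) (auto simp: A_def prob_space)
    finally show ?thesis by (simp add: E_def)
  qed
  show ?thesis
    unfolding indep_vars_def2 indep_sets_def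
  proof (intro conjI ballI allI impI Z)
    fix i assume "i \<in> I"
    then show "{Z i -` A \<inter> space M |A. A \<in> sets borel} \<subseteq> events" using Z by (auto intro: measurable_sets)
  next
    fix K E assume K: "K \<subseteq> I" "K \<noteq> {}" "finite K"
      and E: "E \<in> (\<Pi> i\<in>K. {Z i -` A \<inter> space M |A. A \<in> sets borel})"
    then have "\<forall>j\<in>K. \<exists>B. B \<in> sets borel \<and> E j = Z j -` B \<inter> space M" by (auto simp: Pi_iff)
    then obtain B where B: "\<And>j. j \<in> K \<Longrightarrow> B j \<in> sets borel" "\<And>j. j \<in> K \<Longrightarrow> E j = Z j -` B j \<inter> space M"
      by metis
    show "prob (\<Inter> (E ` K)) = (\<Prod>j\<in>K. prob (E j))"
      using real_claim[OF K(1,2) B(1)] B(2) by (simp cong: INF_cong prod.cong)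
  qed auto
qed

section \<open>Moments, tails and small balls of Gaussian variables\<close>

lemma gaussian_rv_shift:
  assumes "prob_space P" and Y: "gaussian_rv P Y"
  shows "gaussian_rv P (\<lambda>w. Y w - c)"
proof -
  interpret prob_space P by fact
  have [measurable]: "Y \<in> borel_measurable P" using Y by (simp add: gaussian_rv_def)
  show ?thesis
    unfolding gaussian_rv_def
  proof (intro conjI)
    consider (const) k where "AE w in P. Y w = k"
      | (normal) \<mu> \<sigma> where "\<sigma> > 0" "distributed P lborel Y (normal_density \<mu> \<sigma>)"
      using Y by (auto simp: gaussian_rv_def)
    then show "(\<exists>k. AE w in P. Y w - c = k) \<or>
      (\<exists>\<mu> \<sigma>. \<sigma> > 0 \<and> distributed P lborel (\<lambda>w. Y w - c) (normal_density \<mu> \<sigma>))"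
    proof cases
      case const
      then show ?thesis by (intro disjI1 exI[of _ "k - c"]) auto
    next
      case normal
      from normal_density_affine[OF normal(2,1), of 1 "- c"] normal(1) show ?thesis
        by (intro disjI2 exI[of _ "\<mu> - c"] exI[of _ \<sigma>]) simp
    qed
  qed measurable
qed

text \<open>Centring forces the constant of a degenerate law to be 0, so the variance decides
  between the two alternatives. Integrability is recovered from the law, since the value of an
  integral alone does not imply it.\<close>

lemma gaussian_rv_cases:
  assumes "prob_space P" and Y: "gaussian_rv P Y"
    and mean: "(\<integral>w. Y w \<partial>P) = 0" and var: "(\<integral>w. (Y w)\<^sup>2 \<partial>P) = v"
  shows "v = 0 \<and> (AE w in P. Y w = 0) \<or> v > 0 \<and> distributed P lborel Y (normal_density 0 (sqrt v))"
    and "integrable P (\<lambda>w. (Y w)\<^sup>2)" "integrable P Y"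
proof -
  interpret prob_space P by fact
  have [measurable]: "Y \<in> borel_measurable P" using Y by (simp add: gaussian_rv_def)
  consider (const) k where "AE w in P. Y w = k"
    | (normal) \<mu> \<sigma> where "\<sigma> > 0" "distributed P lborel Y (normal_density \<mu> \<sigma>)"
    using Y by (auto simp: gaussian_rv_def)
  then have "(v = 0 \<and> (AE w in P. Y w = 0) \<or> v > 0 \<and> distributed P lborel Y (normal_density 0 (sqrt v)))
    \<and> integrable P (\<lambda>w. (Y w)\<^sup>2) \<and> integrable P Y"
  proof cases
    case const
    have "(\<integral>w. Y w \<partial>P) = (\<integral>w. k \<partial>P)" using const by (intro integral_cong_AE) auto
    then have k: "k = 0" using mean by (simp add: prob_space)
    have "(\<integral>w. (Y w)\<^sup>2 \<partial>P) = (\<integral>w. 0 \<partial>P)" using const k by (intro integral_cong_AE) auto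
    then have "v = 0" using var by simp
    moreover have "integrable P (\<lambda>w. (Y w)\<^sup>2) \<longleftrightarrow> integrable P (\<lambda>w. 0::real)"
      using const k by (intro integrable_cong_AE) auto
    moreover have "integrable P Y \<longleftrightarrow> integrable P (\<lambda>w. 0::real)"
      using const k by (intro integrable_cong_AE) auto
    ultimately show ?thesis using const k by auto
  next
    case normal
    have \<mu>: "\<mu> = 0" using normal_distributed_expectation[OF normal] mean by simp
    have v: "v = \<sigma>\<^sup>2" using normal_distributed_variance[OF normal] mean var by simp
    have "integrable lborel (\<lambda>x. normal_density 0 \<sigma> x * x\<^sup>2)"
      "integrable lborel (\<lambda>x. normal_density 0 \<sigma> x * x)"
      using integrable_normal_moment[OF normal(1), of 0 2] integrable_normal_moment[OF normal(1), of 0 1] by auto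
    then have "integrable P (\<lambda>w. (Y w)\<^sup>2)" "integrable P Y"
      using distributed_integrable[OF normal(2), of "\<lambda>x. x\<^sup>2"]
        distributed_integrable[OF normal(2), of "\<lambda>x. x"] \<mu> by auto
    then show ?thesis using normal \<mu> v by auto
  qed
  then show "v = 0 \<and> (AE w in P. Y w = 0) \<or> v > 0 \<and> distributed P lborel Y (normal_density 0 (sqrt v))"
    "integrable P (\<lambda>w. (Y w)\<^sup>2)" "integrable P Y" by auto
qed

lemma gaussian_rv_char:
  assumes P: "prob_space P" and Y: "gaussian_rv P Y"
    and mean: "(\<integral>w. Y w \<partial>P) = 0" and var: "(\<integral>w. (Y w)\<^sup>2 \<partial>P) = v"
  shows "(\<integral>w. iexp (s * Y w) \<partial>P) = of_real (exp (- s\<^sup>2 * v / 2))"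
proof -
  interpret prob_space P by fact
  have [measurable]: "Y \<in> borel_measurable P" using Y by (simp add: gaussian_rv_def)
  from gaussian_rv_cases(1)[OF assms] show ?thesis
  proof (elim disjE conjE)
    assume v: "v = 0" and Y0: "AE w in P. Y w = 0"
    have "(\<integral>w. iexp (s * Y w) \<partial>P) = (\<integral>w. 1 \<partial>P)" using Y0 by (intro integral_cong_AE) auto
    then show ?thesis using v by (simp add: prob_space)
  next
    assume v: "v > 0" and D: "distributed P lborel Y (normal_density 0 (sqrt v))"
    have D': "distributed P lborel (\<lambda>w. Y w / sqrt v) std_normal_density"
      using D normal_standard_normal_convert[of "sqrt v" Y 0] v by simp
    have "char std_normal_distribution (s * sqrt v) = (\<integral>w. iexp (s * sqrt v * (Y w / sqrt v)) \<partial>P)"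
      unfolding char_def distributed_distr_eq_density[OF D', symmetric]
      by (subst integral_distr) auto
    then show ?thesis using v by (simp add: char_std_normal_distribution power_mult_distrib)
  qed
qed

lemma gaussian_rv_exp_moment:
  assumes P: "prob_space P" and Y: "gaussian_rv P Y"
    and mean: "(\<integral>w. Y w \<partial>P) = 0" and var: "(\<integral>w. (Y w)\<^sup>2 \<partial>P) = v"
  shows "(\<integral>\<^sup>+w. ennreal (exp (\<kappa> * Y w)) \<partial>P) = ennreal (exp (\<kappa>\<^sup>2 * v / 2))"
proof -
  interpret prob_space P by fact
  have [measurable]: "Y \<in> borel_measurable P" using Y by (simp add: gaussian_rv_def)
  from gaussian_rv_cases(1)[OF assms] show ?thesis
  proof (elim disjE conjE)
    assume v: "v = 0" and Y0: "AE w in P. Y w = 0"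
    have "(\<integral>\<^sup>+w. ennreal (exp (\<kappa> * Y w)) \<partial>P) = (\<integral>\<^sup>+w. 1 \<partial>P)" using Y0 by (intro nn_integral_cong_AE) auto
    then show ?thesis using v by (simp add: emeasure_space_1)
  next
    assume v: "v > 0" and D: "distributed P lborel Y (normal_density 0 (sqrt v))"
    have "(\<integral>\<^sup>+w. ennreal (exp (\<kappa> * Y w)) \<partial>P) =
       (\<integral>\<^sup>+x. ennreal (normal_density 0 (sqrt v) x) * ennreal (exp (\<kappa> * x)) \<partial>lborel)"
      by (rule distributed_nn_integral[OF D, symmetric]) measurable
    also have "\<dots> = (\<integral>\<^sup>+x. ennreal (exp (\<kappa>\<^sup>2 * v / 2)) * ennreal (normal_density (\<kappa> * v) (sqrt v) x) \<partial>lborel)"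
    proof (intro nn_integral_cong)
      fix x
      have "- x\<^sup>2 / (2 * v) + \<kappa> * x = \<kappa>\<^sup>2 * v / 2 + - (x - \<kappa> * v)\<^sup>2 / (2 * v)"
        using v by (simp add: field_simps power2_eq_square)
      then have "normal_density 0 (sqrt v) x * exp (\<kappa> * x) = exp (\<kappa>\<^sup>2 * v / 2) * normal_density (\<kappa> * v) (sqrt v) x"
        using v by (simp add: normal_density_def field_simps flip: exp_add)
      then show "ennreal (normal_density 0 (sqrt v) x) * ennreal (exp (\<kappa> * x)) =
         ennreal (exp (\<kappa>\<^sup>2 * v / 2)) * ennreal (normal_density (\<kappa> * v) (sqrt v) x)"
        by (simp flip: ennreal_mult)
    qed
    also have "\<dots> = ennreal (exp (\<kappa>\<^sup>2 * v / 2)) * emeasure (density lborel (normal_density (\<kappa> * v) (sqrt v))) UNIV"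
      by (simp add: nn_integral_cmult emeasure_density)
    also have "emeasure (density lborel (normal_density (\<kappa> * v) (sqrt v))) UNIV = 1"
      using prob_space.emeasure_space_1[OF prob_space_normal_density[of "sqrt v" "\<kappa> * v"]] v by simp
    finally show ?thesis by simp
  qed
qed

text \<open>Chernoff's bound with the exponent \<open>x / v'\<close> that is optimal for variance
  \<open>v'\<close>. Working with an upper bound of the variance includes degenerate laws.\<close>

lemma gaussian_rv_tail:
  assumes P: "prob_space P" and Y: "gaussian_rv P Y"
    and mean: "(\<integral>w. Y w \<partial>P) = 0" and var: "(\<integral>w. (Y w)\<^sup>2 \<partial>P) = v" and v: "v \<le> v'" "v' > 0" and x: "x \<ge> 0"
  shows "measure P {w\<in>space P. \<bar>Y w\<bar> \<ge> x} \<le> 2 * exp (- x\<^sup>2 / (2 * v'))"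
proof -
  interpret prob_space P by fact
  have [measurable]: "Y \<in> borel_measurable P" using Y by (simp add: gaussian_rv_def)
  define l where "l = x / v'"
  have l: "l \<ge> 0" using x v by (simp add: l_def)
  have one: "emeasure P {w\<in>space P. s * Y w \<ge> x} \<le> ennreal (exp (- x\<^sup>2 / (2 * v')))" if s: "s\<^sup>2 = 1" for s
  proof -
    have "emeasure P {w\<in>space P. s * Y w \<ge> x} = (\<integral>\<^sup>+w. indicator {w\<in>space P. s * Y w \<ge> x} w \<partial>P)" by simp
    also have "\<dots> \<le> (\<integral>\<^sup>+w. ennreal (exp (- l * x)) * ennreal (exp ((l * s) * Y w)) \<partial>P)"
    proof (intro nn_integral_mono)
      fix w
      have "x \<le> s * Y w \<Longrightarrow> 0 \<le> - l * x + l * s * Y w"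
        using mult_left_mono[of x "s * Y w" l] l by (simp add: mult.assoc)
      then show "indicator {w\<in>space P. s * Y w \<ge> x} w \<le> ennreal (exp (- l * x)) * ennreal (exp ((l * s) * Y w))"
        by (auto simp: indicator_def simp flip: ennreal_mult exp_add)
    qed
    also have "\<dots> = ennreal (exp (- l * x)) * ennreal (exp ((l * s)\<^sup>2 * v / 2))"
      using gaussian_rv_exp_moment[OF P Y mean var, of "l * s"] by (subst nn_integral_cmult) auto
    also have "\<dots> = ennreal (exp (- l * x + (l * s)\<^sup>2 * v / 2))" by (simp flip: ennreal_mult exp_add)
    also have "\<dots> \<le> ennreal (exp (- x\<^sup>2 / (2 * v')))"
    proof -
      have "l\<^sup>2 * v \<le> l\<^sup>2 * v'" using v by (intro mult_left_mono) auto
      moreover have "l\<^sup>2 * v' = x\<^sup>2 / v'" "l * x = x\<^sup>2 / v'" using v by (auto simp: l_def power2_eq_square)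
      ultimately show ?thesis using s by (simp add: power_mult_distrib)
    qed
    finally show ?thesis .
  qed
  have "emeasure P {w\<in>space P. \<bar>Y w\<bar> \<ge> x} \<le> emeasure P ({w\<in>space P. 1 * Y w \<ge> x} \<union> {w\<in>space P. -1 * Y w \<ge> x})"
    by (intro emeasure_mono) auto
  also have "\<dots> \<le> emeasure P {w\<in>space P. 1 * Y w \<ge> x} + emeasure P {w\<in>space P. -1 * Y w \<ge> x}"
    by (intro emeasure_subadditive) auto
  also have "\<dots> \<le> ennreal (exp (- x\<^sup>2 / (2 * v'))) + ennreal (exp (- x\<^sup>2 / (2 * v')))"
    by (intro add_mono one) auto
  also have "\<dots> = ennreal (2 * exp (- x\<^sup>2 / (2 * v')))" by (simp flip: ennreal_plus)
  finally show ?thesis by (simp add: emeasure_eq_measure)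
qed

text \<open>The tilted density is a multiple of the normal density of variance
  \<open>1 / \<theta>\<close>. The factor \<open>1 / sqrt \<theta>\<close> is the price per grid
  cell for extracting the fraction \<open>1 - \<theta>\<close> of the kinetic energy.\<close>

lemma gaussian_rv_exp_square_moment:
  assumes P: "prob_space P" and Y: "gaussian_rv P Y"
    and mean: "(\<integral>w. Y w \<partial>P) = 0" and var: "(\<integral>w. (Y w)\<^sup>2 \<partial>P) = 1" and \<theta>: "\<theta> > 0"
  shows "(\<integral>\<^sup>+w. ennreal (exp ((1 - \<theta>) * (Y w)\<^sup>2 / 2)) \<partial>P) = ennreal (1 / sqrt \<theta>)"
proof -
  have D: "distributed P lborel Y std_normal_density"
    using gaussian_rv_cases(1)[OF P Y mean var] by simp
  have "(\<integral>\<^sup>+w. ennreal (exp ((1 - \<theta>) * (Y w)\<^sup>2 / 2)) \<partial>P) =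
     (\<integral>\<^sup>+x. ennreal (std_normal_density x) * ennreal (exp ((1 - \<theta>) * x\<^sup>2 / 2)) \<partial>lborel)"
    by (rule distributed_nn_integral[OF D, symmetric]) measurable
  also have "\<dots> = (\<integral>\<^sup>+x. ennreal (1 / sqrt \<theta>) * ennreal (normal_density 0 (1 / sqrt \<theta>) x) \<partial>lborel)"
  proof (intro nn_integral_cong)
    fix x
    have "- x\<^sup>2 / 2 + (1 - \<theta>) * x\<^sup>2 / 2 = - (\<theta> * x\<^sup>2) / 2" by (simp add: field_simps)
    then have "std_normal_density x * exp ((1 - \<theta>) * x\<^sup>2 / 2) = exp (- (\<theta> * x\<^sup>2) / 2) / sqrt (2 * pi)"
      by (simp add: std_normal_density_def flip: exp_add)
    also have "\<dots> = 1 / sqrt \<theta> * normal_density 0 (1 / sqrt \<theta>) x"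
      using \<theta> by (simp add: normal_density_def power_divide real_sqrt_divide mult.commute)
    finally show "ennreal (std_normal_density x) * ennreal (exp ((1 - \<theta>) * x\<^sup>2 / 2)) =
       ennreal (1 / sqrt \<theta>) * ennreal (normal_density 0 (1 / sqrt \<theta>) x)"
      using \<theta> by (simp flip: ennreal_mult)
  qed
  also have "\<dots> = ennreal (1 / sqrt \<theta>) * emeasure (density lborel (normal_density 0 (1 / sqrt \<theta>))) UNIV"
    by (simp add: nn_integral_cmult emeasure_density)
  also have "emeasure (density lborel (normal_density 0 (1 / sqrt \<theta>))) UNIV = 1"
    using prob_space.emeasure_space_1[OF prob_space_normal_density[of "1 / sqrt \<theta>" 0]] \<theta> by simp
  finally show ?thesis by simp
qed

text \<open>On the interval the density is at least its value at \<open>\<bar>y\<bar> + r\<close>,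
  the largest modulus that can occur.\<close>

lemma gaussian_rv_small_ball:
  assumes P: "prob_space P" and Y: "gaussian_rv P Y"
    and mean: "(\<integral>w. Y w \<partial>P) = 0" and var: "(\<integral>w. (Y w)\<^sup>2 \<partial>P) = 1" and r: "r \<ge> 0"
  shows "emeasure P {w\<in>space P. \<bar>Y w - y\<bar> \<le> r} \<ge> ennreal (2 * r / sqrt (2 * pi) * exp (- (\<bar>y\<bar> + r)\<^sup>2 / 2))"
proof -
  have D: "distributed P lborel Y std_normal_density"
    using gaussian_rv_cases(1)[OF P Y mean var] by simp
  let ?c = "1 / sqrt (2 * pi) * exp (- (\<bar>y\<bar> + r)\<^sup>2 / 2)"
  have "ennreal (2 * r / sqrt (2 * pi) * exp (- (\<bar>y\<bar> + r)\<^sup>2 / 2)) = ennreal ?c * emeasure lborel {y - r..y + r}"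
    using r by (simp add: mult_ac flip: ennreal_mult)
  also have "\<dots> = (\<integral>\<^sup>+x. ennreal ?c * indicator {y - r..y + r} x \<partial>lborel)"
    by (simp add: nn_integral_cmult)
  also have "\<dots> \<le> (\<integral>\<^sup>+x. ennreal (std_normal_density x) * indicator {y - r..y + r} x \<partial>lborel)"
  proof (intro nn_integral_mono)
    fix x :: real
    show "ennreal ?c * indicator {y - r..y + r} x \<le> ennreal (std_normal_density x) * indicator {y - r..y + r} x"
    proof (cases "x \<in> {y - r..y + r}")
      case True
      then have "\<bar>x\<bar> \<le> \<bar>y\<bar> + r" by auto
      then have "x\<^sup>2 \<le> (\<bar>y\<bar> + r)\<^sup>2" using abs_le_square_iff by fastforce
      then have "?c \<le> std_normal_density x" unfolding std_normal_density_def by (intro mult_left_mono) auto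
      then show ?thesis by (intro mult_right_mono ennreal_leI) auto
    qed auto
  qed
  also have "\<dots> = emeasure P (Y -` {y - r..y + r} \<inter> space P)"
    by (rule distributed_emeasure[OF D, symmetric]) simp
  also have "Y -` {y - r..y + r} \<inter> space P = {w\<in>space P. \<bar>Y w - y\<bar> \<le> r}" by auto
  finally show ?thesis .
qed

section \<open>The Gaussian space spanned by a centred process\<close>

definition gauss_span :: "('w \<Rightarrow> 't \<Rightarrow> real) \<Rightarrow> ('t \<Rightarrow> real) \<Rightarrow> 't set \<Rightarrow> ('w \<Rightarrow> real) set" where
  "gauss_span X mean I = {Y. \<exists>J a. finite J \<and> J \<subseteq> I \<and> Y = (\<lambda>w. \<Sum>s\<in>J. a s * (X w s - mean s))}"

lemma gauss_span_base: "s \<in> I \<Longrightarrow> (\<lambda>w. X w s - mean s) \<in> gauss_span X mean I"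
  unfolding gauss_span_def by (intro CollectI exI[of _ "{s}"] exI[of _ "\<lambda>_. 1"]) auto

lemma gauss_span_cmult: "Y \<in> gauss_span X mean I \<Longrightarrow> (\<lambda>w. c * Y w) \<in> gauss_span X mean I"
  unfolding gauss_span_def
proof safe
  fix J :: "'b set" and a assume "finite J" "J \<subseteq> I"
  then show "\<exists>J' a'. finite J' \<and> J' \<subseteq> I \<and> (\<lambda>w. c * (\<Sum>s\<in>J. a s * (X w s - mean s))) = (\<lambda>w. \<Sum>s\<in>J'. a' s * (X w s - mean s))"
    by (intro exI[of _ J] exI[of _ "\<lambda>s. c * a s"]) (simp add: sum_distrib_left mult.assoc)
qed

lemma gauss_span_add:
  assumes "Y \<in> gauss_span X mean I" "Z \<in> gauss_span X mean I"
  shows "(\<lambda>w. Y w + Z w) \<in> gauss_span X mean I"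
proof -
  obtain J a where J: "finite J" "J \<subseteq> I" "Y = (\<lambda>w. \<Sum>s\<in>J. a s * (X w s - mean s))"
    using assms(1) by (auto simp: gauss_span_def)
  obtain K b where K: "finite K" "K \<subseteq> I" "Z = (\<lambda>w. \<Sum>s\<in>K. b s * (X w s - mean s))"
    using assms(2) by (auto simp: gauss_span_def)
  define c where "c s = (if s \<in> J then a s else 0) + (if s \<in> K then b s else 0)" for s
  have "Y w + Z w = (\<Sum>s\<in>J \<union> K. c s * (X w s - mean s))" for w
  proof -
    have "(\<Sum>s\<in>J. a s * (X w s - mean s)) = (\<Sum>s\<in>J \<union> K. (if s \<in> J then a s else 0) * (X w s - mean s))"
      using J K by (intro sum.mono_neutral_cong_left) auto
    moreover have "(\<Sum>s\<in>K. b s * (X w s - mean s)) = (\<Sum>s\<in>J \<union> K. (if s \<in> K then b s else 0) * (X w s - mean s))"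
      using J K by (intro sum.mono_neutral_cong_left) auto
    ultimately show ?thesis by (simp add: J K c_def distrib_right sum.distrib)
  qed
  then show ?thesis unfolding gauss_span_def using J K
    by (intro CollectI exI[of _ "J \<union> K"] exI[of _ c]) auto
qed

lemma gauss_span_zero: "(\<lambda>w. 0) \<in> gauss_span X mean I"
  unfolding gauss_span_def by (intro CollectI exI[of _ "{}"]) auto

lemma gauss_span_diff:
  assumes "Y \<in> gauss_span X mean I" "Z \<in> gauss_span X mean I"
  shows "(\<lambda>w. Y w - Z w) \<in> gauss_span X mean I"
  using gauss_span_add[OF assms(1) gauss_span_cmult[OF assms(2), of "-1"]] by simp

lemma gauss_span_sum:
  assumes "\<And>k. k \<in> K \<Longrightarrow> Y k \<in> gauss_span X mean I"
  shows "(\<lambda>w. \<Sum>k\<in>K. Y k w) \<in> gauss_span X mean I"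
  using assms by (induction K rule: infinite_finite_induct) (auto intro: gauss_span_zero gauss_span_add)

lemma gauss_span_gaussian:
  assumes X: "gaussian_process P I X mean cov" and Y: "Y \<in> gauss_span X mean I"
  shows "gaussian_rv P Y" "(\<integral>w. Y w \<partial>P) = 0" "integrable P (\<lambda>w. (Y w)\<^sup>2)" "integrable P Y"
    "Y \<in> borel_measurable P"
proof -
  have P: "prob_space P" using X by (simp add: gaussian_process_def)
  interpret prob_space P by fact
  have lin: "gaussian_rv P (\<lambda>w. \<Sum>s\<in>J. a s * X w s)" if "finite J" "J \<subseteq> I" for J a
    using X that by (auto simp: gaussian_process_def)
  \<comment> \<open>The integrals in \<open>gaussian_process\<close> are 0 by convention for
    functions that are not integrable, so integrability has to come from the normal law.\<close>
  have int_X: "integrable P (\<lambda>w. X w s)" if s: "s \<in> I" for s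
  proof -
    have "gaussian_rv P (\<lambda>w. X w s)" using lin[of "{s}" "\<lambda>_. 1"] s by simp
    from gaussian_rv_shift[OF P this, of "mean s"] have g: "gaussian_rv P (\<lambda>w. X w s - mean s)" .
    then consider k where "AE w in P. X w s - mean s = k"
      | \<mu> \<sigma> where "\<sigma> > 0" "distributed P lborel (\<lambda>w. X w s - mean s) (normal_density \<mu> \<sigma>)"
      by (auto simp: gaussian_rv_def)
    then have "integrable P (\<lambda>w. X w s - mean s)"
    proof cases
      case 1
      then have "integrable P (\<lambda>w. X w s - mean s) \<longleftrightarrow> integrable P (\<lambda>w. k)"
        using g by (intro integrable_cong_AE) (auto simp: gaussian_rv_def)
      then show ?thesis by simp
    next
      case 2
      then show ?thesis by (intro distributed_integrable_var[OF 2(2)] integrable_normal_moment_nz_1) auto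
    qed
    then have "integrable P (\<lambda>w. X w s - mean s + mean s)" by (intro Bochner_Integration.integrable_add) auto
    then show ?thesis by simp
  qed
  obtain J a where J: "finite J" "J \<subseteq> I" "Y = (\<lambda>w. \<Sum>s\<in>J. a s * (X w s - mean s))"
    using Y by (auto simp: gauss_span_def)
  have "Y = (\<lambda>w. (\<Sum>s\<in>J. a s * X w s) - (\<Sum>s\<in>J. a s * mean s))"
    unfolding J by (simp add: right_diff_distrib sum_subtractf)
  then show G: "gaussian_rv P Y" using gaussian_rv_shift[OF P lin[OF J(1,2)]] by simp
  show M: "(\<integral>w. Y w \<partial>P) = 0"
  proof -
    have "(\<integral>w. Y w \<partial>P) = (\<Sum>s\<in>J. a s * ((\<integral>w. X w s \<partial>P) - mean s))"
      unfolding J using J(2) int_X by (subst Bochner_Integration.integral_sum) (auto simp: prob_space subset_iff)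
    also have "\<dots> = 0" using X J(2) by (intro sum.neutral) (auto simp: gaussian_process_def)
    finally show ?thesis .
  qed
  show "integrable P (\<lambda>w. (Y w)\<^sup>2)" "integrable P Y" using gaussian_rv_cases(2,3)[OF P G M refl] .
  show "Y \<in> borel_measurable P" using G by (simp add: gaussian_rv_def)
qed

text \<open>Polarisation reduces products to squares, and the span is closed under addition.\<close>

lemma gauss_span_integrable_mult:
  assumes X: "gaussian_process P I X mean cov" and "Y \<in> gauss_span X mean I" "Z \<in> gauss_span X mean I"
  shows "integrable P (\<lambda>w. Y w * Z w)"
proof -
  have "integrable P (\<lambda>w. ((Y w + Z w)\<^sup>2 - (Y w)\<^sup>2 - (Z w)\<^sup>2) / 2)"
    using gauss_span_gaussian(3)[OF X] assms(2,3) gauss_span_add[OF assms(2,3)] by auto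
  moreover have "((Y w + Z w)\<^sup>2 - (Y w)\<^sup>2 - (Z w)\<^sup>2) / 2 = Y w * Z w" for w
    by (simp add: power2_eq_square algebra_simps)
  ultimately show ?thesis by simp
qed

text \<open>The characteristic function of a centred Gaussian depends on its variance alone.
  Orthogonality makes the variance of a linear combination a sum, and so the joint characteristic
  function a product.\<close>

lemma gauss_span_indep:
  assumes X: "gaussian_process P I X mean cov" and K: "finite K"
    and Y: "\<And>k. k \<in> K \<Longrightarrow> Y k \<in> gauss_span X mean I"
    and orth: "\<And>j k. j \<in> K \<Longrightarrow> k \<in> K \<Longrightarrow> j \<noteq> k \<Longrightarrow> (\<integral>w. Y j w * Y k w \<partial>P) = 0"
  shows "prob_space.indep_vars P (\<lambda>_. borel) Y K"
proof -
  have P: "prob_space P" using X by (simp add: gaussian_process_def)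
  interpret prob_space P by fact
  define v where "v k = (\<integral>w. (Y k w)\<^sup>2 \<partial>P)" for k
  note meas = gauss_span_gaussian(5)[OF X Y]
  show ?thesis
  proof (rule indep_vars_char[OF K meas])
    fix t :: "'c \<Rightarrow> real"
    have S: "(\<lambda>w. \<Sum>k\<in>K. t k * Y k w) \<in> gauss_span X mean I"
      using Y by (intro gauss_span_sum gauss_span_cmult)
    have "(\<integral>w. (\<Sum>k\<in>K. t k * Y k w)\<^sup>2 \<partial>P) = (\<integral>w. (\<Sum>j\<in>K. \<Sum>k\<in>K. t j * t k * (Y j w * Y k w)) \<partial>P)"
      by (intro Bochner_Integration.integral_cong) (auto simp: power2_eq_square sum_product mult_ac)
    also have "\<dots> = (\<Sum>j\<in>K. \<Sum>k\<in>K. t j * t k * (\<integral>w. Y j w * Y k w \<partial>P))"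
      using gauss_span_integrable_mult[OF X Y Y] by (simp add: Bochner_Integration.integral_sum)
    also have "\<dots> = (\<Sum>j\<in>K. \<Sum>k\<in>K. if k = j then (t j)\<^sup>2 * v j else 0)"
      using orth by (intro sum.cong refl) (auto simp: v_def power2_eq_square)
    also have "\<dots> = (\<Sum>j\<in>K. (t j)\<^sup>2 * v j)" using K by simp
    finally have var: "(\<integral>w. (\<Sum>k\<in>K. t k * Y k w)\<^sup>2 \<partial>P) = (\<Sum>j\<in>K. (t j)\<^sup>2 * v j)" .
    have "(\<integral>w. iexp (\<Sum>k\<in>K. t k * Y k w) \<partial>P) = of_real (exp (- (\<Sum>j\<in>K. (t j)\<^sup>2 * v j) / 2))"
      using gaussian_rv_char[OF P gauss_span_gaussian(1,2)[OF X S] var, of 1] by simp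
    also have "- (\<Sum>j\<in>K. (t j)\<^sup>2 * v j) / 2 = (\<Sum>j\<in>K. - (t j)\<^sup>2 * v j / 2)"
      by (simp add: sum_divide_distrib sum_negf)
    also have "complex_of_real (exp \<dots>) = (\<Prod>j\<in>K. of_real (exp (- (t j)\<^sup>2 * v j / 2)))"
      using K by (simp add: exp_sum)
    also have "\<dots> = (\<Prod>j\<in>K. char (distr P borel (Y j)) (t j))"
    proof (rule prod.cong[OF refl])
      fix j assume j: "j \<in> K"
      have "char (distr P borel (Y j)) (t j) = (\<integral>w. iexp (t j * Y j w) \<partial>P)"
        unfolding char_def using meas[OF j] by (subst integral_distr) auto
      then show "of_real (exp (- (t j)\<^sup>2 * v j / 2)) = char (distr P borel (Y j)) (t j)"
        using gaussian_rv_char[OF P gauss_span_gaussian(1,2)[OF X Y[OF j]] refl, of "t j"] by (simp add: v_def)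
    qed
    finally show "(\<integral>w. iexp (\<Sum>k\<in>K. t k * Y k w) \<partial>P) = (\<Prod>k\<in>K. char (distr P borel (Y k)) (t k))" .
  qed
qed

section \<open>The rescaled bridge\<close>

text \<open>The path in stretched time, with variance \<open>\<epsilon>\<close> per unit length; the
  exponent \<open>\<gamma>\<close> enters only through \<open>L\<close>. Continuity and
  measurability are required on the whole line, so that sampling at shifted times needs no case
  distinction.\<close>

definition scaled_bridge :: "real \<Rightarrow> real \<Rightarrow> 'w measure \<Rightarrow> ('w \<Rightarrow> real \<Rightarrow> real) \<Rightarrow> bool" where
  "scaled_bridge \<epsilon> L P V \<longleftrightarrow> \<epsilon> > 0 \<and> L > 0 \<and>
     gaussian_process P {-L..L} V (\<lambda>s. s / L) (\<lambda>s t. \<epsilon> * (min s t + L - (s + L) * (t + L) / (2 * L))) \<and>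
     (\<forall>w\<in>space P. continuous_on UNIV (V w)) \<and> (\<forall>s. (\<lambda>w. V w s) \<in> borel_measurable P)"

abbreviation bridge_span :: "real \<Rightarrow> ('w \<Rightarrow> real \<Rightarrow> real) \<Rightarrow> ('w \<Rightarrow> real) set" where
  "bridge_span L V \<equiv> gauss_span V (\<lambda>s. s / L) {-L..L}"

lemma scaled_bridge_process:
  "scaled_bridge \<epsilon> L P V \<Longrightarrow>
     gaussian_process P {-L..L} V (\<lambda>s. s / L) (\<lambda>s t. \<epsilon> * (min s t + L - (s + L) * (t + L) / (2 * L)))"
  by (simp add: scaled_bridge_def)

lemma scaled_bridge_prob_space: "scaled_bridge \<epsilon> L P V \<Longrightarrow> prob_space P"
  by (simp add: scaled_bridge_def gaussian_process_def)

text \<open>For ordered times the covariance is a product of a function of the earlier and a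
  function of the later time. The orthogonality relations below rest on this product form.\<close>

lemma scaled_bridge_cov:
  assumes "scaled_bridge \<epsilon> L P V" "-L \<le> s" "s \<le> t" "t \<le> L"
  shows "(\<integral>w. (V w s - s / L) * (V w t - t / L) \<partial>P) = \<epsilon> * ((s + L) * (L - t) / (2 * L))"
    and "(\<integral>w. (V w t - t / L) * (V w s - s / L) \<partial>P) = \<epsilon> * ((s + L) * (L - t) / (2 * L))"
proof -
  have L: "L > 0" using assms by (simp add: scaled_bridge_def)
  have *: "min s t + L - (s + L) * (t + L) / (2 * L) = (s + L) * (L - t) / (2 * L)"
    using L assms by (simp add: field_simps)
  show "(\<integral>w. (V w s - s / L) * (V w t - t / L) \<partial>P) = \<epsilon> * ((s + L) * (L - t) / (2 * L))"
    unfolding *[symmetric] using assms by (simp add: scaled_bridge_def gaussian_process_def)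
  then show "(\<integral>w. (V w t - t / L) * (V w s - s / L) \<partial>P) = \<epsilon> * ((s + L) * (L - t) / (2 * L))"
    by (simp add: mult.commute)
qed

lemma bridge_span_base: "-L \<le> s \<Longrightarrow> s \<le> L \<Longrightarrow> (\<lambda>w. V w s - s / L) \<in> bridge_span L V"
  by (rule gauss_span_base) auto

lemma scaled_bridge_measurable: "scaled_bridge \<epsilon> L P V \<Longrightarrow> (\<lambda>w. V w s) \<in> borel_measurable P"
  by (simp add: scaled_bridge_def)

text \<open>With the time rounded down to a multiple of \<open>1 / (k + 1)\<close> the evaluation is
  a countable gluing of measurable maps; continuity of the paths gives the limit. Exchanging
  expectation and time integral requires joint measurability.\<close>

lemma scaled_bridge_joint_measurable:
  assumes V: "scaled_bridge \<epsilon> L P V"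
  shows "(\<lambda>(w, s). V w s) \<in> borel_measurable (P \<Otimes>\<^sub>M lborel)"
proof -
  define q where "q k s = real_of_int \<lfloor>s * (real k + 1)\<rfloor> / (real k + 1)" for k s
  have q: "(\<lambda>k. q k s) \<longlonglongrightarrow> s" for s
  proof (rule tendsto_sandwich[of "\<lambda>k. s - 1 / (real k + 1)" _ _ "\<lambda>_. s"])
    have "s - 1 / (real k + 1) \<le> q k s" "q k s \<le> s" for k
    proof -
      have "(s * (real k + 1) - 1) / (real k + 1) \<le> q k s"
        unfolding q_def by (intro divide_right_mono) linarith+
      then show "s - 1 / (real k + 1) \<le> q k s" by (simp add: diff_divide_distrib)
      have "q k s \<le> s * (real k + 1) / (real k + 1)"
        unfolding q_def by (intro divide_right_mono) linarith+
      then show "q k s \<le> s" by simp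
    qed
    then show "\<forall>\<^sub>F k in sequentially. s - 1 / (real k + 1) \<le> q k s" "\<forall>\<^sub>F k in sequentially. q k s \<le> s"
      by auto
    show "(\<lambda>k. s - 1 / (real k + 1)) \<longlonglongrightarrow> s" by real_asymp
  qed simp
  show ?thesis
  proof (rule borel_measurable_LIMSEQ_real[where u = "\<lambda>k (w, s). V w (q k s)"])
  fix k
  have "(\<lambda>x. (\<lambda>i (w, s). V w (real_of_int i / (real k + 1))) \<lfloor>snd x * (real k + 1)\<rfloor> x) \<in> borel_measurable (P \<Otimes>\<^sub>M lborel)"
  proof (rule measurable_compose_countable[where f = "\<lambda>i (w, s). V w (real_of_int i / (real k + 1))"
        and g = "\<lambda>x. \<lfloor>snd x * (real k + 1)\<rfloor>"])
    show "(\<lambda>(w, s). V w (real_of_int i / (real k + 1))) \<in> borel_measurable (P \<Otimes>\<^sub>M lborel)" for i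
      using measurable_compose[OF measurable_fst scaled_bridge_measurable[OF V]] by (simp add: case_prod_beta')
  qed measurable
  then show "(\<lambda>(w, s). V w (q k s)) \<in> borel_measurable (P \<Otimes>\<^sub>M lborel)" by (simp add: q_def case_prod_beta')
next
  fix x :: "'a \<times> real" assume "x \<in> space (P \<Otimes>\<^sub>M lborel)"
  then have "continuous_on UNIV (V (fst x))" using V by (auto simp: scaled_bridge_def space_pair_measure)
  then have "isCont (V (fst x)) (snd x)" by (simp add: continuous_on_eq_continuous_at)
  then have "(\<lambda>k. V (fst x) (real_of_int \<lfloor>snd x * (real k + 1)\<rfloor> / (real k + 1))) \<longlonglongrightarrow> V (fst x) (snd x)"
    by (rule isCont_tendsto_compose) (rule q[unfolded q_def])
  then show "(\<lambda>k. (\<lambda>(w, s). V w (q k s)) x) \<longlonglongrightarrow> (\<lambda>(w, s). V w s) x"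
    by (simp add: q_def case_prod_beta')
  qed
qed

text \<open>The variance is proportional to \<open>(s + L) * (L - s)\<close> and vanishes at both
  ends.\<close>

lemma scaled_bridge_ends:
  assumes V: "scaled_bridge \<epsilon> L P V"
  shows "AE w in P. V w (-L) = -1 \<and> V w L = 1"
proof -
  have L: "L > 0" using V by (simp add: scaled_bridge_def)
  have "AE w in P. V w s - s / L = 0" if s: "s = L \<or> s = -L" for s
  proof -
    have S: "(\<lambda>w. V w s - s / L) \<in> bridge_span L V" using s L by (intro bridge_span_base) auto
    have "(\<integral>w. (V w s - s / L)\<^sup>2 \<partial>P) = \<epsilon> * ((s + L) * (L - s) / (2 * L))"
      using scaled_bridge_cov(1)[OF V, of s s] s L by (auto simp: power2_eq_square)
    then have "(\<integral>w. (V w s - s / L)\<^sup>2 \<partial>P) = 0" using s by auto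
    from gaussian_rv_cases(1)[OF scaled_bridge_prob_space[OF V]
        gauss_span_gaussian(1,2)[OF scaled_bridge_process[OF V] S] this]
    show ?thesis by auto
  qed
  from this[of L] this[of "-L"] show ?thesis using L by auto
qed

text \<open>For a bridge pinned at \<open>L\<close> the centred path divided by \<open>L - s\<close>
  has orthogonal increments; the root normalises their variance to 1. The value at \<open>L\<close>
  is deterministic, so a grid with \<open>n + 1\<close> cells carries \<open>n\<close> such
  normals.\<close>

definition bridge_step :: "real \<Rightarrow> real \<Rightarrow> (real \<Rightarrow> real) \<Rightarrow> real \<Rightarrow> real \<Rightarrow> real" where
  "bridge_step \<epsilon> L v s t =
     sqrt ((L - s) * (L - t) / (\<epsilon> * (t - s))) * ((v t - t / L) / (L - t) - (v s - s / L) / (L - s))"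

text \<open>With \<open>q\<^sub>s = (1 - v s) / (L - s)\<close> the normalised increment is proportional to \<open>q\<^sub>s - q\<^sub>t\<close>.\<close>

lemma bridge_step_square:
  assumes "\<epsilon> > 0" "L > 0" "s < t" "t < L"
  shows "\<epsilon> * (bridge_step \<epsilon> L v s t)\<^sup>2 =
     (v t - v s)\<^sup>2 / (t - s) + (1 - v t)\<^sup>2 / (L - t) - (1 - v s)\<^sup>2 / (L - s)"
proof -
  define R R' d where "R = L - s" and "R' = L - t" and "d = t - s"
  have pos: "R > 0" "R' > 0" "d > 0" and Rd: "R = R' + d" using assms by (auto simp: R_def R'_def d_def)
  define x y where "x = 1 - v s" and "y = 1 - v t"
  have 1: "(v t - t / L) / R' = 1 / L - y / R'"
    using assms pos by (simp add: y_def R'_def field_simps)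
  have 2: "(v s - s / L) / R = 1 / L - x / R"
    using assms pos by (simp add: x_def R_def field_simps)
  have "\<epsilon> * (bridge_step \<epsilon> L v s t)\<^sup>2 = R * R' / d * (x / R - y / R')\<^sup>2"
    using assms pos 1 2 unfolding bridge_step_def R_def[symmetric] R'_def[symmetric] d_def[symmetric]
    by (simp add: power_mult_distrib)
  also have "\<dots> = (x - y)\<^sup>2 / d + y\<^sup>2 / R' - x\<^sup>2 / R"
  proof -
    have "R * R' / d * (x / R - y / R')\<^sup>2 = (x * R' - y * R)\<^sup>2 / (d * R * R')"
      using pos by (simp add: field_simps power2_eq_square)
    also have "(x * R' - y * R)\<^sup>2 = (x - y)\<^sup>2 * (R * R') + y\<^sup>2 * (d * R) - x\<^sup>2 * (d * R')"
      unfolding Rd by (simp add: algebra_simps power2_eq_square)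
    also have "\<dots> / (d * R * R') = (x - y)\<^sup>2 / d + y\<^sup>2 / R' - x\<^sup>2 / R"
      using pos by (simp add: add_divide_distrib diff_divide_distrib)
    finally show ?thesis .
  qed
  finally show ?thesis by (simp add: x_def y_def R_def R'_def d_def)
qed

lemma bridge_step_span:
  assumes "-L \<le> s" "s \<le> L" "-L \<le> t" "t \<le> L"
  shows "(\<lambda>w. bridge_step \<epsilon> L (V w) s t) \<in> bridge_span L V"
proof -
  have "(\<lambda>w. sqrt ((L - s) * (L - t) / (\<epsilon> * (t - s))) *
      (1 / (L - t) * (V w t - t / L) - 1 / (L - s) * (V w s - s / L))) \<in> bridge_span L V"
    using assms by (intro gauss_span_cmult gauss_span_diff bridge_span_base)
  then show ?thesis by (simp add: bridge_step_def)
qed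

lemma bridge_integral_bilinear:
  assumes V: "scaled_bridge \<epsilon> L P V"
    and "Y1 \<in> bridge_span L V" "Y2 \<in> bridge_span L V" "Z1 \<in> bridge_span L V" "Z2 \<in> bridge_span L V"
  shows "(\<integral>w. (a1 * Y1 w + a2 * Y2 w) * (b1 * Z1 w + b2 * Z2 w) \<partial>P) =
     a1 * b1 * (\<integral>w. Y1 w * Z1 w \<partial>P) + a1 * b2 * (\<integral>w. Y1 w * Z2 w \<partial>P) +
     a2 * b1 * (\<integral>w. Y2 w * Z1 w \<partial>P) + a2 * b2 * (\<integral>w. Y2 w * Z2 w \<partial>P)"
proof -
  note int = gauss_span_integrable_mult[OF scaled_bridge_process[OF V]]
  have "(\<integral>w. (a1 * Y1 w + a2 * Y2 w) * (b1 * Z1 w + b2 * Z2 w) \<partial>P) =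
    (\<integral>w. a1 * b1 * (Y1 w * Z1 w) + a1 * b2 * (Y1 w * Z2 w) + a2 * b1 * (Y2 w * Z1 w) + a2 * b2 * (Y2 w * Z2 w) \<partial>P)"
    by (intro Bochner_Integration.integral_cong) (auto simp: algebra_simps)
  then show ?thesis using int assms(2-5) by simp
qed

text \<open>The covariance of the values at two times, divided by the distance of the later time
  from \<open>L\<close>, depends on the earlier time only. Its difference over the later step is
  therefore 0.\<close>

lemma bridge_step_cov:
  assumes V: "scaled_bridge \<epsilon> L P V"
    and st: "-L \<le> s" "s < t" "t \<le> s'" "s' < t'" "t' < L"
  shows "(\<integral>w. bridge_step \<epsilon> L (V w) s t * bridge_step \<epsilon> L (V w) s' t' \<partial>P) = 0"
proof -
  define k k' where "k = sqrt ((L - s) * (L - t) / (\<epsilon> * (t - s)))" and "k' = sqrt ((L - s') * (L - t') / (\<epsilon> * (t' - s')))"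
  let ?Y = "\<lambda>r w. V w r - r / L"
  have base: "?Y r \<in> bridge_span L V" if "-L \<le> r" "r \<le> L" for r using that by (rule bridge_span_base)
  have eq: "bridge_step \<epsilon> L (V w) s t * bridge_step \<epsilon> L (V w) s' t' =
     (k / (L - t) * ?Y t w + - k / (L - s) * ?Y s w) * (k' / (L - t') * ?Y t' w + - k' / (L - s') * ?Y s' w)" for w
    unfolding bridge_step_def k_def[symmetric] k'_def[symmetric] by (simp add: field_simps)
  have L: "L > 0" "\<epsilon> > 0" using V by (auto simp: scaled_bridge_def)
  have c1: "(\<integral>w. ?Y t w * ?Y t' w \<partial>P) = \<epsilon> * ((t + L) * (L - t') / (2 * L))"
    and c2: "(\<integral>w. ?Y t w * ?Y s' w \<partial>P) = \<epsilon> * ((t + L) * (L - s') / (2 * L))"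
    and c3: "(\<integral>w. ?Y s w * ?Y t' w \<partial>P) = \<epsilon> * ((s + L) * (L - t') / (2 * L))"
    and c4: "(\<integral>w. ?Y s w * ?Y s' w \<partial>P) = \<epsilon> * ((s + L) * (L - s') / (2 * L))"
    by (rule scaled_bridge_cov(1)[OF V]; use st in simp)+
  have nz: "L - t' \<noteq> 0" "L - s' \<noteq> 0" using st by auto
  have c: "a * b * (c * (x * (L - t') / y)) + a * b' * (c * (x * (L - s') / y)) = 0"
    if "b = k' / (L - t')" "b' = - k' / (L - s')" for a b b' c x y :: real
    using nz unfolding that by simp
  have sp: "?Y t \<in> bridge_span L V" "?Y s \<in> bridge_span L V" "?Y t' \<in> bridge_span L V" "?Y s' \<in> bridge_span L V"
    using st by (auto intro!: base)
  show ?thesis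
    unfolding eq bridge_integral_bilinear[OF V sp] c1 c2 c3 c4 using c[OF refl refl] by (metis (no_types, lifting) add.assoc add.right_neutral)
qed

lemma bridge_step_var:
  assumes V: "scaled_bridge \<epsilon> L P V" and st: "-L \<le> s" "s < t" "t < L"
  shows "(\<integral>w. (bridge_step \<epsilon> L (V w) s t)\<^sup>2 \<partial>P) = 1"
proof -
  define k where "k = sqrt ((L - s) * (L - t) / (\<epsilon> * (t - s)))"
  let ?Y = "\<lambda>r w. V w r - r / L"
  have base: "?Y r \<in> bridge_span L V" if "-L \<le> r" "r \<le> L" for r using that by (rule bridge_span_base)
  have L: "L > 0" "\<epsilon> > 0" using V by (auto simp: scaled_bridge_def)
  have eq: "(bridge_step \<epsilon> L (V w) s t)\<^sup>2 =
     (k / (L - t) * ?Y t w + - k / (L - s) * ?Y s w) * (k / (L - t) * ?Y t w + - k / (L - s) * ?Y s w)" for w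
    unfolding bridge_step_def k_def[symmetric] by (simp add: field_simps power2_eq_square)
  have c1: "(\<integral>w. ?Y t w * ?Y t w \<partial>P) = \<epsilon> * ((t + L) * (L - t) / (2 * L))"
    and c2: "(\<integral>w. ?Y s w * ?Y t w \<partial>P) = \<epsilon> * ((s + L) * (L - t) / (2 * L))"
    and c4: "(\<integral>w. ?Y s w * ?Y s w \<partial>P) = \<epsilon> * ((s + L) * (L - s) / (2 * L))"
    by (rule scaled_bridge_cov(1)[OF V]; use st in simp)+
  have c3: "(\<integral>w. ?Y t w * ?Y s w \<partial>P) = \<epsilon> * ((s + L) * (L - t) / (2 * L))"
    by (rule scaled_bridge_cov(2)[OF V]; use st in simp)
  have "(\<integral>w. (bridge_step \<epsilon> L (V w) s t)\<^sup>2 \<partial>P) = k\<^sup>2 * \<epsilon> * ((t + L) / (L - t) - (s + L) / (L - s)) / (2 * L)"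
  proof -
    define R R' where "R = L - s" and "R' = L - t"
    have R: "R > 0" "R' > 0" using st by (auto simp: R_def R'_def)
    have sp: "?Y t \<in> bridge_span L V" "?Y s \<in> bridge_span L V" using st by (auto intro!: base)
    show ?thesis
      unfolding eq bridge_integral_bilinear[OF V sp sp] c1 c2 c3 c4 R_def[symmetric] R'_def[symmetric]
      using R L by (simp add: field_simps power2_eq_square)
  qed
  also have "(t + L) / (L - t) - (s + L) / (L - s) = 2 * L * (t - s) / ((L - s) * (L - t))"
    using st by (simp add: field_simps)
  also have "k\<^sup>2 = (L - s) * (L - t) / (\<epsilon> * (t - s))" using st L by (simp add: k_def)
  finally show ?thesis using st L by simp
qed

lemma interpolation_weights:
  fixes r s t :: real
  assumes "s < t"
  shows "(t - r) / (t - s) + (r - s) / (t - s) = 1" "(t - r) / (t - s) * s + (r - s) / (t - s) * t = r"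
proof -
  show "(t - r) / (t - s) + (r - s) / (t - s) = 1"
    unfolding add_divide_distrib[symmetric] using assms by simp
  have "(t - r) / (t - s) * s + (r - s) / (t - s) * t = ((t - r) * s + (r - s) * t) / (t - s)"
    by (simp add: add_divide_distrib)
  also have "(t - r) * s + (r - s) * t = r * (t - s)" by (simp add: algebra_simps)
  finally show "(t - r) / (t - s) * s + (r - s) / (t - s) * t = r" using assms by simp
qed

section \<open>The bridge inside a cell, relative to its chord\<close>

definition bridge_remainder :: "real \<Rightarrow> (real \<Rightarrow> real) \<Rightarrow> real \<Rightarrow> real \<Rightarrow> real \<Rightarrow> real" where
  "bridge_remainder L v s t r = v r - (t - r) / (t - s) * v s - (r - s) / (t - s) * v t"

lemma bridge_remainder_centered:
  assumes "s < t"
  shows "bridge_remainder L v s t r = (v r - r / L) - (t - r) / (t - s) * (v s - s / L) - (r - s) / (t - s) * (v t - t / L)"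
proof -
  have "(t - r) / (t - s) * (s / L) + (r - s) / (t - s) * (t / L) = r / L"
    using interpolation_weights(2)[OF assms, of r] by (metis add_divide_distrib times_divide_eq_right)
  then show ?thesis by (simp add: bridge_remainder_def right_diff_distrib)
qed

lemma bridge_remainder_span:
  assumes "-L \<le> s" "s < t" "t \<le> L" "s \<le> r" "r \<le> t"
  shows "(\<lambda>w. bridge_remainder L (V w) s t r) \<in> bridge_span L V"
  unfolding bridge_remainder_centered[OF assms(2)]
  using assms by (intro gauss_span_cmult gauss_span_diff bridge_span_base) auto

text \<open>For \<open>x\<close> outside the open cell the covariance with the value at
  \<open>x\<close> is affine in the time that runs through the cell, hence reproduced exactly by
  interpolation between the ends of the cell.\<close>

lemma bridge_remainder_cov_base:
  assumes V: "scaled_bridge \<epsilon> L P V" and st: "-L \<le> s" "s < t" "t \<le> L" "s \<le> r" "r \<le> t"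
    and x: "-L \<le> x" "x \<le> L" "x \<le> s \<or> t \<le> x"
  shows "(\<integral>w. bridge_remainder L (V w) s t r * (V w x - x / L) \<partial>P) = 0"
proof -
  let ?Y = "\<lambda>r w. V w r - r / L"
  have L: "L > 0" "\<epsilon> > 0" using V by (auto simp: scaled_bridge_def)
  define a b where "a = (t - r) / (t - s)" and "b = (r - s) / (t - s)"
  have ab: "a + b = 1" "a * s + b * t = r" using interpolation_weights[OF st(2), of r] by (auto simp: a_def b_def)
  have int: "integrable P (\<lambda>w. ?Y y w * ?Y x w)" if "-L \<le> y" "y \<le> L" for y
    using that x by (intro gauss_span_integrable_mult[OF scaled_bridge_process[OF V]] bridge_span_base)
  have "(\<integral>w. bridge_remainder L (V w) s t r * ?Y x w \<partial>P) =
     (\<integral>w. ?Y r w * ?Y x w - a * (?Y s w * ?Y x w) - b * (?Y t w * ?Y x w) \<partial>P)"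
    unfolding bridge_remainder_centered[OF st(2)] a_def b_def
    by (intro Bochner_Integration.integral_cong refl) (simp only: left_diff_distrib mult.assoc)
  also have "\<dots> = (\<integral>w. ?Y r w * ?Y x w \<partial>P) - a * (\<integral>w. ?Y s w * ?Y x w \<partial>P) - b * (\<integral>w. ?Y t w * ?Y x w \<partial>P)"
    using int[of r] int[of s] int[of t] st by simp
  also have "\<dots> = 0"
  proof (cases "x \<le> s")
    case True
    have I: "(\<integral>w. ?Y y w * ?Y x w \<partial>P) = \<epsilon> * ((x + L) * (L - y) / (2 * L))" if "s \<le> y" "y \<le> t" for y
      by (rule scaled_bridge_cov(2)[OF V]) (use that True st x in auto)
    have "(\<integral>w. ?Y r w * ?Y x w \<partial>P) - a * (\<integral>w. ?Y s w * ?Y x w \<partial>P) - b * (\<integral>w. ?Y t w * ?Y x w \<partial>P)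
       = \<epsilon> * (x + L) / (2 * L) * ((L - r) - a * (L - s) - b * (L - t))"
      unfolding I[OF st(4,5)] I[OF order_refl less_imp_le[OF st(2)]] I[OF less_imp_le[OF st(2)] order_refl]
      by (simp add: algebra_simps add_divide_distrib diff_divide_distrib)
    also have "(L - r) - a * (L - s) - b * (L - t) = (L - (a + b) * L) - (r - (a * s + b * t))"
      by (simp add: algebra_simps)
    finally show ?thesis by (simp add: ab)
  next
    case False
    then have x': "t \<le> x" using x by simp
    have I: "(\<integral>w. ?Y y w * ?Y x w \<partial>P) = \<epsilon> * ((y + L) * (L - x) / (2 * L))" if "s \<le> y" "y \<le> t" for y
      by (rule scaled_bridge_cov(1)[OF V]) (use that x' st x in auto)
    have "(\<integral>w. ?Y r w * ?Y x w \<partial>P) - a * (\<integral>w. ?Y s w * ?Y x w \<partial>P) - b * (\<integral>w. ?Y t w * ?Y x w \<partial>P)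
       = \<epsilon> * (L - x) / (2 * L) * ((r + L) - a * (s + L) - b * (t + L))"
      unfolding I[OF st(4,5)] I[OF order_refl less_imp_le[OF st(2)]] I[OF less_imp_le[OF st(2)] order_refl]
      by (simp add: algebra_simps add_divide_distrib diff_divide_distrib)
    also have "(r + L) - a * (s + L) - b * (t + L) = (L - (a + b) * L) + (r - (a * s + b * t))"
      by (simp add: algebra_simps)
    finally show ?thesis by (simp add: ab)
  qed
  finally show ?thesis .
qed

lemma bridge_remainder_cov_step:
  assumes V: "scaled_bridge \<epsilon> L P V" and st: "-L \<le> s" "s < t" "t \<le> L" "s \<le> r" "r \<le> t"
    and x: "-L \<le> x" "x \<le> L" "x \<le> s \<or> t \<le> x" and y: "-L \<le> y" "y \<le> L" "y \<le> s \<or> t \<le> y"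
  shows "(\<integral>w. bridge_remainder L (V w) s t r * bridge_step \<epsilon> L (V w) x y \<partial>P) = 0"
proof -
  let ?B = "\<lambda>w. bridge_remainder L (V w) s t r"
  have B: "?B \<in> bridge_span L V" using st by (rule bridge_remainder_span)
  define k where "k = sqrt ((L - x) * (L - y) / (\<epsilon> * (y - x)))"
  have eq: "?B w * bridge_step \<epsilon> L (V w) x y =
     (1 * ?B w + 0 * ?B w) * (k / (L - y) * (V w y - y / L) + - k / (L - x) * (V w x - x / L))" for w
    unfolding bridge_step_def k_def[symmetric] by (simp add: field_simps)
  have sp: "(\<lambda>w. V w y - y / L) \<in> bridge_span L V" "(\<lambda>w. V w x - x / L) \<in> bridge_span L V"
    using x y by (auto intro!: bridge_span_base)
  show ?thesis
    unfolding eq bridge_integral_bilinear[OF V B B sp]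
    using bridge_remainder_cov_base[OF V st x] bridge_remainder_cov_base[OF V st y] by simp
qed

text \<open>The exact variance is \<open>\<epsilon> * (r - s) * (t - r) / (t - s)\<close>, that of a
  Brownian bridge on \<open>[s,t]\<close>; it does not involve \<open>L\<close>.\<close>

lemma bridge_remainder_var:
  assumes V: "scaled_bridge \<epsilon> L P V" and st: "-L \<le> s" "s < t" "t \<le> L" "s \<le> r" "r \<le> t"
  shows "(\<integral>w. (bridge_remainder L (V w) s t r)\<^sup>2 \<partial>P) \<le> \<epsilon> * (t - s)"
proof -
  let ?Y = "\<lambda>r w. V w r - r / L" and ?B = "\<lambda>w. bridge_remainder L (V w) s t r"
  have L: "L > 0" "\<epsilon> > 0" using V by (auto simp: scaled_bridge_def)
  define a b where "a = (t - r) / (t - s)" and "b = (r - s) / (t - s)"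
  have ab: "a + b = 1" "a * s + b * t = r" using interpolation_weights[OF st(2), of r] by (auto simp: a_def b_def)
  have ab0: "0 \<le> a" "0 \<le> b" using st by (auto simp: a_def b_def)
  have B: "?B \<in> bridge_span L V" using st by (rule bridge_remainder_span)
  have int: "integrable P (\<lambda>w. ?B w * ?Y y w)" if "-L \<le> y" "y \<le> L" for y
    using that by (intro gauss_span_integrable_mult[OF scaled_bridge_process[OF V]] bridge_span_base B)
  have intY: "integrable P (\<lambda>w. ?Y y w * ?Y r w)" if "-L \<le> y" "y \<le> L" for y
    using that st by (intro gauss_span_integrable_mult[OF scaled_bridge_process[OF V]] bridge_span_base) auto
  have "(\<integral>w. (?B w)\<^sup>2 \<partial>P) = (\<integral>w. ?B w * ?Y r w - a * (?B w * ?Y s w) - b * (?B w * ?Y t w) \<partial>P)"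
  proof (intro Bochner_Integration.integral_cong refl)
    fix w
    have "(?B w)\<^sup>2 = ?B w * (?Y r w - a * ?Y s w - b * ?Y t w)"
      unfolding power2_eq_square bridge_remainder_centered[OF st(2), of L "V w" r] a_def b_def ..
    then show "(?B w)\<^sup>2 = ?B w * ?Y r w - a * (?B w * ?Y s w) - b * (?B w * ?Y t w)"
      by (simp add: algebra_simps)
  qed
  also have "\<dots> = (\<integral>w. ?B w * ?Y r w \<partial>P)"
    using int[of r] int[of s] int[of t] st bridge_remainder_cov_base[OF V st, of s] bridge_remainder_cov_base[OF V st, of t]
    by simp
  also have "\<dots> = (\<integral>w. ?Y r w * ?Y r w - a * (?Y s w * ?Y r w) - b * (?Y t w * ?Y r w) \<partial>P)"
    unfolding bridge_remainder_centered[OF st(2)] a_def b_def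
    by (intro Bochner_Integration.integral_cong refl) (simp only: left_diff_distrib mult.assoc)
  also have "\<dots> = (\<integral>w. ?Y r w * ?Y r w \<partial>P) - a * (\<integral>w. ?Y s w * ?Y r w \<partial>P) - b * (\<integral>w. ?Y t w * ?Y r w \<partial>P)"
    using intY[of r] intY[of s] intY[of t] st by simp
  also have "\<dots> = \<epsilon> * ((r + L) * (L - r) / (2 * L)) - a * (\<epsilon> * ((s + L) * (L - r) / (2 * L))) - b * (\<epsilon> * ((r + L) * (L - t) / (2 * L)))"
    using scaled_bridge_cov(1)[OF V, of r r] scaled_bridge_cov(1)[OF V, of s r] scaled_bridge_cov(2)[OF V, of r t] st by simp
  also have "\<dots> = \<epsilon> * (((r + L) * (L - r) - a * ((s + L) * (L - r)) - b * ((r + L) * (L - t))) / (2 * L))"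
    by (simp add: algebra_simps add_divide_distrib diff_divide_distrib)
  also have "(r + L) * (L - r) - a * ((s + L) * (L - r)) - b * ((r + L) * (L - t)) = 2 * L * (a * (r - s))"
  proof -
    have "(L - r) - b * (L - t) = (a + b) * L - (a * s + b * t) - b * L + b * t"
      unfolding ab by (simp add: algebra_simps)
    then have *: "(L - r) - b * (L - t) = a * (L - s)" by (simp add: algebra_simps)
    have "(r + L) * (L - r) - a * ((s + L) * (L - r)) - b * ((r + L) * (L - t)) =
       (r + L) * ((L - r) - b * (L - t)) - a * ((s + L) * (L - r))" by (simp add: algebra_simps)
    then show ?thesis unfolding * by (simp add: algebra_simps)
  qed
  also have "\<epsilon> * (2 * L * (a * (r - s)) / (2 * L)) = \<epsilon> * (a * (r - s))" using L by simp
  also have "\<dots> \<le> \<epsilon> * (1 * (t - s))"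
    using L st ab ab0 by (intro mult_left_mono mult_mono) auto
  finally show ?thesis by simp
qed

lemma bridge_steps_indep:
  assumes V: "scaled_bridge \<epsilon> L P V" and t: "-L \<le> t 0" "\<And>i. i < n \<Longrightarrow> t i < t (Suc i)" "t n < L"
  shows "prob_space.indep_vars P (\<lambda>_. borel) (\<lambda>i w. bridge_step \<epsilon> L (V w) (t i) (t (Suc i))) {..<n}"
proof (rule gauss_span_indep[OF scaled_bridge_process[OF V]])
  have mono: "t i \<le> t j" if "i \<le> j" "j \<le> n" for i j
    using that
  proof (induction j rule: dec_induct)
    case (step k)
    then show ?case using t(2)[of k] by simp
  qed simp
  have rng: "-L \<le> t i" "t i < L" if "i \<le> n" for i
    using mono[of 0 i] mono[of i n] that t by auto
  show "(\<lambda>w. bridge_step \<epsilon> L (V w) (t i) (t (Suc i))) \<in> bridge_span L V" if "i \<in> {..<n}" for i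
    using rng[of i] rng[of "Suc i"] that by (intro bridge_step_span) auto
  have lt: "(\<integral>w. bridge_step \<epsilon> L (V w) (t i) (t (Suc i)) * bridge_step \<epsilon> L (V w) (t j) (t (Suc j)) \<partial>P) = 0"
    if "i < j" "j < n" for i j
    using that mono[of "Suc i" j] rng[of i] rng[of "Suc j"] t(2)[of i] t(2)[of j]
    by (intro bridge_step_cov[OF V]) auto
  show "(\<integral>w. bridge_step \<epsilon> L (V w) (t i) (t (Suc i)) * bridge_step \<epsilon> L (V w) (t j) (t (Suc j)) \<partial>P) = 0"
    if "i \<in> {..<n}" "j \<in> {..<n}" "i \<noteq> j" for i j
    using that lt[of i j] lt[of j i] by (cases "i < j") (auto simp: mult.commute)
qed simp

lemma bridge_step_gaussian:
  assumes V: "scaled_bridge \<epsilon> L P V" and "-L \<le> s" "s < t" "t < L"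
  shows "gaussian_rv P (\<lambda>w. bridge_step \<epsilon> L (V w) s t)" "(\<integral>w. bridge_step \<epsilon> L (V w) s t \<partial>P) = 0"
  using gauss_span_gaussian(1,2)[OF scaled_bridge_process[OF V] bridge_step_span] assms by auto

text \<open>In \<open>bridge_step_square\<close> the terms with \<open>1 - v\<close> telescope. The
  one at \<open>t n\<close> is the missing contribution of the last cell because
  \<open>v L = 1\<close>, the one at \<open>-L\<close> is \<open>2 / L\<close> because
  \<open>v (-L) = -1\<close>.\<close>

lemma bridge_steps_square_sum:
  assumes "\<epsilon> > 0" "L > 0" and t: "t 0 = -L" "\<And>i. i < n \<Longrightarrow> t i < t (Suc i)" "t n < L" "t (Suc n) = L"
    and v: "v (-L) = -1" "v L = 1"
  shows "\<epsilon> * (\<Sum>i<n. (bridge_step \<epsilon> L v (t i) (t (Suc i)))\<^sup>2) = 2 * grid_kinetic (Suc n) t (\<lambda>i. v (t i)) - 2 / L"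
proof -
  have mono: "t i < L" if "i \<le> n" for i
    using that
  proof (induction i rule: inc_induct)
    case (step k)
    then show ?case using t(2)[of k] by simp
  qed (rule t(3))
  have "\<epsilon> * (\<Sum>i<n. (bridge_step \<epsilon> L v (t i) (t (Suc i)))\<^sup>2) =
     (\<Sum>i<n. (v (t (Suc i)) - v (t i))\<^sup>2 / (t (Suc i) - t i)) +
     (\<Sum>i<n. (1 - v (t (Suc i)))\<^sup>2 / (L - t (Suc i)) - (1 - v (t i))\<^sup>2 / (L - t i))"
    unfolding sum_distrib_left sum.distrib[symmetric]
    using assms mono by (intro sum.cong refl) (simp add: bridge_step_square)
  also have "(\<Sum>i<n. (1 - v (t (Suc i)))\<^sup>2 / (L - t (Suc i)) - (1 - v (t i))\<^sup>2 / (L - t i)) =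
     (1 - v (t n))\<^sup>2 / (L - t n) - (1 - v (t 0))\<^sup>2 / (L - t 0)"
    by (rule sum_lessThan_telescope)
  also have "(1 - v (t 0))\<^sup>2 / (L - t 0) = 2 / L" using assms by simp
  finally have *: "\<epsilon> * (\<Sum>i<n. (bridge_step \<epsilon> L v (t i) (t (Suc i)))\<^sup>2) =
     (\<Sum>i<n. (v (t (Suc i)) - v (t i))\<^sup>2 / (t (Suc i) - t i)) + ((1 - v (t n))\<^sup>2 / (L - t n) - 2 / L)" .
  have two: "2 * (x / (2 * d)) = x / d" for x d :: real by simp
  have "2 * grid_kinetic (Suc n) t (\<lambda>i. v (t i)) = (\<Sum>i<Suc n. (v (t (Suc i)) - v (t i))\<^sup>2 / (t (Suc i) - t i))"
    unfolding grid_kinetic_def sum_distrib_left two ..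
  then show ?thesis unfolding * using t v by simp
qed

text \<open>The level bounds form a geometric series with first term \<open>\<rho> / 4\<close> and
  ratio \<open>3/4\<close>, hence with sum \<open>\<rho>\<close>. A dyadic point that is new on its
  level is reached from its left neighbour on the coarser level, and \<open>s\<close> is the limit
  of its dyadic roundings.\<close>

lemma dyadic_chaining:
  fixes f :: "real \<Rightarrow> real"
  assumes cont: "continuous_on UNIV f" and h: "h > 0" and \<rho>: "\<rho> > 0"
    and inc: "\<And>k j. j < 2 ^ k \<Longrightarrow> \<bar>f (a + h * real (Suc j) / 2 ^ k) - f (a + h * real j / 2 ^ k)\<bar> \<le> \<rho> * (3/4) ^ k / 4"
    and s: "a \<le> s" "s \<le> a + h"
  shows "\<bar>f s - f a\<bar> \<le> \<rho>"
proof -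
  have dy: "\<bar>f (a + h * real j / 2 ^ k) - f a\<bar> \<le> \<rho> * (1 - (3/4) ^ Suc k)" if "j \<le> 2 ^ k" for k j
    using that
  proof (induction k arbitrary: j)
    case 0
    then have "j = 0 \<or> j = 1" by auto
    then show ?case using inc[of 0 0] \<rho> by auto
  next
    case (Suc k)
    have up: "\<rho> * (1 - (3/4) ^ Suc k) \<le> \<rho> * (1 - (3/4) ^ Suc (Suc k))" using \<rho> by simp
    show ?case
    proof (cases "even j")
      case True
      then obtain i where i: "j = 2 * i" by blast
      then have "\<bar>f (a + h * real i / 2 ^ k) - f a\<bar> \<le> \<rho> * (1 - (3/4) ^ Suc k)" using Suc by simp
      moreover have "h * real i / 2 ^ k = h * real j / 2 ^ Suc k" by (simp add: i)
      ultimately show ?thesis using up by simp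
    next
      case False
      then obtain i where "j = 2 * i + 1" by (rule oddE)
      then have i: "j = Suc (2 * i)" by simp
      have IH: "\<bar>f (a + h * real i / 2 ^ k) - f a\<bar> \<le> \<rho> * (1 - (3/4) ^ Suc k)" using Suc i by simp
      have e: "h * real (2 * i) / 2 ^ Suc k = h * real i / 2 ^ k" by simp
      have "\<bar>f (a + h * real j / 2 ^ Suc k) - f (a + h * real (2 * i) / 2 ^ Suc k)\<bar> \<le> \<rho> * (3/4) ^ Suc k / 4"
        unfolding i using Suc(2) i by (intro inc) auto
      then have "\<bar>f (a + h * real j / 2 ^ Suc k) - f (a + h * real i / 2 ^ k)\<bar> \<le> \<rho> * (3/4) ^ Suc k / 4"
        unfolding e .
      then have "\<bar>f (a + h * real j / 2 ^ Suc k) - f a\<bar> \<le> \<rho> * (1 - (3/4) ^ Suc k) + \<rho> * (3/4) ^ Suc k / 4"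
        using IH by linarith
      also have "\<dots> = \<rho> * (1 - (3/4) ^ Suc (Suc k))" by (simp add: algebra_simps)
      finally show ?thesis .
    qed
  qed
  define j where "j k = nat \<lfloor>2 ^ k * ((s - a) / h)\<rfloor>" for k
  define x where "x k = a + h * real (j k) / 2 ^ k" for k
  have q: "0 \<le> (s - a) / h" "(s - a) / h \<le> 1" using s h by auto
  have jr: "real (j k) \<le> 2 ^ k * ((s - a) / h)" "2 ^ k * ((s - a) / h) < real (j k) + 1" for k
  proof -
    let ?z = "2 ^ k * ((s - a) / h)"
    have "0 \<le> ?z" using q by (intro mult_nonneg_nonneg) auto
    then show "real (j k) \<le> ?z" unfolding j_def by (rule of_nat_floor)
    have "?z < real_of_int \<lfloor>?z\<rfloor> + 1" by (rule real_of_int_floor_add_one_gt)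
    moreover have "real_of_int \<lfloor>?z\<rfloor> \<le> real (nat \<lfloor>?z\<rfloor>)" by (cases "\<lfloor>?z\<rfloor> \<ge> 0") auto
    ultimately show "?z < real (j k) + 1" unfolding j_def by linarith
  qed
  have jle: "j k \<le> 2 ^ k" for k
  proof -
    have "2 ^ k * ((s - a) / h) \<le> 2 ^ k * 1" using q by (intro mult_left_mono) auto
    from order.trans[OF jr(1) this] have "real (j k) \<le> real (2 ^ k)" by simp
    then show ?thesis unfolding of_nat_le_iff .
  qed
  have close: "\<bar>x k - s\<bar> \<le> h * (1/2) ^ k" for k
  proof -
    have "s - x k = h / 2 ^ k * (2 ^ k * ((s - a) / h) - real (j k))"
      using h by (simp add: x_def field_simps)
    moreover have "0 \<le> h / 2 ^ k * (2 ^ k * ((s - a) / h) - real (j k))"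
      using jr(1)[of k] h by (intro mult_nonneg_nonneg) auto
    moreover have "h / 2 ^ k * (2 ^ k * ((s - a) / h) - real (j k)) \<le> h / 2 ^ k * 1"
      using jr(2)[of k] h by (intro mult_left_mono) auto
    ultimately show ?thesis by (simp add: power_one_over)
  qed
  have "x \<longlonglongrightarrow> s"
  proof (rule iffD2[OF tendsto_dist_iff])
    show "(\<lambda>k. dist (x k) s) \<longlonglongrightarrow> 0" 
    proof (rule tendsto_sandwich[of "\<lambda>_. 0" _ _ "\<lambda>k. h * (1/2) ^ k"])
      show "(\<lambda>k. h * (1/2) ^ k) \<longlonglongrightarrow> 0" by (intro tendsto_mult_right_zero LIMSEQ_power_zero) auto
    qed (use close in \<open>auto simp: dist_real_def\<close>)
  qed
  then have "(\<lambda>k. f (x k)) \<longlonglongrightarrow> f s"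
    using cont by (intro isCont_tendsto_compose[of s f]) (auto simp: continuous_on_eq_continuous_at)
  then have "(\<lambda>k. \<bar>f (x k) - f a\<bar>) \<longlonglongrightarrow> \<bar>f s - f a\<bar>" by (intro tendsto_intros)
  moreover have "\<bar>f (x k) - f a\<bar> \<le> \<rho>" for k
  proof -
    have "\<bar>f (x k) - f a\<bar> \<le> \<rho> * (1 - (3/4) ^ Suc k)" unfolding x_def by (rule dy[OF jle])
    also have "\<dots> \<le> \<rho> * 1" using \<rho> by (intro mult_left_mono) auto
    finally show ?thesis by simp
  qed
  ultimately show ?thesis by (intro tendsto_upperbound) auto
qed

text \<open>The variance of the centred increment is \<open>\<epsilon>\<close> times
  \<open>(t - s) - (t - s)^2 / (2 * L)\<close>.\<close>

lemma scaled_bridge_increment_tail: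
  assumes V: "scaled_bridge \<epsilon> L P V" and st: "-L \<le> s" "s < t" "t \<le> L" and x: "x \<ge> 0"
  shows "measure P {w\<in>space P. \<bar>(V w t - t / L) - (V w s - s / L)\<bar> \<ge> x} \<le> 2 * exp (- x\<^sup>2 / (2 * (\<epsilon> * (t - s))))"
proof -
  let ?Y = "\<lambda>r w. V w r - r / L"
  have L: "L > 0" "\<epsilon> > 0" using V by (auto simp: scaled_bridge_def)
  have sp: "?Y t \<in> bridge_span L V" "?Y s \<in> bridge_span L V" using st by (auto intro!: bridge_span_base)
  have D: "(\<lambda>w. ?Y t w - ?Y s w) \<in> bridge_span L V" by (intro gauss_span_diff sp)
  have c: "(\<integral>w. ?Y t w * ?Y t w \<partial>P) = \<epsilon> * ((t + L) * (L - t) / (2 * L))"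
    "(\<integral>w. ?Y s w * ?Y t w \<partial>P) = \<epsilon> * ((s + L) * (L - t) / (2 * L))"
    "(\<integral>w. ?Y s w * ?Y s w \<partial>P) = \<epsilon> * ((s + L) * (L - s) / (2 * L))"
    by (rule scaled_bridge_cov(1)[OF V]; use st in simp)+
  have c': "(\<integral>w. ?Y t w * ?Y s w \<partial>P) = \<epsilon> * ((s + L) * (L - t) / (2 * L))"
    by (rule scaled_bridge_cov(2)[OF V]; use st in simp)
  have "(\<integral>w. (?Y t w - ?Y s w)\<^sup>2 \<partial>P) = (\<integral>w. (1 * ?Y t w + -1 * ?Y s w) * (1 * ?Y t w + -1 * ?Y s w) \<partial>P)"
    by (intro Bochner_Integration.integral_cong refl) (simp add: power2_eq_square algebra_simps)
  also have "\<dots> = \<epsilon> * (((t + L) * (L - t) - 2 * ((s + L) * (L - t)) + (s + L) * (L - s)) / (2 * L))"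
    unfolding bridge_integral_bilinear[OF V sp sp] c c' by (simp add: algebra_simps add_divide_distrib diff_divide_distrib)
  also have "\<dots> \<le> \<epsilon> * (t - s)"
  proof (intro mult_left_mono)
    have "(t + L) * (L - t) - 2 * ((s + L) * (L - t)) + (s + L) * (L - s) = 2 * L * (t - s) - (t - s)\<^sup>2"
      by (simp add: algebra_simps power2_eq_square)
    then show "((t + L) * (L - t) - 2 * ((s + L) * (L - t)) + (s + L) * (L - s)) / (2 * L) \<le> t - s"
      using L by (simp add: divide_le_eq mult_ac)
  qed (use L in auto)
  finally have v: "(\<integral>w. (?Y t w - ?Y s w)\<^sup>2 \<partial>P) \<le> \<epsilon> * (t - s)" .
  show ?thesis
    using gaussian_rv_tail[OF scaled_bridge_prob_space[OF V] gauss_span_gaussian(1,2)[OF scaled_bridge_process[OF V] D] refl v _ x]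
      L st by simp
qed

text \<open>Level \<open>k\<close> has \<open>2^k\<close> increments of variance at most
  \<open>\<epsilon> * h / 2^k\<close>, and thresholds that decay like \<open>(3/4)^k\<close>, slower
  than the standard deviations. The tail exponent thus grows like
  \<open>(2 * 9/16)^k = (9/8)^k\<close>, by Bernoulli's inequality at least like
  \<open>1 + k / 8\<close>. An exponent of at least 12 makes \<open>exp (- X / 8)\<close> at most
  \<open>1/4\<close>, which beats the number of increments and leaves a geometric series of ratio
  \<open>1/2\<close>.\<close>

lemma bridge_chaining_event:
  assumes V: "scaled_bridge \<epsilon> L P V" and a: "-L \<le> a" "a + h \<le> L" and h: "h > 0" and \<rho>: "\<rho> > 0"
    and x: "\<rho>\<^sup>2 / (32 * \<epsilon> * h) \<ge> 12"
  obtains W where "W \<in> sets P" "measure P W \<le> 4 * exp (- \<rho>\<^sup>2 / (32 * \<epsilon> * h))"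
    "\<And>w s. w \<in> space P - W \<Longrightarrow> a \<le> s \<Longrightarrow> s \<le> a + h \<Longrightarrow> \<bar>(V w s - s / L) - (V w a - a / L)\<bar> \<le> \<rho>"
proof -
  interpret prob_space P by (rule scaled_bridge_prob_space[OF V])
  have L: "L > 0" "\<epsilon> > 0" using V by (auto simp: scaled_bridge_def)
  define X where "X = \<rho>\<^sup>2 / (32 * \<epsilon> * h)"
  have X: "X \<ge> 12" using x by (simp add: X_def)
  define p where "p k j = a + h * real j / 2 ^ k" for k j
  let ?Y = "\<lambda>r w. V w r - r / L"
  define E where "E k j = {w\<in>space P. \<bar>?Y (p k (Suc j)) w - ?Y (p k j) w\<bar> \<ge> \<rho> * (3/4) ^ k / 4}" for k j
  define W where "W = (\<Union>k. \<Union>j\<in>{..<2^k}. E k j)"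
  have p: "-L \<le> p k j" "p k j \<le> L" if "j \<le> 2 ^ k" for k j
  proof -
    have "real j \<le> real (2 ^ k)" using that by (simp only: of_nat_le_iff)
    then have "h * real j / 2 ^ k \<le> h" using h by (simp add: divide_le_eq)
    moreover have "h * real j / 2 ^ k \<ge> 0" using h by simp
    ultimately show "-L \<le> p k j" "p k j \<le> L" using a by (auto simp: p_def)
  qed
  have E[measurable]: "E k j \<in> sets P" if "j < 2 ^ k" for k j
  proof -
    have [measurable]: "(\<lambda>w. V w (p k j)) \<in> borel_measurable P" "(\<lambda>w. V w (p k (Suc j))) \<in> borel_measurable P"
      using that by (auto intro!: scaled_bridge_measurable[OF V])
    show ?thesis unfolding E_def by measurable
  qed
  have PE: "measure P (E k j) \<le> 2 * exp (- X * (9/8) ^ k)" if j: "j < 2 ^ k" for k j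
  proof -
    have d: "p k (Suc j) - p k j = h / 2 ^ k" by (simp add: p_def field_simps)
    have lt: "p k j < p k (Suc j)" proof -
      have "h / 2 ^ k > 0" using h by simp
      then show ?thesis using d by linarith
    qed
    have "measure P (E k j) \<le> 2 * exp (- (\<rho> * (3/4) ^ k / 4)\<^sup>2 / (2 * (\<epsilon> * (p k (Suc j) - p k j))))"
      unfolding E_def using j \<rho> p[of j k] p[of "Suc j" k] lt by (intro scaled_bridge_increment_tail[OF V]) auto
    also have "- (\<rho> * (3/4) ^ k / 4)\<^sup>2 / (2 * (\<epsilon> * (p k (Suc j) - p k j))) = - (X * (9/8) ^ k)"
    proof -
      have "((3/4) ^ k)\<^sup>2 * 2 ^ k = (9/8 :: real) ^ k"
        by (simp add: power2_eq_square flip: power_mult_distrib)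
      then have "X * (9/8) ^ k = \<rho>\<^sup>2 * ((3/4) ^ k)\<^sup>2 * 2 ^ k / (32 * \<epsilon> * h)" by (simp add: X_def mult_ac)
      then show ?thesis using L h unfolding d by (simp add: power_mult_distrib power_divide field_simps)
    qed
    finally show ?thesis by simp
  qed
  have "ennreal (measure P W) = emeasure P W" by (simp add: emeasure_eq_measure)
  also have "\<dots> \<le> (\<Sum>k. emeasure P (\<Union>j\<in>{..<2^k}. E k j))"
    unfolding W_def by (intro emeasure_subadditive_countably) auto
  also have "\<dots> \<le> (\<Sum>k. ennreal (2 * exp (- X) * (1/2) ^ k))"
  proof (intro suminf_le allI)
    fix k
    have "emeasure P (\<Union>j\<in>{..<2^k}. E k j) \<le> (\<Sum>j\<in>{..<2^k}. emeasure P (E k j))"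
      by (intro emeasure_subadditive_finite) auto
    also have "\<dots> \<le> (\<Sum>j\<in>{..<(2::nat)^k}. ennreal (2 * exp (- X * (9/8) ^ k)))"
      using PE by (intro sum_mono) (auto simp: emeasure_eq_measure intro!: ennreal_leI)
    also have "\<dots> = ennreal (\<Sum>j\<in>{..<(2::nat)^k}. 2 * exp (- X * (9/8) ^ k))"
      by (rule sum_ennreal) auto
    also have "(\<Sum>j\<in>{..<(2::nat)^k}. 2 * exp (- X * (9/8) ^ k)) = 2 ^ k * (2 * exp (- X * (9/8) ^ k))"
      by simp
    also have "\<dots> \<le> ennreal (2 * exp (- X) * (1/2) ^ k)"
    proof (intro ennreal_leI)
      have "1 + real k * (1/8) \<le> (1 + 1/8 :: real) ^ k" by (rule Bernoulli_inequality) simp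
      then have "X * (1 + real k / 8) \<le> X * (9/8) ^ k" using X by (intro mult_left_mono) auto
      then have "exp (- X * (9/8) ^ k) \<le> exp (- X + real k * (- X / 8))" by (simp add: algebra_simps)
      also have "\<dots> = exp (- X) * exp (- X / 8) ^ k" by (simp only: exp_add exp_of_nat_mult)
      also have "\<dots> \<le> exp (- X) * (1/4) ^ k"
      proof (intro mult_left_mono power_mono)
        have "(4::real) \<le> (1 + 1 + 1 / 2 * 1\<^sup>2) * exp (1/2)" using exp_lower_Taylor_quadratic[of "1/2"] by (simp add: power2_eq_square)
        also have "\<dots> \<le> exp 1 * exp (1/2)"
          using exp_lower_Taylor_quadratic[of 1] by (intro mult_right_mono) auto
        also have "\<dots> = exp (3/2)" by (simp flip: exp_add)
        also have "\<dots> \<le> exp (X / 8)" using X by simp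
        finally have "4 \<le> exp (X / 8)" by simp
        then show "exp (- X / 8) \<le> 1 / 4" by (simp add: exp_minus field_simps)
      qed auto
      finally have "2 ^ k * (2 * exp (- X * (9/8) ^ k)) \<le> 2 ^ k * (2 * (exp (- X) * (1/4) ^ k))"
        by (intro mult_left_mono) auto
      also have "\<dots> = 2 * exp (- X) * (2 ^ k * (1/4) ^ k)" by simp
      also have "2 ^ k * (1/4) ^ k = (1/2 :: real) ^ k" by (simp flip: power_mult_distrib)
      finally show "2 ^ k * (2 * exp (- X * (9/8) ^ k)) \<le> 2 * exp (- X) * (1/2) ^ k" .
    qed
    finally show "emeasure P (\<Union>j\<in>{..<2^k}. E k j) \<le> ennreal (2 * exp (- X) * (1/2) ^ k)" .
  qed auto
  also have "\<dots> = ennreal (\<Sum>k. 2 * exp (- X) * (1/2) ^ k)"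
    by (intro suminf_ennreal2 summable_mult summable_geometric) auto
  also have "(\<Sum>k. 2 * exp (- X) * (1/2) ^ k) = 4 * exp (- X)"
    by (subst suminf_mult) (auto simp: suminf_geometric)
  finally have PW: "measure P W \<le> 4 * exp (- X)" by simp
  show thesis
  proof (rule that)
    show "W \<in> sets P" unfolding W_def by (intro sets.countable_UN' sets.finite_UN) auto
    show "measure P W \<le> 4 * exp (- \<rho>\<^sup>2 / (32 * \<epsilon> * h))" using PW by (simp add: X_def)
    fix w s assume w: "w \<in> space P - W" and s: "a \<le> s" "s \<le> a + h"
    show "\<bar>(V w s - s / L) - (V w a - a / L)\<bar> \<le> \<rho>"
    proof (rule dyadic_chaining[OF _ h \<rho> _ s, where f = "\<lambda>s. V w s - s / L"])
      show "continuous_on UNIV (\<lambda>s. V w s - s / L)"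
        using V w by (intro continuous_intros) (auto simp: scaled_bridge_def)
      fix k j :: nat assume "j < 2 ^ k"
      then have "w \<notin> E k j" using w by (auto simp: W_def)
      then show "\<bar>V w (a + h * real (Suc j) / 2 ^ k) - (a + h * real (Suc j) / 2 ^ k) / L -
          (V w (a + h * real j / 2 ^ k) - (a + h * real j / 2 ^ k) / L)\<bar> \<le> \<rho> * (3/4) ^ k / 4"
        using w by (simp add: E_def p_def)
    qed
  qed
qed

text \<open>Chaining in each of the \<open>n\<close> cells. Two times at distance at most
  \<open>h\<close> lie in the same cell or in neighbouring ones and are connected by at most three
  moves within a cell, whence the factor 3; \<open>h / L\<close> accounts for the mean
  \<open>s / L\<close>.\<close>

lemma bridge_modulus_event:
  assumes V: "scaled_bridge \<epsilon> L P V" and n: "n > 0" and h: "h = 2 * L / real n" and \<rho>: "\<rho> > 0"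
    and x: "\<rho>\<^sup>2 / (32 * \<epsilon> * h) \<ge> 12"
  obtains W where "W \<in> sets P" "measure P W \<le> 4 * real n * exp (- \<rho>\<^sup>2 / (32 * \<epsilon> * h))"
    "\<And>w s t. w \<in> space P - W \<Longrightarrow> -L \<le> s \<Longrightarrow> s \<le> t \<Longrightarrow> t \<le> L \<Longrightarrow> t - s \<le> h \<Longrightarrow> \<bar>V w t - V w s\<bar> \<le> 3 * (\<rho> + h / L)"
proof -
  interpret prob_space P by (rule scaled_bridge_prob_space[OF V])
  have L: "L > 0" "\<epsilon> > 0" using V by (auto simp: scaled_bridge_def)
  have h0: "h > 0" using L n by (simp add: h)
  have nh: "real n * h = 2 * L" using n by (simp add: h)
  define p where "p i = -L + h * real i" for i
  have p: "-L \<le> p i" "p i + h \<le> L" if "i < n" for i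
  proof -
    show "-L \<le> p i" using h0 by (simp add: p_def)
    have "h * real (Suc i) \<le> h * real n" using that h0 by (intro mult_left_mono) auto
    then show "p i + h \<le> L" using nh by (simp add: p_def algebra_simps)
  qed
  let ?P = "\<lambda>i W. W \<in> sets P \<and> measure P W \<le> 4 * exp (- \<rho>\<^sup>2 / (32 * \<epsilon> * h)) \<and>
    (\<forall>w s. w \<in> space P - W \<longrightarrow> p i \<le> s \<longrightarrow> s \<le> p i + h \<longrightarrow> \<bar>(V w s - s / L) - (V w (p i) - p i / L)\<bar> \<le> \<rho>)"
  have "\<exists>W. ?P i W" if "i < n" for i
    by (rule bridge_chaining_event[OF V p[OF that] h0 \<rho> x]) blast
  then obtain U where U: "\<And>i. i < n \<Longrightarrow> ?P i (U i)" by metis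
  define W where "W = (\<Union>i\<in>{..<n}. U i)"
  show thesis
  proof (rule that)
    show "W \<in> sets P" unfolding W_def using U by (intro sets.finite_UN) auto
    have "measure P W \<le> (\<Sum>i<n. measure P (U i))"
      unfolding W_def using U by (intro finite_measure_subadditive_finite) auto
    also have "\<dots> \<le> (\<Sum>i<n. 4 * exp (- \<rho>\<^sup>2 / (32 * \<epsilon> * h)))" using U by (intro sum_mono) auto
    finally show "measure P W \<le> 4 * real n * exp (- \<rho>\<^sup>2 / (32 * \<epsilon> * h))" by simp
    fix w s t assume w: "w \<in> space P - W" and st: "-L \<le> s" "s \<le> t" "t \<le> L" "t - s \<le> h"
    have osc: "\<bar>V w r - V w (p i)\<bar> \<le> \<rho> + h / L" if "i < n" "p i \<le> r" "r \<le> p i + h" for i r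
    proof -
      have 1: "\<bar>(V w r - r / L) - (V w (p i) - p i / L)\<bar> \<le> \<rho>" using U[OF that(1)] w that by (auto simp: W_def)
      have 2: "\<bar>r / L - p i / L\<bar> \<le> h / L"
        using that L by (simp add: diff_divide_distrib[symmetric] divide_right_mono)
      show ?thesis using 1 2 by linarith
    qed
    have ex: "\<exists>i<n. p i \<le> r \<and> r \<le> p i + h \<and> r < p i + h \<or> i = n - 1 \<and> p i \<le> r \<and> r \<le> p i + h" if r: "-L \<le> r" "r \<le> L" for r
    proof (cases "r = L")
      case True
      have "p (n - 1) + h = L" using n nh by (simp add: p_def of_nat_diff algebra_simps)
      then show ?thesis using True n h0 by (intro exI[of _ "n - 1"]) auto
    next
      case False
      define i where "i = nat \<lfloor>(r + L) / h\<rfloor>"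
      have q: "0 \<le> (r + L) / h" using r h0 by simp
      have "real i \<le> (r + L) / h" "(r + L) / h < real i + 1" using q by (auto simp: i_def of_nat_nat)
      then have i: "h * real i \<le> r + L" "r + L < h * real i + h"
        using h0 by (auto simp: le_divide_eq divide_less_eq algebra_simps)
      have "h * real i < h * real n" using i(1) False r nh by (simp add: mult.commute)
      then have "i < n" using h0 by simp
      then show ?thesis using i by (intro exI[of _ i]) (auto simp: p_def)
    qed
    obtain i where i: "i < n" "p i \<le> s" "s \<le> p i + h" using ex[of s] st by auto
    show "\<bar>V w t - V w s\<bar> \<le> 3 * (\<rho> + h / L)"
    proof (cases "t \<le> p i + h")
      case True
      have "0 \<le> \<rho> + h / L" using \<rho> h0 L by simp
      then show ?thesis using abs_triangle_ineq4[of "V w t - V w (p i)" "V w s - V w (p i)"]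
          osc[OF i] osc[OF i(1) order.trans[OF i(2) st(2)] True] by simp
    next
      case False
      have pi: "p (Suc i) = p i + h" by (simp add: p_def algebra_simps)
      have lt: "Suc i < n"
      proof (rule ccontr)
        assume "\<not> Suc i < n"
        then have "Suc i = n" using i by simp
        then have "p i + h = L" using nh pi by (auto simp: p_def algebra_simps)
        then show False using False st by simp
      qed
      have "\<bar>V w t - V w (p (Suc i))\<bar> \<le> \<rho> + h / L"
        by (rule osc[OF lt]) (use pi False st i in auto)
      moreover have "\<bar>V w (p (Suc i)) - V w (p i)\<bar> \<le> \<rho> + h / L"
        by (rule osc[OF i(1)]) (use pi h0 in auto)
      ultimately show ?thesis using osc[OF i] by (simp add: abs_le_iff)
    qed
  qed
qed

section \<open>Weight of the paths far from the instantons\<close>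

lemma integral_split_periods:
  fixes f :: "real \<Rightarrow> real"
  assumes f: "continuous_on UNIV f" and h: "h \<ge> 0"
  shows "integral {a..a + real n * h} f = integral {0..h} (\<lambda>\<sigma>. \<Sum>k<n. f (a + \<sigma> + real k * h))"
proof -
  have int: "f integrable_on {x..y}" for x y
    by (intro integrable_continuous_real continuous_on_subset[OF f]) auto
  have shift: "integral {a + real k * h..a + real (Suc k) * h} f = integral {0..h} (\<lambda>\<sigma>. f (a + \<sigma> + real k * h))" for k
  proof -
    have "integral {0..h} (f \<circ> ((+) (a + real k * h))) = integral {0 + (a + real k * h)..h + (a + real k * h)} f"
      by (rule integral_shift_Icc_real)
    then show ?thesis by (simp add: o_def algebra_simps)
  qed
  have "integral {a..a + real n * h} f = (\<Sum>k<n. integral {a + real k * h..a + real (Suc k) * h} f)"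
  proof (induction n)
    case (Suc n)
    have "integral {a..a + real (Suc n) * h} f = integral {a..a + real n * h} f + integral {a + real n * h..a + real (Suc n) * h} f"
      using h by (intro Henstock_Kurzweil_Integration.integral_combine[symmetric] int) (auto simp: distrib_right)
    then show ?case using Suc by simp
  qed simp
  also have "\<dots> = (\<Sum>k<n. integral {0..h} (\<lambda>\<sigma>. f (a + \<sigma> + real k * h)))" unfolding shift ..
  also have "\<dots> = integral {0..h} (\<lambda>\<sigma>. \<Sum>k<n. f (a + \<sigma> + real k * h))"
    by (intro integral_sum[symmetric] integrable_continuous_real continuous_intros continuous_on_compose2[OF f]) auto
  finally show ?thesis .
qed

text \<open>Averaging over the offset of the grid and Jensen's inequality replace the energy integral by
  Riemann sums, without controlling the path between grid points.\<close>

lemma exp_neg_integral_le_offset_average: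
  fixes g :: "real \<Rightarrow> real"
  assumes g: "continuous_on UNIV g" and h: "h > 0"
  shows "ennreal (exp (- c * integral {0..h} g)) \<le>
     ennreal (1 / h) * (\<integral>\<^sup>+\<sigma>. ennreal (exp (- c * h * g \<sigma>)) * indicator {0..h} \<sigma> \<partial>lborel)"
proof -
  define \<mu> where "\<mu> = c * integral {0..h} g"
  have int: "(\<lambda>\<sigma>. exp (- c * h * g \<sigma>)) integrable_on {0..h}" "g integrable_on {0..h}"
    by (intro integrable_continuous_real continuous_intros continuous_on_subset[OF g] subset_UNIV)+
  \<comment> \<open>The integrand is the tangent of \<open>exp\<close> at \<open>- \<mu>\<close>,
    taken at \<open>- c * h * g \<sigma>\<close>. Since \<open>c * h * g\<close> has mean
    \<open>\<mu>\<close> over the period, comparing tangent and function is Jensen's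
    inequality.\<close>
  have "h * exp (- \<mu>) = integral {0..h} (\<lambda>\<sigma>. exp (- \<mu>) * (1 + \<mu>) - exp (- \<mu>) * c * h * g \<sigma>)"
  proof -
    have "integral {0..h} (\<lambda>\<sigma>. exp (- \<mu>) * (1 + \<mu>) - exp (- \<mu>) * c * h * g \<sigma>) =
       h * (exp (- \<mu>) * (1 + \<mu>)) - exp (- \<mu>) * c * h * integral {0..h} g"
      using int(2) h by (subst integral_diff) (auto intro!: integrable_on_mult_right integrable_const_ivl)
    also have "\<dots> = h * exp (- \<mu>)" unfolding \<mu>_def by (simp add: algebra_simps)
    finally show ?thesis by simp
  qed
  also have "\<dots> \<le> integral {0..h} (\<lambda>\<sigma>. exp (- c * h * g \<sigma>))"
  proof (intro integral_le int integrable_diff integrable_on_mult_right integrable_const_ivl)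
    fix \<sigma>
    have "exp (- \<mu>) * (1 + (\<mu> - c * h * g \<sigma>)) \<le> exp (- \<mu>) * exp (\<mu> - c * h * g \<sigma>)"
      by (intro mult_left_mono exp_ge_add_one_self) auto
    also have "\<dots> = exp (- c * h * g \<sigma>)" by (simp flip: exp_add)
    finally show "exp (- \<mu>) * (1 + \<mu>) - exp (- \<mu>) * c * h * g \<sigma> \<le> exp (- c * h * g \<sigma>)"
      by (simp add: algebra_simps)
  qed
  finally have "exp (- \<mu>) \<le> 1 / h * integral {0..h} (\<lambda>\<sigma>. exp (- c * h * g \<sigma>))"
    using h by (simp add: field_simps)
  then have "ennreal (exp (- \<mu>)) \<le> ennreal (1 / h) * ennreal (integral {0..h} (\<lambda>\<sigma>. exp (- c * h * g \<sigma>)))"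
    using h integral_nonneg[OF int(1)] by (subst ennreal_mult[symmetric]) (auto intro!: ennreal_leI)
  also have "ennreal (integral {0..h} (\<lambda>\<sigma>. exp (- c * h * g \<sigma>))) =
      (\<integral>\<^sup>+\<sigma>. ennreal (exp (- c * h * g \<sigma>)) * indicator {0..h} \<sigma> \<partial>lborel)"
    by (rule nn_integral_has_integral_lebesgue'[symmetric]) (use int in \<open>auto simp: integrable_integral\<close>)
  finally show ?thesis by (simp add: \<mu>_def)
qed

text \<open>The shift distributes one period over both ends: the first cell has length
  \<open>\<sigma>\<close>, the last \<open>h - \<sigma>\<close>. The \<open>n\<close> interior
  points are the sample points of the shifted Riemann sum.\<close>

definition offset_grid :: "real \<Rightarrow> real \<Rightarrow> nat \<Rightarrow> real \<Rightarrow> nat \<Rightarrow> real" where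
  "offset_grid L h n \<sigma> i = (if i = 0 then -L else if i \<le> n then -L + \<sigma> + real (i - 1) * h else L)"

lemma offset_grid_mesh:
  assumes "n > 0" "h = 2 * L / real n" "0 < \<sigma>" "\<sigma> < h"
  shows "grid_mesh h (Suc n) (offset_grid L h n \<sigma>)"
  unfolding grid_mesh_def
proof (intro allI impI)
  fix i assume i: "i < Suc n"
  have nh: "real n * h = 2 * L" using assms by simp
  consider "i = 0" | "0 < i" "i < n" | "0 < i" "i = n" using i by linarith
  then show "0 < offset_grid L h n \<sigma> (Suc i) - offset_grid L h n \<sigma> i \<and>
      offset_grid L h n \<sigma> (Suc i) - offset_grid L h n \<sigma> i \<le> h"
  proof cases
    case 1
    then show ?thesis using assms by (simp add: offset_grid_def)
  next
    case 2
    then show ?thesis using assms(3,4) by (simp add: offset_grid_def of_nat_diff algebra_simps)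
  next
    case 3
    then show ?thesis using assms(3,4) nh by (simp add: offset_grid_def of_nat_diff algebra_simps)
  qed
qed

lemma grid_bracket:
  fixes t :: "nat \<Rightarrow> real"
  assumes "t 0 \<le> s" "s \<le> t N" "N > 0"
  shows "\<exists>i<N. t i \<le> s \<and> s \<le> t (Suc i)"
  using assms
proof (induction N)
  case (Suc N)
  show ?case
  proof (cases "s \<le> t N \<and> N > 0")
    case True
    then show ?thesis using Suc by (meson less_SucI)
  next
    case False
    then show ?thesis using Suc by (intro exI[of _ N]) auto
  qed
qed simp

text \<open>The drift vanishes at 1, so along the instanton it is at most
  \<open>\<Lambda> * \<bar>m s - 1\<bar>\<close>, that is, at most
  \<open>2 * \<Lambda>\<close>.\<close>

lemma drift_instanton_lipschitz:
  assumes F: "double_well F" and m: "instanton F m" and lip: "\<And>x y. \<bar>drift F x - drift F y\<bar> \<le> \<Lambda> * \<bar>x - y\<bar>"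
  shows "\<bar>m x - m y\<bar> \<le> 2 * \<Lambda> * \<bar>x - y\<bar>"
proof -
  have \<Lambda>: "\<Lambda> \<ge> 0" using lip[of 0 1] abs_ge_zero[of "drift F 0 - drift F 1"] by simp
  have bd: "\<bar>drift F (m s)\<bar> \<le> 2 * \<Lambda>" for s
  proof -
    have "\<bar>drift F (m s)\<bar> \<le> \<Lambda> * \<bar>m s - 1\<bar>" using lip[of "m s" 1] drift_well(1)[OF F] by simp
    also have "\<dots> \<le> \<Lambda> * 2" using instanton_bounds[OF F m, of s] \<Lambda> by (intro mult_left_mono) auto
    finally show ?thesis by simp
  qed
  have main: "\<bar>m y - m x\<bar> \<le> 2 * \<Lambda> * (y - x)" if "x \<le> y" for x y
  proof (rule DERIV_bounded_lipschitz[OF that])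
    show "continuous_on {x..y} m"
      using instanton_ode[OF F m] by (meson DERIV_isCont continuous_at_imp_continuous_on)
  qed (use instanton_ode[OF F m] bd in blast)
  show ?thesis using main[of x y] main[of y x] by (cases "x \<le> y") (auto simp: abs_minus_commute)
qed

definition near_instanton :: "(real \<Rightarrow> real) \<Rightarrow> real \<Rightarrow> real \<Rightarrow> (real \<Rightarrow> real) \<Rightarrow> bool" where
  "near_instanton m L \<rho> v \<longleftrightarrow> (\<exists>\<xi>. \<forall>s\<in>{-L..L}. \<bar>v s - m (s - \<xi>)\<bar> \<le> \<rho>)"

text \<open>Exponential Chebyshev inequality: on \<open>B\<close> the exponential of
  \<open>(1 - \<theta>) / \<epsilon>\<close> times the surplus of the action over \<open>A\<close>
  is at least 1. Inserting this factor compensates the potential energy and leaves exponential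
  moments of squares of independent normals. The term \<open>1 / L\<close> is the boundary term of
  \<open>bridge_steps_square_sum\<close>.\<close>

lemma offset_grid_tilted_bound:
  assumes V: "scaled_bridge \<epsilon> L P V" and n: "n > 0" and h: "h = 2 * L / real n" and \<sigma>: "0 < \<sigma>" "\<sigma> < h"
    and \<theta>: "0 < \<theta>" "\<theta> < 1" and F: "\<And>x. F x \<ge> 0" and B: "B \<in> sets P"
    and act: "\<And>w. w \<in> B \<Longrightarrow> V w (-L) = -1 \<Longrightarrow> V w L = 1 \<Longrightarrow>
        grid_kinetic (Suc n) (offset_grid L h n \<sigma>) (\<lambda>i. V w (offset_grid L h n \<sigma> i))
          + h * (\<Sum>k<n. F (V w (-L + \<sigma> + real k * h))) \<ge> A"
  shows "(\<integral>\<^sup>+w. ennreal (exp (- (h / \<epsilon>) * (\<Sum>k<n. F (V w (-L + \<sigma> + real k * h))))) * indicator B w \<partial>P)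
     \<le> ennreal (exp (- ((1 - \<theta>) * (A - 1 / L)) / \<epsilon>) * (1 / sqrt \<theta>) ^ n)"
proof -
  interpret prob_space P by (rule scaled_bridge_prob_space[OF V])
  have L: "L > 0" "\<epsilon> > 0" using V by (auto simp: scaled_bridge_def)
  have hpos: "h > 0" using \<sigma> by simp
  define t where "t = offset_grid L h n \<sigma>"
  have mesh: "grid_mesh h (Suc n) t" unfolding t_def by (rule offset_grid_mesh[OF n h \<sigma>])
  have t0: "t 0 = -L" and tN: "t (Suc n) = L" by (auto simp: t_def offset_grid_def)
  have inc: "t i < t (Suc i)" if "i < Suc n" for i using mesh that by (auto simp: grid_mesh_def)
  have tn: "t n < L" using inc[of n] tN by simp
  define Y where "Y i w = bridge_step \<epsilon> L (V w) (t i) (t (Suc i))" for i w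
  have rng: "-L \<le> t i" "t i < L" if "i \<le> n" for i
  proof -
    have "t 0 \<le> t i \<and> t i \<le> t n" using that
    proof (induction i)
      case 0
      have "t 0 \<le> t k" if "k \<le> n" for k using that
      proof (induction k)
        case (Suc k) then show ?case using inc[of k] by simp
      qed simp
      then show ?case by simp
    next
      case (Suc i)
      have "t (Suc i) \<le> t k" if "Suc i \<le> k" "k \<le> n" for k using that
      proof (induction k rule: dec_induct)
        case (step k) then show ?case using inc[of k] by simp
      qed simp
      then show ?case using Suc inc[of i] by fastforce
    qed
    then show "-L \<le> t i" "t i < L" using t0 tn by auto
  qed
  have indep: "indep_vars (\<lambda>_. borel) Y {..<n}"
    unfolding Y_def by (rule bridge_steps_indep[OF V]) (use t0 inc tn in auto)
  have Ym[measurable]: "i < n \<Longrightarrow> Y i \<in> borel_measurable P" for i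
    using indep by (auto simp: indep_vars_def)
  have expY: "(\<integral>\<^sup>+w. ennreal (exp ((1 - \<theta>) * (Y i w)\<^sup>2 / 2)) \<partial>P) = ennreal (1 / sqrt \<theta>)" if i: "i < n" for i
    unfolding Y_def using rng[of i] rng[of "Suc i"] inc[of i] i
    by (intro gaussian_rv_exp_square_moment prob_space_axioms bridge_step_gaussian[OF V] bridge_step_var[OF V] \<theta>(1)) auto
  have prodY: "(\<integral>\<^sup>+w. (\<Prod>i<n. ennreal (exp ((1 - \<theta>) * (Y i w)\<^sup>2 / 2))) \<partial>P) = ennreal ((1 / sqrt \<theta>) ^ n)"
  proof -
    have "indep_vars (\<lambda>_. borel) (\<lambda>i. (\<lambda>y. ennreal (exp ((1 - \<theta>) * y\<^sup>2 / 2))) \<circ> Y i) {..<n}"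
      by (intro indep_vars_compose[OF indep]) measurable
    then have "indep_vars (\<lambda>_. borel) (\<lambda>i w. ennreal (exp ((1 - \<theta>) * (Y i w)\<^sup>2 / 2))) {..<n}"
      by (simp add: o_def)
    then have "(\<integral>\<^sup>+w. (\<Prod>i<n. ennreal (exp ((1 - \<theta>) * (Y i w)\<^sup>2 / 2))) \<partial>P) = (\<Prod>i<n. ennreal (1 / sqrt \<theta>))"
      using expY by (subst indep_vars_nn_integral) auto
    also have "\<dots> = ennreal ((1 / sqrt \<theta>) ^ n)" using \<theta> by (simp add: ennreal_power)
    finally show ?thesis .
  qed
  define S where "S w = (\<Sum>k<n. F (V w (-L + \<sigma> + real k * h)))" for w
  have S: "S w \<ge> 0" for w unfolding S_def using F by (intro sum_nonneg) auto
  let ?C = "exp (- ((1 - \<theta>) * (A - 1 / L)) / \<epsilon>)"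
  have "(\<integral>\<^sup>+w. ennreal (exp (- (h / \<epsilon>) * S w)) * indicator B w \<partial>P) \<le>
     (\<integral>\<^sup>+w. ennreal ?C * (\<Prod>i<n. ennreal (exp ((1 - \<theta>) * (Y i w)\<^sup>2 / 2))) \<partial>P)"
  proof (rule nn_integral_mono_AE)
    show "AE w in P. ennreal (exp (- (h / \<epsilon>) * S w)) * indicator B w \<le>
       ennreal ?C * (\<Prod>i<n. ennreal (exp ((1 - \<theta>) * (Y i w)\<^sup>2 / 2)))"
      using scaled_bridge_ends[OF V]
    proof eventually_elim
      fix w assume w: "V w (-L) = -1 \<and> V w L = 1"
      show "ennreal (exp (- (h / \<epsilon>) * S w)) * indicator B w \<le>
         ennreal ?C * (\<Prod>i<n. ennreal (exp ((1 - \<theta>) * (Y i w)\<^sup>2 / 2)))"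
      proof (cases "w \<in> B")
        case True
        define K where "K = grid_kinetic (Suc n) t (\<lambda>i. V w (t i))"
        have sq: "\<epsilon> * (\<Sum>i<n. (Y i w)\<^sup>2) = 2 * K - 2 / L"
          unfolding Y_def K_def by (rule bridge_steps_square_sum) (use L t0 inc tn tN w in auto)
        have KA: "K + h * S w \<ge> A" using act[OF True] w by (simp add: K_def S_def t_def)
        have "(1 - \<theta>) * (h * S w) \<le> 1 * (h * S w)"
          using \<theta> hpos S[of w] by (intro mult_right_mono) auto
        moreover have "(1 - \<theta>) * A \<le> (1 - \<theta>) * (K + h * S w)" using KA \<theta> by (intro mult_left_mono) auto
        ultimately have "- (h * S w) \<le> - ((1 - \<theta>) * (A - 1 / L)) + (1 - \<theta>) * (K - 1 / L)"
          by (simp add: algebra_simps)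
        also have "K - 1 / L = \<epsilon> * (\<Sum>i<n. (Y i w)\<^sup>2) / 2" using sq by simp
        finally have "- (h * S w) / \<epsilon> \<le> (- ((1 - \<theta>) * (A - 1 / L)) + (1 - \<theta>) * (\<epsilon> * (\<Sum>i<n. (Y i w)\<^sup>2) / 2)) / \<epsilon>"
          using L by (intro divide_right_mono) auto
        also have "\<dots> = - ((1 - \<theta>) * (A - 1 / L)) / \<epsilon> + (\<Sum>i<n. (1 - \<theta>) * (Y i w)\<^sup>2 / 2)"
        proof -
          have "(- ((1 - \<theta>) * (A - 1 / L)) + (1 - \<theta>) * (\<epsilon> * T / 2)) / \<epsilon> =
              - ((1 - \<theta>) * (A - 1 / L)) / \<epsilon> + (1 - \<theta>) * T / 2" for T
            using L(2) by (simp add: add_divide_distrib diff_divide_distrib)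
          note e = this
          have "(1 - \<theta>) * (\<Sum>i<n. (Y i w)\<^sup>2) / 2 = (\<Sum>i<n. (1 - \<theta>) * (Y i w)\<^sup>2 / 2)"
            by (simp add: sum_distrib_left sum_divide_distrib)
          then show ?thesis unfolding e by simp
        qed
        finally have "exp (- (h / \<epsilon>) * S w) \<le> exp (- ((1 - \<theta>) * (A - 1 / L)) / \<epsilon> + (\<Sum>i<n. (1 - \<theta>) * (Y i w)\<^sup>2 / 2))"
          by simp
        also have "\<dots> = ?C * (\<Prod>i<n. exp ((1 - \<theta>) * (Y i w)\<^sup>2 / 2))"
          by (simp only: exp_add exp_sum finite_lessThan)
        finally show ?thesis using True
          by (simp add: prod_ennreal ennreal_leI prod_nonneg flip: ennreal_mult)
      qed simp
    qed
  qed
  also have "\<dots> = ennreal ?C * ennreal ((1 / sqrt \<theta>) ^ n)"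
    unfolding prodY[symmetric] by (intro nn_integral_cmult borel_measurable_prod_ennreal) auto
  also have "\<dots> = ennreal (?C * (1 / sqrt \<theta>) ^ n)" using \<theta> by (simp add: ennreal_mult)
  finally show ?thesis unfolding S_def .
qed

text \<open>On the event of large oscillations the weight is bounded by 1. Elsewhere a path far from
  all instantons has action at least \<open>A\<close> on every shifted grid: otherwise
  \<open>low\<close> would place its grid values within \<open>\<delta> / 4\<close> of an instanton,
  and the oscillations of path and instanton inside a cell, \<open>\<delta> / 8\<close> each, would
  still leave it within \<open>\<delta> / 2\<close>.\<close>

lemma low_weight_off_instanton:
  fixes V :: "'w \<Rightarrow> real \<Rightarrow> real"
  assumes F: "double_well F" and m: "instanton F m"
    and lip: "\<And>x y. \<bar>drift F x - drift F y\<bar> \<le> \<Lambda> * \<bar>x - y\<bar>"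
    and V: "scaled_bridge \<epsilon> L P V" and n: "n > 0" and h: "h = 2 * L / real n" and \<rho>: "\<rho> > 0"
    and x: "\<rho>\<^sup>2 / (32 * \<epsilon> * h) \<ge> 12" and \<theta>: "0 < \<theta>" "\<theta> < 1"
    and \<delta>: "3 * (\<rho> + h / L) \<le> \<delta> / 8" "2 * \<Lambda> * h \<le> \<delta> / 8"
    and low: "\<And>t u. grid_mesh h (Suc n) t \<Longrightarrow> u 0 = -1 \<Longrightarrow> u (Suc n) = 1 \<Longrightarrow>
        grid_kinetic (Suc n) t u + h * (\<Sum>i\<in>{1..<Suc n}. F (u i)) \<le> A \<Longrightarrow>
        \<exists>\<xi>. \<forall>i\<le>Suc n. \<bar>u i - m (t i - \<xi>)\<bar> \<le> \<delta> / 4"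
    and B: "B \<in> sets P" "\<And>w. w \<in> B \<Longrightarrow> \<not> near_instanton m L (\<delta> / 2) (V w)"
  shows "(\<integral>\<^sup>+w. ennreal (exp (- (1 / \<epsilon>) * integral {-L..L} (\<lambda>s. F (V w s)))) * indicator B w \<partial>P) \<le>
     ennreal (4 * real n * exp (- \<rho>\<^sup>2 / (32 * \<epsilon> * h)) + exp (- ((1 - \<theta>) * (A - 1 / L)) / \<epsilon>) * (1 / sqrt \<theta>) ^ n)"
proof -
  interpret prob_space P by (rule scaled_bridge_prob_space[OF V])
  interpret pair_sigma_finite P lborel ..
  have L: "L > 0" "\<epsilon> > 0" using V by (auto simp: scaled_bridge_def)
  have hpos: "h > 0" using L n by (simp add: h)
  have nh: "real n * h = 2 * L" using n by (simp add: h)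
  have \<Lambda>: "\<Lambda> \<ge> 0" using lip[of 0 1] abs_ge_zero[of "drift F 0 - drift F 1"] by simp
  have Vc: "continuous_on UNIV (V w)" if "w \<in> space P" for w using V that by (auto simp: scaled_bridge_def)
  have FV: "continuous_on UNIV (\<lambda>s. F (V w s))" if "w \<in> space P" for w
    by (rule continuous_on_compose2[OF double_well_continuous[OF F, of UNIV] Vc[OF that]]) auto
  obtain W where W: "W \<in> sets P" "measure P W \<le> 4 * real n * exp (- \<rho>\<^sup>2 / (32 * \<epsilon> * h))"
    "\<And>w s t. w \<in> space P - W \<Longrightarrow> -L \<le> s \<Longrightarrow> s \<le> t \<Longrightarrow> t \<le> L \<Longrightarrow> t - s \<le> h \<Longrightarrow> \<bar>V w t - V w s\<bar> \<le> 3 * (\<rho> + h / L)"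
    using bridge_modulus_event[OF V n h \<rho> x] by blast
  define S where "S w \<sigma> = (\<Sum>k<n. F (V w (-L + \<sigma> + real k * h)))" for w \<sigma>
  define M where "M = exp (- ((1 - \<theta>) * (A - 1 / L)) / \<epsilon>) * (1 / sqrt \<theta>) ^ n"
  let ?wt = "\<lambda>w. ennreal (exp (- (1 / \<epsilon>) * integral {-L..L} (\<lambda>s. F (V w s))))"
  let ?G = "\<lambda>w \<sigma>. ennreal (exp (- (h / \<epsilon>) * S w \<sigma>))"
  have BW: "B - W \<in> sets P" using B W by auto
  have wt1: "?wt w \<le> 1" if "w \<in> space P" for w
  proof -
    have "0 \<le> integral {-L..L} (\<lambda>s. F (V w s))"
      by (intro integral_nonneg integrable_continuous_real continuous_on_subset[OF FV[OF that]] double_well_nonneg[OF F]) auto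
    then show ?thesis using L by (simp add: ennreal_le_1)
  qed
  have wt2: "?wt w \<le> ennreal (1 / h) * (\<integral>\<^sup>+\<sigma>. ?G w \<sigma> * indicator {0..h} \<sigma> \<partial>lborel)" if w: "w \<in> space P" for w
  proof -
    have "integral {-L..L} (\<lambda>s. F (V w s)) = integral {0..h} (S w)"
      using integral_split_periods[OF FV[OF w] less_imp_le[OF hpos], of "-L" n] nh by (simp add: S_def[abs_def])
    moreover have "continuous_on UNIV (S w)"
      unfolding S_def by (intro continuous_intros continuous_on_compose2[OF FV[OF w]]) auto
    ultimately show ?thesis using exp_neg_integral_le_offset_average[of "S w" h "1 / \<epsilon>"] hpos by simp
  qed
  have meas: "(\<lambda>(w, \<sigma>). ?G w \<sigma>) \<in> borel_measurable (P \<Otimes>\<^sub>M lborel)"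
  proof -
    have [measurable]: "F \<in> borel_measurable borel"
      by (intro borel_measurable_continuous_onI double_well_continuous[OF F])
    have [measurable]: "(\<lambda>x. V (fst x) (-L + snd x + real k * h)) \<in> borel_measurable (P \<Otimes>\<^sub>M lborel)" for k
    proof -
      have "(\<lambda>x. (fst x, -L + snd x + real k * h)) \<in> measurable (P \<Otimes>\<^sub>M lborel) (P \<Otimes>\<^sub>M lborel)" by measurable
      from measurable_compose[OF this scaled_bridge_joint_measurable[OF V]] show ?thesis by simp
    qed
    show ?thesis unfolding S_def case_prod_beta' by measurable
  qed
  have inner: "(\<integral>\<^sup>+w. ?G w \<sigma> * indicator (B - W) w \<partial>P) \<le> ennreal M" if \<sigma>: "0 < \<sigma>" "\<sigma> < h" for \<sigma>
    unfolding S_def M_def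
  proof (rule offset_grid_tilted_bound[OF V n h \<sigma> \<theta> double_well_nonneg[OF F] BW])
    fix w assume w: "w \<in> B - W" and ends: "V w (-L) = -1" "V w L = 1"
    define t where "t = offset_grid L h n \<sigma>"
    have mesh: "grid_mesh h (Suc n) t" unfolding t_def by (rule offset_grid_mesh[OF n h \<sigma>])
    have t0: "t 0 = -L" and tN: "t (Suc n) = L" by (auto simp: t_def offset_grid_def)
    have sum: "(\<Sum>i\<in>{1..<Suc n}. F (V w (t i))) = S w \<sigma>"
      unfolding S_def One_nat_def sum.shift_bounds_Suc_ivl lessThan_atLeast0
      by (intro sum.cong) (auto simp: t_def offset_grid_def)
    show "A \<le> grid_kinetic (Suc n) (offset_grid L h n \<sigma>) (\<lambda>i. V w (offset_grid L h n \<sigma> i))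
          + h * (\<Sum>k<n. F (V w (-L + \<sigma> + real k * h)))"
    proof (rule ccontr)
      assume "\<not> ?thesis"
      then have "grid_kinetic (Suc n) t (\<lambda>i. V w (t i)) + h * (\<Sum>i\<in>{1..<Suc n}. F (V w (t i))) \<le> A"
        unfolding sum by (simp add: t_def S_def)
      from low[OF mesh _ _ this] obtain \<xi> where \<xi>: "\<And>i. i \<le> Suc n \<Longrightarrow> \<bar>V w (t i) - m (t i - \<xi>)\<bar> \<le> \<delta> / 4"
        using t0 tN ends by auto
      have "\<bar>V w s - m (s - \<xi>)\<bar> \<le> \<delta> / 2" if s: "s \<in> {-L..L}" for s
      proof -
        obtain i where i: "i < Suc n" "t i \<le> s" "s \<le> t (Suc i)"
          using grid_bracket[of t s "Suc n"] s t0 tN by auto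
        have d: "s - t i \<le> h" using mesh i by (fastforce simp: grid_mesh_def)
        have ge: "-L \<le> t i" using i(1) \<sigma> hpos n s nh by (auto simp: t_def offset_grid_def)
        have 1: "\<bar>V w s - V w (t i)\<bar> \<le> \<delta> / 8"
          using W(3)[of w "t i" s] w B(1) sets.sets_into_space[OF B(1)] s i d ge \<delta>(1) by force
        have "\<bar>m (s - \<xi>) - m (t i - \<xi>)\<bar> \<le> 2 * \<Lambda> * \<bar>(s - \<xi>) - (t i - \<xi>)\<bar>"
          by (rule drift_instanton_lipschitz[OF F m lip])
        also have "\<dots> \<le> 2 * \<Lambda> * h" using d i \<Lambda> by (intro mult_left_mono) auto
        finally have 2: "\<bar>m (s - \<xi>) - m (t i - \<xi>)\<bar> \<le> \<delta> / 8" using \<delta>(2) by linarith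
        have 3: "\<bar>V w (t i) - m (t i - \<xi>)\<bar> \<le> \<delta> / 4" using i by (intro \<xi>) auto
        show ?thesis using 1 2 3 by linarith
      qed
      then have "near_instanton m L (\<delta> / 2) (V w)"
        unfolding near_instanton_def by (intro exI[of _ \<xi>] ballI)
      then show False using B(2) w by auto
    qed
  qed
  have "(\<integral>\<^sup>+w. ?wt w * indicator B w \<partial>P) \<le>
     (\<integral>\<^sup>+w. indicator W w + (\<integral>\<^sup>+\<sigma>. ennreal (1 / h) * (?G w \<sigma> * indicator {0..h} \<sigma> * indicator (B - W) w) \<partial>lborel) \<partial>P)"
  proof (rule nn_integral_mono)
    fix w assume w: "w \<in> space P"
    have [measurable]: "(\<lambda>\<sigma>. ?G w \<sigma>) \<in> borel_measurable lborel"
      using measurable_compose[OF measurable_Pair1'[OF w] meas] by simp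
    have eq: "(\<integral>\<^sup>+\<sigma>. ennreal (1 / h) * (?G w \<sigma> * indicator {0..h} \<sigma> * indicator (B - W) w) \<partial>lborel) =
        ennreal (1 / h) * (\<integral>\<^sup>+\<sigma>. ?G w \<sigma> * indicator {0..h} \<sigma> \<partial>lborel) * indicator (B - W) w"
    proof -
      define g where "g \<sigma> = ?G w \<sigma> * indicator {0..h} \<sigma>" for \<sigma>
      have [measurable]: "g \<in> borel_measurable lborel" unfolding g_def by measurable
      have "(\<integral>\<^sup>+\<sigma>. ennreal (1 / h) * (g \<sigma> * indicator (B - W) w) \<partial>lborel) =
          ennreal (1 / h) * (\<integral>\<^sup>+\<sigma>. g \<sigma> * indicator (B - W) w \<partial>lborel)"
        by (rule nn_integral_cmult) measurable
      also have "(\<integral>\<^sup>+\<sigma>. g \<sigma> * indicator (B - W) w \<partial>lborel) = (\<integral>\<^sup>+\<sigma>. g \<sigma> \<partial>lborel) * indicator (B - W) w"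
        by (rule nn_integral_multc) measurable
      finally show ?thesis unfolding g_def by (simp only: mult.assoc)
    qed
    show "?wt w * indicator B w \<le> indicator W w + (\<integral>\<^sup>+\<sigma>. ennreal (1 / h) * (?G w \<sigma> * indicator {0..h} \<sigma> * indicator (B - W) w) \<partial>lborel)"
      unfolding eq using wt1[OF w] wt2[OF w]
      by (cases "w \<in> W"; cases "w \<in> B") (auto simp: add_increasing2)
  qed
  also have "\<dots> = emeasure P W + (\<integral>\<^sup>+w. (\<integral>\<^sup>+\<sigma>. ennreal (1 / h) * (?G w \<sigma> * indicator {0..h} \<sigma> * indicator (B - W) w) \<partial>lborel) \<partial>P)"
  proof (subst nn_integral_add)
    show "(\<lambda>w. \<integral>\<^sup>+\<sigma>. ennreal (1 / h) * (?G w \<sigma> * indicator {0..h} \<sigma> * indicator (B - W) w) \<partial>lborel) \<in> borel_measurable P"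
      using meas BW by (intro lborel.borel_measurable_nn_integral) (simp add: case_prod_beta')
  qed (use W in auto)
  also have "(\<integral>\<^sup>+w. (\<integral>\<^sup>+\<sigma>. ennreal (1 / h) * (?G w \<sigma> * indicator {0..h} \<sigma> * indicator (B - W) w) \<partial>lborel) \<partial>P) =
     (\<integral>\<^sup>+\<sigma>. (\<integral>\<^sup>+w. ennreal (1 / h) * (?G w \<sigma> * indicator {0..h} \<sigma> * indicator (B - W) w) \<partial>P) \<partial>lborel)"
    using meas BW by (intro Fubini'[symmetric]) (simp add: case_prod_beta')
  also have "\<dots> \<le> (\<integral>\<^sup>+\<sigma>. ennreal (1 / h * M) * indicator {0..h} \<sigma> \<partial>lborel)"
  proof (rule nn_integral_mono_AE)
    \<comment> \<open>The offsets 0 and \<open>h\<close> would create an empty cell; they form a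
      null set.\<close>
    have "AE \<sigma> in lborel. \<sigma> \<noteq> 0" "AE \<sigma> in lborel. \<sigma> \<noteq> h" by (rule AE_lborel_singleton)+
    then show "AE \<sigma> in lborel. (\<integral>\<^sup>+w. ennreal (1 / h) * (?G w \<sigma> * indicator {0..h} \<sigma> * indicator (B - W) w) \<partial>P)
        \<le> ennreal (1 / h * M) * indicator {0..h} \<sigma>"
    proof eventually_elim
      fix \<sigma> assume "\<sigma> \<noteq> 0" "\<sigma> \<noteq> h"
      show "(\<integral>\<^sup>+w. ennreal (1 / h) * (?G w \<sigma> * indicator {0..h} \<sigma> * indicator (B - W) w) \<partial>P)
        \<le> ennreal (1 / h * M) * indicator {0..h} \<sigma>"
      proof (cases "\<sigma> \<in> {0..h}")
        case True
        then have \<sigma>: "0 < \<sigma>" "\<sigma> < h" using \<open>\<sigma> \<noteq> 0\<close> \<open>\<sigma> \<noteq> h\<close> by auto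
        have gm: "(\<lambda>w. ?G w \<sigma>) \<in> borel_measurable P"
          using measurable_compose[OF measurable_Pair2'[of \<sigma> lborel P] meas] by simp
        have "(\<integral>\<^sup>+w. ennreal (1 / h) * (?G w \<sigma> * indicator {0..h} \<sigma> * indicator (B - W) w) \<partial>P) =
          ennreal (1 / h) * (\<integral>\<^sup>+w. ?G w \<sigma> * indicator (B - W) w \<partial>P)"
        proof -
          have "(\<integral>\<^sup>+w. ennreal (1 / h) * (?G w \<sigma> * indicator (B - W) w) \<partial>P) =
            ennreal (1 / h) * (\<integral>\<^sup>+w. ?G w \<sigma> * indicator (B - W) w \<partial>P)"
            by (intro nn_integral_cmult borel_measurable_times_ennreal borel_measurable_indicator gm BW)
          then show ?thesis using True by simp
        qed
        also have "\<dots> \<le> ennreal (1 / h) * ennreal M" by (intro mult_left_mono inner \<sigma>) auto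
        also have "\<dots> = ennreal (1 / h * M)" using hpos by (intro ennreal_mult[symmetric]) (auto simp: M_def \<theta> less_imp_le)
        finally show ?thesis using True by simp
      qed simp
    qed
  qed
  also have "\<dots> = ennreal M"
  proof -
    have "ennreal (1 / h * M) * ennreal h = ennreal (1 / h * M * h)"
      using hpos by (intro ennreal_mult[symmetric]) (auto simp: M_def \<theta> less_imp_le)
    then show ?thesis using hpos by (simp add: nn_integral_cmult)
  qed
  finally have "(\<integral>\<^sup>+w. ?wt w * indicator B w \<partial>P) \<le> ennreal (measure P W) + ennreal M"
    by (simp add: emeasure_eq_measure add_left_mono)
  also have "\<dots> \<le> ennreal (4 * real n * exp (- \<rho>\<^sup>2 / (32 * \<epsilon> * h))) + ennreal M"
    using W(2) by (intro add_right_mono ennreal_leI)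
  also have "\<dots> = ennreal (4 * real n * exp (- \<rho>\<^sup>2 / (32 * \<epsilon> * h)) + M)"
    by (intro ennreal_plus[symmetric]) (auto simp: M_def \<theta> less_imp_le)
  finally show ?thesis unfolding M_def .
qed

text \<open>The upper bound \<open>h1\<close> for the mesh depends on \<open>F\<close>,
  \<open>m\<close> and \<open>\<delta>\<close> but not on \<open>\<epsilon>\<close>, so
  \<open>n\<close> is of order \<open>L\<close> and the factor
  \<open>(1 / sqrt \<theta>) ^ n\<close> costs a multiple of \<open>\<epsilon> * L\<close> in the
  exponent. A small mesh also makes oscillations inside the cells more expensive than the action
  \<open>A\<close>.\<close>

lemma weight_off_instanton_eventually:
  fixes V :: "real \<Rightarrow> 'w \<Rightarrow> real \<Rightarrow> real"
  assumes F: "double_well F" and m: "instanton F m"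
    and L: "filterlim L at_top (at_right 0)" "((\<lambda>\<epsilon>. \<epsilon> * L \<epsilon>) \<longlongrightarrow> 0) (at_right 0)"
    and V: "\<And>\<epsilon>. \<epsilon> > 0 \<Longrightarrow> scaled_bridge \<epsilon> (L \<epsilon>) (P \<epsilon>) (V \<epsilon>)"
  obtains c \<delta>0 where "c > 0" "\<delta>0 > 0" "\<And>\<delta> \<kappa>. 0 < \<delta> \<Longrightarrow> \<delta> \<le> \<delta>0 \<Longrightarrow> \<kappa> > 0 \<Longrightarrow>
    \<forall>\<^sub>F \<epsilon> in at_right 0. \<forall>B\<in>sets (P \<epsilon>). (\<forall>w\<in>B. \<not> near_instanton m (L \<epsilon>) (\<delta> / 2) (V \<epsilon> w)) \<longrightarrow>
      (\<integral>\<^sup>+w. ennreal (exp (- (1 / \<epsilon>) * integral {-L \<epsilon>..L \<epsilon>} (\<lambda>s. F (V \<epsilon> w s)))) * indicator B w \<partial>P \<epsilon>)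
        \<le> ennreal (exp (- (wall_cost F + c * \<delta>\<^sup>2 - \<kappa>) / \<epsilon>))"
proof -
  obtain \<Lambda> where \<Lambda>: "\<Lambda> > 0" "\<And>x y. \<bar>drift F x - drift F y\<bar> \<le> \<Lambda> * \<bar>x - y\<bar>"
    using drift_lipschitz[OF F] by blast
  obtain c \<delta>0 where c: "c > 0" "\<delta>0 > 0" and low: "\<And>\<delta>. 0 < \<delta> \<Longrightarrow> \<delta> \<le> \<delta>0 \<Longrightarrow> \<exists>h0>0. \<forall>h N t u.
      0 < h \<and> h \<le> h0 \<and> 0 < N \<and> grid_mesh h N t \<and> u 0 = -1 \<and> u N = 1 \<and>
      grid_kinetic N t u + h * (\<Sum>i\<in>{1..<N}. F (u i)) \<le> wall_cost F + c * \<delta>\<^sup>2 \<longrightarrow>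
      (\<exists>\<xi>. \<forall>i\<le>N. \<bar>u i - m (t i - \<xi>)\<bar> \<le> \<delta> / 4)"
    using low_action_near_instanton[OF F m] by blast
  show thesis
  proof (rule that[OF c])
    fix \<delta> \<kappa> :: real assume \<delta>: "0 < \<delta>" "\<delta> \<le> \<delta>0" and \<kappa>: "\<kappa> > 0"
    define A where "A = wall_cost F + c * \<delta>\<^sup>2"
    have A: "A \<ge> 0" using wall_cost_nonneg[OF F] c by (simp add: A_def)
    obtain h0 where h0: "h0 > 0" and low': "\<And>h N t u.
      0 < h \<and> h \<le> h0 \<and> 0 < N \<and> grid_mesh h N t \<and> u 0 = -1 \<and> u N = 1 \<and>
      grid_kinetic N t u + h * (\<Sum>i\<in>{1..<N}. F (u i)) \<le> A \<Longrightarrow>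
      (\<exists>\<xi>. \<forall>i\<le>N. \<bar>u i - m (t i - \<xi>)\<bar> \<le> \<delta> / 4)"
      using low[OF \<delta>] unfolding A_def by blast
    \<comment> \<open>With \<open>h / L \<le> \<rho>\<close> the modulus bound
      \<open>3 * (\<rho> + h / L)\<close> is at most
      \<open>6 * \<rho> = \<delta> / 8\<close>.\<close>
    define \<rho> where "\<rho> = \<delta> / 48"
    have \<rho>: "\<rho> > 0" using \<delta> by (simp add: \<rho>_def)
    \<comment> \<open>In this order: shadowing; the modulus bound; a movement of the instanton by at
      most \<open>\<delta> / 8\<close> in a cell; a chaining exponent of at least
      \<open>(A + 1) / \<epsilon>\<close>.\<close>
    define h1 where "h1 = Min {h0, \<rho>, \<delta> / (16 * \<Lambda>), \<rho>\<^sup>2 / (32 * (A + 1))}"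
    have h1: "h1 > 0" "h1 \<le> h0" "h1 \<le> \<rho>" "h1 \<le> \<delta> / (16 * \<Lambda>)" "h1 \<le> \<rho>\<^sup>2 / (32 * (A + 1))"
      using h0 \<rho> \<delta> \<Lambda> A by (auto simp: h1_def)
    \<comment> \<open>The allowance \<open>\<kappa>\<close> is shared by four losses of at most
      \<open>\<kappa> / 4\<close>: the part \<open>\<theta> * A\<close> of the action, the boundary
      term \<open>1 / L\<close>, the cost \<open>\<epsilon> * n * H\<close> of the moments, and
      \<open>\<epsilon>\<close> for a factor 2.\<close>
    define \<theta> where "\<theta> = min (1/2) (\<kappa> / (4 * (A + 1)))"
    have \<theta>: "0 < \<theta>" "\<theta> < 1" "\<theta> * A \<le> \<kappa> / 4"
    proof -
      show "0 < \<theta>" "\<theta> < 1" using \<kappa> A by (auto simp: \<theta>_def)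
      have "\<theta> * A \<le> \<kappa> / (4 * (A + 1)) * (A + 1)" using A \<kappa> by (intro mult_mono) (auto simp: \<theta>_def)
      also have "\<kappa> / (4 * (A + 1)) * (A + 1) = \<kappa> / 4" using A by (simp add: field_simps)
      finally show "\<theta> * A \<le> \<kappa> / 4" .
    qed
    define H where "H = ln (1 / sqrt \<theta>)"
    have H: "H \<ge> 0" using \<theta> by (simp add: H_def real_sqrt_le_1_iff ln_div)
    have ev1: "\<forall>\<^sub>F \<epsilon> in at_right 0. L \<epsilon> \<ge> max 1 (max h1 (4 / \<kappa>))"
      using L(1) unfolding filterlim_at_top by blast
    have ev2: "\<forall>\<^sub>F \<epsilon> in at_right 0. \<epsilon> * L \<epsilon> < min (h1 / 32) (\<kappa> * h1 / (16 * (H + 1)))"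
      using \<kappa> h1 H by (intro order_tendstoD(2)[OF L(2)]) auto
    have ev3: "\<forall>\<^sub>F \<epsilon> in at_right (0::real). 0 < \<epsilon> \<and> \<epsilon> < min (1 / 12) (\<kappa> / 4)"
      using \<kappa> by (intro eventually_conj eventually_at_right_less eventually_at_rightI[of 0 "min (1 / 12) (\<kappa> / 4)"]) auto
    show "\<forall>\<^sub>F \<epsilon> in at_right 0. \<forall>B\<in>sets (P \<epsilon>). (\<forall>w\<in>B. \<not> near_instanton m (L \<epsilon>) (\<delta> / 2) (V \<epsilon> w)) \<longrightarrow>
      (\<integral>\<^sup>+w. ennreal (exp (- (1 / \<epsilon>) * integral {-L \<epsilon>..L \<epsilon>} (\<lambda>s. F (V \<epsilon> w s)))) * indicator B w \<partial>P \<epsilon>)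
        \<le> ennreal (exp (- (wall_cost F + c * \<delta>\<^sup>2 - \<kappa>) / \<epsilon>))"
      using ev1 ev2 ev3
    proof eventually_elim
      fix \<epsilon> assume e1: "L \<epsilon> \<ge> max 1 (max h1 (4 / \<kappa>))" and e2: "\<epsilon> * L \<epsilon> < min (h1 / 32) (\<kappa> * h1 / (16 * (H + 1)))"
        and e3: "0 < \<epsilon> \<and> \<epsilon> < min (1 / 12) (\<kappa> / 4)"
      have \<epsilon>: "0 < \<epsilon>" "\<epsilon> < 1 / 12" "\<epsilon> < \<kappa> / 4" using e3 by auto
      have Lp: "L \<epsilon> \<ge> 1" "L \<epsilon> \<ge> h1" "L \<epsilon> \<ge> 4 / \<kappa>" using e1 by auto
      \<comment> \<open>Rounding up makes \<open>h\<close> at most \<open>h1\<close>, while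
        \<open>n\<close> stays below \<open>4 * L \<epsilon> / h1\<close>.\<close>
      define n where "n = nat \<lceil>2 * L \<epsilon> / h1\<rceil>"
      define h where "h = 2 * L \<epsilon> / real n"
      have q: "2 * L \<epsilon> / h1 \<ge> 1" using Lp h1 by (simp add: le_divide_eq)
      have nr: "2 * L \<epsilon> / h1 \<le> real n" "real n \<le> 2 * L \<epsilon> / h1 + 1"
        using q unfolding n_def by linarith+
      have n: "n > 0" using nr q by (cases n) auto
      have n4: "real n \<le> 4 * L \<epsilon> / h1" using nr q by linarith
      have h: "h > 0" "h \<le> h1"
        using nr(1) n Lp h1(1) by (auto simp: h_def field_simps)
      have expo: "\<rho>\<^sup>2 / (32 * \<epsilon> * h) \<ge> (A + 1) / \<epsilon>"
      proof -
        have "h * (32 * (A + 1)) \<le> h1 * (32 * (A + 1))" using h A by (intro mult_right_mono) auto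
        also have "\<dots> \<le> \<rho>\<^sup>2" using h1(5) A by (simp add: le_divide_eq)
        finally have "A + 1 \<le> \<rho>\<^sup>2 / (32 * h)" using h by (simp add: le_divide_eq mult_ac)
        then have "(A + 1) / \<epsilon> \<le> \<rho>\<^sup>2 / (32 * h) / \<epsilon>" using \<epsilon> by (intro divide_right_mono) auto
        then show ?thesis by (simp add: mult_ac)
      qed
      have one: "1 / \<epsilon> \<ge> 12" using \<epsilon> by (simp add: le_divide_eq)
      have A1: "(A + 1) / \<epsilon> \<ge> 1 / \<epsilon>" using A \<epsilon> by (intro divide_right_mono) auto
      have n\<epsilon>: "\<epsilon> * real n \<le> 4 * (\<epsilon> * L \<epsilon>) / h1"
        using mult_left_mono[OF n4, of \<epsilon>] \<epsilon> by (simp add: mult_ac)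
      have n8: "8 * real n \<le> exp (1 / \<epsilon>)"
      proof -
        have "4 * (\<epsilon> * L \<epsilon>) / h1 \<le> 4 * (h1 / 32) / h1" using e2 h1 by (intro divide_right_mono) auto
        also have "4 * (h1 / 32) / h1 = 1 / 8" using h1(1) by simp
        finally have "\<epsilon> * real n \<le> 1 / 8" using n\<epsilon> by linarith
        then have "8 * real n \<le> 1 / \<epsilon>" using \<epsilon> by (simp add: field_simps)
        also have "\<dots> \<le> exp (1 / \<epsilon>)" using exp_ge_add_one_self[of "1 / \<epsilon>"] by linarith
        finally show ?thesis .
      qed
      have nH: "\<epsilon> * (real n * H) \<le> \<kappa> / 4"
      proof -
        have "\<epsilon> * real n * H \<le> (4 * (\<kappa> * h1 / (16 * (H + 1))) / h1) * (H + 1)"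
        proof (intro mult_mono)
          have "4 * (\<epsilon> * L \<epsilon>) / h1 \<le> 4 * (\<kappa> * h1 / (16 * (H + 1))) / h1"
            using e2 h1 by (intro divide_right_mono) auto
          then show "\<epsilon> * real n \<le> 4 * (\<kappa> * h1 / (16 * (H + 1))) / h1" using n\<epsilon> by linarith
        qed (use H \<kappa> h1 in auto)
        also have "\<dots> = \<kappa> / 4"
        proof -
          have "(4 * (\<kappa> * h1 / (16 * g)) / h1) * g = \<kappa> / 4" if "g > 0" for g
            using that h1(1) by simp
          from this[of "H + 1"] show ?thesis using H by linarith
        qed
        finally show ?thesis by (simp add: mult.assoc)
      qed
      have V\<epsilon>: "scaled_bridge \<epsilon> (L \<epsilon>) (P \<epsilon>) (V \<epsilon>)" using V \<epsilon> by auto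
      show "\<forall>B\<in>sets (P \<epsilon>). (\<forall>w\<in>B. \<not> near_instanton m (L \<epsilon>) (\<delta> / 2) (V \<epsilon> w)) \<longrightarrow>
        (\<integral>\<^sup>+w. ennreal (exp (- (1 / \<epsilon>) * integral {-L \<epsilon>..L \<epsilon>} (\<lambda>s. F (V \<epsilon> w s)))) * indicator B w \<partial>P \<epsilon>)
        \<le> ennreal (exp (- (wall_cost F + c * \<delta>\<^sup>2 - \<kappa>) / \<epsilon>))"
      proof (intro ballI impI)
        fix B assume B: "B \<in> sets (P \<epsilon>)" "\<forall>w\<in>B. \<not> near_instanton m (L \<epsilon>) (\<delta> / 2) (V \<epsilon> w)"
        have "(\<integral>\<^sup>+w. ennreal (exp (- (1 / \<epsilon>) * integral {-L \<epsilon>..L \<epsilon>} (\<lambda>s. F (V \<epsilon> w s)))) * indicator B w \<partial>P \<epsilon>) \<le>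
          ennreal (4 * real n * exp (- \<rho>\<^sup>2 / (32 * \<epsilon> * h)) + exp (- ((1 - \<theta>) * (A - 1 / L \<epsilon>)) / \<epsilon>) * (1 / sqrt \<theta>) ^ n)"
        proof (rule low_weight_off_instanton[OF F m \<Lambda>(2) V\<epsilon> n h_def \<rho> _ \<theta>(1,2) _ _ _ B(1)])
          show "12 \<le> \<rho>\<^sup>2 / (32 * \<epsilon> * h)" using expo A1 one by linarith
          have "h / L \<epsilon> \<le> h / 1" using Lp h by (intro divide_left_mono) auto
          then show "3 * (\<rho> + h / L \<epsilon>) \<le> \<delta> / 8" using h h1(3) by (simp add: \<rho>_def)
          have "h * (16 * \<Lambda>) \<le> h1 * (16 * \<Lambda>)" using h \<Lambda>(1) by (intro mult_right_mono) auto
          also have "\<dots> \<le> \<delta>" using h1(4) \<Lambda>(1) by (simp add: le_divide_eq)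
          finally have "h * (16 * \<Lambda>) \<le> \<delta>" .
          then show "2 * \<Lambda> * h \<le> \<delta> / 8" by (simp add: mult_ac)
          show "\<exists>\<xi>. \<forall>i\<le>Suc n. \<bar>u i - m (t i - \<xi>)\<bar> \<le> \<delta> / 4"
            if "grid_mesh h (Suc n) t" "u 0 = -1" "u (Suc n) = 1"
              "grid_kinetic (Suc n) t u + h * (\<Sum>i\<in>{1..<Suc n}. F (u i)) \<le> A" for t u
            using low'[of h "Suc n" t u] that h h1(2) by auto
        qed (use B(2) in auto)
        also have "\<dots> \<le> ennreal (exp (- (A - \<kappa>) / \<epsilon>))"
        proof (intro ennreal_leI)
          have "4 * real n * exp (- \<rho>\<^sup>2 / (32 * \<epsilon> * h)) \<le> (exp (1 / \<epsilon>) / 2) * exp (- ((A + 1) / \<epsilon>))"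
            using n8 expo by (intro mult_mono) auto
          also have "\<dots> = exp (- A / \<epsilon>) / 2"
            by (simp add: add_divide_distrib flip: exp_add)
          also have "\<dots> \<le> exp (- (A - \<kappa>) / \<epsilon>) / 2"
          proof -
            have "- A / \<epsilon> \<le> - (A - \<kappa>) / \<epsilon>" using \<kappa> \<epsilon> by (intro divide_right_mono) auto
            then show ?thesis unfolding exp_le_cancel_iff[symmetric, of "- A / \<epsilon>"] by simp
          qed
          finally have 1: "4 * real n * exp (- \<rho>\<^sup>2 / (32 * \<epsilon> * h)) \<le> exp (- (A - \<kappa>) / \<epsilon>) / 2" .
          have pw: "(1 / sqrt \<theta>) ^ n = exp (real n * H)"
            using \<theta> by (simp add: H_def exp_of_nat_mult)
          have "- ((1 - \<theta>) * (A - 1 / L \<epsilon>)) / \<epsilon> + real n * H + 1 \<le> - (A - \<kappa>) / \<epsilon>"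
          proof -
            have i: "(1 - \<theta>) * (1 / L \<epsilon>) \<le> \<kappa> / 4"
            proof -
              have "(1 - \<theta>) * (1 / L \<epsilon>) \<le> 1 * (1 / L \<epsilon>)" using \<theta> Lp by (intro mult_right_mono) auto
              also have "1 / L \<epsilon> \<le> \<kappa> / 4" using Lp \<kappa> by (simp add: field_simps)
              finally show ?thesis by simp
            qed
            have "- ((1 - \<theta>) * (A - 1 / L \<epsilon>)) + \<epsilon> * (real n * H) + \<epsilon> \<le> - (A - \<kappa>)"
            proof -
              have "(1 - \<theta>) * (A - 1 / L \<epsilon>) = A - \<theta> * A - (1 - \<theta>) * (1 / L \<epsilon>)"
                by (simp only: right_diff_distrib left_diff_distrib mult_1)
              then show ?thesis using i \<theta>(3) nH \<epsilon>(3) by linarith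
            qed
            then have "(- ((1 - \<theta>) * (A - 1 / L \<epsilon>)) + \<epsilon> * (real n * H) + \<epsilon>) / \<epsilon> \<le> - (A - \<kappa>) / \<epsilon>"
              using \<epsilon> by (intro divide_right_mono) auto
            then show ?thesis using \<epsilon>(1) unfolding add_divide_distrib by simp
          qed
          then have "exp (- ((1 - \<theta>) * (A - 1 / L \<epsilon>)) / \<epsilon> + real n * H) * exp 1 \<le> exp (- (A - \<kappa>) / \<epsilon>)"
            by (simp flip: exp_add)
          moreover have "exp (- ((1 - \<theta>) * (A - 1 / L \<epsilon>)) / \<epsilon> + real n * H) * 2 \<le>
              exp (- ((1 - \<theta>) * (A - 1 / L \<epsilon>)) / \<epsilon> + real n * H) * exp 1"
            using exp_ge_add_one_self[of 1] by (intro mult_left_mono) auto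
          ultimately have 2: "exp (- ((1 - \<theta>) * (A - 1 / L \<epsilon>)) / \<epsilon>) * (1 / sqrt \<theta>) ^ n \<le> exp (- (A - \<kappa>) / \<epsilon>) / 2"
            unfolding pw exp_add[symmetric] by linarith
          show "4 * real n * exp (- \<rho>\<^sup>2 / (32 * \<epsilon> * h)) + exp (- ((1 - \<theta>) * (A - 1 / L \<epsilon>)) / \<epsilon>) * (1 / sqrt \<theta>) ^ n
             \<le> exp (- (A - \<kappa>) / \<epsilon>)"
            using 1 2 by linarith
        qed
        finally show "(\<integral>\<^sup>+w. ennreal (exp (- (1 / \<epsilon>) * integral {-L \<epsilon>..L \<epsilon>} (\<lambda>s. F (V \<epsilon> w s)))) * indicator B w \<partial>P \<epsilon>)
          \<le> ennreal (exp (- (wall_cost F + c * \<delta>\<^sup>2 - \<kappa>) / \<epsilon>))" by (simp add: A_def)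
      qed
    qed
  qed
qed

section \<open>Lower bound for the partition function\<close>

definition unif_grid :: "real \<Rightarrow> real \<Rightarrow> nat \<Rightarrow> real" where
  "unif_grid L h i = -L + h * real i"

text \<open>The instanton misses the boundary values of the bridge by an amount that vanishes as
  \<open>L\<close> grows. Correcting it at the two ends only affects the outermost grid
  cells.\<close>

definition pinned :: "(real \<Rightarrow> real) \<Rightarrow> real \<Rightarrow> real \<Rightarrow> real" where
  "pinned m L s = (if s \<le> -L then -1 else if s \<ge> L then 1 else m s)"

lemma unif_grid_Suc: "unif_grid L h (Suc i) = unif_grid L h i + h"
  by (simp add: unif_grid_def algebra_simps)

lemma unif_grid_range:
  assumes "h > 0" "real N * h = 2 * L" "i \<le> N"
  shows "-L \<le> unif_grid L h i" "unif_grid L h i \<le> L"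
proof -
  have "h * real i \<le> h * real N" using assms by (intro mult_left_mono) auto
  also have "\<dots> = 2 * L" using assms(2) by (simp add: mult.commute)
  finally show "-L \<le> unif_grid L h i" "unif_grid L h i \<le> L"
    using assms by (auto simp: unif_grid_def mult.commute)
qed

lemma unif_grid_last: "real N * h = 2 * L \<Longrightarrow> unif_grid L h N = L"
  by (simp add: unif_grid_def mult.commute)

lemma unif_grid_mono: "h > 0 \<Longrightarrow> unif_grid L h i \<le> unif_grid L h j \<longleftrightarrow> i \<le> j"
  by (simp add: unif_grid_def)

lemma drift_potential_instanton_le:
  assumes F: "double_well F" and m: "instanton F m"
    and \<Phi>: "\<And>x. (\<Phi> has_real_derivative drift F x) (at x)" "\<Phi> 1 - \<Phi> (-1) = wall_cost F"
  shows "\<Phi> (m y) - \<Phi> (m x) \<le> wall_cost F"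
proof -
  have mono: "\<Phi> a \<le> \<Phi> b" if "-1 \<le> a" "a \<le> b" "b \<le> 1" for a b
  proof (rule DERIV_nonneg_imp_nondecreasing[OF that(2)])
    fix z assume "a \<le> z" "z \<le> b"
    then show "\<exists>D. (\<Phi> has_real_derivative D) (at z) \<and> 0 \<le> D"
      using \<Phi>(1)[of z] that double_well_nonneg[OF F, of z] by (intro exI[of _ "drift F z"]) (auto simp: drift_eq_sqrt)
  qed
  show ?thesis using mono[of "m y" 1] mono[of "-1" "m x"] instanton_bounds[OF F m] \<Phi>(2) by fastforce
qed

text \<open>Equipartition: along the instanton \<open>F (m s)\<close> is half the derivative of
  \<open>\<Phi> (m s)\<close>, so the potential energy amounts to at most half of the wall
  cost.\<close>

lemma instanton_potential_energy:
  assumes F: "double_well F" and m: "instanton F m" and L: "L \<ge> 0"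
  shows "integral {-L..L} (\<lambda>s. F (m s)) \<le> wall_cost F / 2"
proof -
  obtain \<Phi> where \<Phi>: "\<And>x. (\<Phi> has_real_derivative drift F x) (at x)" "\<Phi> 1 - \<Phi> (-1) = wall_cost F"
    using drift_potential[OF F] by blast
  have "((\<lambda>s. \<Phi> (m s) / 2) has_vector_derivative F (m s)) (at s within {-L..L})" for s
  proof -
    have "((\<lambda>s. \<Phi> (m s)) has_real_derivative drift F (m s) * drift F (m s)) (at s)"
      by (rule DERIV_chain2[OF \<Phi>(1) instanton_ode[OF F m]])
    then have "((\<lambda>s. \<Phi> (m s) / 2) has_real_derivative drift F (m s) * drift F (m s) / 2) (at s)"
      by (rule DERIV_cdivide)
    moreover have "drift F (m s) * drift F (m s) / 2 = F (m s)"
      using drift_square_eq[OF F, of "m s"] instanton_bounds[OF F m, of s] by (simp add: power2_eq_square)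
    ultimately show ?thesis
      by (simp add: has_real_derivative_iff_has_vector_derivative has_vector_derivative_at_within)
  qed
  then have "((\<lambda>s. F (m s)) has_integral (\<Phi> (m L) / 2 - \<Phi> (m (-L)) / 2)) {-L..L}"
    using L by (intro fundamental_theorem_of_calculus) auto
  then have "integral {-L..L} (\<lambda>s. F (m s)) = \<Phi> (m L) / 2 - \<Phi> (m (-L)) / 2" by (rule integral_unique)
  then show ?thesis using drift_potential_instanton_le[OF F m \<Phi>, of L "-L"] by simp
qed

text \<open>The kinetic half of the equipartition. In each cell the discretisation error is
  \<open>\<Lambda>^2 * h\<close> times the increment of the instanton, and the increments telescope
  to at most 2, whatever the number of cells.\<close>

lemma instanton_grid_kinetic:
  assumes F: "double_well F" and m: "instanton F m" and lip: "\<And>x y. \<bar>drift F x - drift F y\<bar> \<le> \<Lambda> * \<bar>x - y\<bar>"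
    and h: "h > 0"
  shows "grid_kinetic N (unif_grid L h) (\<lambda>i. m (unif_grid L h i)) \<le> wall_cost F / 2 + 2 * \<Lambda>\<^sup>2 * h"
proof -
  let ?t = "unif_grid L h"
  obtain \<Phi> where \<Phi>: "\<And>x. (\<Phi> has_real_derivative drift F x) (at x)" "\<Phi> 1 - \<Phi> (-1) = wall_cost F"
    using drift_potential[OF F] by blast
  have \<Lambda>: "\<Lambda> \<ge> 0" using lip[of 0 1] abs_ge_zero[of "drift F 0 - drift F 1"] by simp
  have "(m (?t (Suc i)) - m (?t i))\<^sup>2 / (2 * (?t (Suc i) - ?t i)) \<le>
     (\<Phi> (m (?t (Suc i))) - \<Phi> (m (?t i))) / 2 + \<Lambda>\<^sup>2 * h * (m (?t (Suc i)) - m (?t i))" for i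
  proof -
    define x y where "x = ?t i" and "y = ?t (Suc i)"
    have xy: "y = x + h" by (simp add: x_def y_def unif_grid_Suc)
    have "x < y" using h xy by simp
    then obtain c where c: "x < c" "c < y" "m y - m x = (y - x) * drift F (m c)"
      using MVT2[of x y m "\<lambda>s. drift F (m s)"] instanton_ode[OF F m] by blast
    have mono: "m x \<le> m c" "m c \<le> m y" using c monoD[OF instanton_mono[OF F m]] by auto
    define d where "d = m y - m x"
    have d: "d \<ge> 0" "d \<le> 2 * \<Lambda> * h"
      using mono drift_instanton_lipschitz[OF F m lip, of y x] xy h by (auto simp: d_def)
    have "drift F (m c) * d \<le> \<Phi> (m y) - \<Phi> (m x) + \<Lambda> * d\<^sup>2"
    proof (cases "m x < m y")
      case True
      then obtain z where z: "m x < z" "z < m y" "\<Phi> (m y) - \<Phi> (m x) = (m y - m x) * drift F z"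
        using MVT2[of "m x" "m y" \<Phi> "drift F"] \<Phi>(1) by blast
      have "\<bar>drift F (m c) - drift F z\<bar> \<le> \<Lambda> * \<bar>m c - z\<bar>" by (rule lip)
      also have "\<dots> \<le> \<Lambda> * d" using z mono \<Lambda> by (intro mult_left_mono) (auto simp: d_def)
      finally have "(drift F (m c) - drift F z) * d \<le> (\<Lambda> * d) * d" using d by (intro mult_right_mono) auto
      then show ?thesis using z(3) by (simp add: d_def algebra_simps power2_eq_square)
    next
      case False
      then have "d = 0" "m y = m x" using mono by (auto simp: d_def)
      then show ?thesis by simp
    qed
    moreover have "\<Lambda> * d\<^sup>2 \<le> \<Lambda> * (2 * \<Lambda> * h * d)"
      using d \<Lambda> by (intro mult_left_mono) (auto simp: power2_eq_square intro: mult_right_mono)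
    moreover have "d\<^sup>2 / (2 * h) = drift F (m c) * d / 2"
      using c(3) xy h by (simp add: d_def power2_eq_square)
    moreover have "\<Lambda> * (2 * \<Lambda> * h * d) = 2 * (\<Lambda>\<^sup>2 * h * d)" by (simp add: power2_eq_square)
    ultimately have "d\<^sup>2 / (2 * h) \<le> (\<Phi> (m y) - \<Phi> (m x)) / 2 + \<Lambda>\<^sup>2 * h * d"
    proof -
      have "k \<le> b / 2 + z" if "a \<le> b + c" "c \<le> e" "k = a / 2" "e = 2 * z" for a b c e k z :: real
        using that by linarith
      then show ?thesis using \<open>drift F (m c) * d \<le> _\<close> \<open>\<Lambda> * d\<^sup>2 \<le> _\<close> \<open>d\<^sup>2 / (2 * h) = _\<close> \<open>\<Lambda> * (2 * \<Lambda> * h * d) = _\<close> by blast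
    qed
    then show ?thesis using xy by (simp add: d_def x_def y_def)
  qed
  then have "grid_kinetic N ?t (\<lambda>i. m (?t i)) \<le> (\<Sum>i<N. (\<Phi> (m (?t (Suc i))) - \<Phi> (m (?t i))) / 2 + \<Lambda>\<^sup>2 * h * (m (?t (Suc i)) - m (?t i)))"
    unfolding grid_kinetic_def by (intro sum_mono)
  also have "\<dots> = (\<Sum>i<N. \<Phi> (m (?t (Suc i))) - \<Phi> (m (?t i))) / 2 + \<Lambda>\<^sup>2 * h * (\<Sum>i<N. m (?t (Suc i)) - m (?t i))"
    by (simp only: sum.distrib sum_divide_distrib[symmetric] sum_distrib_left[symmetric])
  also have "\<dots> = (\<Phi> (m (?t N)) - \<Phi> (m (?t 0))) / 2 + \<Lambda>\<^sup>2 * h * (m (?t N) - m (?t 0))"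
    by (simp only: sum_lessThan_telescope[of "\<lambda>i. m (?t i)"] sum_lessThan_telescope[of "\<lambda>i. \<Phi> (m (?t i))"])
  also have "\<dots> \<le> wall_cost F / 2 + \<Lambda>\<^sup>2 * h * 2"
    using drift_potential_instanton_le[OF F m \<Phi>] instanton_bounds[OF F m, of "?t N"] instanton_bounds[OF F m, of "?t 0"] h
    by (intro add_mono divide_right_mono mult_left_mono) auto
  finally show ?thesis by simp
qed

text \<open>Only the two outer cells feel the corrected ends; an increment there starts or stops
  exactly at a well and costs at most \<open>e / (2 * h)\<close>.\<close>

lemma pinned_grid_kinetic:
  assumes F: "double_well F" and m: "instanton F m" and lip: "\<And>x y. \<bar>drift F x - drift F y\<bar> \<le> \<Lambda> * \<bar>x - y\<bar>"
    and h: "h > 0" and N: "real N * h = 2 * L" "N \<ge> 2"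
    and e: "(1 + m (-L + h))\<^sup>2 \<le> e" "(1 - m (L - h))\<^sup>2 \<le> e"
  shows "grid_kinetic N (unif_grid L h) (\<lambda>i. pinned m L (unif_grid L h i)) \<le> wall_cost F / 2 + 2 * \<Lambda>\<^sup>2 * h + e / h"
proof -
  let ?t = "unif_grid L h"
  have e0: "e \<ge> 0" using e(1) by (meson order_trans zero_le_power2)
  have in_pin: "pinned m L (?t i) = m (?t i)" if "0 < i" "i < N" for i
  proof -
    have "h * real i < h * real N" using that h by (intro mult_strict_left_mono) auto
    also have "\<dots> = 2 * L" using N(1) by (simp add: mult.commute)
    finally have "-L < ?t i" "?t i < L" using that h N by (auto simp: unif_grid_def mult.commute)
    then show ?thesis by (simp add: pinned_def)
  qed
  have L: "L > 0" using N h by (metis mult_pos_pos of_nat_0_less_iff order_less_le_trans pos2 zero_less_mult_pos zero_less_numeral)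
  have p0: "pinned m L (?t 0) = -1" by (simp add: pinned_def unif_grid_def)
  have pN: "pinned m L (?t N) = 1" using unif_grid_last[OF N(1)] L by (simp add: pinned_def)
  have "(pinned m L (?t (Suc i)) - pinned m L (?t i))\<^sup>2 / (2 * (?t (Suc i) - ?t i)) \<le>
     (m (?t (Suc i)) - m (?t i))\<^sup>2 / (2 * (?t (Suc i) - ?t i)) + (if i = 0 then e / (2 * h) else 0) + (if i = N - 1 then e / (2 * h) else 0)"
    if i: "i < N" for i
  proof -
    have d: "?t (Suc i) - ?t i = h" by (simp add: unif_grid_Suc)
    have nn: "(m (?t (Suc i)) - m (?t i))\<^sup>2 / (2 * h) \<ge> 0" "e / (2 * h) \<ge> 0" using h e0 by auto
    consider "i = 0" | "i = N - 1" "i \<noteq> 0" | "i \<noteq> 0" "i \<noteq> N - 1" by blast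
    then show ?thesis
    proof cases
      case 1
      have "pinned m L (?t (Suc i)) - pinned m L (?t i) = 1 + m (-L + h)"
        using 1 p0 in_pin[of 1] N(2) by (simp add: unif_grid_def)
      then have "(pinned m L (?t (Suc i)) - pinned m L (?t i))\<^sup>2 / (2 * h) \<le> e / (2 * h)"
        using e(1) h by (simp add: divide_right_mono)
      then show ?thesis unfolding d using 1 nn N(2) by simp
    next
      case 2
      have "?t i = L - h" using unif_grid_last[OF N(1)] unif_grid_Suc[of L h i] 2 N(2) by simp
      then have "pinned m L (?t (Suc i)) - pinned m L (?t i) = 1 - m (L - h)"
        using 2 pN in_pin[of i] N(2) by simp
      then have "(pinned m L (?t (Suc i)) - pinned m L (?t i))\<^sup>2 / (2 * h) \<le> e / (2 * h)"
        using e(2) h by (simp add: divide_right_mono)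
      then show ?thesis unfolding d using 2 nn by simp
    next
      case 3
      then show ?thesis using in_pin[of i] in_pin[of "Suc i"] i by simp
    qed
  qed
  then have "grid_kinetic N ?t (\<lambda>i. pinned m L (?t i)) \<le> (\<Sum>i<N. (m (?t (Suc i)) - m (?t i))\<^sup>2 / (2 * (?t (Suc i) - ?t i))
      + (if i = 0 then e / (2 * h) else 0) + (if i = N - 1 then e / (2 * h) else 0))"
    unfolding grid_kinetic_def by (intro sum_mono) auto
  also have "\<dots> = grid_kinetic N ?t (\<lambda>i. m (?t i)) + e / (2 * h) + e / (2 * h)"
    using N(2) by (simp add: sum.distrib grid_kinetic_def)
  also have "e / (2 * h) + e / (2 * h) = e / h" using h by (simp add: field_simps)
  then have "grid_kinetic N ?t (\<lambda>i. m (?t i)) + e / (2 * h) + e / (2 * h) = grid_kinetic N ?t (\<lambda>i. m (?t i)) + e / h" by simp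
  also have "\<dots> \<le> wall_cost F / 2 + 2 * \<Lambda>\<^sup>2 * h + e / h"
    using instanton_grid_kinetic[OF F m lip h] by simp
  finally show ?thesis .
qed

text \<open>Let \<open>z\<close> be the deviation and \<open>R\<close> the distance to
  \<open>L\<close>. Closeness of the normals bounds the change of \<open>z / R\<close> over a step,
  and \<open>R\<close> decreases, so \<open>\<bar>z\<bar>\<close> gains at most
  \<open>sqrt (\<epsilon> * h) / N\<close>. The radius \<open>1 / N\<close> thus keeps the deviation
  below \<open>sqrt (\<epsilon> * h)\<close> on the whole grid.\<close>

lemma bridge_step_tube:
  assumes \<epsilon>: "\<epsilon> > 0" and h: "h > 0" and N: "real N * h = 2 * L" "N \<ge> 2"
    and ends: "v (-L) = u (-L)"
    and near: "\<And>i. i < N - 1 \<Longrightarrow> \<bar>bridge_step \<epsilon> L v (unif_grid L h i) (unif_grid L h (Suc i)) -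
       bridge_step \<epsilon> L u (unif_grid L h i) (unif_grid L h (Suc i))\<bar> \<le> 1 / real N"
    and i: "i \<le> N - 1"
  shows "\<bar>v (unif_grid L h i) - u (unif_grid L h i)\<bar> \<le> real i / real N * sqrt (\<epsilon> * h)"
  using i
proof (induction i)
  case 0
  then show ?case using ends by (simp add: unif_grid_def)
next
  case (Suc i)
  define s t where "s = unif_grid L h i" and "t = unif_grid L h (Suc i)"
  define R R' where "R = L - s" and "R' = L - t"
  have st: "t = s + h" by (simp add: s_def t_def unif_grid_Suc)
  have R': "R' > 0"
  proof -
    have "h * real (Suc i) < h * real N" using Suc.prems N(2) h by (intro mult_strict_left_mono) auto
    then show ?thesis using N(1) by (simp add: R'_def t_def unif_grid_def mult.commute)
  qed
  have R: "R = R' + h" "R > 0" using st h R' by (auto simp: R_def R'_def)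
  define z z' where "z = v s - u s" and "z' = v t - u t"
  define q where "q = sqrt (R * R' / (\<epsilon> * h))"
  have q: "q > 0" using R R' \<epsilon> h by (simp add: q_def)
  have "bridge_step \<epsilon> L v s t - bridge_step \<epsilon> L u s t = q * (z' / R' - z / R)"
    unfolding bridge_step_def z_def z'_def q_def R_def R'_def using st by (simp add: algebra_simps diff_divide_distrib)
  then have "q * \<bar>z' / R' - z / R\<bar> \<le> 1 / real N"
    using near[of i] Suc.prems q by (simp add: s_def t_def abs_mult)
  then have 1: "\<bar>z' / R' - z / R\<bar> \<le> 1 / real N / q" by (subst pos_le_divide_eq[OF q]) (simp only: mult.commute)
  have "\<bar>z'\<bar> = R' * \<bar>(z' / R' - z / R) + z / R\<bar>" using R' by (simp add: abs_mult[symmetric] abs_divide)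
  also have "\<dots> \<le> R' * (1 / real N / q + \<bar>z\<bar> / R)"
    using 1 R R' by (intro mult_left_mono order.trans[OF abs_triangle_ineq] add_mono) (auto simp: abs_divide)
  also have "\<dots> = R' / q * (1 / real N) + R' / R * \<bar>z\<bar>" by (simp add: algebra_simps)
  also have "\<dots> \<le> sqrt (\<epsilon> * h) * (1 / real N) + 1 * \<bar>z\<bar>"
  proof (intro add_mono mult_right_mono)
    have "R' = sqrt (R' * R')" using R' by simp
    also have "\<dots> \<le> sqrt (\<epsilon> * h * (R * R' / (\<epsilon> * h)))"
      using R R' \<epsilon> h by (intro real_sqrt_le_mono) (auto intro: mult_right_mono)
    also have "\<dots> = sqrt (\<epsilon> * h) * q" by (simp only: q_def real_sqrt_mult)
    finally show "R' / q \<le> sqrt (\<epsilon> * h)" using q by (simp add: divide_le_eq)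
    show "R' / R \<le> 1" using R R' h by simp
  qed auto
  also have "\<dots> \<le> sqrt (\<epsilon> * h) * (1 / real N) + real i / real N * sqrt (\<epsilon> * h)"
    using Suc.IH Suc.prems by (simp add: z_def s_def)
  also have "\<dots> = real (Suc i) / real N * sqrt (\<epsilon> * h)" by (simp add: add_divide_distrib distrib_right)
  finally show ?case by (simp add: z'_def t_def)
qed

text \<open>A product set in the \<open>N - 1\<close> independent normals, which makes its
  probability computable; the last cell has no normal of its own. The radius costs a factor of order
  \<open>1 / N\<close> per normal, hence \<open>N * ln N\<close> in the logarithm of the
  probability.\<close>

definition step_tube :: "'w measure \<Rightarrow> real \<Rightarrow> real \<Rightarrow> real \<Rightarrow> nat \<Rightarrow> ('w \<Rightarrow> real \<Rightarrow> real) \<Rightarrow> (real \<Rightarrow> real) \<Rightarrow> 'w set" where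
  "step_tube P \<epsilon> L h N V u = {w\<in>space P. \<forall>i<N - 1.
     \<bar>bridge_step \<epsilon> L (V w) (unif_grid L h i) (unif_grid L h (Suc i)) -
       bridge_step \<epsilon> L u (unif_grid L h i) (unif_grid L h (Suc i))\<bar> \<le> 1 / real N}"

lemma unif_grid_interior:
  assumes h: "h > 0" and N: "real N * h = 2 * L" and i: "i < N - 1"
  shows "-L \<le> unif_grid L h i" "unif_grid L h i < unif_grid L h (Suc i)" "unif_grid L h (Suc i) < L"
proof -
  show "-L \<le> unif_grid L h i" using h by (simp add: unif_grid_def)
  show "unif_grid L h i < unif_grid L h (Suc i)" using h by (simp add: unif_grid_Suc)
  have "h * real (Suc i) < h * real N" using i h by (intro mult_strict_left_mono) auto
  then show "unif_grid L h (Suc i) < L" using N by (simp add: unif_grid_def mult.commute)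
qed

text \<open>The normals involve the path at grid points only, and the remainder inside a cell is
  orthogonal to all values there; within the Gaussian space this is independence.\<close>

lemma step_tube_remainder_indep:
  assumes V: "scaled_bridge \<epsilon> L P V" and h: "h > 0" and N: "real N * h = 2 * L"
    and j: "j < N" and s: "unif_grid L h j \<le> s" "s \<le> unif_grid L h (Suc j)" and f[measurable]: "f \<in> borel_measurable borel"
  shows "(\<integral>\<^sup>+w. f (bridge_remainder L (V w) (unif_grid L h j) (unif_grid L h (Suc j)) s) * indicator (step_tube P \<epsilon> L h N V u) w \<partial>P) =
    (\<integral>\<^sup>+w. f (bridge_remainder L (V w) (unif_grid L h j) (unif_grid L h (Suc j)) s) \<partial>P) *
    (\<Prod>i<N - 1. emeasure P {w\<in>space P. \<bar>bridge_step \<epsilon> L (V w) (unif_grid L h i) (unif_grid L h (Suc i)) -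
       bridge_step \<epsilon> L u (unif_grid L h i) (unif_grid L h (Suc i))\<bar> \<le> 1 / real N})"
proof -
  interpret prob_space P by (rule scaled_bridge_prob_space[OF V])
  let ?t = "unif_grid L h"
  define n where "n = N - 1"
  define y where "y i = bridge_step \<epsilon> L u (?t i) (?t (Suc i))" for i
  \<comment> \<open>The remainder is appended to the normals as the variable with index
    \<open>n\<close>, so that a single independence statement covers both.\<close>
  define Z where "Z k w = (if k < n then bridge_step \<epsilon> L (V w) (?t k) (?t (Suc k)) else bridge_remainder L (V w) (?t j) (?t (Suc j)) s)" for k w
  define E where "E i = {w\<in>space P. \<bar>bridge_step \<epsilon> L (V w) (?t i) (?t (Suc i)) - y i\<bar> \<le> 1 / real N}" for i
  have inc: "?t i < ?t (Suc i)" for i using h by (simp add: unif_grid_Suc)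
  have rng: "-L \<le> ?t i" "?t i \<le> L" if "i \<le> N" for i using unif_grid_range[OF h N that] by auto
  have rem: "-L \<le> ?t j" "?t j < ?t (Suc j)" "?t (Suc j) \<le> L" using rng[of j] rng[of "Suc j"] inc[of j] j by auto
  have Zspan: "Z k \<in> bridge_span L V" for k
  proof (cases "k < n")
    case True
    then show ?thesis using rng[of k] rng[of "Suc k"] unfolding Z_def by (simp add: bridge_step_span n_def)
  next
    case False
    then show ?thesis using bridge_remainder_span[OF rem s] unfolding Z_def by simp
  qed
  have orth1: "(\<integral>w. Z i w * Z k w \<partial>P) = 0" if ik: "i < k" "k \<le> n" for i k
  proof (cases "k < n")
    case True
    have "?t (Suc i) \<le> ?t k" using ik by (simp add: unif_grid_mono[OF h])
    then show ?thesis
      using ik True unif_grid_interior[OF h N, of i] unif_grid_interior[OF h N, of k] unfolding Z_def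
      by (simp add: n_def) (intro bridge_step_cov[OF V]; auto)
  next
    case False
    have "(\<integral>w. bridge_remainder L (V w) (?t j) (?t (Suc j)) s * bridge_step \<epsilon> L (V w) (?t i) (?t (Suc i)) \<partial>P) = 0"
    proof (rule bridge_remainder_cov_step[OF V rem s])
      show "-L \<le> ?t i" "?t i \<le> L" "-L \<le> ?t (Suc i)" "?t (Suc i) \<le> L"
        using rng[of i] rng[of "Suc i"] ik by (auto simp: n_def)
      show "?t i \<le> ?t j \<or> ?t (Suc j) \<le> ?t i" "?t (Suc i) \<le> ?t j \<or> ?t (Suc j) \<le> ?t (Suc i)"
        unfolding unif_grid_mono[OF h] by linarith+
    qed
    then show ?thesis using ik False unfolding Z_def by (simp add: mult.commute)
  qed
  have orth: "(\<integral>w. Z i w * Z k w \<partial>P) = 0" if "i \<in> {..n}" "k \<in> {..n}" "i \<noteq> k" for i k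
    using that orth1[of i k] orth1[of k i] by (cases "i < k") (auto simp: mult.commute)
  have indep: "indep_vars (\<lambda>_. borel) Z {..n}"
    by (rule gauss_span_indep[OF scaled_bridge_process[OF V] _ Zspan orth]) auto
  define g where "g k x = (if k < n then indicator {z. \<bar>z - y k\<bar> \<le> 1 / real N} x else f x)" for k :: nat and x :: real
  have gm[measurable]: "g k \<in> borel_measurable borel" for k
    by (cases "k < n") (auto simp: g_def[abs_def])
  have gn: "g n (Z n w) = f (bridge_remainder L (V w) (?t j) (?t (Suc j)) s)" for w by (simp add: g_def Z_def)
  have "indep_vars (\<lambda>_. borel) (\<lambda>k. g k \<circ> Z k) {..n}" by (intro indep_vars_compose[OF indep]) measurable
  then have "indep_vars (\<lambda>_. borel) (\<lambda>k w. g k (Z k w)) {..n}" by (simp add: o_def)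
  then have "(\<integral>\<^sup>+w. (\<Prod>k\<le>n. g k (Z k w)) \<partial>P) = (\<Prod>k\<le>n. \<integral>\<^sup>+w. g k (Z k w) \<partial>P)"
    by (intro indep_vars_nn_integral) auto
  also have "\<dots> = (\<integral>\<^sup>+w. g n (Z n w) \<partial>P) * (\<Prod>k<n. \<integral>\<^sup>+w. g k (Z k w) \<partial>P)"
    by (simp add: lessThan_Suc_atMost[symmetric] mult.commute)
  also have "(\<Prod>k<n. \<integral>\<^sup>+w. g k (Z k w) \<partial>P) = (\<Prod>k<n. emeasure P (E k))"
  proof (rule prod.cong[OF refl])
    fix k assume "k \<in> {..<n}"
    then have k: "k < n" by simp
    have [measurable]: "Z k \<in> borel_measurable P" by (rule gauss_span_gaussian(5)[OF scaled_bridge_process[OF V] Zspan])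
    have Ek: "E k = {w\<in>space P. \<bar>Z k w - y k\<bar> \<le> 1 / real N}" using k by (simp add: E_def Z_def)
    have "E k \<in> sets P" unfolding Ek by measurable
    moreover have "(\<integral>\<^sup>+w. g k (Z k w) \<partial>P) = (\<integral>\<^sup>+w. indicator (E k) w \<partial>P)"
      using k by (intro nn_integral_cong) (auto simp: g_def Ek indicator_def)
    ultimately show "(\<integral>\<^sup>+w. g k (Z k w) \<partial>P) = emeasure P (E k)" by simp
  qed
  also have "(\<integral>\<^sup>+w. (\<Prod>k\<le>n. g k (Z k w)) \<partial>P) =
     (\<integral>\<^sup>+w. f (bridge_remainder L (V w) (?t j) (?t (Suc j)) s) * indicator (step_tube P \<epsilon> L h N V u) w \<partial>P)"
  proof (rule nn_integral_cong)
    fix w assume w: "w \<in> space P"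
    have "(\<Prod>k<n. g k (Z k w)) = indicator (step_tube P \<epsilon> L h N V u) w"
    proof (cases "w \<in> step_tube P \<epsilon> L h N V u")
      case True
      then show ?thesis by (intro trans[OF prod.neutral]) (auto simp: g_def Z_def step_tube_def y_def n_def)
    next
      case False
      then obtain k where "k < n" "\<not> \<bar>bridge_step \<epsilon> L (V w) (?t k) (?t (Suc k)) - y k\<bar> \<le> 1 / real N"
        using w by (auto simp: step_tube_def y_def n_def)
      then have "(\<Prod>k<n. g k (Z k w)) = 0"
        by (intro prod_zero) (auto intro!: bexI[of _ k] simp: g_def Z_def)
      then show ?thesis using False by simp
    qed
    then show "(\<Prod>k\<le>n. g k (Z k w)) = f (bridge_remainder L (V w) (?t j) (?t (Suc j)) s) * indicator (step_tube P \<epsilon> L h N V u) w"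
      by (simp add: lessThan_Suc_atMost[symmetric] g_def[of n] Z_def[of n] mult.commute)
  qed
  finally show ?thesis unfolding gn by (simp only: E_def y_def n_def)
qed

lemma step_tube_sets:
  assumes V: "scaled_bridge \<epsilon> L P V" and h: "h > 0" and N: "real N * h = 2 * L"
  shows "step_tube P \<epsilon> L h N V u \<in> sets P"
proof -
  have [measurable]: "(\<lambda>w. bridge_step \<epsilon> L (V w) (unif_grid L h i) (unif_grid L h (Suc i))) \<in> borel_measurable P" if "i < N - 1" for i
    using unif_grid_interior[OF h N that]
    by (intro gauss_span_gaussian(5)[OF scaled_bridge_process[OF V] bridge_step_span]) auto
  have "step_tube P \<epsilon> L h N V u = space P \<inter> (\<Inter>i\<in>{..<N - 1}. {w\<in>space P. \<bar>bridge_step \<epsilon> L (V w) (unif_grid L h i) (unif_grid L h (Suc i)) -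
       bridge_step \<epsilon> L u (unif_grid L h i) (unif_grid L h (Suc i))\<bar> \<le> 1 / real N})"
    by (auto simp: step_tube_def)
  also have "\<dots> \<in> sets P" by (cases "N - 1 = 0") (auto intro!: sets.Int sets.finite_INT)
  finally show ?thesis .
qed

lemma step_tube_measure:
  assumes V: "scaled_bridge \<epsilon> L P V" and h: "h > 0" and N: "real N * h = 2 * L" "N > 0"
  shows "emeasure P (step_tube P \<epsilon> L h N V u) =
    (\<Prod>i<N - 1. emeasure P {w\<in>space P. \<bar>bridge_step \<epsilon> L (V w) (unif_grid L h i) (unif_grid L h (Suc i)) -
       bridge_step \<epsilon> L u (unif_grid L h i) (unif_grid L h (Suc i))\<bar> \<le> 1 / real N})"
proof -
  interpret prob_space P by (rule scaled_bridge_prob_space[OF V])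
  have "unif_grid L h 0 \<le> unif_grid L h 0" "unif_grid L h 0 \<le> unif_grid L h (Suc 0)" using h by (auto simp: unif_grid_def)
  from step_tube_remainder_indep[OF V h N this, of "\<lambda>_. 1" u] show ?thesis
    using step_tube_sets[OF V h N(1), of u] by (simp add: emeasure_space_1)
qed

text \<open>The tube is exponentially unlikely, but by independence conditioning on it leaves the
  variance of the remainder unchanged.\<close>

lemma step_tube_remainder_second_moment:
  assumes V: "scaled_bridge \<epsilon> L P V" and h: "h > 0" and N: "real N * h = 2 * L"
    and j: "j < N" and s: "unif_grid L h j \<le> s" "s \<le> unif_grid L h (Suc j)"
  shows "(\<integral>\<^sup>+w. ennreal ((bridge_remainder L (V w) (unif_grid L h j) (unif_grid L h (Suc j)) s)\<^sup>2) * indicator (step_tube P \<epsilon> L h N V u) w \<partial>P)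
     \<le> ennreal (\<epsilon> * h) * emeasure P (step_tube P \<epsilon> L h N V u)"
proof -
  let ?B = "\<lambda>w. bridge_remainder L (V w) (unif_grid L h j) (unif_grid L h (Suc j)) s"
  have N0: "N > 0" using j by simp
  have rem: "-L \<le> unif_grid L h j" "unif_grid L h j < unif_grid L h (Suc j)" "unif_grid L h (Suc j) \<le> L"
    using unif_grid_range[OF h N, of j] unif_grid_range[OF h N, of "Suc j"] j h by (auto simp: unif_grid_Suc)
  have "(\<integral>\<^sup>+w. ennreal ((?B w)\<^sup>2) \<partial>P) = ennreal (\<integral>w. (?B w)\<^sup>2 \<partial>P)"
    by (intro nn_integral_eq_integral gauss_span_gaussian(3)[OF scaled_bridge_process[OF V] bridge_remainder_span[OF rem s]]) auto
  also have "\<dots> \<le> ennreal (\<epsilon> * h)"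
    using bridge_remainder_var[OF V rem s] by (intro ennreal_leI) (simp add: unif_grid_Suc)
  finally have le: "(\<integral>\<^sup>+w. ennreal ((?B w)\<^sup>2) \<partial>P) \<le> ennreal (\<epsilon> * h)" .
  have fm: "(\<lambda>x::real. ennreal (x\<^sup>2)) \<in> borel_measurable borel" by measurable
  from le show ?thesis
    unfolding step_tube_remainder_indep[OF V h N j s fm] step_tube_measure[OF V h N N0]
    by (intro mult_right_mono) auto
qed

text \<open>The target values \<open>y i\<close> have squares that sum to at most
  \<open>2 * K / \<epsilon>\<close>. Young's inequality separates them from the radius, whose
  squares sum to at most 1; the factor \<open>1 / (2 * N)\<close> is the length of the small ball
  times a lower bound for \<open>1 / sqrt (2 * pi)\<close>.\<close>

lemma step_tube_measure_ge:
  assumes V: "scaled_bridge \<epsilon> L P V" and h: "h > 0" and N: "real N * h = 2 * L" "N \<ge> 2" and \<theta>: "\<theta> > 0"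
    and u: "u (-L) = -1" "u L = 1" and K: "grid_kinetic N (unif_grid L h) (\<lambda>i. u (unif_grid L h i)) \<le> K"
  shows "measure P (step_tube P \<epsilon> L h N V u) \<ge> (1 / (2 * real N)) ^ N * exp (- ((1 + \<theta>) * K / \<epsilon>) - (1 + 1 / \<theta>) / 2)"
proof -
  interpret prob_space P by (rule scaled_bridge_prob_space[OF V])
  have L: "L > 0" "\<epsilon> > 0" using V by (auto simp: scaled_bridge_def)
  let ?t = "unif_grid L h"
  define n where "n = N - 1"
  have Nn: "N = Suc n" "n > 0" using N(2) by (auto simp: n_def)
  define y where "y i = bridge_step \<epsilon> L u (?t i) (?t (Suc i))" for i
  define r where "r = 1 / real N"
  have r: "r > 0" using N(2) by (simp add: r_def)
  have "\<epsilon> * (\<Sum>i<n. (y i)\<^sup>2) = 2 * grid_kinetic (Suc n) ?t (\<lambda>i. u (?t i)) - 2 / L"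
    unfolding y_def
  proof (rule bridge_steps_square_sum)
    show "?t 0 = -L" by (simp add: unif_grid_def)
    show "?t (Suc n) = L" using unif_grid_last[OF N(1)] Nn by simp
    show "?t i < ?t (Suc i)" for i using h by (simp add: unif_grid_Suc)
    show "?t n < L" using unif_grid_interior(3)[OF h N(1), of "n - 1"] Nn by simp
  qed (use L u in auto)
  also have "\<dots> \<le> 2 * K"
  proof -
    have "grid_kinetic (Suc n) ?t (\<lambda>i. u (?t i)) \<le> K" "0 \<le> 2 / L" using K Nn(1) L by auto
    then show ?thesis by linarith
  qed
  finally have yK: "(\<Sum>i<n. (y i)\<^sup>2) \<le> 2 * K / \<epsilon>" using L by (simp add: le_divide_eq mult.commute)
  have one: "ennreal (1 / (2 * real N) * exp (- ((1 + \<theta>) * (y i)\<^sup>2 / 2) - (1 + 1 / \<theta>) * r\<^sup>2 / 2)) \<le>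
     emeasure P {w\<in>space P. \<bar>bridge_step \<epsilon> L (V w) (?t i) (?t (Suc i)) - y i\<bar> \<le> r}" if i: "i < n" for i
  proof -
    note ti = unif_grid_interior[OF h N(1), of i]
    have "ennreal (2 * r / sqrt (2 * pi) * exp (- (\<bar>y i\<bar> + r)\<^sup>2 / 2)) \<le>
      emeasure P {w\<in>space P. \<bar>bridge_step \<epsilon> L (V w) (?t i) (?t (Suc i)) - y i\<bar> \<le> r}"
      using ti i r by (intro gaussian_rv_small_ball prob_space_axioms bridge_step_gaussian[OF V] bridge_step_var[OF V]) (auto simp: n_def)
    moreover have "1 / (2 * real N) * exp (- ((1 + \<theta>) * (y i)\<^sup>2 / 2) - (1 + 1 / \<theta>) * r\<^sup>2 / 2) \<le> 2 * r / sqrt (2 * pi) * exp (- (\<bar>y i\<bar> + r)\<^sup>2 / 2)"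
    proof (intro mult_mono)
      have "sqrt (2 * pi) \<le> sqrt (4\<^sup>2)" using pi_less_4 by (intro real_sqrt_le_mono) simp
      then have "sqrt (2 * pi) \<le> 4" by simp
      then have "2 * r / 4 \<le> 2 * r / sqrt (2 * pi)" using r by (intro divide_left_mono) auto
      then show "1 / (2 * real N) \<le> 2 * r / sqrt (2 * pi)" by (simp add: r_def)
      have "(\<bar>y i\<bar> + r)\<^sup>2 \<le> (1 + \<theta>) * \<bar>y i\<bar>\<^sup>2 + (1 + 1 / \<theta>) * r\<^sup>2" by (rule power2_add_le_weighted[OF \<theta>])
      moreover have "- (b / 2) - c / 2 \<le> - a / 2" if "a \<le> b + c" for a b c :: real using that by linarith
      ultimately show "exp (- ((1 + \<theta>) * (y i)\<^sup>2 / 2) - (1 + 1 / \<theta>) * r\<^sup>2 / 2) \<le> exp (- (\<bar>y i\<bar> + r)\<^sup>2 / 2)"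
        unfolding exp_le_cancel_iff power2_abs by blast
    qed (use r in auto)
    ultimately show ?thesis by (meson ennreal_leI order_trans)
  qed
  have "(1 / (2 * real N)) ^ N * exp (- ((1 + \<theta>) * K / \<epsilon>) - (1 + 1 / \<theta>) / 2) \<le>
     (\<Prod>i<n. 1 / (2 * real N) * exp (- ((1 + \<theta>) * (y i)\<^sup>2 / 2) - (1 + 1 / \<theta>) * r\<^sup>2 / 2))"
  proof -
    have "(1 / (2 * real N)) ^ N * exp (- ((1 + \<theta>) * K / \<epsilon>) - (1 + 1 / \<theta>) / 2) \<le>
      (1 / (2 * real N)) ^ n * exp (\<Sum>i<n. - ((1 + \<theta>) * (y i)\<^sup>2 / 2) - (1 + 1 / \<theta>) * r\<^sup>2 / 2)"
    proof (intro mult_mono)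
      \<comment> \<open>There are only \<open>N - 1\<close> factors; a further one below 1 gives the
        simpler exponent.\<close>
      show "(1 / (2 * real N)) ^ N \<le> (1 / (2 * real N)) ^ n"
        using N(2) Nn by (intro power_decreasing) auto
      have "(\<Sum>i<n. - ((1 + \<theta>) * (y i)\<^sup>2 / 2) - (1 + 1 / \<theta>) * r\<^sup>2 / 2) =
        - ((1 + \<theta>) / 2 * (\<Sum>i<n. (y i)\<^sup>2)) - real n * ((1 + 1 / \<theta>) * r\<^sup>2 / 2)"
        by (simp add: sum_subtractf sum_negf sum_distrib_left)
      moreover have "(1 + \<theta>) / 2 * (\<Sum>i<n. (y i)\<^sup>2) \<le> (1 + \<theta>) / 2 * (2 * K / \<epsilon>)"
        using yK \<theta> by (intro mult_left_mono) auto
      moreover have "real n * ((1 + 1 / \<theta>) * r\<^sup>2 / 2) \<le> (1 + 1 / \<theta>) / 2"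
      proof -
        have "real n * 1 \<le> real N * real N" using Nn by (intro mult_mono) auto
        then have "real n * r\<^sup>2 \<le> real N * real N * r\<^sup>2" by (intro mult_right_mono) auto
        also have "\<dots> = 1" using N(2) by (simp add: r_def power2_eq_square)
        finally have "real n * r\<^sup>2 * ((1 + 1 / \<theta>) / 2) \<le> 1 * ((1 + 1 / \<theta>) / 2)"
          using \<theta> by (intro mult_right_mono) (auto intro: add_nonneg_nonneg)
        then show ?thesis by (simp add: mult_ac)
      qed
      moreover have "(1 + \<theta>) / 2 * (2 * K / \<epsilon>) = (1 + \<theta>) * K / \<epsilon>" by simp
      ultimately show "exp (- ((1 + \<theta>) * K / \<epsilon>) - (1 + 1 / \<theta>) / 2) \<le> exp (\<Sum>i<n. - ((1 + \<theta>) * (y i)\<^sup>2 / 2) - (1 + 1 / \<theta>) * r\<^sup>2 / 2)"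
        unfolding exp_le_cancel_iff by linarith
    qed auto
    also have "\<dots> = (\<Prod>i<n. 1 / (2 * real N) * exp (- ((1 + \<theta>) * (y i)\<^sup>2 / 2) - (1 + 1 / \<theta>) * r\<^sup>2 / 2))"
      by (simp only: exp_sum finite_lessThan prod.distrib prod_constant card_lessThan)
    finally show ?thesis .
  qed
  then have "ennreal ((1 / (2 * real N)) ^ N * exp (- ((1 + \<theta>) * K / \<epsilon>) - (1 + 1 / \<theta>) / 2)) \<le>
     (\<Prod>i<n. ennreal (1 / (2 * real N) * exp (- ((1 + \<theta>) * (y i)\<^sup>2 / 2) - (1 + 1 / \<theta>) * r\<^sup>2 / 2)))"
    by (subst prod_ennreal) (auto intro!: ennreal_leI)
  also have "\<dots> \<le> (\<Prod>i<n. emeasure P {w\<in>space P. \<bar>bridge_step \<epsilon> L (V w) (?t i) (?t (Suc i)) - y i\<bar> \<le> r})"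
    using one by (intro prod_mono_ennreal) auto
  also have "\<dots> = emeasure P (step_tube P \<epsilon> L h N V u)"
    using step_tube_measure[OF V h N(1), of u] Nn by (simp add: y_def r_def)
  finally show ?thesis by (simp add: emeasure_eq_measure)
qed

section \<open>Mean potential energy in the tube\<close>

lemma power2_convex_combination_le:
  fixes x y a b :: real
  assumes "a \<ge> 0" "b \<ge> 0" "a + b = 1"
  shows "(a * x + b * y)\<^sup>2 \<le> a * x\<^sup>2 + b * y\<^sup>2"
proof -
  have "a * x\<^sup>2 + b * y\<^sup>2 - (a * x + b * y)\<^sup>2 = a * b * (x - y)\<^sup>2 + (a * x\<^sup>2 + b * y\<^sup>2) * (1 - (a + b))"
    by (simp add: power2_eq_square algebra_simps)
  also have "\<dots> \<ge> 0" using assms by simp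
  finally show ?thesis by simp
qed

lemma power2_sum4_le:
  fixes a b c d :: real
  shows "(a + b + c + d)\<^sup>2 \<le> 4 * (a\<^sup>2 + b\<^sup>2 + c\<^sup>2 + d\<^sup>2)"
proof -
  have "0 \<le> (a - b)\<^sup>2 + (a - c)\<^sup>2 + (a - d)\<^sup>2 + (b - c)\<^sup>2 + (b - d)\<^sup>2 + (c - d)\<^sup>2" by simp
  then show ?thesis by (simp add: power2_eq_square algebra_simps)
qed

text \<open>\<open>F\<close> is half the square of the Lipschitz drift, so a perturbation costs a
  relative error and a quadratic one. A linear error term of order \<open>sqrt \<epsilon>\<close>,
  integrated over the interval, would contribute \<open>L * sqrt \<epsilon>\<close>.\<close>

lemma double_well_perturb_le:
  assumes F: "double_well F" and lip: "\<And>x y. \<bar>drift F x - drift F y\<bar> \<le> \<Lambda> * \<bar>x - y\<bar>"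
    and \<theta>: "\<theta> > 0" and xy: "\<bar>x\<bar> \<le> 3" "\<bar>y\<bar> \<le> 3"
  shows "F y \<le> (1 + \<theta>) * F x + (1 + 1 / \<theta>) * \<Lambda>\<^sup>2 / 2 * (y - x)\<^sup>2"
proof -
  have "(drift F y - drift F x)\<^sup>2 \<le> (\<Lambda> * \<bar>y - x\<bar>)\<^sup>2" using lip[of y x] by (metis abs_ge_zero power2_abs power_mono)
  then have d: "(drift F y - drift F x)\<^sup>2 \<le> \<Lambda>\<^sup>2 * (y - x)\<^sup>2" by (simp add: power_mult_distrib)
  have "(drift F y)\<^sup>2 = (drift F x + (drift F y - drift F x))\<^sup>2" by simp
  also have "\<dots> \<le> (1 + \<theta>) * (drift F x)\<^sup>2 + (1 + 1 / \<theta>) * (drift F y - drift F x)\<^sup>2"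
    by (rule power2_add_le_weighted[OF \<theta>])
  also have "\<dots> \<le> (1 + \<theta>) * (drift F x)\<^sup>2 + (1 + 1 / \<theta>) * (\<Lambda>\<^sup>2 * (y - x)\<^sup>2)"
    using d \<theta> by (intro add_left_mono mult_left_mono) (auto intro: add_nonneg_nonneg)
  finally have "(drift F y)\<^sup>2 / 2 \<le> (1 + \<theta>) * ((drift F x)\<^sup>2 / 2) + (1 + 1 / \<theta>) * \<Lambda>\<^sup>2 / 2 * (y - x)\<^sup>2"
    by simp
  then show ?thesis using drift_square_eq[OF F] xy by simp
qed

lemma pinned_minus_instanton:
  assumes F: "double_well F" and m: "instanton F m" and h: "h > 0" and N: "real N * h = 2 * L" "N \<ge> 2"
    and e: "(1 + m (-L + h))\<^sup>2 \<le> e" "(1 - m (L - h))\<^sup>2 \<le> e" and i: "i \<le> N"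
  shows "(pinned m L (unif_grid L h i) - m (unif_grid L h i))\<^sup>2 \<le> (if i = 0 \<or> i = N then e else 0)"
proof -
  have L: "L > 0" using N h by (metis mult_pos_pos of_nat_0_less_iff order_less_le_trans pos2 zero_less_mult_pos zero_less_numeral)
  consider "i = 0" | "i = N" | "0 < i" "i < N" using i by linarith
  then show ?thesis
  proof cases
    case 1
    have "\<bar>-1 - m (-L)\<bar> \<le> \<bar>1 + m (-L + h)\<bar>"
      using instanton_bounds[OF F m, of "-L"] monoD[OF instanton_mono[OF F m], of "-L" "-L + h"] h by simp
    then have "(-1 - m (-L))\<^sup>2 \<le> (1 + m (-L + h))\<^sup>2" by (simp only: abs_le_square_iff)
    then show ?thesis using 1 e(1) by (simp add: pinned_def unif_grid_def)
  next
    case 2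
    have "\<bar>1 - m L\<bar> \<le> \<bar>1 - m (L - h)\<bar>"
      using instanton_bounds[OF F m, of L] monoD[OF instanton_mono[OF F m], of "L - h" L] h by simp
    then have "(1 - m L)\<^sup>2 \<le> (1 - m (L - h))\<^sup>2" by (simp only: abs_le_square_iff)
    then show ?thesis using 2 e(2) unif_grid_last[OF N(1)] L by (simp add: pinned_def)
  next
    case 3
    have "h * real i < h * real N" using 3 h by (intro mult_strict_left_mono) auto
    also have "\<dots> = 2 * L" using N(1) by (simp add: mult.commute)
    finally have "-L < unif_grid L h i" "unif_grid L h i < L" using 3 h by (auto simp: unif_grid_def)
    then show ?thesis using 3 by (simp add: pinned_def)
  qed
qed

text \<open>The deviation from the instanton has four parts: the remainder inside the cell, the
  interpolated deviation at the grid points, the interpolation error of the instanton, and the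
  correction at the ends. The path stays in \<open>[-3,3]\<close>, where \<open>F\<close> is half
  the squared drift: 1 for the target profile, 1 for the tube, 1 for the oscillation.\<close>

lemma tube_path_energy_density:
  assumes F: "double_well F" and m: "instanton F m" and lip: "\<And>x y. \<bar>drift F x - drift F y\<bar> \<le> \<Lambda> * \<bar>x - y\<bar>"
    and \<epsilon>: "\<epsilon> > 0" and h: "h > 0" "\<epsilon> * h \<le> 1" and N: "real N * h = 2 * L" "N \<ge> 2" and \<theta>: "\<theta> > 0"
    and e: "(1 + m (-L + h))\<^sup>2 \<le> e" "(1 - m (L - h))\<^sup>2 \<le> e"
    and v: "v (-L) = -1" "v L = 1"
    and near: "\<And>i. i < N - 1 \<Longrightarrow> \<bar>bridge_step \<epsilon> L v (unif_grid L h i) (unif_grid L h (Suc i)) -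
       bridge_step \<epsilon> L (pinned m L) (unif_grid L h i) (unif_grid L h (Suc i))\<bar> \<le> 1 / real N"
    and j: "j < N" and s: "unif_grid L h j \<le> s" "s \<le> unif_grid L h (Suc j)" and osc: "\<bar>v s - v (unif_grid L h j)\<bar> \<le> 1"
  shows "F (v s) \<le> (1 + \<theta>) * F (m s) + 2 * (1 + 1 / \<theta>) * \<Lambda>\<^sup>2 *
     ((bridge_remainder L v (unif_grid L h j) (unif_grid L h (Suc j)) s)\<^sup>2 +
      (\<epsilon> * h + (m (unif_grid L h (Suc j)) - m (unif_grid L h j))\<^sup>2 + (if j = 0 \<or> j = N - 1 then e else 0)))"
proof -
  let ?t = "unif_grid L h" and ?u = "pinned m L"
  have L: "L > 0" using N h by (metis mult_pos_pos of_nat_0_less_iff order_less_le_trans pos2 zero_less_mult_pos zero_less_numeral)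
  have e0: "e \<ge> 0" using e(1) by (meson order_trans zero_le_power2)
  have z: "\<bar>v (?t i) - ?u (?t i)\<bar> \<le> sqrt (\<epsilon> * h)" if "i \<le> N" for i
  proof (cases "i = N")
    case True
    have "?t i = L" using unif_grid_last[OF N(1)] True by simp
    then show ?thesis using v(2) L h \<epsilon> by (simp add: pinned_def)
  next
    case False
    have "\<bar>v (?t i) - ?u (?t i)\<bar> \<le> real i / real N * sqrt (\<epsilon> * h)"
      by (rule bridge_step_tube[OF \<epsilon> h(1) N _ near]) (use v L False that in \<open>auto simp: pinned_def\<close>)
    also have "\<dots> \<le> 1 * sqrt (\<epsilon> * h)" using that N(2) h \<epsilon> by (intro mult_right_mono) auto
    finally show ?thesis by simp
  qed
  define a b where "a = (?t (Suc j) - s) / (?t (Suc j) - ?t j)" and "b = (s - ?t j) / (?t (Suc j) - ?t j)"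
  have inc: "?t j < ?t (Suc j)" using h by (simp add: unif_grid_Suc)
  have ab: "a \<ge> 0" "b \<ge> 0" "a + b = 1"
    using s inc interpolation_weights(1)[OF inc, of s] by (auto simp: a_def b_def)
  define R where "R = bridge_remainder L v (?t j) (?t (Suc j)) s"
  have vs: "v s = R + a * v (?t j) + b * v (?t (Suc j))"
    by (simp add: R_def bridge_remainder_def a_def b_def)
  define z1 z2 where "z1 = v (?t j) - ?u (?t j)" and "z2 = v (?t (Suc j)) - ?u (?t (Suc j))"
  define p1 p2 where "p1 = ?u (?t j) - m (?t j)" and "p2 = ?u (?t (Suc j)) - m (?t (Suc j))"
  define m1 m2 where "m1 = m (?t j) - m s" and "m2 = m (?t (Suc j)) - m s"
  have split: "v s - m s = R + (a * z1 + b * z2) + (a * m1 + b * m2) + (a * p1 + b * p2)"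
  proof -
    have "a * z1 + b * z2 + (a * m1 + b * m2) + (a * p1 + b * p2) = a * v (?t j) + b * v (?t (Suc j)) - (a + b) * m s"
      by (simp add: z1_def z2_def p1_def p2_def m1_def m2_def algebra_simps)
    then show ?thesis using vs ab(3) by simp
  qed
  have zsq: "z1\<^sup>2 \<le> \<epsilon> * h" "z2\<^sup>2 \<le> \<epsilon> * h"
    using z[of j] z[of "Suc j"] j h \<epsilon> power_mono[of "\<bar>z1\<bar>" "sqrt (\<epsilon> * h)" 2] power_mono[of "\<bar>z2\<bar>" "sqrt (\<epsilon> * h)" 2]
    by (auto simp: z1_def z2_def)
  have q1: "(a * z1 + b * z2)\<^sup>2 \<le> \<epsilon> * h"
  proof -
    have "(a * z1 + b * z2)\<^sup>2 \<le> a * z1\<^sup>2 + b * z2\<^sup>2" by (rule power2_convex_combination_le[OF ab])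
    also have "\<dots> \<le> a * (\<epsilon> * h) + b * (\<epsilon> * h)" using zsq ab by (intro add_mono mult_left_mono) auto
    also have "\<dots> = \<epsilon> * h" using ab(3) by (simp flip: distrib_right)
    finally show ?thesis .
  qed
  have mm: "m (?t j) \<le> m s" "m s \<le> m (?t (Suc j))" using s monoD[OF instanton_mono[OF F m]] by auto
  have q2: "(a * m1 + b * m2)\<^sup>2 \<le> (m (?t (Suc j)) - m (?t j))\<^sup>2"
  proof -
    let ?D = "m (?t (Suc j)) - m (?t j)"
    have "(a * m1 + b * m2)\<^sup>2 \<le> a * m1\<^sup>2 + b * m2\<^sup>2" by (rule power2_convex_combination_le[OF ab])
    also have "\<dots> \<le> a * ?D\<^sup>2 + b * ?D\<^sup>2"
    proof (intro add_mono mult_left_mono ab)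
      show "m1\<^sup>2 \<le> ?D\<^sup>2" "m2\<^sup>2 \<le> ?D\<^sup>2"
        unfolding abs_le_square_iff[symmetric] using mm by (auto simp: m1_def m2_def)
    qed
    also have "\<dots> = ?D\<^sup>2" using ab(3) by (simp flip: distrib_right)
    finally show ?thesis .
  qed
  have q3: "(a * p1 + b * p2)\<^sup>2 \<le> (if j = 0 \<or> j = N - 1 then e else 0)"
  proof -
    have p: "p1\<^sup>2 \<le> (if j = 0 \<or> j = N - 1 then e else 0)" "p2\<^sup>2 \<le> (if j = 0 \<or> j = N - 1 then e else 0)"
      using pinned_minus_instanton[OF F m h(1) N e, of j] pinned_minus_instanton[OF F m h(1) N e, of "Suc j"] j e0
      by (auto simp: p1_def p2_def split: if_splits)
    have "(a * p1 + b * p2)\<^sup>2 \<le> a * p1\<^sup>2 + b * p2\<^sup>2" by (rule power2_convex_combination_le[OF ab])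
    also have "\<dots> \<le> a * (if j = 0 \<or> j = N - 1 then e else 0) + b * (if j = 0 \<or> j = N - 1 then e else 0)"
      by (intro add_mono mult_left_mono ab p)
    also have "\<dots> = (if j = 0 \<or> j = N - 1 then e else 0)" using ab(3) by (simp flip: distrib_right)
    finally show ?thesis .
  qed
  have "(v s - m s)\<^sup>2 \<le> 4 * (R\<^sup>2 + (a * z1 + b * z2)\<^sup>2 + (a * m1 + b * m2)\<^sup>2 + (a * p1 + b * p2)\<^sup>2)"
    unfolding split by (rule power2_sum4_le)
  also have "\<dots> \<le> 4 * (R\<^sup>2 + (\<epsilon> * h + (m (?t (Suc j)) - m (?t j))\<^sup>2 + (if j = 0 \<or> j = N - 1 then e else 0)))"
    using q1 q2 q3 by simp
  finally have sq: "(v s - m s)\<^sup>2 \<le> 4 * (R\<^sup>2 + (\<epsilon> * h + (m (?t (Suc j)) - m (?t j))\<^sup>2 + (if j = 0 \<or> j = N - 1 then e else 0)))" .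
  have ubd: "\<bar>?u x\<bar> \<le> 1" for x using instanton_bounds[OF F m, of x] by (auto simp: pinned_def)
  have "sqrt (\<epsilon> * h) \<le> 1" using h \<epsilon> by simp
  then have v3: "\<bar>v s\<bar> \<le> 3" using z[of j] ubd[of "?t j"] osc j by linarith
  have m3: "\<bar>m s\<bar> \<le> 3" using instanton_bounds[OF F m, of s] by simp
  have "F (v s) \<le> (1 + \<theta>) * F (m s) + (1 + 1 / \<theta>) * \<Lambda>\<^sup>2 / 2 * (v s - m s)\<^sup>2"
    by (rule double_well_perturb_le[OF F lip \<theta> m3 v3])
  also have "\<dots> \<le> (1 + \<theta>) * F (m s) + (1 + 1 / \<theta>) * \<Lambda>\<^sup>2 / 2 *
      (4 * (R\<^sup>2 + (\<epsilon> * h + (m (?t (Suc j)) - m (?t j))\<^sup>2 + (if j = 0 \<or> j = N - 1 then e else 0))))"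
    using sq \<theta> by (intro add_left_mono mult_left_mono) (auto intro: add_nonneg_nonneg)
  also have "(1 + 1 / \<theta>) * \<Lambda>\<^sup>2 / 2 * (4 * x) = 2 * (1 + 1 / \<theta>) * \<Lambda>\<^sup>2 * x" for x by simp
  finally show ?thesis unfolding R_def .
qed

lemma scaled_bridge_energy_nn_integral:
  assumes F: "double_well F" and V: "scaled_bridge \<epsilon> L P V" and w: "w \<in> space P"
  shows "ennreal (integral {-L..L} (\<lambda>s. F (V w s))) = (\<integral>\<^sup>+s. ennreal (F (V w s)) * indicator {-L..L} s \<partial>lborel)"
proof (rule nn_integral_has_integral_lebesgue'[symmetric])
  have "continuous_on UNIV (V w)" using V w by (simp add: scaled_bridge_def)
  then have FV: "continuous_on UNIV (\<lambda>s. F (V w s))"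
    by (rule continuous_on_compose2[OF double_well_continuous[OF F, of UNIV]]) auto
  then show "((\<lambda>s. F (V w s)) has_integral integral {-L..L} (\<lambda>s. F (V w s))) {-L..L}"
    by (intro integrable_integral integrable_continuous_real continuous_on_subset[OF FV subset_UNIV])
qed (rule double_well_nonneg[OF F])

lemma scaled_bridge_energy_measurable:
  assumes F: "double_well F" and V: "scaled_bridge \<epsilon> L P V"
  shows "(\<lambda>w. integral {-L..L} (\<lambda>s. F (V w s))) \<in> borel_measurable P"
proof -
  have [measurable]: "F \<in> borel_measurable borel"
    by (intro borel_measurable_continuous_onI double_well_continuous[OF F])
  note [measurable] = scaled_bridge_joint_measurable[OF V]
  have "(\<lambda>w. enn2real (\<integral>\<^sup>+s. ennreal (F (V w s)) * indicator {-L..L} s \<partial>lborel)) \<in> borel_measurable P"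
    by measurable
  moreover have "integral {-L..L} (\<lambda>s. F (V w s)) = enn2real (\<integral>\<^sup>+s. ennreal (F (V w s)) * indicator {-L..L} s \<partial>lborel)"
    if w: "w \<in> space P" for w
  proof -
    have "continuous_on UNIV (V w)" using V w by (simp add: scaled_bridge_def)
    then have FV: "continuous_on UNIV (\<lambda>s. F (V w s))"
      by (rule continuous_on_compose2[OF double_well_continuous[OF F, of UNIV]]) auto
    then have "0 \<le> integral {-L..L} (\<lambda>s. F (V w s))"
      by (intro integral_nonneg integrable_continuous_real continuous_on_subset[OF FV subset_UNIV] double_well_nonneg[OF F])
    then show ?thesis by (simp flip: scaled_bridge_energy_nn_integral[OF F V w])
  qed
  ultimately show ?thesis by (simp cong: measurable_cong)
qed

text \<open>Tonelli's theorem takes the expectation at a fixed time, where the remainder contributes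
  at most \<open>\<epsilon> * h\<close>. Besides the energy of the instanton, \<open>J\<close>
  contains the remainder and the tube deviation, \<open>2 * \<epsilon> * h\<close> over the length
  \<open>2 * L\<close>; the interpolation error, where one factor of the squared increments
  telescopes; and the two end cells.\<close>

lemma tube_energy_expectation:
  assumes F: "double_well F" and m: "instanton F m" and lip: "\<And>x y. \<bar>drift F x - drift F y\<bar> \<le> \<Lambda> * \<bar>x - y\<bar>"
    and V: "scaled_bridge \<epsilon> L P V" and h: "h > 0" "\<epsilon> * h \<le> 1" and N: "real N * h = 2 * L" "N \<ge> 2" and \<theta>: "\<theta> > 0"
    and e: "(1 + m (-L + h))\<^sup>2 \<le> e" "(1 - m (L - h))\<^sup>2 \<le> e"
    and osc: "\<And>w s t. w \<in> space P - W \<Longrightarrow> -L \<le> s \<Longrightarrow> s \<le> t \<Longrightarrow> t \<le> L \<Longrightarrow> t - s \<le> h \<Longrightarrow> \<bar>V w t - V w s\<bar> \<le> 1"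
  defines "G \<equiv> step_tube P \<epsilon> L h N V (pinned m L)"
    and "J \<equiv> (1 + \<theta>) * (wall_cost F / 2) + 2 * (1 + 1 / \<theta>) * \<Lambda>\<^sup>2 * (4 * L * \<epsilon> * h + 4 * \<Lambda> * h\<^sup>2 + 2 * h * e)"
  shows "(\<integral>\<^sup>+w. ennreal (integral {-L..L} (\<lambda>s. F (V w s))) * indicator (G - W) w \<partial>P) \<le> ennreal J * emeasure P G"
proof -
  interpret prob_space P by (rule scaled_bridge_prob_space[OF V])
  interpret pair_sigma_finite P lborel ..
  have L: "L > 0" "\<epsilon> > 0" using V by (auto simp: scaled_bridge_def)
  let ?t = "unif_grid L h"
  define c where "c = 2 * (1 + 1 / \<theta>) * \<Lambda>\<^sup>2"
  have c: "c \<ge> 0" using \<theta> by (auto simp: c_def intro!: mult_nonneg_nonneg add_nonneg_nonneg)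
  have e0: "e \<ge> 0" using e(1) by (meson order_trans zero_le_power2)
  have \<Lambda>: "\<Lambda> \<ge> 0" using lip[of 0 1] abs_ge_zero[of "drift F 0 - drift F 1"] by simp
  define r where "r j = \<epsilon> * h + (m (?t (Suc j)) - m (?t j))\<^sup>2 + (if j = 0 \<or> j = N - 1 then e else 0)" for j
  have r: "r j \<ge> 0" for j using L h e0 by (auto simp: r_def)
  define B where "B j w s = bridge_remainder L (V w) (?t j) (?t (Suc j)) s" for j w s
  define I where "I j = {?t j..?t (Suc j)}" for j
  have [measurable]: "I j \<in> sets borel" for j by (simp add: I_def)
  have G[measurable]: "G \<in> sets P" unfolding G_def by (rule step_tube_sets[OF V h(1) N(1)])
  have [measurable]: "(\<lambda>x. indicator G (fst x) :: ennreal) \<in> borel_measurable (P \<Otimes>\<^sub>M lborel)"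
    by (intro measurable_compose[OF measurable_fst borel_measurable_indicator] G)
  have [measurable]: "F \<in> borel_measurable borel" "m \<in> borel_measurable borel"
    by (intro borel_measurable_continuous_onI double_well_continuous[OF F])
      (intro borel_measurable_continuous_onI, meson DERIV_isCont continuous_at_imp_continuous_on instanton_ode[OF F m])
  note [measurable] = scaled_bridge_joint_measurable[OF V] scaled_bridge_measurable[OF V]
  have [measurable]: "(\<lambda>(w, s). B j w s) \<in> borel_measurable (P \<Otimes>\<^sub>M lborel)" for j
    unfolding B_def bridge_remainder_def by measurable
  have point: "ennreal (F (V w s)) * indicator {-L..L} s * indicator (G - W) w \<le>
      (ennreal ((1 + \<theta>) * F (m s)) * indicator {-L..L} s + (\<Sum>j<N. ennreal (c * ((B j w s)\<^sup>2 + r j)) * indicator (I j) s)) * indicator G w"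
    if w: "w \<in> space P" "V w (-L) = -1" "V w L = 1" for w s
  proof (cases "s \<in> {-L..L} \<and> w \<in> G - W")
    case True
    obtain j where j: "j < N" "?t j \<le> s" "s \<le> ?t (Suc j)"
      using grid_bracket[of ?t s N] True N unif_grid_last[OF N(1)] by (auto simp: unif_grid_def)
    have "F (V w s) \<le> (1 + \<theta>) * F (m s) + c * ((B j w s)\<^sup>2 + r j)"
      unfolding c_def B_def r_def
    proof (rule tube_path_energy_density[OF F m lip L(2) h N \<theta> e w(2,3) _ j])
      show "\<bar>bridge_step \<epsilon> L (V w) (?t i) (?t (Suc i)) - bridge_step \<epsilon> L (pinned m L) (?t i) (?t (Suc i))\<bar> \<le> 1 / real N"
        if "i < N - 1" for i using True that by (auto simp: G_def step_tube_def)
      show "\<bar>V w s - V w (?t j)\<bar> \<le> 1"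
        using j True w unif_grid_range(1)[OF h(1) N(1), of j] by (intro osc) (auto simp: unif_grid_Suc)
    qed
    then have "ennreal (F (V w s)) \<le> ennreal ((1 + \<theta>) * F (m s) + c * ((B j w s)\<^sup>2 + r j))" by (rule ennreal_leI)
    also have "\<dots> = ennreal ((1 + \<theta>) * F (m s)) + ennreal (c * ((B j w s)\<^sup>2 + r j))"
      using \<theta> c r[of j] double_well_nonneg[OF F, of "m s"] by (intro ennreal_plus mult_nonneg_nonneg) auto
    also have "\<dots> \<le> ennreal ((1 + \<theta>) * F (m s)) + (\<Sum>j<N. ennreal (c * ((B j w s)\<^sup>2 + r j)) * indicator (I j) s)"
    proof (intro add_left_mono)
      have "ennreal (c * ((B j w s)\<^sup>2 + r j)) = ennreal (c * ((B j w s)\<^sup>2 + r j)) * indicator (I j) s"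
        using j by (simp add: I_def)
      also have "\<dots> \<le> (\<Sum>j<N. ennreal (c * ((B j w s)\<^sup>2 + r j)) * indicator (I j) s)"
        using j by (intro member_le_sum) auto
      finally show "ennreal (c * ((B j w s)\<^sup>2 + r j)) \<le> (\<Sum>j<N. ennreal (c * ((B j w s)\<^sup>2 + r j)) * indicator (I j) s)" .
    qed
    finally show ?thesis using True by simp
  qed (auto simp: indicator_def)
  have "(\<integral>\<^sup>+w. ennreal (integral {-L..L} (\<lambda>s. F (V w s))) * indicator (G - W) w \<partial>P) =
     (\<integral>\<^sup>+w. (\<integral>\<^sup>+s. ennreal (F (V w s)) * indicator {-L..L} s * indicator (G - W) w \<partial>lborel) \<partial>P)"
  proof (rule nn_integral_cong)
    fix w assume w: "w \<in> space P"
    have [measurable]: "V w \<in> borel_measurable borel"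
      using V w by (intro borel_measurable_continuous_onI) (simp add: scaled_bridge_def)
    show "ennreal (integral {-L..L} (\<lambda>s. F (V w s))) * indicator (G - W) w =
      (\<integral>\<^sup>+s. ennreal (F (V w s)) * indicator {-L..L} s * indicator (G - W) w \<partial>lborel)"
      unfolding scaled_bridge_energy_nn_integral[OF F V w] by (rule nn_integral_multc[symmetric]) measurable
  qed
  also have "\<dots> \<le> (\<integral>\<^sup>+w. (\<integral>\<^sup>+s. (ennreal ((1 + \<theta>) * F (m s)) * indicator {-L..L} s +
      (\<Sum>j<N. ennreal (c * ((B j w s)\<^sup>2 + r j)) * indicator (I j) s)) * indicator G w \<partial>lborel) \<partial>P)"
  proof (rule nn_integral_mono_AE)
    show "AE w in P. (\<integral>\<^sup>+s. ennreal (F (V w s)) * indicator {-L..L} s * indicator (G - W) w \<partial>lborel) \<le>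
      (\<integral>\<^sup>+s. (ennreal ((1 + \<theta>) * F (m s)) * indicator {-L..L} s +
      (\<Sum>j<N. ennreal (c * ((B j w s)\<^sup>2 + r j)) * indicator (I j) s)) * indicator G w \<partial>lborel)"
      using scaled_bridge_ends[OF V] AE_space
    proof eventually_elim
      case (elim w)
      then show ?case by (intro nn_integral_mono point) auto
    qed
  qed
  also have "\<dots> = (\<integral>\<^sup>+s. (\<integral>\<^sup>+w. (ennreal ((1 + \<theta>) * F (m s)) * indicator {-L..L} s +
      (\<Sum>j<N. ennreal (c * ((B j w s)\<^sup>2 + r j)) * indicator (I j) s)) * indicator G w \<partial>P) \<partial>lborel)"
    by (intro Fubini'[symmetric]) measurable
  also have "\<dots> \<le> (\<integral>\<^sup>+s. (ennreal ((1 + \<theta>) * F (m s)) * indicator {-L..L} s +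
      (\<Sum>j<N. ennreal (c * (\<epsilon> * h + r j)) * indicator (I j) s)) * emeasure P G \<partial>lborel)"
  proof (rule nn_integral_mono)
    fix s :: real
    have Bm[measurable]: "(\<lambda>w. B j w s) \<in> borel_measurable P" for j
      unfolding B_def bridge_remainder_def by measurable
    have "(\<integral>\<^sup>+w. (ennreal ((1 + \<theta>) * F (m s)) * indicator {-L..L} s +
      (\<Sum>j<N. ennreal (c * ((B j w s)\<^sup>2 + r j)) * indicator (I j) s)) * indicator G w \<partial>P) =
      (\<integral>\<^sup>+w. ennreal ((1 + \<theta>) * F (m s)) * indicator {-L..L} s * indicator G w +
      (\<Sum>j<N. ennreal (c * ((B j w s)\<^sup>2 + r j)) * indicator (I j) s * indicator G w) \<partial>P)"
      by (simp only: distrib_right sum_distrib_right)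
    also have "\<dots> = ennreal ((1 + \<theta>) * F (m s)) * indicator {-L..L} s * emeasure P G +
      (\<Sum>j<N. \<integral>\<^sup>+w. ennreal (c * ((B j w s)\<^sup>2 + r j)) * indicator (I j) s * indicator G w \<partial>P)"
    proof -
      have "(\<integral>\<^sup>+w. ennreal ((1 + \<theta>) * F (m s)) * indicator {-L..L} s * indicator G w \<partial>P) =
          ennreal ((1 + \<theta>) * F (m s)) * indicator {-L..L} s * emeasure P G"
        by (rule nn_integral_cmult_indicator[OF G])
      moreover have "(\<integral>\<^sup>+w. (\<Sum>j<N. ennreal (c * ((B j w s)\<^sup>2 + r j)) * indicator (I j) s * indicator G w) \<partial>P) =
          (\<Sum>j<N. \<integral>\<^sup>+w. ennreal (c * ((B j w s)\<^sup>2 + r j)) * indicator (I j) s * indicator G w \<partial>P)"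
        by (rule nn_integral_sum) measurable
      moreover have "(\<integral>\<^sup>+w. ennreal ((1 + \<theta>) * F (m s)) * indicator {-L..L} s * indicator G w +
          (\<Sum>j<N. ennreal (c * ((B j w s)\<^sup>2 + r j)) * indicator (I j) s * indicator G w) \<partial>P) =
        (\<integral>\<^sup>+w. ennreal ((1 + \<theta>) * F (m s)) * indicator {-L..L} s * indicator G w \<partial>P) +
        (\<integral>\<^sup>+w. (\<Sum>j<N. ennreal (c * ((B j w s)\<^sup>2 + r j)) * indicator (I j) s * indicator G w) \<partial>P)"
        by (rule nn_integral_add) measurable
      ultimately show ?thesis by (simp only:)
    qed
    also have "\<dots> \<le> ennreal ((1 + \<theta>) * F (m s)) * indicator {-L..L} s * emeasure P G +
      (\<Sum>j<N. ennreal (c * (\<epsilon> * h + r j)) * indicator (I j) s * emeasure P G)"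
    proof (intro add_left_mono sum_mono)
      fix j assume "j \<in> {..<N}"
      then have j: "j < N" by simp
      show "(\<integral>\<^sup>+w. ennreal (c * ((B j w s)\<^sup>2 + r j)) * indicator (I j) s * indicator G w \<partial>P) \<le>
        ennreal (c * (\<epsilon> * h + r j)) * indicator (I j) s * emeasure P G"
      proof (cases "s \<in> I j")
        case True
        have "(\<integral>\<^sup>+w. ennreal (c * ((B j w s)\<^sup>2 + r j)) * indicator (I j) s * indicator G w \<partial>P) =
          (\<integral>\<^sup>+w. ennreal c * (ennreal ((B j w s)\<^sup>2) * indicator G w + ennreal (r j) * indicator G w) \<partial>P)"
          using True c r[of j] by (intro nn_integral_cong) (simp add: ennreal_mult ennreal_plus distrib_left distrib_right mult.assoc)
        also have "\<dots> = ennreal c * ((\<integral>\<^sup>+w. ennreal ((B j w s)\<^sup>2) * indicator G w \<partial>P) + ennreal (r j) * emeasure P G)"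
          by (subst nn_integral_cmult, measurable, subst nn_integral_add) (auto simp: nn_integral_cmult)
        also have "\<dots> \<le> ennreal c * (ennreal (\<epsilon> * h) * emeasure P G + ennreal (r j) * emeasure P G)"
          using True unfolding B_def G_def I_def
          by (intro mult_left_mono add_right_mono step_tube_remainder_second_moment[OF V h(1) N(1) j]) auto
        also have "\<dots> = ennreal (c * (\<epsilon> * h + r j)) * emeasure P G"
          using c r[of j] L h by (simp add: ennreal_mult ennreal_plus distrib_left distrib_right mult.assoc)
        finally show ?thesis using True by simp
      qed simp
    qed
    also have "\<dots> = (ennreal ((1 + \<theta>) * F (m s)) * indicator {-L..L} s +
      (\<Sum>j<N. ennreal (c * (\<epsilon> * h + r j)) * indicator (I j) s)) * emeasure P G"
      by (simp only: distrib_right sum_distrib_right)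
    finally show "(\<integral>\<^sup>+w. (ennreal ((1 + \<theta>) * F (m s)) * indicator {-L..L} s +
      (\<Sum>j<N. ennreal (c * ((B j w s)\<^sup>2 + r j)) * indicator (I j) s)) * indicator G w \<partial>P) \<le>
      (ennreal ((1 + \<theta>) * F (m s)) * indicator {-L..L} s +
      (\<Sum>j<N. ennreal (c * (\<epsilon> * h + r j)) * indicator (I j) s)) * emeasure P G" .
  qed
  also have "\<dots> = ((\<integral>\<^sup>+s. ennreal ((1 + \<theta>) * F (m s)) * indicator {-L..L} s \<partial>lborel) +
      (\<Sum>j<N. \<integral>\<^sup>+s. ennreal (c * (\<epsilon> * h + r j)) * indicator (I j) s \<partial>lborel)) * emeasure P G"
  proof -
    have "(\<integral>\<^sup>+s. (\<Sum>j<N. ennreal (c * (\<epsilon> * h + r j)) * indicator (I j) s) \<partial>lborel) =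
        (\<Sum>j<N. \<integral>\<^sup>+s. ennreal (c * (\<epsilon> * h + r j)) * indicator (I j) s \<partial>lborel)"
      by (rule nn_integral_sum) measurable
    moreover have "(\<integral>\<^sup>+s. ennreal ((1 + \<theta>) * F (m s)) * indicator {-L..L} s + (\<Sum>j<N. ennreal (c * (\<epsilon> * h + r j)) * indicator (I j) s) \<partial>lborel) =
      (\<integral>\<^sup>+s. ennreal ((1 + \<theta>) * F (m s)) * indicator {-L..L} s \<partial>lborel) +
      (\<integral>\<^sup>+s. (\<Sum>j<N. ennreal (c * (\<epsilon> * h + r j)) * indicator (I j) s) \<partial>lborel)"
      by (rule nn_integral_add) measurable
    moreover have "(\<integral>\<^sup>+s. (ennreal ((1 + \<theta>) * F (m s)) * indicator {-L..L} s +
        (\<Sum>j<N. ennreal (c * (\<epsilon> * h + r j)) * indicator (I j) s)) * emeasure P G \<partial>lborel) =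
      (\<integral>\<^sup>+s. ennreal ((1 + \<theta>) * F (m s)) * indicator {-L..L} s + (\<Sum>j<N. ennreal (c * (\<epsilon> * h + r j)) * indicator (I j) s) \<partial>lborel) * emeasure P G"
      by (rule nn_integral_multc) measurable
    ultimately show ?thesis by (simp only:)
  qed
  also have "\<dots> \<le> ennreal J * emeasure P G"
  proof (intro mult_right_mono)
    have mc: "continuous_on UNIV (\<lambda>s. F (m s))"
      by (rule continuous_on_compose2[OF double_well_continuous[OF F, of UNIV]])
        (use instanton_ode[OF F m] in \<open>auto intro!: continuous_at_imp_continuous_on DERIV_isCont\<close>)
    have A: "(\<integral>\<^sup>+s. ennreal ((1 + \<theta>) * F (m s)) * indicator {-L..L} s \<partial>lborel) \<le> ennreal ((1 + \<theta>) * (wall_cost F / 2))"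
    proof -
      have "((\<lambda>s. (1 + \<theta>) * F (m s)) has_integral (1 + \<theta>) * integral {-L..L} (\<lambda>s. F (m s))) {-L..L}"
        by (intro has_integral_mult_right integrable_integral integrable_continuous_real continuous_on_subset[OF mc]) auto
      then have "(\<integral>\<^sup>+s. ennreal ((1 + \<theta>) * F (m s)) * indicator {-L..L} s \<partial>lborel) = ennreal ((1 + \<theta>) * integral {-L..L} (\<lambda>s. F (m s)))"
        using \<theta> double_well_nonneg[OF F] by (intro nn_integral_has_integral_lebesgue') auto
      also have "\<dots> \<le> ennreal ((1 + \<theta>) * (wall_cost F / 2))"
        using \<theta> instanton_potential_energy[OF F m, of L] L by (intro ennreal_leI mult_left_mono) auto
      finally show ?thesis .
    qed
    have S: "(\<Sum>j<N. \<integral>\<^sup>+s. ennreal (c * (\<epsilon> * h + r j)) * indicator (I j) s \<partial>lborel) \<le>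
        ennreal (c * (4 * L * \<epsilon> * h + 4 * \<Lambda> * h\<^sup>2 + 2 * h * e))"
    proof -
      have "(\<integral>\<^sup>+s. ennreal (c * (\<epsilon> * h + r j)) * indicator (I j) s \<partial>lborel) = ennreal (c * (h * (\<epsilon> * h + r j)))" for j
      proof -
        have "(\<integral>\<^sup>+s. ennreal (c * (\<epsilon> * h + r j)) * indicator (I j) s \<partial>lborel) = ennreal (c * (\<epsilon> * h + r j)) * ennreal h"
          using h by (simp add: I_def nn_integral_cmult unif_grid_Suc)
        also have "\<dots> = ennreal (c * (\<epsilon> * h + r j) * h)" using c r[of j] L h by (intro ennreal_mult[symmetric]) auto
        finally show ?thesis by (simp add: mult_ac)
      qed
      then have "(\<Sum>j<N. \<integral>\<^sup>+s. ennreal (c * (\<epsilon> * h + r j)) * indicator (I j) s \<partial>lborel) = (\<Sum>j<N. ennreal (c * (h * (\<epsilon> * h + r j))))"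
        by simp
      also have "\<dots> = ennreal (\<Sum>j<N. c * (h * (\<epsilon> * h + r j)))"
        using c r L h by (intro sum_ennreal) auto
      also have "(\<Sum>j<N. c * (h * (\<epsilon> * h + r j))) = c * (h * (\<Sum>j<N. \<epsilon> * h + r j))"
        by (simp only: sum_distrib_left)
      also have "ennreal \<dots> \<le> ennreal (c * (4 * L * \<epsilon> * h + 4 * \<Lambda> * h\<^sup>2 + 2 * h * e))"
      proof (intro ennreal_leI mult_left_mono c)
        have D: "(\<Sum>j<N. (m (?t (Suc j)) - m (?t j))\<^sup>2) \<le> 4 * \<Lambda> * h"
        proof -
          have "(\<Sum>j<N. (m (?t (Suc j)) - m (?t j))\<^sup>2) \<le> (\<Sum>j<N. 2 * \<Lambda> * h * (m (?t (Suc j)) - m (?t j)))"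
          proof (rule sum_mono)
            fix j
            have "0 \<le> m (?t (Suc j)) - m (?t j)"
              using monoD[OF instanton_mono[OF F m], of "?t j" "?t (Suc j)"] h by (simp add: unif_grid_Suc)
            moreover have "m (?t (Suc j)) - m (?t j) \<le> 2 * \<Lambda> * h"
              using drift_instanton_lipschitz[OF F m lip, of "?t (Suc j)" "?t j"] h by (simp add: unif_grid_Suc)
            ultimately show "(m (?t (Suc j)) - m (?t j))\<^sup>2 \<le> 2 * \<Lambda> * h * (m (?t (Suc j)) - m (?t j))"
              unfolding power2_eq_square by (intro mult_right_mono)
          qed
          also have "\<dots> = 2 * \<Lambda> * h * (m (?t N) - m (?t 0))"
            by (simp only: sum_distrib_left[symmetric] sum_lessThan_telescope[of "\<lambda>j. m (?t j)"])
          also have "\<dots> \<le> 2 * \<Lambda> * h * 2"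
            using instanton_bounds[OF F m, of "?t N"] instanton_bounds[OF F m, of "?t 0"] \<Lambda> h by (intro mult_left_mono) auto
          finally show ?thesis by simp
        qed
        have E: "(\<Sum>j<N. if j = 0 \<or> j = N - 1 then e else 0) \<le> 2 * e"
        proof -
          have "(\<Sum>j<N. if j = 0 \<or> j = N - 1 then e else 0) \<le> (\<Sum>j<N. (if j = 0 then e else 0) + (if j = N - 1 then e else 0))"
            using e0 by (intro sum_mono) auto
          also have "\<dots> = 2 * e" using N(2) by (simp add: sum.distrib)
          finally show ?thesis .
        qed
        have "(\<Sum>j<N. \<epsilon> * h + r j) = real N * (2 * (\<epsilon> * h)) + (\<Sum>j<N. (m (?t (Suc j)) - m (?t j))\<^sup>2) + (\<Sum>j<N. if j = 0 \<or> j = N - 1 then e else 0)"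
          by (simp add: r_def sum.distrib)
        also have "\<dots> \<le> real N * (2 * (\<epsilon> * h)) + 4 * \<Lambda> * h + 2 * e" using D E by simp
        finally have "h * (\<Sum>j<N. \<epsilon> * h + r j) \<le> h * (real N * (2 * (\<epsilon> * h)) + 4 * \<Lambda> * h + 2 * e)"
          using h by (intro mult_left_mono) auto
        also have "\<dots> = (real N * h) * (2 * (\<epsilon> * h)) + 4 * \<Lambda> * h\<^sup>2 + 2 * h * e"
          by (simp add: algebra_simps power2_eq_square)
        also have "\<dots> = 4 * L * \<epsilon> * h + 4 * \<Lambda> * h\<^sup>2 + 2 * h * e" unfolding N(1) by simp
        finally show "h * (\<Sum>j<N. \<epsilon> * h + r j) \<le> 4 * L * \<epsilon> * h + 4 * \<Lambda> * h\<^sup>2 + 2 * h * e" .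
      qed
      finally show ?thesis .
    qed
    have "ennreal J = ennreal ((1 + \<theta>) * (wall_cost F / 2)) + ennreal (c * (4 * L * \<epsilon> * h + 4 * \<Lambda> * h\<^sup>2 + 2 * h * e))"
      unfolding J_def c_def[symmetric] using \<theta> wall_cost_nonneg[OF F] c \<Lambda> L h e0
      by (intro ennreal_plus mult_nonneg_nonneg add_nonneg_nonneg) auto
    then show "(\<integral>\<^sup>+s. ennreal ((1 + \<theta>) * F (m s)) * indicator {-L..L} s \<partial>lborel) +
      (\<Sum>j<N. \<integral>\<^sup>+s. ennreal (c * (\<epsilon> * h + r j)) * indicator (I j) s \<partial>lborel) \<le> ennreal J"
      using A S by (simp add: add_mono)
  qed simp
  finally show ?thesis .
qed

text \<open>Jensen's inequality for \<open>exp\<close> on the event \<open>D\<close>, in a form free of subtraction.\<close>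

lemma (in prob_space) exp_neg_integral_ge_on_event:
  assumes D: "D \<in> events" and E[measurable]: "E \<in> borel_measurable M" and E0: "\<And>w. w \<in> space M \<Longrightarrow> E w \<ge> 0"
    and \<mu>: "\<mu> \<ge> 0" and le: "(\<integral>\<^sup>+w. ennreal (E w) * indicator D w \<partial>M) \<le> ennreal \<mu> * emeasure M D"
  shows "ennreal (exp (- \<mu>)) * emeasure M D \<le> (\<integral>\<^sup>+w. ennreal (exp (- E w)) \<partial>M)"
proof -
  note [measurable] = D
  let ?p = "emeasure M D"
  have "ennreal (exp (- \<mu>)) * ennreal \<mu> * ?p + ennreal (exp (- \<mu>)) * ?p = (\<integral>\<^sup>+w. ennreal (exp (- \<mu>) * (1 + \<mu>)) * indicator D w \<partial>M)"
  proof -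
    have "ennreal (exp (- \<mu>) * (1 + \<mu>)) = ennreal (exp (- \<mu>)) * ennreal \<mu> + ennreal (exp (- \<mu>))"
      using \<mu> by (simp add: distrib_left add.commute flip: ennreal_mult ennreal_plus)
    then show ?thesis unfolding nn_integral_cmult_indicator[OF D] by (simp only: distrib_right)
  qed
  also have "\<dots> \<le> (\<integral>\<^sup>+w. ennreal (exp (- E w)) + ennreal (exp (- \<mu>)) * (ennreal (E w) * indicator D w) \<partial>M)"
  proof (rule nn_integral_mono)
    fix w assume w: "w \<in> space M"
    have "exp (- \<mu>) * (1 + (\<mu> - E w)) \<le> exp (- \<mu>) * exp (\<mu> - E w)"
      by (intro mult_left_mono exp_ge_add_one_self) auto
    also have "\<dots> = exp (- E w)" by (simp flip: exp_add)
    finally have "exp (- \<mu>) * (1 + \<mu>) \<le> exp (- E w) + exp (- \<mu>) * E w" by (simp add: algebra_simps)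
    then have "ennreal (exp (- \<mu>) * (1 + \<mu>)) \<le> ennreal (exp (- E w)) + ennreal (exp (- \<mu>)) * ennreal (E w)"
      using E0[OF w] by (simp flip: ennreal_mult ennreal_plus)
    then show "ennreal (exp (- \<mu>) * (1 + \<mu>)) * indicator D w \<le> ennreal (exp (- E w)) + ennreal (exp (- \<mu>)) * (ennreal (E w) * indicator D w)"
      by (simp add: indicator_def)
  qed
  also have "\<dots> = (\<integral>\<^sup>+w. ennreal (exp (- E w)) \<partial>M) + ennreal (exp (- \<mu>)) * (\<integral>\<^sup>+w. ennreal (E w) * indicator D w \<partial>M)"
    by (subst nn_integral_add) (auto simp: nn_integral_cmult)
  also have "\<dots> \<le> (\<integral>\<^sup>+w. ennreal (exp (- E w)) \<partial>M) + ennreal (exp (- \<mu>)) * (ennreal \<mu> * ?p)"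
    using le by (intro add_left_mono mult_left_mono) auto
  finally have "ennreal (exp (- \<mu>)) * ennreal \<mu> * ?p + ennreal (exp (- \<mu>)) * ?p \<le>
     ennreal (exp (- \<mu>)) * ennreal \<mu> * ?p + (\<integral>\<^sup>+w. ennreal (exp (- E w)) \<partial>M)"
    by (simp add: mult.assoc add.commute)
  moreover have "ennreal (exp (- \<mu>)) * ennreal \<mu> * ?p \<noteq> \<top>"
    by (simp add: ennreal_mult_eq_top_iff emeasure_eq_measure)
  ultimately show ?thesis by (simp add: ennreal_add_left_cancel_le)
qed

text \<open>Jensen's inequality is applied on the tube without the event \<open>U\<close> of large
  oscillations. By \<open>W\<close> this event takes at most the fraction
  \<open>\<theta> / 2\<close> of the tube, so an energy bound relative to the tube holds relative to
  \<open>D\<close> up to the factor \<open>1 + \<theta>\<close>, as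
  \<open>(1 + \<theta>) * (1 - \<theta> / 2)\<close> is at least 1.\<close>

lemma partition_function_ge:
  assumes F: "double_well F" and m: "instanton F m" and lip: "\<And>x y. \<bar>drift F x - drift F y\<bar> \<le> \<Lambda> * \<bar>x - y\<bar>"
    and V: "scaled_bridge \<epsilon> L P V" and h: "h > 0" "\<epsilon> * h \<le> 1" and N: "real N * h = 2 * L" "N \<ge> 2" and \<theta>: "\<theta> > 0" "\<theta> \<le> 1"
    and e: "(1 + m (-L + h))\<^sup>2 \<le> e" "(1 - m (L - h))\<^sup>2 \<le> e"
    and \<rho>: "\<rho> > 0" "\<rho>\<^sup>2 / (32 * \<epsilon> * h) \<ge> 12" "3 * (\<rho> + h / L) \<le> 1"
    and g: "0 < g" "g \<le> (1 / (2 * real N)) ^ N * exp (- ((1 + \<theta>) * (wall_cost F / 2 + 2 * \<Lambda>\<^sup>2 * h + e / h) / \<epsilon>) - (1 + 1 / \<theta>) / 2)"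
    and W: "4 * real N * exp (- \<rho>\<^sup>2 / (32 * \<epsilon> * h)) \<le> \<theta> / 2 * g"
  defines "J \<equiv> (1 + \<theta>) * (wall_cost F / 2) + 2 * (1 + 1 / \<theta>) * \<Lambda>\<^sup>2 * (4 * L * \<epsilon> * h + 4 * \<Lambda> * h\<^sup>2 + 2 * h * e)"
  shows "ennreal (exp (- ((1 + \<theta>) * J / \<epsilon>)) * (g / 2)) \<le>
     (\<integral>\<^sup>+w. ennreal (exp (- (1 / \<epsilon>) * integral {-L..L} (\<lambda>s. F (V w s)))) \<partial>P)"
proof -
  interpret prob_space P by (rule scaled_bridge_prob_space[OF V])
  have L: "L > 0" "\<epsilon> > 0" using V by (auto simp: scaled_bridge_def)
  have e0: "e \<ge> 0" using e(1) by (meson order_trans zero_le_power2)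
  have \<Lambda>: "\<Lambda> \<ge> 0" using lip[of 0 1] abs_ge_zero[of "drift F 0 - drift F 1"] by simp
  have hN: "h = 2 * L / real N" using N by (simp add: field_simps)
  have J: "J \<ge> 0"
    unfolding J_def using \<theta> wall_cost_nonneg[OF F] \<Lambda> L h e0 by (intro add_nonneg_nonneg mult_nonneg_nonneg) auto
  have N0: "N > 0" using N by simp
  obtain U where U: "U \<in> sets P" "measure P U \<le> 4 * real N * exp (- \<rho>\<^sup>2 / (32 * \<epsilon> * h))"
    "\<And>w s t. w \<in> space P - U \<Longrightarrow> -L \<le> s \<Longrightarrow> s \<le> t \<Longrightarrow> t \<le> L \<Longrightarrow> t - s \<le> h \<Longrightarrow> \<bar>V w t - V w s\<bar> \<le> 3 * (\<rho> + h / L)"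
    using bridge_modulus_event[OF V N0 hN \<rho>(1,2)] by blast
  define G where "G = step_tube P \<epsilon> L h N V (pinned m L)"
  have G: "G \<in> sets P" unfolding G_def by (rule step_tube_sets[OF V h(1) N(1)])
  have PG: "measure P G \<ge> g"
  proof -
    have "g \<le> (1 / (2 * real N)) ^ N * exp (- ((1 + \<theta>) * (wall_cost F / 2 + 2 * \<Lambda>\<^sup>2 * h + e / h) / \<epsilon>) - (1 + 1 / \<theta>) / 2)" by (rule g(2))
    also have "\<dots> \<le> measure P G"
      unfolding G_def using L
      by (intro step_tube_measure_ge[OF V h(1) N \<theta>(1)] pinned_grid_kinetic[OF F m lip h(1) N e]) (auto simp: pinned_def)
    finally show ?thesis .
  qed
  define D where "D = G - U"
  have D: "D \<in> sets P" using G U by (auto simp: D_def)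
  have PD: "measure P G \<le> (1 + \<theta>) * measure P D" "g / 2 \<le> measure P D"
  proof -
    have "measure P G \<le> measure P D + measure P U"
      using measure_Un_le[OF D U(1)] finite_measure_mono[of G "D \<union> U"] D U(1) G by (auto simp: D_def)
    moreover have "measure P U \<le> \<theta> / 2 * measure P G"
      using U(2) W PG \<theta> mult_left_mono[of g "measure P G" "\<theta> / 2"] by linarith
    ultimately have 1: "(1 - \<theta> / 2) * measure P G \<le> measure P D" by (simp add: algebra_simps)
    have "1 * measure P G \<le> ((1 + \<theta>) * (1 - \<theta> / 2)) * measure P G"
    proof (intro mult_right_mono)
      have "0 \<le> \<theta> * (1 - \<theta>)" using \<theta> by (intro mult_nonneg_nonneg) auto
      then show "1 \<le> (1 + \<theta>) * (1 - \<theta> / 2)" by (simp add: algebra_simps)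
    qed simp
    also have "\<dots> = (1 + \<theta>) * ((1 - \<theta> / 2) * measure P G)" by simp
    also have "\<dots> \<le> (1 + \<theta>) * measure P D" using 1 \<theta> by (intro mult_left_mono) auto
    finally show "measure P G \<le> (1 + \<theta>) * measure P D" by simp
    have "1 / 2 * g \<le> (1 - \<theta> / 2) * measure P G" using PG \<theta> g by (intro mult_mono) auto
    then show "g / 2 \<le> measure P D" using 1 by simp
  qed
  define E where "E w = (1 / \<epsilon>) * integral {-L..L} (\<lambda>s. F (V w s))" for w
  have Em: "E \<in> borel_measurable P"
    unfolding E_def using scaled_bridge_energy_measurable[OF F V] by measurable
  have E0: "E w \<ge> 0" if w: "w \<in> space P" for w
  proof -
    have "continuous_on UNIV (V w)" using V w by (simp add: scaled_bridge_def)
    then have FV: "continuous_on UNIV (\<lambda>s. F (V w s))"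
      by (rule continuous_on_compose2[OF double_well_continuous[OF F, of UNIV]]) auto
    then have "0 \<le> integral {-L..L} (\<lambda>s. F (V w s))"
      by (intro integral_nonneg integrable_continuous_real continuous_on_subset[OF FV subset_UNIV] double_well_nonneg[OF F])
    then show ?thesis using L by (simp add: E_def)
  qed
  have "(\<integral>\<^sup>+w. ennreal (E w) * indicator D w \<partial>P) = (\<integral>\<^sup>+w. ennreal (1 / \<epsilon>) * (ennreal (integral {-L..L} (\<lambda>s. F (V w s))) * indicator D w) \<partial>P)"
  proof (rule nn_integral_cong)
    fix w assume w: "w \<in> space P"
    have "0 \<le> integral {-L..L} (\<lambda>s. F (V w s))" using E0[OF w] L by (simp add: E_def zero_le_divide_iff)
    then show "ennreal (E w) * indicator D w = ennreal (1 / \<epsilon>) * (ennreal (integral {-L..L} (\<lambda>s. F (V w s))) * indicator D w)"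
      using L unfolding E_def by (subst ennreal_mult) (auto simp: mult.assoc)
  qed
  also have "\<dots> = ennreal (1 / \<epsilon>) * (\<integral>\<^sup>+w. ennreal (integral {-L..L} (\<lambda>s. F (V w s))) * indicator D w \<partial>P)"
    using D scaled_bridge_energy_measurable[OF F V] by (intro nn_integral_cmult) auto
  also have "\<dots> \<le> ennreal (1 / \<epsilon>) * (ennreal J * emeasure P G)"
    unfolding D_def G_def J_def using U(3) \<rho>(3)
    by (intro mult_left_mono tube_energy_expectation[OF F m lip V h N \<theta>(1) e]) (auto intro: order_trans)
  also have "\<dots> \<le> ennreal (1 / \<epsilon>) * (ennreal J * (ennreal (1 + \<theta>) * emeasure P D))"
  proof (intro mult_left_mono)
    have "ennreal (measure P G) \<le> ennreal ((1 + \<theta>) * measure P D)" by (rule ennreal_leI[OF PD(1)])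
    also have "\<dots> = ennreal (1 + \<theta>) * ennreal (measure P D)" using \<theta> by (intro ennreal_mult) auto
    finally show "emeasure P G \<le> ennreal (1 + \<theta>) * emeasure P D" by (simp only: emeasure_eq_measure)
  qed auto
  also have "\<dots> = ennreal ((1 + \<theta>) * J / \<epsilon>) * emeasure P D"
  proof -
    have a: "ennreal J * ennreal (1 + \<theta>) = ennreal (J * (1 + \<theta>))"
      using J \<theta> by (intro ennreal_mult[symmetric]) auto
    have b: "ennreal (1 / \<epsilon>) * ennreal (J * (1 + \<theta>)) = ennreal (1 / \<epsilon> * (J * (1 + \<theta>)))"
      using J \<theta> L by (intro ennreal_mult[symmetric]) auto
    have c: "(1 + \<theta>) * J / \<epsilon> = 1 / \<epsilon> * (J * (1 + \<theta>))" by simp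
    show ?thesis unfolding c b[symmetric] a[symmetric] by (simp only: mult.assoc)
  qed
  finally have "ennreal (exp (- ((1 + \<theta>) * J / \<epsilon>))) * emeasure P D \<le> (\<integral>\<^sup>+w. ennreal (exp (- E w)) \<partial>P)"
    using J \<theta> L by (intro exp_neg_integral_ge_on_event[OF D Em E0]) auto
  moreover have "ennreal (exp (- ((1 + \<theta>) * J / \<epsilon>)) * (g / 2)) \<le> ennreal (exp (- ((1 + \<theta>) * J / \<epsilon>))) * emeasure P D"
  proof -
    have "ennreal (exp (- ((1 + \<theta>) * J / \<epsilon>)) * (g / 2)) \<le> ennreal (exp (- ((1 + \<theta>) * J / \<epsilon>)) * measure P D)"
      using PD(2) by (intro ennreal_leI mult_left_mono) auto
    also have "\<dots> = ennreal (exp (- ((1 + \<theta>) * J / \<epsilon>))) * ennreal (measure P D)"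
      by (intro ennreal_mult) auto
    finally show ?thesis by (simp only: emeasure_eq_measure)
  qed
  ultimately have "ennreal (exp (- ((1 + \<theta>) * J / \<epsilon>)) * (g / 2)) \<le> (\<integral>\<^sup>+w. ennreal (exp (- E w)) \<partial>P)"
    by (rule order_trans[rotated])
  then show ?thesis unfolding E_def minus_mult_left .
qed

text \<open>Half of the wall cost appears as the kinetic cost \<open>K\<close> of the tube, the
  other half as the mean energy \<open>J\<close> in the tube. The radius of the tube adds
  \<open>\<epsilon> * N * ln (2 * N)\<close>, which explains the limit with the logarithm.\<close>

lemma partition_function_eventually:
  fixes V :: "real \<Rightarrow> 'w \<Rightarrow> real \<Rightarrow> real"
  assumes F: "double_well F" and m: "instanton F m"
    and L: "filterlim L at_top (at_right 0)" "((\<lambda>\<epsilon>. \<epsilon> * L \<epsilon>) \<longlongrightarrow> 0) (at_right 0)"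
      "((\<lambda>\<epsilon>. \<epsilon> * (L \<epsilon> * ln (L \<epsilon>))) \<longlongrightarrow> 0) (at_right 0)"
    and V: "\<And>\<epsilon>. \<epsilon> > 0 \<Longrightarrow> scaled_bridge \<epsilon> (L \<epsilon>) (P \<epsilon>) (V \<epsilon>)" and \<kappa>: "\<kappa> > 0"
  shows "\<forall>\<^sub>F \<epsilon> in at_right 0. ennreal (exp (- (wall_cost F + \<kappa>) / \<epsilon>)) \<le>
     (\<integral>\<^sup>+w. ennreal (exp (- (1 / \<epsilon>) * integral {-L \<epsilon>..L \<epsilon>} (\<lambda>s. F (V \<epsilon> w s)))) \<partial>P \<epsilon>)"
proof -
  obtain \<Lambda> where \<Lambda>: "\<Lambda> > 0" "\<And>x y. \<bar>drift F x - drift F y\<bar> \<le> \<Lambda> * \<bar>x - y\<bar>"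
    using drift_lipschitz[OF F] by blast
  define w where "w = wall_cost F"
  have w: "w \<ge> 0" using wall_cost_nonneg[OF F] by (simp add: w_def)
  \<comment> \<open>The two halves of \<open>w\<close> are multiplied by \<open>1 + \<theta>\<close>
    and by its square, which together adds at most \<open>2 * \<theta> * w\<close>.\<close>
  define \<theta> where "\<theta> = min 1 (\<kappa> / (16 * (w + 1)))"
  have \<theta>: "0 < \<theta>" "\<theta> \<le> 1" "2 * \<theta> * w \<le> \<kappa> / 8"
  proof -
    show "0 < \<theta>" "\<theta> \<le> 1" using \<kappa> w by (auto simp: \<theta>_def)
    have "2 * \<theta> * w \<le> 2 * (\<kappa> / (16 * (w + 1))) * (w + 1)" using w \<kappa> by (intro mult_mono) (auto simp: \<theta>_def)
    also have "\<dots> = \<kappa> / 8"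
    proof -
      have "2 * (\<kappa> / (16 * x)) * x = \<kappa> / 8" if "x > 0" for x using that by simp
      from this[of "w + 1"] show ?thesis using w by linarith
    qed
    finally show "2 * \<theta> * w \<le> \<kappa> / 8" .
  qed
  define c where "c = 2 * (1 + 1 / \<theta>) * \<Lambda>\<^sup>2"
  have c: "c > 0" using \<theta> \<Lambda> by (auto simp: c_def intro!: mult_pos_pos add_pos_pos)
  \<comment> \<open>Collects the coefficients of \<open>h\<close> in \<open>K\<close> and
    \<open>J\<close>, using \<open>h^2 \<le> h\<close>.\<close>
  define a where "a = 2 * \<Lambda>\<^sup>2 + 4 * c * \<Lambda>"
  have a: "a > 0" using \<Lambda> c by (auto simp: a_def intro!: add_pos_pos)
  \<comment> \<open>In this order: the oscillation bound \<open>3 * (1 / 6 + h / L)\<close> at most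
    1; the discretisation errors; a chaining exponent of at least
    \<open>(w + \<kappa> + 1) / \<epsilon>\<close> for \<open>\<rho> = 1 / 6\<close>, where
    \<open>1152 = 32 * 6^2\<close>.\<close>
  define h1 where "h1 = Min {1 / 6, \<kappa> / (16 * a), 1 / (1152 * (w + \<kappa> + 1))}"
  have h1: "h1 > 0" "h1 \<le> 1 / 6" "h1 \<le> \<kappa> / (16 * a)" "h1 \<le> 1 / (1152 * (w + \<kappa> + 1))"
    using \<kappa> a w by (auto simp: h1_def)
  \<comment> \<open>\<open>q\<close> bounds the coefficient of \<open>e\<close> in
    \<open>K + J\<close>, as rounding leaves \<open>h \<ge> h1 / 2\<close>. Choosing
    \<open>e\<close> after \<open>h1\<close> fixes, independently of \<open>\<epsilon>\<close>, the
    times at which the instanton is close enough to the wells.\<close>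
  define q where "q = 2 / h1 + 2 * c"
  have q: "q > 0" using h1 c by (auto simp: q_def intro!: add_pos_pos)
  define e where "e = \<kappa> / (16 * q)"
  have e: "e > 0" using \<kappa> q by (simp add: e_def)
  \<comment> \<open>The constants that are not multiplied by \<open>1 / \<epsilon>\<close>: the
    radius term of the tube probability and the factor \<open>1 / 2\<close> in
    \<open>g / 2\<close>.\<close>
  define B where "B = (1 + 1 / \<theta>) / 2 + ln 2"
  have B: "B > 0" using \<theta> by (auto simp: B_def intro!: add_pos_pos)
  obtain T where T: "T \<ge> 0" "\<And>s. s \<ge> T \<Longrightarrow> m s > 1 - sqrt e"
    using instanton_eventually_near_one[OF m, of "sqrt e"] e by auto
  obtain T' where T': "T' \<ge> 0" "\<And>s. s \<ge> T' \<Longrightarrow> - m (- s) > 1 - sqrt e"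
    using instanton_eventually_near_one[OF instanton_reflect[OF F m], of "sqrt e"] e by auto
  have ev1: "\<forall>\<^sub>F \<epsilon> in at_right 0. L \<epsilon> \<ge> max 1 (max (T + 1) (T' + 1))"
    using L(1) unfolding filterlim_at_top by blast
  have ev2: "\<forall>\<^sub>F \<epsilon> in at_right 0. \<epsilon> * L \<epsilon> < min (\<kappa> / (64 * c)) (\<theta> * h1 / 32)"
    using \<kappa> c \<theta> h1 by (intro order_tendstoD(2)[OF L(2)]) auto
  have ev3: "\<forall>\<^sub>F \<epsilon> in at_right 0. 4 / h1 * (\<epsilon> * (L \<epsilon> * ln (L \<epsilon>)) + ln (8 / h1) * (\<epsilon> * L \<epsilon>)) < \<kappa> / 8"
  proof (rule order_tendstoD(2))
    show "((\<lambda>\<epsilon>. 4 / h1 * (\<epsilon> * (L \<epsilon> * ln (L \<epsilon>)) + ln (8 / h1) * (\<epsilon> * L \<epsilon>))) \<longlongrightarrow> 4 / h1 * (0 + ln (8 / h1) * 0)) (at_right 0)"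
      by (intro tendsto_intros L)
  qed (use \<kappa> in auto)
  have ev4: "\<forall>\<^sub>F \<epsilon> in at_right (0::real). 0 < \<epsilon> \<and> \<epsilon> < min (1 / 12) (\<kappa> / (8 * B))"
    using \<kappa> B by (intro eventually_conj eventually_at_right_less eventually_at_rightI[of 0 "min (1 / 12) (\<kappa> / (8 * B))"]) auto
  show ?thesis
    using ev1 ev2 ev3 ev4
  proof eventually_elim
    fix \<epsilon> assume e1: "L \<epsilon> \<ge> max 1 (max (T + 1) (T' + 1))" and e2: "\<epsilon> * L \<epsilon> < min (\<kappa> / (64 * c)) (\<theta> * h1 / 32)"
      and e3: "4 / h1 * (\<epsilon> * (L \<epsilon> * ln (L \<epsilon>)) + ln (8 / h1) * (\<epsilon> * L \<epsilon>)) < \<kappa> / 8"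
      and e4: "0 < \<epsilon> \<and> \<epsilon> < min (1 / 12) (\<kappa> / (8 * B))"
    have \<epsilon>: "0 < \<epsilon>" "\<epsilon> < 1 / 12" "\<epsilon> * B < \<kappa> / 8"
    proof -
      have "\<epsilon> < \<kappa> / (8 * B)" using e4 by simp
      then have "\<epsilon> * (8 * B) < \<kappa>" using B by (simp only: pos_less_divide_eq mult_pos_pos zero_less_numeral)
      then show "\<epsilon> * B < \<kappa> / 8" by simp
    qed (use e4 in auto)
    have Lp: "L \<epsilon> \<ge> 1" "L \<epsilon> \<ge> T + 1" "L \<epsilon> \<ge> T' + 1" using e1 by auto
    define N where "N = nat \<lceil>2 * L \<epsilon> / h1\<rceil>"
    define h where "h = 2 * L \<epsilon> / real N"
    have q12: "2 * L \<epsilon> / h1 \<ge> 12"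
    proof -
      have "12 * h1 \<le> 2 * L \<epsilon>" using h1 Lp by linarith
      then show ?thesis using h1(1) by (simp add: pos_le_divide_eq)
    qed
    have nr: "2 * L \<epsilon> / h1 \<le> real N" "real N \<le> 2 * L \<epsilon> / h1 + 1"
      using q12 unfolding N_def by linarith+
    have N2: "N \<ge> 2" using nr(1) q12 by linarith
    have n4: "real N \<le> 4 * L \<epsilon> / h1" using nr q12 by linarith
    have Nh: "real N * h = 2 * L \<epsilon>" using N2 by (simp add: h_def)
    have h: "h > 0" "h \<le> h1" "1 / h \<le> 2 / h1"
    proof -
      show h0: "h > 0" using N2 Lp by (simp add: h_def)
      have "2 * L \<epsilon> \<le> real N * h1" using nr(1) h1(1) by (simp add: pos_divide_le_eq)
      then show "h \<le> h1" using N2 by (simp add: h_def pos_divide_le_eq mult.commute)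
      have "real N * h1 \<le> 4 * L \<epsilon>" using n4 h1(1) by (simp add: pos_le_divide_eq)
      then have "h1 * real N \<le> 2 * (real N * h)" using Nh by (simp add: mult.commute)
      then have "h1 \<le> 2 * h" using N2 by simp
      then show "1 / h \<le> 2 / h1" using h0 h1(1) by (simp add: field_simps)
    qed
    have \<epsilon>N: "\<epsilon> * real N \<le> 4 / h1 * (\<epsilon> * L \<epsilon>)"
      using mult_left_mono[OF n4, of \<epsilon>] \<epsilon> by (simp add: mult_ac)
    have lnN: "\<epsilon> * (real N * ln (2 * real N)) \<le> \<kappa> / 8"
    proof -
      have "ln (2 * real N) \<le> ln (8 / h1 * L \<epsilon>)"
        using n4 N2 h1(1) Lp(1) by (subst ln_le_cancel_iff) auto
      also have "\<dots> = ln (8 / h1) + ln (L \<epsilon>)" using h1(1) Lp(1) by (intro ln_mult_pos) auto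
      finally have l: "ln (2 * real N) \<le> ln (8 / h1) + ln (L \<epsilon>)" .
      have "(\<epsilon> * real N) * ln (2 * real N) \<le> (4 / h1 * (\<epsilon> * L \<epsilon>)) * (ln (8 / h1) + ln (L \<epsilon>))"
        by (rule mult_mono[OF \<epsilon>N l]) (use h1(1) \<epsilon> Lp(1) N2 in auto)
      also have "\<dots> = 4 / h1 * (\<epsilon> * (L \<epsilon> * ln (L \<epsilon>)) + ln (8 / h1) * (\<epsilon> * L \<epsilon>))"
        by (simp add: algebra_simps)
      also have "\<dots> \<le> \<kappa> / 8" using e3 by (rule less_imp_le)
      finally show ?thesis by (simp only: mult.assoc)
    qed
    define K where "K = w / 2 + 2 * \<Lambda>\<^sup>2 * h + e / h"
    define J where "J = (1 + \<theta>) * (w / 2) + c * (4 * L \<epsilon> * \<epsilon> * h + 4 * \<Lambda> * h\<^sup>2 + 2 * h * e)"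
    have h16: "h \<le> 1" using h(2) h1(2) by linarith
    have KJ: "(1 + \<theta>) * K + (1 + \<theta>) * J \<le> w + \<kappa> / 2"
    proof -
      have h2: "h\<^sup>2 \<le> h" using h16 h(1) by (simp add: power2_eq_square mult_left_le)
      have x1: "2 * \<Lambda>\<^sup>2 * h + c * (4 * \<Lambda> * h\<^sup>2) \<le> \<kappa> / 16"
      proof -
        have "c * (4 * \<Lambda> * h\<^sup>2) \<le> c * (4 * \<Lambda> * h)" using h2 c \<Lambda>(1) by (intro mult_left_mono) auto
        then have "2 * \<Lambda>\<^sup>2 * h + c * (4 * \<Lambda> * h\<^sup>2) \<le> h * a" by (simp add: a_def algebra_simps)
        also have "\<dots> \<le> \<kappa> / (16 * a) * a" using h(2) h1(3) a by (intro mult_right_mono) auto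
        also have "\<dots> = \<kappa> / 16" using a by simp
        finally show ?thesis .
      qed
      have x2: "e / h + c * (2 * h * e) \<le> \<kappa> / 16"
      proof -
        have "e / h \<le> e * (2 / h1)" using mult_left_mono[OF h(3), of e] e by simp
        moreover have "c * (2 * h * e) \<le> c * (2 * 1 * e)" using h16 c e by (intro mult_left_mono mult_right_mono) auto
        ultimately have "e / h + c * (2 * h * e) \<le> e * q" by (simp add: q_def algebra_simps)
        also have "\<dots> = \<kappa> / 16" using q by (simp add: e_def)
        finally show ?thesis .
      qed
      have x3: "c * (4 * L \<epsilon> * \<epsilon> * h) \<le> \<kappa> / 16"
      proof -
        have "c * (4 * L \<epsilon> * \<epsilon> * h) \<le> c * (4 * L \<epsilon> * \<epsilon> * 1)"
          using h16 c \<epsilon> Lp by (intro mult_left_mono) auto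
        also have "\<dots> = 4 * c * (\<epsilon> * L \<epsilon>)" by simp
        also have "\<dots> \<le> 4 * c * (\<kappa> / (64 * c))" using e2 c by (intro mult_left_mono) auto
        also have "\<dots> = \<kappa> / 16" using c by simp
        finally show ?thesis .
      qed
      define Y where "Y = 2 * \<Lambda>\<^sup>2 * h + c * (4 * \<Lambda> * h\<^sup>2) + (e / h + c * (2 * h * e)) + c * (4 * L \<epsilon> * \<epsilon> * h)"
      have Y: "Y \<le> 3 * \<kappa> / 16" "Y \<ge> 0"
        using x1 x2 x3 e h c \<Lambda>(1) \<epsilon> Lp by (auto simp: Y_def intro!: add_nonneg_nonneg mult_nonneg_nonneg)
      have "K + J = w + \<theta> * w / 2 + Y" by (simp add: K_def J_def Y_def algebra_simps add_divide_distrib)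
      then have "(1 + \<theta>) * K + (1 + \<theta>) * J = (1 + \<theta>) * (w + \<theta> * w / 2 + Y)" by (simp flip: distrib_left)
      also have "\<dots> = w + \<theta> * w * (3 / 2 + \<theta> / 2) + (1 + \<theta>) * Y" by (simp add: field_simps)
      also have "\<dots> \<le> w + \<theta> * w * 2 + 2 * Y"
        using \<theta> w Y by (intro add_mono mult_mono mult_left_mono) auto
      also have "\<dots> \<le> w + \<kappa> / 2" using \<theta>(3) Y(1) by (simp add: mult_ac)
      finally show ?thesis .
    qed
    have J0: "J \<ge> 0"
      using \<theta> w c \<Lambda>(1) h \<epsilon> Lp e by (auto simp: J_def intro!: add_nonneg_nonneg mult_nonneg_nonneg)
    define g where "g = (1 / (2 * real N)) ^ N * exp (- ((1 + \<theta>) * K / \<epsilon>) - (1 + 1 / \<theta>) / 2)"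
    have g_exp: "g = exp (- (real N * ln (2 * real N)) - ((1 + \<theta>) * K / \<epsilon>) - (1 + 1 / \<theta>) / 2)"
    proof -
      have "(1 / (2 * real N)) ^ N = exp (- (real N * ln (2 * real N)))"
        using N2 by (simp add: exp_minus exp_of_nat_mult power_one_over inverse_eq_divide)
      then show ?thesis by (simp add: g_def flip: exp_add)
    qed
    have main: "exp (- (w + \<kappa>) / \<epsilon>) \<le> exp (- ((1 + \<theta>) * J / \<epsilon>)) * (g / 2)"
    proof -
      have "\<epsilon> * (real N * ln (2 * real N)) + (1 + \<theta>) * K + (1 + \<theta>) * J + \<epsilon> * B \<le> w + \<kappa>"
        using KJ lnN \<epsilon>(3) \<kappa> by linarith
      then have "(\<epsilon> * (real N * ln (2 * real N)) + (1 + \<theta>) * K + (1 + \<theta>) * J + \<epsilon> * B) / \<epsilon> \<le> (w + \<kappa>) / \<epsilon>"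
        using \<epsilon> by (intro divide_right_mono) auto
      then have "real N * ln (2 * real N) + (1 + \<theta>) * K / \<epsilon> + (1 + \<theta>) * J / \<epsilon> + B \<le> (w + \<kappa>) / \<epsilon>"
        using \<epsilon>(1) unfolding add_divide_distrib by simp
      then have "- ((w + \<kappa>) / \<epsilon>) \<le> - ((1 + \<theta>) * J / \<epsilon>) + (- (real N * ln (2 * real N)) - ((1 + \<theta>) * K / \<epsilon>) - (1 + 1 / \<theta>) / 2) + - ln 2"
        unfolding B_def by linarith
      then have "exp (- ((w + \<kappa>) / \<epsilon>)) \<le> exp (- ((1 + \<theta>) * J / \<epsilon>)) * g * exp (- ln 2)"
        unfolding g_exp exp_add[symmetric] exp_le_cancel_iff .
      moreover have "exp (- ln 2) = (1 / 2 :: real)" by (simp add: exp_minus)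
      moreover have "- (w + \<kappa>) / \<epsilon> = - ((w + \<kappa>) / \<epsilon>)" by (rule minus_divide_left[symmetric])
      ultimately show ?thesis by (metis mult.assoc times_divide_eq_right mult.right_neutral)
    qed
    have "ennreal (exp (- ((1 + \<theta>) * J / \<epsilon>)) * (g / 2)) \<le>
     (\<integral>\<^sup>+w. ennreal (exp (- (1 / \<epsilon>) * integral {-L \<epsilon>..L \<epsilon>} (\<lambda>s. F (V \<epsilon> w s)))) \<partial>P \<epsilon>)"
      unfolding J_def c_def w_def
    proof (rule partition_function_ge[OF F m \<Lambda>(2) V[OF \<epsilon>(1)] h(1) _ Nh N2 \<theta>(1,2), where \<rho> = "1 / 6"])
      have "\<epsilon> * h \<le> 1 * 1" using \<epsilon> h h16 by (intro mult_mono) auto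
      then show "\<epsilon> * h \<le> 1" by simp
      have hl: "T \<le> L \<epsilon> - h" "T' \<le> L \<epsilon> - h" using Lp h16 by auto
      have s: "(1 + m (- L \<epsilon> + h))\<^sup>2 \<le> (sqrt e)\<^sup>2"
        using T'(2)[OF hl(2)] instanton_bounds(1)[OF F m, of "- L \<epsilon> + h"] by (intro power_mono) auto
      have s': "(1 - m (L \<epsilon> - h))\<^sup>2 \<le> (sqrt e)\<^sup>2"
        using T(2)[OF hl(1)] instanton_bounds(2)[OF F m, of "L \<epsilon> - h"] by (intro power_mono) auto
      show "(1 + m (- L \<epsilon> + h))\<^sup>2 \<le> e" "(1 - m (L \<epsilon> - h))\<^sup>2 \<le> e" using s s' e by auto
      have expo: "(w + \<kappa> + 1) / \<epsilon> \<le> (1 / 6)\<^sup>2 / (32 * \<epsilon> * h)"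
      proof -
        have "h * (1152 * (w + \<kappa> + 1)) \<le> h1 * (1152 * (w + \<kappa> + 1))" using h w \<kappa> by (intro mult_right_mono) auto
        also have "\<dots> \<le> 1" using h1(4) w \<kappa> by (simp add: pos_le_divide_eq)
        finally have "w + \<kappa> + 1 \<le> 1 / (1152 * h)" using h by (simp add: pos_le_divide_eq mult_ac)
        then have "(w + \<kappa> + 1) / \<epsilon> \<le> 1 / (1152 * h) / \<epsilon>" using \<epsilon> by (intro divide_right_mono) auto
        then show ?thesis by (simp add: power2_eq_square mult_ac)
      qed
      have "12 \<le> 1 / \<epsilon>" using \<epsilon> by (simp add: pos_le_divide_eq)
      also have "\<dots> \<le> (w + \<kappa> + 1) / \<epsilon>" using \<epsilon> w \<kappa> by (intro divide_right_mono) auto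
      finally show "12 \<le> (1 / 6)\<^sup>2 / (32 * \<epsilon> * h)" using expo by linarith
      have "h / L \<epsilon> \<le> h / 1" using Lp h by (intro divide_left_mono) auto
      then show "3 * (1 / 6 + h / L \<epsilon>) \<le> 1" using h(2) h1(2) by simp
      show "0 < g" by (simp add: g_exp)
      show "g \<le> (1 / (2 * real N)) ^ N * exp (- ((1 + \<theta>) * (wall_cost F / 2 + 2 * \<Lambda>\<^sup>2 * h + e / h) / \<epsilon>) - (1 + 1 / \<theta>) / 2)"
        unfolding g_def K_def w_def ..
      show "4 * real N * exp (- (1 / 6)\<^sup>2 / (32 * \<epsilon> * h)) \<le> \<theta> / 2 * g"
      proof -
        have g0: "g \<ge> 0" by (simp add: g_exp)
        have "exp (- ((1 + \<theta>) * J / \<epsilon>)) \<le> 1" using J0 \<theta> \<epsilon> by simp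
        then have "exp (- ((1 + \<theta>) * J / \<epsilon>)) * (g / 2) \<le> 1 * (g / 2)" using g0 by (intro mult_right_mono) auto
        \<comment> \<open>\<open>main\<close> also bounds the tube probability from below. The
          chaining exponent is \<open>w + \<kappa> + 1\<close>, larger by 1, so the oscillation
          event is negligible relative to the tube.\<close>
        then have ge: "exp (- (w + \<kappa>) / \<epsilon>) \<le> g" using main g0 by linarith
        have n8: "4 * real N * exp (- 1 / \<epsilon>) \<le> \<theta> / 2"
        proof -
          have "4 / h1 * (\<epsilon> * L \<epsilon>) \<le> 4 / h1 * (\<theta> * h1 / 32)" using e2 h1 by (intro mult_left_mono) auto
          also have "\<dots> = \<theta> / 8" using h1(1) by simp
          finally have n: "\<epsilon> * real N \<le> \<theta> / 8" using \<epsilon>N by linarith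
          have "1 / \<epsilon> \<le> exp (1 / \<epsilon>)" using exp_ge_add_one_self[of "1 / \<epsilon>"] by linarith
          then have "exp (- (1 / \<epsilon>)) \<le> \<epsilon>" using \<epsilon> by (simp add: exp_minus field_simps)
          then have "4 * real N * exp (- (1 / \<epsilon>)) \<le> 4 * real N * \<epsilon>" by (intro mult_left_mono) auto
          also have "\<dots> \<le> \<theta> / 2" using n by (simp add: mult_ac)
          finally show ?thesis by simp
        qed
        have "4 * real N * exp (- (1 / 6)\<^sup>2 / (32 * \<epsilon> * h)) \<le> 4 * real N * exp (- ((w + \<kappa> + 1) / \<epsilon>))"
          using expo by (intro mult_left_mono) auto
        also have "\<dots> = (4 * real N * exp (- 1 / \<epsilon>)) * exp (- (w + \<kappa>) / \<epsilon>)"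
        proof -
          have "- ((w + \<kappa> + 1) / \<epsilon>) = - 1 / \<epsilon> + - (w + \<kappa>) / \<epsilon>" by (simp add: add_divide_distrib diff_divide_distrib)
          then show ?thesis by (simp only: exp_add mult.assoc)
        qed
        also have "\<dots> \<le> \<theta> / 2 * g" using n8 ge \<theta> by (intro mult_mono) auto
        finally show ?thesis .
      qed
    qed (use e in auto)
    with main show "ennreal (exp (- (wall_cost F + \<kappa>) / \<epsilon>)) \<le>
     (\<integral>\<^sup>+w. ennreal (exp (- (1 / \<epsilon>) * integral {-L \<epsilon>..L \<epsilon>} (\<lambda>s. F (V \<epsilon> w s)))) \<partial>P \<epsilon>)"
      unfolding w_def[symmetric] by (meson ennreal_leI order_trans)
  qed
qed

section \<open>Measurability in \<open>L\<^sup>2\<close>\<close>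

text \<open>A measure built by \<open>measure_of\<close> takes on a set either the prescribed value
  or 0, so the upper bound holds for arbitrary \<open>f\<close> and \<open>A\<close>. Upper bounds
  are all that the final estimate takes from the two pushforwards.\<close>

lemma emeasure_distr_le: "emeasure (distr M N f) A \<le> emeasure M (f -` A \<inter> space M)"
  unfolding distr_def by (simp add: emeasure_measure_of_conv)

lemma emeasure_density_le: "emeasure (density M f) A \<le> (\<integral>\<^sup>+x. f x * indicator A x \<partial>M)"
  unfolding density_def by (simp add: emeasure_measure_of_conv)

lemma space_L2_borel: "space (L2_borel S) = L2 S"
  by (simp add: affine_L2_borel_def affine_L2_def space_measure_of_conv)

lemma sets_L2_borel_open:
  assumes "L2_open (\<lambda>_. 0) S U"
  shows "U \<in> sets (L2_borel S)"
proof -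
  have "{U. L2_open (\<lambda>_. 0) S U} \<subseteq> Pow (affine_L2 (\<lambda>_. 0) S)" by (auto simp: L2_open_def)
  then show ?thesis using assms by (simp add: affine_L2_borel_def sets_measure_of)
qed

lemma L2_measurable_indicator: "u \<in> L2 S \<Longrightarrow> (\<lambda>s. indicator S s * u s) \<in> borel_measurable lborel"
  by (simp add: L2_def set_borel_measurable_def)

lemma L2_square_diff_integrable:
  assumes u: "u \<in> L2 S" and v: "v \<in> L2 S"
  shows "integrable lborel (\<lambda>s. indicator S s * (u s - v s)\<^sup>2)"
proof (rule Bochner_Integration.integrable_bound)
  show "integrable lborel (\<lambda>s. 2 * (indicator S s * (u s)\<^sup>2) + 2 * (indicator S s * (v s)\<^sup>2))"
    using u v by (auto simp: L2_def set_integrable_def)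
  have "indicator S s * (u s - v s)\<^sup>2 = (indicator S s * u s - indicator S s * v s)\<^sup>2" for s :: real
    by (simp add: indicator_def)
  then show "(\<lambda>s. indicator S s * (u s - v s)\<^sup>2) \<in> borel_measurable lborel"
    using L2_measurable_indicator[OF u] L2_measurable_indicator[OF v] by simp
  have "(x - y)\<^sup>2 \<le> 2 * x\<^sup>2 + 2 * y\<^sup>2" for x y :: real
    using zero_le_power2[of "x + y"] by (simp add: power2_eq_square algebra_simps)
  then show "AE s in lborel. norm (indicator S s * (u s - v s)\<^sup>2) \<le> norm (2 * (indicator S s * (u s)\<^sup>2) + 2 * (indicator S s * (v s)\<^sup>2))"
    by (intro AE_I2) (simp add: indicator_def)
qed

lemma L2_dist_square:
  assumes "u \<in> L2 S" "v \<in> L2 S"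
  shows "(L2_dist S u v)\<^sup>2 = (\<integral>s. indicator S s * (u s - v s)\<^sup>2 \<partial>lborel)"
proof -
  have "0 \<le> (\<integral>s. indicator S s * (u s - v s)\<^sup>2 \<partial>lborel)" by (intro Bochner_Integration.integral_nonneg) auto
  then show ?thesis by (simp add: L2_dist_def set_lebesgue_integral_def)
qed

lemma L2_dist_nonneg: "L2_dist S u v \<ge> 0"
proof -
  have "0 \<le> (\<integral>s. indicator S s * (u s - v s)\<^sup>2 \<partial>lborel)" by (intro Bochner_Integration.integral_nonneg) auto
  then show ?thesis by (simp add: L2_dist_def set_lebesgue_integral_def)
qed

lemma L2_dist_commute: "L2_dist S u v = L2_dist S v u"
  by (simp add: L2_dist_def power2_commute)

text \<open>Integrated from a pointwise inequality between squares. With the constant 2 it takes the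
  place of Minkowski's inequality and suffices to compare neighbourhoods.\<close>

lemma L2_dist_quasi_triangle:
  assumes u: "u \<in> L2 S" and v: "v \<in> L2 S" and x: "x \<in> L2 S"
  shows "(L2_dist S u x)\<^sup>2 \<le> 2 * (L2_dist S u v)\<^sup>2 + 2 * (L2_dist S v x)\<^sup>2"
proof -
  have sq: "(p - r)\<^sup>2 \<le> 2 * (p - q)\<^sup>2 + 2 * (q - r)\<^sup>2" for p q r :: real
    using zero_le_power2[of "p + r - 2 * q"] by (simp add: power2_eq_square algebra_simps)
  have "(\<integral>s. indicator S s * (u s - x s)\<^sup>2 \<partial>lborel) \<le>
     (\<integral>s. 2 * (indicator S s * (u s - v s)\<^sup>2) + 2 * (indicator S s * (v s - x s)\<^sup>2) \<partial>lborel)"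
    using sq L2_square_diff_integrable u v x by (intro Bochner_Integration.integral_mono) (auto simp: indicator_def)
  then show ?thesis
    using L2_square_diff_integrable u v x by (simp add: L2_dist_square)
qed

lemma L2_dist_uniform_le:
  assumes u: "u \<in> L2 {-1..1}" and v: "v \<in> L2 {-1..1}" and \<eta>: "\<And>s. s \<in> {-1..1} \<Longrightarrow> \<bar>u s - v s\<bar> \<le> \<eta>"
  shows "(L2_dist {-1..1} u v)\<^sup>2 \<le> 2 * \<eta>\<^sup>2"
proof -
  have "(\<integral>s. indicator {-1..1} s * (u s - v s)\<^sup>2 \<partial>lborel) \<le> (\<integral>s. indicator {-1..1::real} s * \<eta>\<^sup>2 \<partial>lborel)"
  proof (rule Bochner_Integration.integral_mono)
    show "integrable lborel (\<lambda>s. indicator {-1..1} s * (u s - v s)\<^sup>2)" by (rule L2_square_diff_integrable[OF u v])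
    show "integrable lborel (\<lambda>s. indicator {-1..1::real} s * \<eta>\<^sup>2)" by (intro integrable_mult_left) simp
    show "indicator {-1..1} s * (u s - v s)\<^sup>2 \<le> indicator {-1..1} s * \<eta>\<^sup>2" for s :: real
      using \<eta>[of s] power_mono[of "\<bar>u s - v s\<bar>" \<eta> 2] by (auto simp: indicator_def)
  qed
  then show ?thesis using u v by (simp add: L2_dist_square)
qed

lemma continuous_in_L2:
  assumes "continuous_on {-1..1} u"
  shows "u \<in> L2 {-1..1}"
proof -
  have "set_borel_measurable lborel {-1..1} u"
    using borel_measurable_continuous_on_indicator[OF _ assms] by (simp add: set_borel_measurable_def)
  moreover have "set_integrable lborel {-1..1} (\<lambda>s. (u s)\<^sup>2)"
    by (rule borel_integrable_atLeastAtMost') (intro continuous_intros assms)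
  ultimately show ?thesis by (simp add: L2_def)
qed

text \<open>Both the time and the value are rounded down to multiples of \<open>1 / (n + 1)\<close>,
  so for fixed \<open>n\<close> only countably many functions arise.\<close>

definition step_approx :: "nat \<Rightarrow> (real \<Rightarrow> real) \<Rightarrow> real \<Rightarrow> real" where
  "step_approx n v s = (if s \<in> {-1..1}
     then real_of_int \<lfloor>real (Suc n) * v (real_of_int \<lfloor>real (Suc n) * s\<rfloor> / real (Suc n))\<rfloor> / real (Suc n) else 0)"

lemma floor_grid_approx:
  fixes s :: real and n :: nat
  defines "r \<equiv> real_of_int \<lfloor>real (Suc n) * s\<rfloor> / real (Suc n)"
  shows "r \<le> s" "s - r \<le> 1 / real (Suc n)"
proof -
  have "r \<le> real (Suc n) * s / real (Suc n)"
    unfolding r_def by (intro divide_right_mono) auto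
  then show "r \<le> s" by simp
  have "(real (Suc n) * s - 1) / real (Suc n) \<le> r"
    unfolding r_def by (intro divide_right_mono) linarith+
  moreover have "(real (Suc n) * s - 1) / real (Suc n) = s - 1 / real (Suc n)"
    by (subst diff_divide_distrib) simp
  ultimately show "s - r \<le> 1 / real (Suc n)" by linarith
qed

lemma floor_grid_range:
  assumes "s \<in> {-1..1::real}"
  shows "\<lfloor>real (Suc n) * s\<rfloor> \<in> {- int (Suc n)..int (Suc n)}"
    and "real_of_int \<lfloor>real (Suc n) * s\<rfloor> / real (Suc n) \<in> {-1..1}"
proof -
  have "real (Suc n) * -1 \<le> real (Suc n) * s" "real (Suc n) * s \<le> real (Suc n) * 1"
    using assms by (intro mult_left_mono; simp)+
  moreover have "\<lfloor>x\<rfloor> \<in> {- int k..int k}" if "real k * -1 \<le> x" "x \<le> real k * 1" for x :: real and k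
    using that by (auto simp: le_floor_iff floor_le_iff)
  ultimately show *: "\<lfloor>real (Suc n) * s\<rfloor> \<in> {- int (Suc n)..int (Suc n)}" by blast
  have gen: "- real k \<le> real_of_int j" "real_of_int j \<le> real k" if "j \<in> {- int k..int k}" for j k
    using that by auto
  have "- real (Suc n) \<le> real_of_int \<lfloor>real (Suc n) * s\<rfloor>" "real_of_int \<lfloor>real (Suc n) * s\<rfloor> \<le> real (Suc n)"
    by (rule gen[OF *])+
  then show "real_of_int \<lfloor>real (Suc n) * s\<rfloor> / real (Suc n) \<in> {-1..1}"
    by (simp add: divide_le_eq le_divide_eq)
qed

lemma step_approx_in_L2: "step_approx n v \<in> L2 {-1..1}"
proof -
  let ?g = "\<lambda>j::int. real_of_int \<lfloor>real (Suc n) * v (real_of_int j / real (Suc n))\<rfloor> / real (Suc n)"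
  define K where "K = Max ((\<lambda>j. \<bar>?g j\<bar>) ` {- int (Suc n)..int (Suc n)})"
  have K: "\<bar>step_approx n v s\<bar> \<le> K" if "s \<in> {-1..1}" for s
    using that floor_grid_range(1)[OF that, of n] unfolding step_approx_def K_def
    by (simp only: if_True) (intro Max_ge; auto)
  have m: "(\<lambda>s. ?g \<lfloor>real (Suc n) * s\<rfloor>) \<in> borel_measurable borel"
    by (rule measurable_compose[where N = "count_space UNIV" and g = ?g]) auto
  have eq: "indicator {-1..1} s * step_approx n v s = indicator {-1..1} s * ?g \<lfloor>real (Suc n) * s\<rfloor>" for s
    by (simp add: step_approx_def indicator_def)
  have m1: "(\<lambda>s. indicator {-1..1} s * step_approx n v s) \<in> borel_measurable borel"
    unfolding eq using m by measurable
  have "integrable lborel (\<lambda>s. indicator {-1..1} s * (step_approx n v s)\<^sup>2)"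
  proof (rule Bochner_Integration.integrable_bound)
    show "integrable lborel (\<lambda>s. indicator {-1..1::real} s * K\<^sup>2)" by (intro integrable_mult_left) simp
    have "indicator {-1..1} s * (step_approx n v s)\<^sup>2 = (indicator {-1..1} s * step_approx n v s)\<^sup>2" for s
      by (simp add: indicator_def)
    then show "(\<lambda>s. indicator {-1..1} s * (step_approx n v s)\<^sup>2) \<in> borel_measurable lborel"
      using m1 by simp
    show "AE s in lborel. norm (indicator {-1..1} s * (step_approx n v s)\<^sup>2) \<le> norm (indicator {-1..1} s * K\<^sup>2)"
    proof (intro AE_I2)
      fix s :: real
      show "norm (indicator {-1..1} s * (step_approx n v s)\<^sup>2) \<le> norm (indicator {-1..1} s * K\<^sup>2)"
        using K[of s] power_mono[of "\<bar>step_approx n v s\<bar>" K 2] by (auto simp: indicator_def)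
    qed
  qed
  then show ?thesis using m1 by (simp add: L2_def set_borel_measurable_def set_integrable_def)
qed

lemma step_approx_converges:
  assumes v: "continuous_on {-1..1} v"
  shows "(\<lambda>n. L2_dist {-1..1} v (step_approx n v)) \<longlonglongrightarrow> 0"
proof (rule LIMSEQ_I)
  fix r :: real assume r: "r > 0"
  have uc: "uniformly_continuous_on {-1..1} v" using v by (intro compact_uniformly_continuous) auto
  then obtain d where d: "d > 0" "\<And>x y. x \<in> {-1..1} \<Longrightarrow> y \<in> {-1..1} \<Longrightarrow> \<bar>x - y\<bar> < d \<Longrightarrow> \<bar>v x - v y\<bar> < r / 4"
    using r unfolding uniformly_continuous_on_def dist_real_def by (metis divide_pos_pos zero_less_numeral)
  obtain N where N: "1 / real (Suc N) < min d (r / 4)"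
    using nat_approx_posE[of "min d (r / 4)"] d r by auto
  show "\<exists>no. \<forall>n\<ge>no. norm (L2_dist {-1..1} v (step_approx n v) - 0) < r"
  proof (intro exI[of _ N] allI impI)
    fix n assume n: "n \<ge> N"
    have "1 / real (Suc n) \<le> 1 / real (Suc N)" using n by (intro divide_left_mono) auto
    then have small: "1 / real (Suc n) < d" "1 / real (Suc n) < r / 4" using N by auto
    have "\<bar>v s - step_approx n v s\<bar> \<le> r / 2" if s: "s \<in> {-1..1}" for s
    proof -
      define q where "q = real_of_int \<lfloor>real (Suc n) * s\<rfloor> / real (Suc n)"
      have q: "q \<in> {-1..1}" "\<bar>s - q\<bar> < d"
        using floor_grid_range(2)[OF s, of n] floor_grid_approx[where s=s and n=n] small by (auto simp: q_def)
      have "step_approx n v s = real_of_int \<lfloor>real (Suc n) * v q\<rfloor> / real (Suc n)"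
        using s by (simp add: step_approx_def q_def)
      then have "\<bar>v q - step_approx n v s\<bar> \<le> 1 / real (Suc n)"
        using floor_grid_approx[where s="v q" and n=n] by simp
      then show ?thesis using d(2)[OF s q] small by linarith
    qed
    then have "(L2_dist {-1..1} v (step_approx n v))\<^sup>2 \<le> 2 * (r / 2)\<^sup>2"
      by (intro L2_dist_uniform_le continuous_in_L2 v step_approx_in_L2)
    also have "\<dots> < r\<^sup>2" using r by (simp add: power2_eq_square)
    finally show "norm (L2_dist {-1..1} v (step_approx n v) - 0) < r"
      using L2_dist_nonneg[of "{-1..1}" v "step_approx n v"] r power2_less_imp_less[of _ r] by simp
  qed
qed

text \<open>The approximation is a function of the finite list \<open>k w\<close> of integers. The
  event is a countable union of events \<open>k w = l\<close>, so \<open>A\<close> may be an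
  arbitrary set.\<close>

lemma step_approx_event_measurable:
  assumes X: "\<And>s. s \<in> {-1..1} \<Longrightarrow> (\<lambda>w. X w s) \<in> borel_measurable P"
  shows "{w\<in>space P. step_approx n (X w) \<in> A} \<in> sets P"
proof -
  define D where "D = [- int (Suc n)..int (Suc n)]"
  define k where "k w = map (\<lambda>j. \<lfloor>real (Suc n) * X w (real_of_int j / real (Suc n))\<rfloor>) D" for w
  define \<sigma> where "\<sigma> l s = (if s \<in> {-1..1} then real_of_int (the (map_of (zip D l) \<lfloor>real (Suc n) * s\<rfloor>)) / real (Suc n) else 0)"
    for l :: "int list" and s :: real
  have eq: "step_approx n (X w) = \<sigma> (k w)" for w
  proof
    fix s
    show "step_approx n (X w) s = \<sigma> (k w) s"
    proof (cases "s \<in> {-1..1}")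
      case True
      have "\<lfloor>real (Suc n) * s\<rfloor> \<in> set D" using floor_grid_range(1)[OF True, of n] by (simp add: D_def)
      then have "map_of (zip D (k w)) \<lfloor>real (Suc n) * s\<rfloor> = Some \<lfloor>real (Suc n) * X w (real_of_int \<lfloor>real (Suc n) * s\<rfloor> / real (Suc n))\<rfloor>"
        unfolding k_def by (simp add: map_of_zip_map)
      then show ?thesis using True by (simp add: step_approx_def \<sigma>_def)
    next
      case False
      then show ?thesis by (simp only: step_approx_def \<sigma>_def if_False)
    qed
  qed
  have kl: "{w\<in>space P. k w = l} \<in> sets P" for l
  proof (cases "length l = length D")
    case True
    have "{w\<in>space P. k w = l} = space P \<inter> (\<Inter>i\<in>{..<length D}. {w\<in>space P. \<lfloor>real (Suc n) * X w (real_of_int (D ! i) / real (Suc n))\<rfloor> = l ! i})"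
      using True by (auto simp: k_def list_eq_iff_nth_eq)
    also have "\<dots> \<in> sets P"
    proof (cases "length D = 0")
      case False
      have "{w\<in>space P. \<lfloor>real (Suc n) * X w (real_of_int (D ! i) / real (Suc n))\<rfloor> = l ! i} \<in> sets P" if i: "i < length D" for i
      proof -
        have "D ! i \<in> set D" using i by simp
        then have "D ! i \<in> {- int (Suc n)..int (Suc n)}" by (simp add: D_def)
        then have "- real (Suc n) \<le> real_of_int (D ! i)" "real_of_int (D ! i) \<le> real (Suc n)" by auto
        then have "real_of_int (D ! i) / real (Suc n) \<in> {-1..1}" by (simp add: divide_le_eq le_divide_eq)
        note [measurable] = X[OF this]
        show ?thesis by measurable
      qed
      then show ?thesis using False by (intro sets.Int sets.top sets.finite_INT) auto
    qed simp
    finally show ?thesis .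
  next
    case False
    then have e: "{w\<in>space P. k w = l} = {}" by (auto simp: k_def)
    show ?thesis unfolding e by simp
  qed
  have "{w\<in>space P. step_approx n (X w) \<in> A} = (\<Union>l\<in>{l. \<sigma> l \<in> A}. {w\<in>space P. k w = l})"
    by (auto simp: eq)
  also have "\<dots> \<in> sets P" using kl by (intro sets.countable_UN'') auto
  finally show ?thesis .
qed

text \<open>The path is a limit of countably valued approximations, whose events are measurable for any
  target set; an open set is reached exactly when the approximations eventually stay at a fixed
  positive distance from its complement.\<close>

lemma continuous_process_L2_measurable:
  assumes X: "\<And>s. s \<in> {-1..1} \<Longrightarrow> (\<lambda>w. X w s) \<in> borel_measurable P"
    and cont: "\<And>w. w \<in> space P \<Longrightarrow> continuous_on {-1..1} (X w)"
  shows "X \<in> measurable P (L2_borel {-1..1})"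
proof -
  let ?S = "{-1..1::real}"
  have "X -` U \<inter> space P \<in> sets P" if U: "L2_open (\<lambda>_. 0) ?S U" for U
  proof -
    have UL: "U \<subseteq> L2 ?S" using U by (auto simp: L2_open_def affine_L2_def)
    have Ur: "\<exists>r>0. \<forall>v\<in>L2 ?S. L2_dist ?S u v < r \<longrightarrow> v \<in> U" if "u \<in> U" for u
      using U that by (auto simp: L2_open_def affine_L2_def)
    define A where "A k = {u. \<forall>v\<in>L2 ?S. L2_dist ?S u v < 1 / real (Suc k) \<longrightarrow> v \<in> U}" for k
    have "X w \<in> U \<longleftrightarrow> (\<exists>k N. \<forall>n\<ge>N. step_approx n (X w) \<in> A k)" if w: "w \<in> space P" for w
    proof
      note lim = step_approx_converges[OF cont[OF w]]
      have XL: "X w \<in> L2 ?S" by (rule continuous_in_L2[OF cont[OF w]])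
      {
        assume "X w \<in> U"
        then obtain r where r: "r > 0" "\<And>v. v \<in> L2 ?S \<Longrightarrow> L2_dist ?S (X w) v < r \<Longrightarrow> v \<in> U" using Ur by blast
        obtain k where k: "1 / real (Suc k) < r / 2" using nat_approx_posE[of "r / 2"] r by auto
        obtain N where N: "\<And>n. n \<ge> N \<Longrightarrow> L2_dist ?S (X w) (step_approx n (X w)) < r / 2"
          using order_tendstoD(2)[OF lim, of "r / 2"] r by (auto simp: eventually_sequentially)
        have "step_approx n (X w) \<in> A k" if n: "n \<ge> N" for n
          unfolding A_def
        proof (intro CollectI ballI impI)
          fix v assume v: "v \<in> L2 ?S" "L2_dist ?S (step_approx n (X w)) v < 1 / real (Suc k)"
          have "(L2_dist ?S (X w) v)\<^sup>2 \<le> 2 * (L2_dist ?S (X w) (step_approx n (X w)))\<^sup>2 + 2 * (L2_dist ?S (step_approx n (X w)) v)\<^sup>2"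
            by (rule L2_dist_quasi_triangle[OF XL step_approx_in_L2 v(1)])
          also have "\<dots> < 2 * (r / 2)\<^sup>2 + 2 * (r / 2)\<^sup>2"
            using N[OF n] v(2) k L2_dist_nonneg[of ?S]
            by (intro add_strict_mono mult_strict_left_mono power_strict_mono) auto
          also have "\<dots> = r\<^sup>2" by (simp add: power2_eq_square)
          finally have "L2_dist ?S (X w) v < r" using r(1) power2_less_imp_less[of _ r] by simp
          then show "v \<in> U" by (rule r(2)[OF v(1)])
        qed
        then show "\<exists>k N. \<forall>n\<ge>N. step_approx n (X w) \<in> A k" by blast
      }
      assume "\<exists>k N. \<forall>n\<ge>N. step_approx n (X w) \<in> A k"
      then obtain k N where kN: "\<And>n. n \<ge> N \<Longrightarrow> step_approx n (X w) \<in> A k" by blast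
      obtain N' where N': "\<And>n. n \<ge> N' \<Longrightarrow> L2_dist ?S (X w) (step_approx n (X w)) < 1 / real (Suc k)"
        using order_tendstoD(2)[OF lim, of "1 / real (Suc k)"] by (auto simp: eventually_sequentially)
      show "X w \<in> U"
        using kN[of "max N N'"] N'[of "max N N'"] XL L2_dist_commute[of ?S "X w"] by (auto simp: A_def)
    qed
    then have "X -` U \<inter> space P = {w\<in>space P. \<exists>k N. \<forall>n\<ge>N. step_approx n (X w) \<in> A k}" by auto
    also have "\<dots> \<in> sets P"
    proof -
      have [measurable]: "Measurable.pred P (\<lambda>w. step_approx n (X w) \<in> A k)" for n k
        unfolding pred_def by (rule step_approx_event_measurable[OF X])
      show ?thesis by measurable
    qed
    finally show ?thesis .
  qed
  then show ?thesis
    unfolding affine_L2_borel_def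
    by (intro measurable_measure_of) (auto simp: L2_open_def affine_L2_def intro: continuous_in_L2[OF cont])
qed

text \<open>Lower semicontinuity of the energy: Fatou's lemma along a subsequence that converges
  almost everywhere.\<close>

lemma L2_energy_sublevel_limit:
  assumes F: "continuous_on UNIV F" and u: "u \<in> L2 S" and v: "\<And>k. v k \<in> L2 S" and S: "S \<in> sets borel"
    and lim: "(\<lambda>k. L2_dist S u (v k)) \<longlonglongrightarrow> 0"
    and le: "\<And>k. (\<integral>\<^sup>+s\<in>S. ennreal (F (v k s)) \<partial>lborel) \<le> c"
  shows "(\<integral>\<^sup>+s\<in>S. ennreal (F (u s)) \<partial>lborel) \<le> c"
proof -
  have Fm[measurable]: "F \<in> borel_measurable borel" using F by (rule borel_measurable_continuous_onI)
  have meas: "(\<lambda>s. ennreal (F (x s)) * indicator S s) \<in> borel_measurable lborel" if x: "x \<in> L2 S" for x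
  proof -
    note [measurable] = L2_measurable_indicator[OF x] S
    have "ennreal (F (x s)) * indicator S s = ennreal (F (indicator S s * x s)) * indicator S s" for s
      by (simp add: indicator_def)
    then show ?thesis by simp
  qed
  have "(\<lambda>k. (L2_dist S u (v k))\<^sup>2) \<longlonglongrightarrow> 0\<^sup>2" by (intro tendsto_power lim)
  then have "(\<lambda>k. \<integral>s. norm (indicator S s * (u s - v k s)\<^sup>2) \<partial>lborel) \<longlonglongrightarrow> 0"
    using u v by (simp add: L2_dist_square)
  then obtain r where r: "strict_mono r" "AE s in lborel. (\<lambda>k. indicator S s * (u s - v (r k) s)\<^sup>2) \<longlonglongrightarrow> 0"
    using tendsto_L1_AE_subseq[of lborel "\<lambda>k s. indicator S s * (u s - v k s)\<^sup>2"] L2_square_diff_integrable[OF u v] by auto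
  have "(\<integral>\<^sup>+s\<in>S. ennreal (F (u s)) \<partial>lborel) \<le> (\<integral>\<^sup>+s. liminf (\<lambda>k. ennreal (F (v (r k) s)) * indicator S s) \<partial>lborel)"
  proof (rule nn_integral_mono_AE)
    show "AE s in lborel. ennreal (F (u s)) * indicator S s \<le> liminf (\<lambda>k. ennreal (F (v (r k) s)) * indicator S s)"
      using r(2)
    proof eventually_elim
      fix s assume s: "(\<lambda>k. indicator S s * (u s - v (r k) s)\<^sup>2) \<longlonglongrightarrow> 0"
      show "ennreal (F (u s)) * indicator S s \<le> liminf (\<lambda>k. ennreal (F (v (r k) s)) * indicator S s)"
      proof (cases "s \<in> S")
        case True
        then have "(\<lambda>k. sqrt ((u s - v (r k) s)\<^sup>2)) \<longlonglongrightarrow> sqrt 0" using s by (intro tendsto_real_sqrt) simp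
        then have "(\<lambda>k. \<bar>v (r k) s - u s\<bar>) \<longlonglongrightarrow> 0" by (simp add: abs_minus_commute)
        then have "(\<lambda>k. v (r k) s) \<longlonglongrightarrow> u s" by (subst LIM_zero_iff[symmetric]) (simp add: tendsto_rabs_zero_iff)
        then have "(\<lambda>k. F (v (r k) s)) \<longlonglongrightarrow> F (u s)"
          using F by (intro isCont_tendsto_compose[of "u s" F]) (auto simp: continuous_on_eq_continuous_at)
        then have "(\<lambda>k. ennreal (F (v (r k) s))) \<longlonglongrightarrow> ennreal (F (u s))" by (intro tendsto_ennrealI)
        then have "liminf (\<lambda>k. ennreal (F (v (r k) s))) = ennreal (F (u s))"
          by (intro lim_imp_Liminf) auto
        then show ?thesis using True by simp
      qed simp
    qed
  qed
  also have "\<dots> \<le> liminf (\<lambda>k. \<integral>\<^sup>+s\<in>S. ennreal (F (v (r k) s)) \<partial>lborel)"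
    by (intro nn_integral_liminf meas v)
  also have "\<dots> \<le> c"
    using le by (intro Liminf_le) auto
  finally show ?thesis .
qed

text \<open>By lower semicontinuity the superlevel sets of the energy are open. A failure of
  openness at \<open>u\<close> would give a sequence of energy at most \<open>c\<close> converging
  to \<open>u\<close>.\<close>

lemma L2_energy_measurable:
  assumes F: "continuous_on UNIV F" and S: "S \<in> sets borel"
  shows "(\<lambda>u. \<integral>\<^sup>+s\<in>S. ennreal (F (u s)) \<partial>lborel) \<in> borel_measurable (L2_borel S)"
proof (rule borel_measurableI_greater)
  fix c :: ennreal
  let ?E = "\<lambda>u. \<integral>\<^sup>+s\<in>S. ennreal (F (u s)) \<partial>lborel"
  have "L2_open (\<lambda>_. 0) S {u \<in> L2 S. c < ?E u}"
    unfolding L2_open_def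
  proof (intro conjI ballI)
    show "{u \<in> L2 S. c < ?E u} \<subseteq> affine_L2 (\<lambda>_. 0) S" by (auto simp: affine_L2_def)
    fix u assume u: "u \<in> {u \<in> L2 S. c < ?E u}"
    show "\<exists>r>0. \<forall>v\<in>affine_L2 (\<lambda>_. 0) S. L2_dist S u v < r \<longrightarrow> v \<in> {u \<in> L2 S. c < ?E u}"
    proof (rule ccontr)
      assume *: "\<not> ?thesis"
      have "\<exists>v. v \<in> L2 S \<and> L2_dist S u v < 1 / real (Suc k) \<and> ?E v \<le> c" for k
      proof -
        have "\<not> (\<forall>v\<in>affine_L2 (\<lambda>_. 0) S. L2_dist S u v < 1 / real (Suc k) \<longrightarrow> v \<in> {u \<in> L2 S. c < ?E u})"
        proof
          assume "\<forall>v\<in>affine_L2 (\<lambda>_. 0) S. L2_dist S u v < 1 / real (Suc k) \<longrightarrow> v \<in> {u \<in> L2 S. c < ?E u}"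
          then have "\<exists>r>0. \<forall>v\<in>affine_L2 (\<lambda>_. 0) S. L2_dist S u v < r \<longrightarrow> v \<in> {u \<in> L2 S. c < ?E u}"
            by (intro exI[of _ "1 / real (Suc k)"] conjI) simp
          then show False using * by contradiction
        qed
        then show ?thesis by (auto simp: affine_L2_def not_less)
      qed
      then obtain v where v: "\<And>k. v k \<in> L2 S" "\<And>k. L2_dist S u (v k) < 1 / real (Suc k)" "\<And>k. ?E (v k) \<le> c" by metis
      have "(\<lambda>k. L2_dist S u (v k)) \<longlonglongrightarrow> 0"
      proof (rule tendsto_sandwich[of "\<lambda>_. 0" _ _ "\<lambda>k. 1 / real (Suc k)"])
        show "(\<lambda>k. 1 / real (Suc k)) \<longlonglongrightarrow> 0" by (rule LIMSEQ_Suc[OF lim_1_over_n])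
        show "\<forall>\<^sub>F k in sequentially. L2_dist S u (v k) \<le> 1 / real (Suc k)"
          using v(2) by (intro always_eventually allI less_imp_le)
        show "\<forall>\<^sub>F k in sequentially. 0 \<le> L2_dist S u (v k)" by (simp add: L2_dist_nonneg)
      qed simp
      then have "?E u \<le> c" using L2_energy_sublevel_limit[where v = v, OF F _ v(1) S _ v(3)] u by blast
      then show False using u by auto
    qed
  qed
  then show "{u \<in> space (L2_borel S). c < ?E u} \<in> sets (L2_borel S)"
    unfolding space_L2_borel by (rule sets_L2_borel_open)
qed

lemma gibbs_weight_measurable:
  assumes "continuous_on UNIV F"
  shows "gibbs_weight b F \<in> borel_measurable (L2_borel {-1..1})"
proof -
  note [measurable] = L2_energy_measurable[OF assms, of "{-1..1}", simplified]
  show ?thesis unfolding gibbs_weight_def[abs_def] Let_def by measurable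
qed

section \<open>Tail estimate for the rescaled measure\<close>

text \<open>Freezing the path outside \<open>[-1,1]\<close> keeps it continuous on the whole line.\<close>

definition rescaled_path :: "real \<Rightarrow> ('w \<Rightarrow> real \<Rightarrow> real) \<Rightarrow> 'w \<Rightarrow> real \<Rightarrow> real" where
  "rescaled_path L X w s = X w (max (-1) (min 1 (s / L)))"

lemma rescaled_path_inside: "L > 0 \<Longrightarrow> s \<in> {-L..L} \<Longrightarrow> rescaled_path L X w s = X w (s / L)"
  by (simp add: rescaled_path_def field_simps)

lemma bridge_process_measurable:
  assumes "bridge_process \<gamma> \<epsilon> P X" "s \<in> {-1..1}"
  shows "(\<lambda>w. X w s) \<in> borel_measurable P"
proof -
  have "\<And>J a. finite J \<Longrightarrow> J \<subseteq> {-1..1} \<Longrightarrow> gaussian_rv P (\<lambda>w. \<Sum>s\<in>J. a s * X w s)"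
    using assms by (simp add: bridge_process_def gaussian_process_def)
  from this[of "{s}" "\<lambda>_. 1"] show ?thesis using assms by (simp add: gaussian_rv_def)
qed

lemma scaled_bridge_rescaled_path:
  assumes X: "bridge_process \<gamma> \<epsilon> P X" and \<epsilon>: "\<epsilon> > 0" and L: "L = \<epsilon> powr (- \<gamma>)"
  shows "scaled_bridge \<epsilon> L P (rescaled_path L X)"
proof -
  have L0: "L > 0" using \<epsilon> by (simp add: L)
  have gp: "prob_space P" "\<And>J a. finite J \<Longrightarrow> J \<subseteq> {-1..1} \<Longrightarrow> gaussian_rv P (\<lambda>w. \<Sum>s\<in>J. a s * X w s)"
    "\<And>s. s \<in> {-1..1} \<Longrightarrow> (\<integral>w. X w s \<partial>P) = s"
    "\<And>s t. s \<in> {-1..1} \<Longrightarrow> t \<in> {-1..1} \<Longrightarrow> (\<integral>w. (X w s - s) * (X w t - t) \<partial>P) = bridge_cov \<gamma> \<epsilon> s t"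
    using X by (auto simp: bridge_process_def gaussian_process_def)
  have unit: "s / L \<in> {-1..1}" if "s \<in> {-L..L}" for s using that L0 by (auto simp: field_simps)
  have inj: "inj_on (\<lambda>s. s / L) J" for J using L0 by (auto simp: inj_on_def)
  \<comment> \<open>The variance \<open>\<epsilon> powr (1 - \<gamma>)\<close> on the unit scale
    becomes \<open>\<epsilon>\<close> per unit length after stretching by \<open>L\<close>.\<close>
  have eL: "\<epsilon> powr (1 - \<gamma>) = \<epsilon> * L" using \<epsilon> by (simp add: L powr_diff powr_minus_divide)
  have cov: "bridge_cov \<gamma> \<epsilon> (s / L) (t / L) = \<epsilon> * (min s t + L - (s + L) * (t + L) / (2 * L))" for s t
  proof -
    have "min (s / L) (t / L) = min s t / L" using L0 by (simp add: min_def field_simps)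
    then show ?thesis unfolding bridge_cov_def eL using L0 by (simp add: field_simps)
  qed
  have "gaussian_process P {-L..L} (rescaled_path L X) (\<lambda>s. s / L)
      (\<lambda>s t. \<epsilon> * (min s t + L - (s + L) * (t + L) / (2 * L)))"
    unfolding gaussian_process_def
  proof (intro conjI allI impI ballI)
    fix J :: "real set" and a assume J: "finite J \<and> J \<subseteq> {-L..L}"
    have "gaussian_rv P (\<lambda>w. \<Sum>r\<in>(\<lambda>s. s / L) ` J. a (L * r) * X w r)"
      using J unit by (intro gp(2)) auto
    moreover have "(\<Sum>r\<in>(\<lambda>s. s / L) ` J. a (L * r) * X w r) = (\<Sum>s\<in>J. a s * rescaled_path L X w s)" for w
      using J L0 by (subst sum.reindex[OF inj]) (auto intro!: sum.cong simp: rescaled_path_inside subset_iff)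
    ultimately show "gaussian_rv P (\<lambda>w. \<Sum>s\<in>J. a s * rescaled_path L X w s)" by simp
  qed (use gp unit L0 cov in \<open>simp_all add: rescaled_path_inside\<close>)
  moreover have "continuous_on UNIV (rescaled_path L X w)" if "w \<in> space P" for w
    unfolding rescaled_path_def[abs_def]
  proof (rule continuous_on_compose2[of "{-1..1}" "X w" UNIV "\<lambda>s. max (-1) (min 1 (s / L))"])
    show "continuous_on {-1..1} (X w)" using X that by (simp add: bridge_process_def)
    show "continuous_on UNIV (\<lambda>s. max (-1) (min 1 (s / L)))"
      using L0 by (intro continuous_intros) auto
  qed auto
  moreover have "(\<lambda>w. rescaled_path L X w s) \<in> borel_measurable P" for s
    unfolding rescaled_path_def by (rule bridge_process_measurable[OF X]) auto
  ultimately show ?thesis using \<epsilon> L0 by (simp add: scaled_bridge_def)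
qed

lemma bridge_process_L2_measurable:
  "bridge_process \<gamma> \<epsilon> P X \<Longrightarrow> X \<in> measurable P (L2_borel {-1..1})"
  by (rule continuous_process_L2_measurable)
    (auto intro: bridge_process_measurable simp: bridge_process_def)

text \<open>The prefactor of the energy is \<open>L / \<epsilon>\<close>, and the change of
  variables to \<open>[-L,L]\<close> absorbs \<open>L\<close>. A continuous path has finite energy,
  so the zero branch of the weight does not occur.\<close>

lemma gibbs_weight_rescaled_path:
  assumes F: "double_well F" and X: "bridge_process \<gamma> \<epsilon> P X" and \<epsilon>: "\<epsilon> > 0" and L: "L = \<epsilon> powr (- \<gamma>)"
    and w: "w \<in> space P"
  shows "gibbs_weight (\<epsilon> powr (- 1 - \<gamma>)) F (X w)
    = ennreal (exp (- (1 / \<epsilon>) * integral {-L..L} (\<lambda>s. F (rescaled_path L X w s))))"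
proof -
  let ?V = "rescaled_path L X"
  have V: "scaled_bridge \<epsilon> L P ?V" by (rule scaled_bridge_rescaled_path[OF X \<epsilon> L])
  have L0: "L > 0" using \<epsilon> by (simp add: L)
  define I where "I = integral {-L..L} (\<lambda>s. F (?V w s))"
  define E where "E = (\<integral>\<^sup>+s\<in>{-1..1}. ennreal (F (X w s)) \<partial>lborel)"
  have "continuous_on UNIV (?V w)" using V w by (simp add: scaled_bridge_def)
  then have cont: "continuous_on UNIV (\<lambda>s. F (?V w s))"
    by (rule continuous_on_compose2[OF double_well_continuous[OF F, of UNIV]]) auto
  from cont have [measurable]: "(\<lambda>s. F (?V w s)) \<in> borel_measurable borel"
    by (rule borel_measurable_continuous_onI)
  have I0: "I \<ge> 0"
    unfolding I_def using double_well_nonneg[OF F]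
    by (intro Henstock_Kurzweil_Integration.integral_nonneg integrable_continuous_interval
        continuous_on_subset[OF cont]) auto
  have "ennreal I = ennreal L * (\<integral>\<^sup>+s. ennreal (F (?V w (0 + L * s))) * indicator {-L..L} (0 + L * s) \<partial>lborel)"
    unfolding I_def scaled_bridge_energy_nn_integral[OF F V w] using L0
    by (subst nn_integral_real_affine[where c = L and t = 0]) auto
  also have "(\<integral>\<^sup>+s. ennreal (F (?V w (0 + L * s))) * indicator {-L..L} (0 + L * s) \<partial>lborel) = E"
  proof -
    have "- L \<le> L * s \<longleftrightarrow> - 1 \<le> s" "L * s \<le> L \<longleftrightarrow> s \<le> 1" for s
      using mult_le_cancel_left_pos[OF L0, of "-1" s] mult_le_cancel_left_pos[OF L0, of s 1] by simp_all
    then have "ennreal (F (?V w (0 + L * s))) * indicator {-L..L} (0 + L * s)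
        = ennreal (F (X w s)) * indicator {-1..1} s" for s
      using L0 by (cases "s \<in> {-1..1}") (simp_all add: indicator_def rescaled_path_def)
    then show ?thesis unfolding E_def by simp
  qed
  finally have IE: "ennreal I = ennreal L * E" .
  then have fin: "E \<noteq> \<infinity>" using L0 by (auto simp: ennreal_mult_top)
  have "I = L * enn2real E"
    using arg_cong[OF IE, of enn2real] I0 L0 by (simp add: enn2real_mult)
  moreover have "\<epsilon> powr (- 1 - \<gamma>) = L / \<epsilon>"
  proof -
    have *: "- 1 - \<gamma> = - \<gamma> - 1" by simp
    show ?thesis unfolding * powr_diff L using \<epsilon> by simp
  qed
  ultimately show ?thesis
    using fin unfolding gibbs_weight_def E_def[symmetric] I_def[symmetric] by simp
qed

lemma dist_Linf_instantons_le:
  assumes u: "u \<in> borel_measurable borel" and m: "m \<in> borel_measurable borel"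
    and le: "\<And>s. \<bar>u s - m (s - \<xi>)\<bar> \<le> r"
  shows "dist_Linf u (instantons m) \<le> ereal r"
  unfolding dist_Linf_def
proof (rule INF_lower2)
  show "(\<lambda>s. m (s - \<xi>)) \<in> instantons m" by (auto simp: instantons_def)
  note [measurable] = u m
  show "Linf_norm (\<lambda>s. u s - m (s - \<xi>)) \<le> ereal r"
    unfolding Linf_norm_def using le by (intro esssup_I) auto
qed

text \<open>Outside \<open>[-L,L]\<close> the extended path sits at a well. The instanton is
  monotone between the wells, so its distance to that well is no larger there than at the end
  point.\<close>

lemma near_instanton_extend:
  assumes F: "double_well F" and m: "instanton F m" and L: "L > 0" and near: "near_instanton m L \<rho> v"
    and ends: "v (-L) = -1" "v L = 1" and u: "\<And>s. s \<in> {-L..L} \<Longrightarrow> u s = v s"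
  shows "\<exists>\<xi>. \<forall>s. \<bar>extend L u s - m (s - \<xi>)\<bar> \<le> \<rho>"
proof -
  obtain \<xi> where \<xi>: "\<And>s. s \<in> {-L..L} \<Longrightarrow> \<bar>v s - m (s - \<xi>)\<bar> \<le> \<rho>"
    using near unfolding near_instanton_def by blast
  have "\<bar>extend L u s - m (s - \<xi>)\<bar> \<le> \<rho>" for s
  proof -
    consider "s < - L" | "s > L" | "s \<in> {-L..L}" by fastforce
    then show ?thesis
    proof cases
      case 1
      then have "m (s - \<xi>) \<le> m (- L - \<xi>)" by (intro monoD[OF instanton_mono[OF F m]]) simp
      then show ?thesis using \<xi>[of "-L"] ends instanton_bounds[OF F m, of "s - \<xi>"] L 1 by (simp add: extend_def)
    next
      case 2
      then have "m (L - \<xi>) \<le> m (s - \<xi>)" by (intro monoD[OF instanton_mono[OF F m]]) simp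
      then show ?thesis using \<xi>[of L] ends instanton_bounds[OF F m, of "s - \<xi>"] L 2 by (simp add: extend_def)
    next
      case 3
      then show ?thesis using \<xi>[of s] u[of s] by (simp add: extend_def)
    qed
  qed
  then show ?thesis by blast
qed

lemma ennreal_divide_le_quotient:
  assumes "x \<le> ennreal a" "ennreal b \<le> z" "a \<ge> 0" "b > 0"
  shows "x / z \<le> ennreal (a / b)"
proof -
  have "x / z \<le> ennreal a / z" using assms by (intro divide_right_mono_ennreal)
  also have "\<dots> \<le> ennreal (a / b)"
    using assms by (cases z) (auto simp: divide_ennreal intro!: ennreal_leI divide_left_mono)
  finally show ?thesis .
qed

text \<open>The quotient of the weight of the far paths by the partition function. The radius
  \<open>\<delta> / 2\<close> gives the contradiction its strict gap: a path that close to an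
  instanton has distance at most \<open>\<delta> / 2\<close> and not at least
  \<open>\<delta>\<close>.\<close>

lemma measure_mu_off_instantons_le:
  assumes F: "double_well F" and m: "instanton F m" and X: "bridge_process \<gamma> \<epsilon> P X" and \<epsilon>: "\<epsilon> > 0"
    and L: "L = \<epsilon> powr (- \<gamma>)" and \<delta>: "\<delta> > 0" and a: "a \<ge> 0" and b: "b > 0"
    and off: "\<And>B. B \<in> sets P \<Longrightarrow> (\<And>w. w \<in> B \<Longrightarrow> \<not> near_instanton m L (\<delta> / 2) (rescaled_path L X w)) \<Longrightarrow>
      (\<integral>\<^sup>+w. ennreal (exp (- (1 / \<epsilon>) * integral {-L..L} (\<lambda>s. F (rescaled_path L X w s)))) * indicator B w \<partial>P)
        \<le> ennreal a"
    and total: "ennreal b \<le> (\<integral>\<^sup>+w. ennreal (exp (- (1 / \<epsilon>) * integral {-L..L} (\<lambda>s. F (rescaled_path L X w s)))) \<partial>P)"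
  shows "measure (mu F m \<gamma> \<epsilon> (process_law P X)) {u \<in> affine_L2 m UNIV. dist_Linf u (instantons m) \<ge> ereal \<delta>}
    \<le> a / b"
proof -
  let ?V = "rescaled_path L X"
  define S where "S = {u \<in> affine_L2 m UNIV. dist_Linf u (instantons m) \<ge> ereal \<delta>}"
  define \<nu> where "\<nu> = process_law P X"
  define g where "g = gibbs_weight (\<epsilon> powr (- 1 - \<gamma>)) F"
  define \<mu> where "\<mu> = mu_tilde F \<gamma> \<epsilon> \<nu>"
  define T where "T = T_map \<gamma> \<epsilon>"
  define S' where "S' = T -` (extend L -` S \<inter> space (distr \<mu> (L2_borel {-L..L}) T)) \<inter> space \<mu>"
  have V: "scaled_bridge \<epsilon> L P ?V" by (rule scaled_bridge_rescaled_path[OF X \<epsilon> L])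
  have L0: "L > 0" using \<epsilon> by (simp add: L)
  note [measurable] = bridge_process_L2_measurable[OF X]
  have gm[measurable]: "g \<in> borel_measurable (L2_borel {-1..1})"
    unfolding g_def by (rule gibbs_weight_measurable[OF double_well_continuous[OF F]])
  have mm: "m \<in> borel_measurable borel"
    using m unfolding instanton_def
    by (intro borel_measurable_continuous_onI continuous_at_imp_continuous_on) (auto intro: DERIV_isCont)
  have weight: "g (X w) = ennreal (exp (- (1 / \<epsilon>) * integral {-L..L} (\<lambda>s. F (?V w s))))" if "w \<in> space P" for w
    unfolding g_def by (rule gibbs_weight_rescaled_path[OF F X \<epsilon> L that])
  have \<nu>: "\<nu> = distr P (L2_borel {-1..1}) X" by (simp add: \<nu>_def process_law_def)
  have \<mu>: "\<mu> = density \<nu> (\<lambda>u. g u / (\<integral>\<^sup>+v. g v \<partial>\<nu>))" by (simp add: \<mu>_def mu_tilde_def g_def Let_def)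
  have Z: "ennreal b \<le> (\<integral>\<^sup>+v. g v \<partial>\<nu>)"
    unfolding \<nu> using total weight by (subst nn_integral_distr) (auto cong: nn_integral_cong)
  have "emeasure (mu F m \<gamma> \<epsilon> \<nu>) S \<le> emeasure \<mu> S'"
  proof -
    have "emeasure (mu F m \<gamma> \<epsilon> \<nu>) S
        \<le> emeasure (distr \<mu> (L2_borel {-L..L}) T) (extend L -` S \<inter> space (distr \<mu> (L2_borel {-L..L}) T))"
      unfolding mu_def Let_def \<mu>_def T_def L by (rule emeasure_distr_le)
    also have "\<dots> \<le> emeasure \<mu> S'" unfolding S'_def by (rule emeasure_distr_le)
    finally show ?thesis .
  qed
  also have "emeasure \<mu> S' \<le> ennreal (a / b)"
  \<comment> \<open>A set outside the sigma-algebra has \<open>emeasure\<close> 0, so only a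
    measurable event is left to estimate.\<close>
  proof (cases "S' \<in> sets (L2_borel {-1..1})")
    case False
    then have "S' \<notin> sets \<mu>" by (simp add: \<mu> \<nu>)
    then show ?thesis by (simp add: emeasure_notin_sets)
  next
    case True
    note [measurable] = True
    \<comment> \<open>The end values hold almost surely; recording them in the event allows
      closeness on \<open>[-L,L]\<close> to extend to the whole line.\<close>
    define B where "B = {w \<in> space P. X w \<in> S' \<and> ?V w (-L) = -1 \<and> ?V w L = 1}"
    have [measurable]: "(\<lambda>w. ?V w s) \<in> borel_measurable P" for s by (rule scaled_bridge_measurable[OF V])
    have B: "B \<in> sets P" unfolding B_def by measurable
    have far: "\<not> near_instanton m L (\<delta> / 2) (?V w)" if w: "w \<in> B" for w
    proof
      assume near: "near_instanton m L (\<delta> / 2) (?V w)"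
      have T: "T (X w) s = ?V w s" if "s \<in> {-L..L}" for s
        using rescaled_path_inside[OF L0 that, of X w] by (simp add: T_def T_map_def L powr_minus_divide mult.commute)
      obtain \<xi> where \<xi>: "\<And>s. \<bar>extend L (T (X w)) s - m (s - \<xi>)\<bar> \<le> \<delta> / 2"
        using near_instanton_extend[OF F m L0 near _ _ T] w by (auto simp: B_def)
      have "continuous_on UNIV (?V w)" using V w by (simp add: scaled_bridge_def B_def)
      then have [measurable]: "?V w \<in> borel_measurable borel" by (rule borel_measurable_continuous_onI)
      have "extend L (T (X w)) = (\<lambda>s. if s < - L then -1 else if s > L then 1 else ?V w s)"
        by (auto simp: extend_def T fun_eq_iff)
      also have "\<dots> \<in> borel_measurable borel" by measurable
      finally have "dist_Linf (extend L (T (X w))) (instantons m) \<le> ereal (\<delta> / 2)"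
        by (rule dist_Linf_instantons_le[OF _ mm \<xi>])
      moreover have "ereal \<delta> \<le> dist_Linf (extend L (T (X w))) (instantons m)"
        using w by (simp add: B_def S'_def S_def)
      ultimately have "ereal \<delta> \<le> ereal (\<delta> / 2)" by (rule order_trans[rotated])
      then show False using \<delta> by simp
    qed
    have "emeasure \<mu> S' \<le> (\<integral>\<^sup>+u. g u / (\<integral>\<^sup>+v. g v \<partial>\<nu>) * indicator S' u \<partial>\<nu>)"
      unfolding \<mu> by (rule emeasure_density_le)
    also have "\<dots> = (\<integral>\<^sup>+u. g u * indicator S' u / (\<integral>\<^sup>+v. g v \<partial>\<nu>) \<partial>\<nu>)"
      by (intro nn_integral_cong) (auto simp: indicator_def)
    also have "\<dots> = (\<integral>\<^sup>+u. g u * indicator S' u \<partial>\<nu>) / (\<integral>\<^sup>+v. g v \<partial>\<nu>)"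
      by (rule nn_integral_divide) (simp add: \<nu>)
    also have "(\<integral>\<^sup>+u. g u * indicator S' u \<partial>\<nu>) = (\<integral>\<^sup>+w. g (X w) * indicator S' (X w) \<partial>P)"
      unfolding \<nu> by (rule nn_integral_distr) measurable
    also have "\<dots> = (\<integral>\<^sup>+w. ennreal (exp (- (1 / \<epsilon>) * integral {-L..L} (\<lambda>s. F (?V w s)))) * indicator B w \<partial>P)"
    proof (rule nn_integral_cong_AE)
      show "AE w in P. g (X w) * indicator S' (X w)
          = ennreal (exp (- (1 / \<epsilon>) * integral {-L..L} (\<lambda>s. F (?V w s)))) * indicator B w"
        using scaled_bridge_ends[OF V] AE_space
        by eventually_elim (simp add: weight B_def indicator_def)
    qed
    also have "\<dots> / (\<integral>\<^sup>+v. g v \<partial>\<nu>) \<le> ennreal (a / b)"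
      by (rule ennreal_divide_le_quotient[OF off[OF B far] Z a b])
    finally show ?thesis .
  qed
  finally show ?thesis
    unfolding S_def \<nu>_def measure_def using a b by (intro enn2real_leI) auto
qed

lemma scaled_eln_le:
  assumes "\<epsilon> > 0" "0 \<le> p" "p \<le> exp (- a / \<epsilon>)"
  shows "ereal \<epsilon> * eln p \<le> ereal (- a)"
proof (cases "p = 0")
  case True
  then show ?thesis using assms by (simp add: eln_def)
next
  case False
  then have "ln p \<le> - a / \<epsilon>" using assms ln_mono[of p "exp (- a / \<epsilon>)"] by simp
  then have "\<epsilon> * ln p \<le> - a" using assms by (simp add: field_simps)
  then show ?thesis using False by (simp add: eln_def)
qed

theorem theorem1p3:
  fixes F m :: "real \<Rightarrow> real" and \<gamma> :: real
    and P :: "real \<Rightarrow> 'w measure" and X :: "real \<Rightarrow> 'w \<Rightarrow> real \<Rightarrow> real"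
    and \<nu> :: "real \<Rightarrow> (real \<Rightarrow> real) measure"
  assumes "double_well F"
    and "instanton F m"
    and "\<And>\<epsilon>. \<epsilon> > 0 \<Longrightarrow> bridge_process \<gamma> \<epsilon> (P \<epsilon>) (X \<epsilon>)"
    and "\<And>\<epsilon>. \<epsilon> > 0 \<Longrightarrow> \<nu> \<epsilon> = process_law (P \<epsilon>) (X \<epsilon>)"
    and "0 < \<gamma>" and "\<gamma> < 2 / 3"
  shows "\<exists>c0>0. \<exists>\<delta>0>0. \<forall>\<delta>::real. 0 < \<delta> \<and> \<delta> \<le> \<delta>0 \<longrightarrow>
    Limsup (at_right 0)
      (\<lambda>\<epsilon>. ereal \<epsilon> * eln (measure (mu F m \<gamma> \<epsilon> (\<nu> \<epsilon>))
              {u \<in> affine_L2 m UNIV. dist_Linf u (instantons m) \<ge> ereal \<delta>}))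
      \<le> ereal (- c0 * \<delta>\<^sup>2)"
proof -
  note F = assms(1) and m = assms(2) and X = assms(3) and \<nu> = assms(4) and \<gamma> = assms(5,6)
  define L where "L \<epsilon> = \<epsilon> powr (- \<gamma>)" for \<epsilon> :: real
  define V where "V \<epsilon> = rescaled_path (L \<epsilon>) (X \<epsilon>)" for \<epsilon>
  have V: "scaled_bridge \<epsilon> (L \<epsilon>) (P \<epsilon>) (V \<epsilon>)" if "\<epsilon> > 0" for \<epsilon>
    unfolding V_def by (rule scaled_bridge_rescaled_path[OF X[OF that] that L_def])
  \<comment> \<open>The first limit gives the transition layer room, the second removes losses per
    unit length and constant factors per grid point, the third pays for the radius
    \<open>1 / N\<close> of the tube.\<close>
  have L1: "filterlim L at_top (at_right 0)"
    unfolding L_def using \<gamma> by real_asymp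
  have L2: "((\<lambda>\<epsilon>. \<epsilon> * L \<epsilon>) \<longlongrightarrow> 0) (at_right 0)"
    unfolding L_def using \<gamma> by real_asymp
  have L3: "((\<lambda>\<epsilon>. \<epsilon> * (L \<epsilon> * ln (L \<epsilon>))) \<longlongrightarrow> 0) (at_right 0)"
    unfolding L_def using \<gamma> by real_asymp
  obtain c \<delta>0 where c: "c > 0" "\<delta>0 > 0" and off: "\<And>\<delta> \<kappa>. 0 < \<delta> \<Longrightarrow> \<delta> \<le> \<delta>0 \<Longrightarrow> \<kappa> > 0 \<Longrightarrow>
    \<forall>\<^sub>F \<epsilon> in at_right 0. \<forall>B\<in>sets (P \<epsilon>). (\<forall>w\<in>B. \<not> near_instanton m (L \<epsilon>) (\<delta> / 2) (V \<epsilon> w)) \<longrightarrow>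
      (\<integral>\<^sup>+w. ennreal (exp (- (1 / \<epsilon>) * integral {-L \<epsilon>..L \<epsilon>} (\<lambda>s. F (V \<epsilon> w s)))) * indicator B w \<partial>P \<epsilon>)
        \<le> ennreal (exp (- (wall_cost F + c * \<delta>\<^sup>2 - \<kappa>) / \<epsilon>))"
    by (rule weight_off_instanton_eventually[OF F m L1 L2 V]) (assumption, rule that)
  have "Limsup (at_right 0)
      (\<lambda>\<epsilon>. ereal \<epsilon> * eln (measure (mu F m \<gamma> \<epsilon> (\<nu> \<epsilon>))
              {u \<in> affine_L2 m UNIV. dist_Linf u (instantons m) \<ge> ereal \<delta>}))
      \<le> ereal (- (c / 2) * \<delta>\<^sup>2)" if \<delta>: "0 < \<delta>" "\<delta> \<le> \<delta>0" for \<delta>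
  proof (rule Limsup_bounded)
    \<comment> \<open>Numerator and denominator each lose \<open>\<kappa>\<close> in the exponent,
      which leaves \<open>c * \<delta>^2 - 2 * \<kappa>\<close>, half of the rate
      \<open>c * \<delta>^2\<close>.\<close>
    define \<kappa> where "\<kappa> = c * \<delta>\<^sup>2 / 4"
    have \<kappa>: "\<kappa> > 0" using c \<delta> by (simp add: \<kappa>_def)
    have total: "\<forall>\<^sub>F \<epsilon> in at_right 0. ennreal (exp (- (wall_cost F + \<kappa>) / \<epsilon>)) \<le>
        (\<integral>\<^sup>+w. ennreal (exp (- (1 / \<epsilon>) * integral {-L \<epsilon>..L \<epsilon>} (\<lambda>s. F (V \<epsilon> w s)))) \<partial>P \<epsilon>)"
      by (rule partition_function_eventually[OF F m L1 L2 L3 V \<kappa>])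
    show "\<forall>\<^sub>F \<epsilon> in at_right 0. ereal \<epsilon> * eln (measure (mu F m \<gamma> \<epsilon> (\<nu> \<epsilon>))
              {u \<in> affine_L2 m UNIV. dist_Linf u (instantons m) \<ge> ereal \<delta>}) \<le> ereal (- (c / 2) * \<delta>\<^sup>2)"
      using off[OF \<delta> \<kappa>] total eventually_at_right_less[of "0::real"]
    proof eventually_elim
      case (elim \<epsilon>)
      have "measure (mu F m \<gamma> \<epsilon> (\<nu> \<epsilon>)) {u \<in> affine_L2 m UNIV. dist_Linf u (instantons m) \<ge> ereal \<delta>}
        \<le> exp (- (wall_cost F + c * \<delta>\<^sup>2 - \<kappa>) / \<epsilon>) / exp (- (wall_cost F + \<kappa>) / \<epsilon>)"
        unfolding \<nu>[OF elim(3)]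
        by (rule measure_mu_off_instantons_le[OF F m X[OF elim(3)] elim(3) L_def \<delta>(1) _ _ _ elim(2)[unfolded V_def]])
          (use elim(1) in \<open>auto simp: V_def\<close>)
      also have "\<dots> = exp (- (c / 2 * \<delta>\<^sup>2) / \<epsilon>)"
      proof -
        have "- (wall_cost F + c * \<delta>\<^sup>2 - \<kappa>) / \<epsilon> - - (wall_cost F + \<kappa>) / \<epsilon>
            = (- (wall_cost F + c * \<delta>\<^sup>2 - \<kappa>) - - (wall_cost F + \<kappa>)) / \<epsilon>"
          by (rule diff_divide_distrib[symmetric])
        also have "- (wall_cost F + c * \<delta>\<^sup>2 - \<kappa>) - - (wall_cost F + \<kappa>) = - (c / 2 * \<delta>\<^sup>2)"
          by (simp add: \<kappa>_def)
        finally show ?thesis by (simp only: exp_diff[symmetric])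
      qed
      finally show ?case unfolding mult_minus_left by (rule scaled_eln_le[OF elim(3) measure_nonneg])
    qed
  qed
  then show ?thesis using c by (intro exI[of _ "c / 2"] exI[of _ \<delta>0] conjI) auto
qed

end
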